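(* Let $\mathcal{C}_4$ be the fourth Calogero-Moser space and $\mathcal{C}om_4$ the fourth invariant commuting variety, let $I(\mathcal{C}_4), I(\mathcal{C}om_4)\subset \mathbb{C}[a_3,\dots,a_{14}]$ be their ideals of relations, and let $I$ and $J$ be the bracket-ideals of $\mathbb{C}[a_3,\dots,a_{14}]$ generated by $r_1$ and by $r_1-8a_3$ respectively (all as defined in the context), where $$r_1=8a_3+a_3(a_4^2-a_3a_5)-2(a_7^2-a_6a_8)+2(a_3a_{12}-2a_4a_{11}+a_5a_{10}).$$ Then $I=I(\mathcal{C}_4)$ and $J=I(\mathcal{C}om_4)$. In particular, there are Poisson algebra isomorphisms $$\mathbb{C}[\mathcal{C}_4]\cong \mathbb{C}[a_1,a_2]\otimes \frac{\mathbb{C}[a_3,\dots,a_{14}]}{I},\qquad \mathbb{C}[\mathcal{C}om_4]\cong \mathbb{C}[a_1,a_2]\otimes \frac{\mathbb{C}[a_3,\dots,a_{14}]}{J}.$$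
   Context: Varieties. Let $\mathcal{M}_n$ be the space of complex $n\times n$ matrices. $\mathrm{GL}_n$ acts on $\mathcal{M}_n\times\mathcal{M}_n$ by simultaneous conjugation. Put $\mathrm{C}_n=\{(X,Y): \mathrm{rank}([X,Y]+I_n)=1\}$ and $\mathrm{Com}_n=\{(X,Y): [X,Y]=0\}$ (subvarieties of $\mathcal{M}_n\times\mathcal{M}_n$). The Calogero-Moser space is the affine quotient $\mathcal{C}_n=\mathrm{C}_n/\!/\mathrm{GL}_n$ and the invariant commuting variety is $\mathcal{C}om_n=\mathrm{Com}_n/\!/\mathrm{GL}_n$. Generators. For $n=4$ put $A=X-\frac14\mathrm{Tr}(X)I_4$, $B=Y-\frac14\mathrm{Tr}(Y)I_4$, and let $a_1=\mathrm{Tr}(X)$, $a_2=\mathrm{Tr}(Y)$, $a_3=\mathrm{Tr}(A^2)$, $a_4=\mathrm{Tr}(AB)$, $a_5=\mathrm{Tr}(B^2)$, $a_6=\mathrm{Tr}(A^3)$, $a_7=\mathrm{Tr}(A^2B)$, $a_8=\mathrm{Tr}(AB^2)$, $a_9=\mathrm{Tr}(B^3)$, $a_{10}=\mathrm{Tr}(A^4)$, $a_{11}=\mathrm{Tr}(A^3B)$, $a_{12}=\mathrm{Tr}(A^2B^2)$, $a_{13}=\mathrm{Tr}(AB^3)$, $a_{14}=\mathrm{Tr}(B^4)$. It is known that these functions generate both $\mathbb{C}[\mathcal{C}_4]$ and $\mathbb{C}[\mathcal{C}om_4]$, and that $a_1,a_2$ split off as a polynomial tensor factor. The symbols $a_i$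 also denote polynomial variables. $I(\mathcal{C}_4)$ (resp. $I(\mathcal{C}om_4)$) is the ideal of all polynomials in $\mathbb{C}[a_3,\dots,a_{14}]$ that vanish identically as functions on $\mathcal{C}_4$ (resp. $\mathcal{C}om_4$). Poisson structures. $\mathbb{C}[\mathcal{M}_n\times\mathcal{M}_n]^{\mathrm{GL}_n}$ carries the Poisson bracket given on traces of words $u_1\cdots u_p$, $v_1\cdots v_q$ in the letters $X,Y$ by $$\{\mathrm{Tr}(u_1\cdots u_p),\mathrm{Tr}(v_1\cdots v_q)\}=\sum_{i,j}\omega(u_i,v_j)\,\mathrm{Tr}(u_{i+1}\cdots u_pu_1\cdots u_{i-1}v_{j+1}\cdots v_qv_1\cdots v_{j-1}),$$ with $\omega(X,Y)=-\omega(Y,X)=1$, $\omega(X,X)=\omega(Y,Y)=0$. The Poisson brackets on $\mathbb{C}[\mathcal{C}_n]$ and $\mathbb{C}[\mathcal{C}om_n]$ (coming from the symplectic structure by Hamiltonian reduction) are the ones induced by this bracket on these quotient rings. Brackets on the polynomial ring. For $\varepsilon\in\{0,1\}$, let $\{-,-\}_\varepsilon$ be the antisymmetric bilinear bracket on $\mathbb{C}[a_1,\dots,a_{14}]$, a derivation in each argument (not required to satisfy the Jacobi identity), given on generators as follows. $\{a_1,a_2\}=4$; $\{a_i,a_j\}=0$ for $i\in\{1,2\}$, $j\ge3$. Let $s$ be the involutive algebra automorphism of $\mathbb{C}[a_3,\dots,a_{14}]$ fixing $a_4,a_{12}$ and exchanging $a_3\leftrightarrow a_5$, $a_6\leftrightarrow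 a_9$, $a_7\leftrightarrow a_8$, $a_{10}\leftrightarrow a_{14}$, $a_{11}\leftrightarrow a_{13}$. The bracket satisfies $\{a_i^s,a_j^s\}=-\{a_i,a_j\}^s$, and: $\{a_3,a_4\}=2a_3$, $\{a_3,a_5\}=4a_4$, $\{a_3,a_6\}=0$, $\{a_3,a_7\}=2a_6$, $\{a_3,a_8\}=4a_7$, $\{a_3,a_9\}=6a_8$, $\{a_3,a_{10}\}=0$, $\{a_3,a_{11}\}=2a_{10}$, $\{a_3,a_{12}\}=4a_{11}$, $\{a_3,a_{13}\}=6a_{12}+12\varepsilon$, $\{a_3,a_{14}\}=8a_{13}$; $\{a_4,a_6\}=-3a_6$, $\{a_4,a_7\}=-a_7$, $\{a_4,a_{10}\}=-4a_{10}$, $\{a_4,a_{11}\}=-2a_{11}$, $\{a_4,a_{12}\}=0$; $\{a_6,a_7\}=3a_{10}-\frac34a_3^2$, $\{a_6,a_8\}=6a_{11}-\frac32a_3a_4$, $\{a_6,a_9\}=9a_{12}-\frac94a_3a_5$, $\{a_6,a_{10}\}=0$, $\{a_6,a_{11}\}=\frac74a_3a_6$, $\{a_6,a_{12}\}=2a_4a_6+\frac32a_3a_7$, $\{a_6,a_{13}\}=\frac34a_5a_6+\frac92a_4a_7$, $\{a_6,a_{14}\}=6a_4a_8+3a_5a_7-2a_3a_9$; $\{a_7,a_8\}=3a_{12}+12\varepsilon-a_4^2+\frac14a_3a_5$, $\{a_7,a_{10}\}=-\frac73a_3a_6$, $\{a_7,a_{11}\}=-\frac56a_4a_6+\frac14a_3a_7$,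 $\{a_7,a_{12}\}=a_3a_8+\frac16a_5a_6$, $\{a_7,a_{13}\}=\frac23a_3a_9+a_4a_8+\frac54a_5a_7$, $\{a_7,a_{14}\}=4a_5a_8+\frac23a_4a_9$; $\{a_{10},a_{11}\}=-\frac12a_3^3+\frac13a_6^2+3a_3a_{10}$, $\{a_{10},a_{12}\}=-a_3^2a_4+\frac23a_6a_7+4a_3a_{11}+2a_4a_{10}$, $\{a_{10},a_{13}\}=10\varepsilon a_3-\frac32a_3^2a_5+a_6a_8+6a_3a_{12}+3a_5a_{10}$, $\{a_{10},a_{14}\}=-\frac45a_4(16\varepsilon+\frac32a_3a_5+a_4^2)+\frac4{15}(18a_7a_8-13a_6a_9)+\frac{12}5(a_5a_{11}+3a_4a_{12}+a_3a_{13})$; $\{a_{11},a_{12}\}=9\varepsilon a_3-\frac12a_3^2a_5+\frac{11}6a_6a_8-\frac32a_7^2+2a_3a_{12}+a_5a_{10}$, $\{a_{11},a_{13}\}=\frac15a_4(53\varepsilon-2a_4^2-3a_3a_5)+\frac65(3a_4a_{12}+a_3a_{13}+a_5a_{11})+\frac1{60}(9a_7a_8+31a_6a_9)$. All remaining brackets of generators follow from antisymmetry and the $s$-rule. For $\varepsilon=1$ (resp. $\varepsilon=0$) this bracket lifts the Poisson bracket of $\mathbb{C}[\mathcal{C}_4]$ (resp. $\mathbb{C}[\mathcal{C}om_4]$). Bracket-ideals. $I$ is the smallest ideal of the ring $\mathbb{C}[a_3,\dots,a_{14}]$ that contains $r_1$ and satisfies $\{I,f\}_1\subset I$ for all $f\in\mathbb{C}[a_3,\dots,a_{14}]$.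 $J$ is the smallest ideal of $\mathbb{C}[a_3,\dots,a_{14}]$ that contains $r_1-8a_3$ and satisfies $\{J,f\}_0\subset J$ for all $f$. The tensor products carry the bracket induced by $\{-,-\}_1$, resp. $\{-,-\}_0$. *)

theory Defs
  imports "HOL-Analysis.Analysis" "HOL-Algebra.Module" "HOL-Algebra.QuotRing" "HOL-Library.Poly_Mapping"
begin

abbreviation (input) "keys \<equiv> Poly_Mapping.keys"
abbreviation (input) "lookup \<equiv> Poly_Mapping.lookup"

section \<open>Poisson algebras over the complex numbers\<close>

definition complex_ring :: "complex ring" where
  "complex_ring = \<lparr>carrier = UNIV, mult = (*), one = 1, zero = 0, add = (+)\<rparr>"

record 'a poisson = "(complex, 'a) module" +
  pbr :: "'a \<Rightarrow> 'a \<Rightarrow> 'a"  (\<open>\<lbrace>_,/ _\<rbrace>\<index>\<close>)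

locale poisson_algebra = algebra complex_ring P
  for P :: "('a, 'm) poisson_scheme" (structure) +
  assumes pbr_closed: "x \<in> carrier P \<Longrightarrow> y \<in> carrier P \<Longrightarrow> \<lbrace>x, y\<rbrace> \<in> carrier P"
    and pbr_antisym: "x \<in> carrier P \<Longrightarrow> y \<in> carrier P \<Longrightarrow> \<lbrace>x, y\<rbrace> = \<ominus> \<lbrace>y, x\<rbrace>"
    and pbr_add: "x \<in> carrier P \<Longrightarrow> y \<in> carrier P \<Longrightarrow> z \<in> carrier P \<Longrightarrow>
      \<lbrace>x \<oplus> y, z\<rbrace> = \<lbrace>x, z\<rbrace> \<oplus> \<lbrace>y, z\<rbrace>"
    and pbr_smult: "x \<in> carrier P \<Longrightarrow> y \<in> carrier P \<Longrightarrow> \<lbrace>c \<odot>\<^bsub>P\<^esub> x, y\<rbrace> = c \<odot>\<^bsub>P\<^esub> \<lbrace>x, y\<rbrace>"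
    and pbr_leibniz: "x \<in> carrier P \<Longrightarrow> y \<in> carrier P \<Longrightarrow> z \<in> carrier P \<Longrightarrow>
      \<lbrace>x \<otimes> y, z\<rbrace> = x \<otimes> \<lbrace>y, z\<rbrace> \<oplus> \<lbrace>x, z\<rbrace> \<otimes> y"
    and pbr_jacobi: "x \<in> carrier P \<Longrightarrow> y \<in> carrier P \<Longrightarrow> z \<in> carrier P \<Longrightarrow>
      \<lbrace>x, \<lbrace>y, z\<rbrace>\<rbrace> \<oplus> \<lbrace>y, \<lbrace>z, x\<rbrace>\<rbrace> \<oplus> \<lbrace>z, \<lbrace>x, y\<rbrace>\<rbrace> = \<zero>"

definition poisson_iso :: "('a, 'm) poisson_scheme \<Rightarrow> ('b, 'k) poisson_scheme \<Rightarrow> ('a \<Rightarrow> 'b) set" where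
  "poisson_iso P Q = {h \<in> ring_iso P Q.
     (\<forall>c. \<forall>x\<in>carrier P. h (c \<odot>\<^bsub>P\<^esub> x) = c \<odot>\<^bsub>Q\<^esub> h x) \<and>
     (\<forall>x\<in>carrier P. \<forall>y\<in>carrier P. h \<lbrace>x, y\<rbrace>\<^bsub>P\<^esub> = \<lbrace>h x, h y\<rbrace>\<^bsub>Q\<^esub>)}"

definition poisson_isomorphic :: "('a, 'm) poisson_scheme \<Rightarrow> ('b, 'k) poisson_scheme \<Rightarrow> bool"
    (infix \<open>\<cong>\<^sub>P\<close> 50) where
  "P \<cong>\<^sub>P Q \<longleftrightarrow> poisson_algebra P \<and> poisson_algebra Q \<and> poisson_iso P Q \<noteq> {}"

text \<open>The quotient by an ideal, with the operations induced on cosets: the ring part is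
  \<^const>\<open>FactRing\<close>, and scalar multiplication and bracket follow the pattern of
  \<^const>\<open>rcoset_mult\<close>. The input need not satisfy the Jacobi identity.\<close>

definition pquot :: "('a, 'm) poisson_scheme \<Rightarrow> 'a set \<Rightarrow> 'a set poisson" where
  "pquot P I = \<lparr>carrier = carrier (P Quot I), mult = mult (P Quot I), one = one (P Quot I),
     zero = zero (P Quot I), add = add (P Quot I),
     smult = (\<lambda>c A. \<Union>a\<in>A. I +>\<^bsub>P\<^esub> (c \<odot>\<^bsub>P\<^esub> a)),
     pbr = (\<lambda>A B. \<Union>a\<in>A. \<Union>b\<in>B. I +>\<^bsub>P\<^esub> \<lbrace>a, b\<rbrace>\<^bsub>P\<^esub>)\<rparr>"

text \<open>The tensor product over the complex numbers is the free vector space on pairs modulo the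
  bilinearity relations, with the bracket determined by
  {a (x) b, a' (x) b'} = {a, a'} (x) b b' + a a' (x) {b, b'}.\<close>

definition free_pairs :: "('a, 'm) poisson_scheme \<Rightarrow> ('b, 'k) poisson_scheme \<Rightarrow>
    (('a \<times> 'b) \<Rightarrow>\<^sub>0 complex) poisson" where
  "free_pairs P Q = \<lparr>carrier = {f. keys f \<subseteq> carrier P \<times> carrier Q},
     mult = (\<lambda>f g. \<Sum>(a, b)\<in>keys f. \<Sum>(a', b')\<in>keys g.
       Poly_Mapping.single (a \<otimes>\<^bsub>P\<^esub> a', b \<otimes>\<^bsub>Q\<^esub> b') (lookup f (a, b) * lookup g (a', b'))),
     one = Poly_Mapping.single (\<one>\<^bsub>P\<^esub>, \<one>\<^bsub>Q\<^esub>) 1,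
     zero = 0, add = (+), smult = (\<lambda>c. Poly_Mapping.map ((*) c)),
     pbr = (\<lambda>f g. \<Sum>(a, b)\<in>keys f. \<Sum>(a', b')\<in>keys g.
       Poly_Mapping.single (\<lbrace>a, a'\<rbrace>\<^bsub>P\<^esub>, b \<otimes>\<^bsub>Q\<^esub> b') (lookup f (a, b) * lookup g (a', b')) +
       Poly_Mapping.single (a \<otimes>\<^bsub>P\<^esub> a', \<lbrace>b, b'\<rbrace>\<^bsub>Q\<^esub>) (lookup f (a, b) * lookup g (a', b')))\<rparr>"

inductive_set tensor_relations :: "('a, 'm) poisson_scheme \<Rightarrow> ('b, 'k) poisson_scheme \<Rightarrow>
    (('a \<times> 'b) \<Rightarrow>\<^sub>0 complex) set"
  for P Q where
  zero: "0 \<in> tensor_relations P Q"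
| add: "f \<in> tensor_relations P Q \<Longrightarrow> g \<in> tensor_relations P Q \<Longrightarrow> f + g \<in> tensor_relations P Q"
| scale: "f \<in> tensor_relations P Q \<Longrightarrow> Poly_Mapping.map ((*) c) f \<in> tensor_relations P Q"
| add_left: "a \<in> carrier P \<Longrightarrow> a' \<in> carrier P \<Longrightarrow> b \<in> carrier Q \<Longrightarrow>
    Poly_Mapping.single (a \<oplus>\<^bsub>P\<^esub> a', b) 1 - Poly_Mapping.single (a, b) 1 - Poly_Mapping.single (a', b) 1
      \<in> tensor_relations P Q"
| add_right: "a \<in> carrier P \<Longrightarrow> b \<in> carrier Q \<Longrightarrow> b' \<in> carrier Q \<Longrightarrow>
    Poly_Mapping.single (a, b \<oplus>\<^bsub>Q\<^esub> b') 1 - Poly_Mapping.single (a, b) 1 - Poly_Mapping.single (a, b') 1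
      \<in> tensor_relations P Q"
| smult_left: "a \<in> carrier P \<Longrightarrow> b \<in> carrier Q \<Longrightarrow>
    Poly_Mapping.single (c \<odot>\<^bsub>P\<^esub> a, b) 1 - Poly_Mapping.single (a, b) c \<in> tensor_relations P Q"
| smult_right: "a \<in> carrier P \<Longrightarrow> b \<in> carrier Q \<Longrightarrow>
    Poly_Mapping.single (a, c \<odot>\<^bsub>Q\<^esub> b) 1 - Poly_Mapping.single (a, b) c \<in> tensor_relations P Q"

definition ptensor :: "('a, 'm) poisson_scheme \<Rightarrow> ('b, 'k) poisson_scheme \<Rightarrow>
    (('a \<times> 'b) \<Rightarrow>\<^sub>0 complex) set poisson"  (infixr \<open>\<otimes>\<^sub>P\<close> 70) where
  "P \<otimes>\<^sub>P Q = pquot (free_pairs P Q) (tensor_relations P Q)"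


section \<open>Polynomials\<close>

text \<open>Polynomials with variables indexed by an arbitrary type: the outer \<open>\<Rightarrow>\<^sub>0\<close> sends a monomial
  (an exponent vector) to its coefficient; multiplication is the convolution product of
  \<open>Poly_Mapping\<close>.\<close>

type_synonym 'x mpoly = "('x \<Rightarrow>\<^sub>0 nat) \<Rightarrow>\<^sub>0 complex"

definition cst :: "complex \<Rightarrow> 'x mpoly" where
  "cst c = Poly_Mapping.single 0 c"

definition \<a> :: "'x \<Rightarrow> 'x mpoly" where
  "\<a> i = Poly_Mapping.single (Poly_Mapping.single i 1) 1"

definition poly_subst :: "(complex \<Rightarrow> 'b) \<Rightarrow> ('x \<Rightarrow> 'b) \<Rightarrow> 'x mpoly \<Rightarrow> 'b::comm_ring_1" where
  "poly_subst \<iota> x p = (\<Sum>m\<in>keys p. \<iota> (lookup p m) * (\<Prod>i\<in>keys m. x i ^ lookup m i))"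

abbreviation peval :: "('x \<Rightarrow> complex) \<Rightarrow> 'x mpoly \<Rightarrow> complex" where
  "peval \<equiv> poly_subst (\<lambda>c. c)"

definition pdiff :: "'x \<Rightarrow> 'x mpoly \<Rightarrow> 'x mpoly" where
  "pdiff i p = (\<Sum>m\<in>keys p.
     Poly_Mapping.single (m - Poly_Mapping.single i 1) (of_nat (lookup m i) * lookup p m))"

definition polys_in :: "'x set \<Rightarrow> 'x mpoly set" where
  "polys_in V = {p. \<forall>m\<in>keys p. keys m \<subseteq> V}"


section \<open>The brackets on the polynomial ring in \<open>a\<^sub>1, \<dots>, a\<^sub>1\<^sub>4\<close>\<close>

definition swap_index :: "nat \<Rightarrow> nat" where
  "swap_index i = (case map_of [(3, 5), (5, 3), (6, 9), (9, 6), (7, 8), (8, 7),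
     (10, 14), (14, 10), (11, 13), (13, 11)] i of Some j \<Rightarrow> j | None \<Rightarrow> i)"

definition swap :: "nat mpoly \<Rightarrow> nat mpoly" where
  "swap = poly_subst cst (\<lambda>i. \<a> (swap_index i))"

definition bracket_table :: "complex \<Rightarrow> ((nat \<times> nat) \<times> nat mpoly) list" where
  "bracket_table \<epsilon> =
  [((1, 2), 4),
   ((3, 4), 2 * \<a> 3),
   ((3, 5), 4 * \<a> 4),
   ((3, 6), 0),
   ((3, 7), 2 * \<a> 6),
   ((3, 8), 4 * \<a> 7),
   ((3, 9), 6 * \<a> 8),
   ((3, 10), 0),
   ((3, 11), 2 * \<a> 10),
   ((3, 12), 4 * \<a> 11),
   ((3, 13), 6 * \<a> 12 + cst (12 * \<epsilon>)),
   ((3, 14), 8 * \<a> 13),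
   ((4, 6), -3 * \<a> 6),
   ((4, 7), - \<a> 7),
   ((4, 10), -4 * \<a> 10),
   ((4, 11), -2 * \<a> 11),
   ((4, 12), 0),
   ((6, 7), 3 * \<a> 10 - cst (3/4) * \<a> 3 ^ 2),
   ((6, 8), 6 * \<a> 11 - cst (3/2) * \<a> 3 * \<a> 4),
   ((6, 9), 9 * \<a> 12 - cst (9/4) * \<a> 3 * \<a> 5),
   ((6, 10), 0),
   ((6, 11), cst (7/4) * \<a> 3 * \<a> 6),
   ((6, 12), 2 * \<a> 4 * \<a> 6 + cst (3/2) * \<a> 3 * \<a> 7),
   ((6, 13), cst (3/4) * \<a> 5 * \<a> 6 + cst (9/2) * \<a> 4 * \<a> 7),
   ((6, 14), 6 * \<a> 4 * \<a> 8 + 3 * \<a> 5 * \<a> 7 - 2 * \<a> 3 * \<a> 9),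
   ((7, 8), 3 * \<a> 12 + cst (12 * \<epsilon>) - \<a> 4 ^ 2 + cst (1/4) * \<a> 3 * \<a> 5),
   ((7, 10), - cst (7/3) * \<a> 3 * \<a> 6),
   ((7, 11), - cst (5/6) * \<a> 4 * \<a> 6 + cst (1/4) * \<a> 3 * \<a> 7),
   ((7, 12), \<a> 3 * \<a> 8 + cst (1/6) * \<a> 5 * \<a> 6),
   ((7, 13), cst (2/3) * \<a> 3 * \<a> 9 + \<a> 4 * \<a> 8 + cst (5/4) * \<a> 5 * \<a> 7),
   ((7, 14), 4 * \<a> 5 * \<a> 8 + cst (2/3) * \<a> 4 * \<a> 9),
   ((10, 11), - cst (1/2) * \<a> 3 ^ 3 + cst (1/3) * \<a> 6 ^ 2 + 3 * \<a> 3 * \<a> 10),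
   ((10, 12), - (\<a> 3 ^ 2 * \<a> 4) + cst (2/3) * \<a> 6 * \<a> 7 + 4 * \<a> 3 * \<a> 11
        + 2 * \<a> 4 * \<a> 10),
   ((10, 13), cst (10 * \<epsilon>) * \<a> 3 - cst (3/2) * \<a> 3 ^ 2 * \<a> 5 + \<a> 6 * \<a> 8
        + 6 * \<a> 3 * \<a> 12 + 3 * \<a> 5 * \<a> 10),
   ((10, 14), - cst (4/5) * \<a> 4 * (cst (16 * \<epsilon>) + cst (3/2) * \<a> 3 * \<a> 5
        + \<a> 4 ^ 2) + cst (4/15) * (18 * \<a> 7 * \<a> 8 - 13 * \<a> 6 * \<a> 9)
        + cst (12/5) * (\<a> 5 * \<a> 11 + 3 * \<a> 4 * \<a> 12 + \<a> 3 * \<a> 13)),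
   ((11, 12), cst (9 * \<epsilon>) * \<a> 3 - cst (1/2) * \<a> 3 ^ 2 * \<a> 5
        + cst (11/6) * \<a> 6 * \<a> 8 - cst (3/2) * \<a> 7 ^ 2 + 2 * \<a> 3 * \<a> 12
        + \<a> 5 * \<a> 10),
   ((11, 13), cst (1/5) * \<a> 4 * (cst (53 * \<epsilon>) - 2 * \<a> 4 ^ 2 - 3 * \<a> 3 * \<a> 5)
        + cst (6/5) * (3 * \<a> 4 * \<a> 12 + \<a> 3 * \<a> 13 + \<a> 5 * \<a> 11)
        + cst (1/60) * (9 * \<a> 7 * \<a> 8 + 31 * \<a> 6 * \<a> 9))]"

text \<open>Pairs not in the table are obtained from it by antisymmetry and by the rule
  {s p, s q} = - s {p, q}. The final 0 is reached only by {a1, aj}, {a2, aj} with j > 2 (up to order)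
  and by the pairs {ai, ai}.\<close>

definition gen_bracket :: "complex \<Rightarrow> nat \<Rightarrow> nat \<Rightarrow> nat mpoly" where
  "gen_bracket \<epsilon> i j = (let T = map_of (bracket_table \<epsilon>); s = swap_index in
     case T (i, j) of Some p \<Rightarrow> p
     | None \<Rightarrow> (case T (j, i) of Some p \<Rightarrow> - p
     | None \<Rightarrow> (case T (s i, s j) of Some p \<Rightarrow> - swap p
     | None \<Rightarrow> (case T (s j, s i) of Some p \<Rightarrow> swap p
     | None \<Rightarrow> 0))))"

text \<open>The biderivation with the prescribed values on generators; the lemmas below confirm that it is
  bilinear, antisymmetric, a derivation, and takes these values.\<close>

definition poly_bracket :: "complex \<Rightarrow> nat mpoly \<Rightarrow> nat mpoly \<Rightarrow> nat mpoly" where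
  "poly_bracket \<epsilon> p q = (\<Sum>i\<in>{1..14}. \<Sum>j\<in>{1..14}. pdiff i p * pdiff j q * gen_bracket \<epsilon> i j)"

lemma pdiff_superset:
  assumes "finite S" "keys p \<subseteq> S"
  shows "pdiff i p = (\<Sum>m\<in>S. Poly_Mapping.single (m - Poly_Mapping.single i 1)
    (of_nat (lookup m i) * lookup p m))"
  unfolding pdiff_def using assms
  by (intro sum.mono_neutral_left) (auto simp: in_keys_iff)

lemma pdiff_add: "pdiff i (p + q) = pdiff i p + pdiff i q"
  by (subst (1 2 3) pdiff_superset[where S = "keys p \<union> keys q"])
    (auto simp: keys_add lookup_add algebra_simps single_add sum.distrib)

lemma pdiff_single:
  "pdiff i (Poly_Mapping.single m c) =
    Poly_Mapping.single (m - Poly_Mapping.single i 1) (of_nat (lookup m i) * c)"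
  by (subst pdiff_superset[where S = "{m}"]) auto

lemma pdiff_cst: "pdiff i (cst c) = 0"
  by (simp add: cst_def pdiff_single)

lemma pdiff_var: "pdiff i (\<a> j) = (if i = j then 1 else 0)"
  by (auto simp: \<a>_def pdiff_single lookup_single single_one)

lemma pdiff_mult_single:
  "pdiff i (Poly_Mapping.single m c * Poly_Mapping.single n d) =
    Poly_Mapping.single m c * pdiff i (Poly_Mapping.single n d) +
    pdiff i (Poly_Mapping.single m c) * Poly_Mapping.single n d"
proof -
  let ?e = "Poly_Mapping.single i (1::nat)"
  have 1: "m + (n - ?e) = m + n - ?e" if "lookup n i \<noteq> 0"
    using that by (intro poly_mapping_eqI) (auto simp: lookup_add lookup_minus lookup_single when_def)
  have 2: "(m - ?e) + n = m + n - ?e" if "lookup m i \<noteq> 0"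
    using that by (intro poly_mapping_eqI) (auto simp: lookup_add lookup_minus lookup_single when_def)
  show ?thesis
    using 1 2 by (cases "lookup m i = 0"; cases "lookup n i = 0")
      (simp_all add: mult_single pdiff_single lookup_add algebra_simps flip: single_add)
qed

lemma pdiff_sum: "pdiff i (\<Sum>x\<in>S. f x) = (\<Sum>x\<in>S. pdiff i (f x))"
  by (induction S rule: infinite_finite_induct)
    (auto simp: pdiff_add pdiff_cst[of i 0, unfolded cst_def, simplified])

lemma sum_monomials: "(\<Sum>m\<in>keys p. Poly_Mapping.single m (lookup p m)) = p"
  by (rule poly_mapping_eqI) (auto simp: lookup_sum lookup_single when_def in_keys_iff)

lemma pdiff_mult: "pdiff i (p * q) = p * pdiff i q + pdiff i p * q"
proof -
  let ?t = "\<lambda>p m. Poly_Mapping.single m (lookup p m)"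
  have "pdiff i ((\<Sum>m\<in>keys p. ?t p m) * (\<Sum>n\<in>keys q. ?t q n)) =
    (\<Sum>m\<in>keys p. ?t p m) * pdiff i (\<Sum>n\<in>keys q. ?t q n) +
    pdiff i (\<Sum>m\<in>keys p. ?t p m) * (\<Sum>n\<in>keys q. ?t q n)"
    by (simp only: sum_product pdiff_sum pdiff_mult_single sum.distrib)
  then show ?thesis
    by (simp only: sum_monomials)
qed

lemma poly_bracket_add: "poly_bracket \<epsilon> (p + q) f = poly_bracket \<epsilon> p f + poly_bracket \<epsilon> q f"
  by (simp add: poly_bracket_def pdiff_add distrib_right sum.distrib)

lemma poly_bracket_cst_mult: "poly_bracket \<epsilon> (cst c * p) f = cst c * poly_bracket \<epsilon> p f"
  by (simp add: poly_bracket_def pdiff_mult pdiff_cst sum_distrib_left mult.assoc)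

lemma poly_bracket_mult:
  "poly_bracket \<epsilon> (p * q) f = p * poly_bracket \<epsilon> q f + poly_bracket \<epsilon> p f * q"
  by (simp add: poly_bracket_def pdiff_mult sum_distrib_left sum_distrib_right
      flip: sum.distrib) (simp add: algebra_simps)

lemma gen_bracket_antisym: "gen_bracket \<epsilon> i j = - gen_bracket \<epsilon> j i"
proof -
  let ?D = "fst ` set (bracket_table \<epsilon>)"
  have lt: "x < y" if "(x, y) \<in> ?D" for x y
    using that by (auto simp: bracket_table_def)
  have "map_of (bracket_table \<epsilon>) (y, x) = None" if "map_of (bracket_table \<epsilon>) (x, y) = Some p" for x y p
  proof -
    have "(x, y) \<in> ?D" using that by (metis map_of_eq_None_iff option.distinct(1))
    then have "(y, x) \<notin> ?D" using lt[of x y] lt[of y x] by linarith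
    then show ?thesis by (simp add: map_of_eq_None_iff)
  qed
  then show ?thesis
    unfolding gen_bracket_def Let_def
    by (auto split: option.splits)
qed

lemma poly_bracket_antisym: "poly_bracket \<epsilon> p q = - poly_bracket \<epsilon> q p"
  unfolding poly_bracket_def
  by (subst sum.swap, subst gen_bracket_antisym) (simp add: sum_negf mult_ac)

lemma poly_bracket_vars:
  assumes "i \<in> {1..14}" "j \<in> {1..14}"
  shows "poly_bracket \<epsilon> (\<a> i) (\<a> j) = gen_bracket \<epsilon> i j"
proof -
  have "pdiff k (\<a> i) * pdiff l (\<a> j) * gen_bracket \<epsilon> k l =
      (if k = i then if l = j then gen_bracket \<epsilon> i j else 0 else 0)" for k l
    by (auto simp: pdiff_var)
  then have "(\<Sum>l\<in>{1..14}. pdiff k (\<a> i) * pdiff l (\<a> j) * gen_bracket \<epsilon> k l) =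
      (if k = i then gen_bracket \<epsilon> i j else 0)" for k
    using assms by (cases "k = i") simp_all
  then show ?thesis
    using assms by (simp add: poly_bracket_def)
qed

definition poly_alg :: "complex \<Rightarrow> nat set \<Rightarrow> nat mpoly poisson" where
  "poly_alg \<epsilon> V = \<lparr>carrier = polys_in V, mult = (*), one = 1, zero = 0, add = (+),
     smult = (\<lambda>c p. cst c * p), pbr = poly_bracket \<epsilon>\<rparr>"

text \<open>The smallest ideal of the ring in the variables 3 to 14 that contains \<open>r\<close> and is stable
  under bracketing with that ring.\<close>

definition bracket_ideal :: "complex \<Rightarrow> nat mpoly \<Rightarrow> nat mpoly set" where
  "bracket_ideal \<epsilon> r = \<Inter>{I. ideal I (poly_alg \<epsilon> {3..14}) \<and> r \<in> I \<and>
     (\<forall>p\<in>I. \<forall>f\<in>polys_in {3..14}. poly_bracket \<epsilon> p f \<in> I)}"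

definition r\<^sub>1 :: "nat mpoly" where
  "r\<^sub>1 = 8 * \<a> 3 + \<a> 3 * (\<a> 4 ^ 2 - \<a> 3 * \<a> 5) - 2 * (\<a> 7 ^ 2 - \<a> 6 * \<a> 8)
     + 2 * (\<a> 3 * \<a> 12 - 2 * \<a> 4 * \<a> 11 + \<a> 5 * \<a> 10)"


section \<open>Varieties of pairs of matrices and their affine quotients\<close>

type_synonym 'n mpair = "(complex^'n^'n) \<times> (complex^'n^'n)"

definition CM_pairs :: "('n::finite) mpair set" where
  "CM_pairs = {(X, Y). rank (X ** Y - Y ** X + mat 1) = 1}"

definition commuting_pairs :: "('n::finite) mpair set" where
  "commuting_pairs = {(X, Y). X ** Y - Y ** X = 0}"

datatype letter = LX | LY

fun letter_mat :: "('n::finite) mpair \<Rightarrow> letter \<Rightarrow> complex^'n^'n" where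
  "letter_mat z LX = fst z"
| "letter_mat z LY = snd z"

definition entry :: "('n::finite) mpair \<Rightarrow> letter \<times> 'n \<times> 'n \<Rightarrow> complex" where
  "entry z = (\<lambda>(l, i, j). letter_mat z l $ i $ j)"

definition conj_pair :: "complex^'n^'n \<Rightarrow> ('n::finite) mpair \<Rightarrow> 'n mpair" where
  "conj_pair g z = (g ** fst z ** matrix_inv g, g ** snd z ** matrix_inv g)"

text \<open>For a conjugation-stable Zariski closed set \<open>V\<close> of pairs, the coordinate ring of the affine
  quotient of \<open>V\<close> by the general linear group: the invariant functions on \<open>V\<close> that are
  restrictions of polynomials in the matrix entries. For \<open>V = UNIV\<close> these are the invariant
  polynomials on all pairs of matrices.\<close>

definition quotient_functions :: "('n::finite) mpair set \<Rightarrow> ('n mpair \<Rightarrow> complex) set" where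
  "quotient_functions V = {f. (\<exists>p. f = (\<lambda>z\<in>V. peval (entry z) p)) \<and>
     (\<forall>g. \<forall>z\<in>V. invertible g \<longrightarrow> f (conj_pair g z) = f z)}"

definition quotient_alg :: "('n::finite) mpair set \<Rightarrow>
    (('n mpair \<Rightarrow> complex) \<Rightarrow> ('n mpair \<Rightarrow> complex) \<Rightarrow> 'n mpair \<Rightarrow> complex) \<Rightarrow>
    ('n mpair \<Rightarrow> complex) poisson" where
  "quotient_alg V b = \<lparr>carrier = quotient_functions V, mult = (\<lambda>f g. \<lambda>z\<in>V. f z * g z),
     one = (\<lambda>z\<in>V. 1), zero = (\<lambda>z\<in>V. 0), add = (\<lambda>f g. \<lambda>z\<in>V. f z + g z),
     smult = (\<lambda>c f. \<lambda>z\<in>V. c * f z), pbr = b\<rparr>"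

definition word_trace :: "letter list \<Rightarrow> ('n::finite) mpair \<Rightarrow> complex" where
  "word_trace w z = trace (foldr (\<lambda>l M. letter_mat z l ** M) w (mat 1))"

fun \<omega> :: "letter \<Rightarrow> letter \<Rightarrow> complex" where
  "\<omega> LX LY = 1"
| "\<omega> LY LX = -1"
| "\<omega> LX LX = 0"
| "\<omega> LY LY = 0"

text \<open>Letters of a word are numbered from 0, so \<open>drop (Suc i) u @ take i u\<close> is the cyclic word left
  after deleting letter \<open>i\<close>. The last conjunct only fixes the value outside the invariant
  polynomials, so that the bracket is unique as a total function; on invariant polynomials it is
  determined by the trace formula because the traces of words generate them.\<close>

definition is_trace_bracket ::
    "(('n::finite mpair \<Rightarrow> complex) \<Rightarrow> ('n mpair \<Rightarrow> complex) \<Rightarrow> 'n mpair \<Rightarrow> complex) \<Rightarrow> bool" where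
  "is_trace_bracket b \<longleftrightarrow> poisson_algebra (quotient_alg UNIV b) \<and>
     (\<forall>u v. b (word_trace u) (word_trace v) = (\<lambda>z. \<Sum>i<length u. \<Sum>j<length v.
        \<omega> (u ! i) (v ! j) *
        word_trace (drop (Suc i) u @ take i u @ drop (Suc j) v @ take j v) z)) \<and>
     (\<forall>f g. f \<notin> quotient_functions UNIV \<or> g \<notin> quotient_functions UNIV \<longrightarrow> b f g = undefined)"

definition trace_bracket ::
    "('n::finite mpair \<Rightarrow> complex) \<Rightarrow> ('n mpair \<Rightarrow> complex) \<Rightarrow> 'n mpair \<Rightarrow> complex" where
  "trace_bracket = (THE b. is_trace_bracket b)"

definition induced_bracket :: "('n::finite) mpair set \<Rightarrow>
    ('n mpair \<Rightarrow> complex) \<Rightarrow> ('n mpair \<Rightarrow> complex) \<Rightarrow> 'n mpair \<Rightarrow> complex" where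
  "induced_bracket V f g = (THE h. \<exists>F\<in>quotient_functions UNIV. \<exists>G\<in>quotient_functions UNIV.
     f = restrict F V \<and> g = restrict G V \<and> h = restrict (trace_bracket F G) V)"

definition coord_alg :: "('n::finite) mpair set \<Rightarrow> ('n mpair \<Rightarrow> complex) poisson" where
  "coord_alg V = quotient_alg V (induced_bracket V)"


section \<open>The generators for 4 by 4 matrices and their relations\<close>

definition generator :: "nat \<Rightarrow> 4 mpair \<Rightarrow> complex" where
  "generator i = (\<lambda>(X, Y). let z = (X - mat (trace X / 4), Y - mat (trace Y / 4)) in
     the (map_of [(1, trace X), (2, trace Y),
       (3, word_trace [LX, LX] z), (4, word_trace [LX, LY] z), (5, word_trace [LY, LY] z),
       (6, word_trace [LX, LX, LX] z), (7, word_trace [LX, LX, LY] z),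
       (8, word_trace [LX, LY, LY] z), (9, word_trace [LY, LY, LY] z),
       (10, word_trace [LX, LX, LX, LX] z), (11, word_trace [LX, LX, LX, LY] z),
       (12, word_trace [LX, LX, LY, LY] z), (13, word_trace [LX, LY, LY, LY] z),
       (14, word_trace [LY, LY, LY, LY] z)] i))"

text \<open>Functions on the affine quotient of \<open>V\<close> are invariant functions on \<open>V\<close>, so vanishing on the
  quotient means vanishing on \<open>V\<close>.\<close>

definition relations_ideal :: "4 mpair set \<Rightarrow> nat mpoly set" where
  "relations_ideal V = {p \<in> polys_in {3..14}. \<forall>z\<in>V. peval (\<lambda>i. generator i z) p = 0}"

end

theory Submission
  imports Defs "HOL-Computational_Algebra.Fundamental_Theorem_Algebra"
begin

text \<open>Let \<open>V\<close> be one of the two varieties. Invariants on \<open>V\<close> are polynomials in traces of words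
  (double commutant theorem for the symmetric group acting on tensors). The letters of a word can be
  sorted modulo shorter words since the commutator, shifted by \<open>\<epsilon>\<close>, has rank at most one, and the
  Cayley--Hamilton identity removes long words; hence \<open>a\<^sub>1, \<dots>, a\<^sub>1\<^sub>4\<close> generate. Since \<open>V\<close> is stable
  under the flows of the traces of powers of \<open>X\<close> and of \<open>Y\<close>, invariants vanishing on \<open>V\<close> form a
  Poisson ideal; the same reduction of words evaluates the brackets of the generators and shows that
  the generators of \<open>I\<close> and \<open>J\<close> are relations.

  Conversely, modulo \<open>J\<close> the ring is spanned over the polynomials in \<open>a\<^sub>3, a\<^sub>5, a\<^sub>6, a\<^sub>9, a\<^sub>1\<^sub>0, a\<^sub>1\<^sub>4\<close> by 24
  elements, which are independent on pairs of diagonal matrices: this gives \<open>J\<close>. For \<open>I\<close> consider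
  leading forms: those of \<open>I\<close> include \<open>J\<close>, while the leading form of a relation on the Calogero--Moser
  space vanishes on pairs of diagonal matrices, as these are limits of rescaled Calogero--Moser pairs.\<close>

section \<open>Polynomial rings\<close>

text \<open>The number 24 is 4!: pairs of traceless diagonal matrices modulo simultaneous
  permutations map to pairs modulo separate permutations with fibres of generically 4! points, and
  the six power sums are coordinates of the target. Spanning by 24 elements is therefore the best
  possible, and their independence, tested on one well chosen fibre, decides membership in J without
  a separate argument that J is radical. J is given only by a closure property, so the relations
  behind the spanning set are found as iterated brackets of r_1 - 8 a_3. For the grading by word
  length {-,-}_0 has degree -2, so each computation stays in a small graded piece; {-,-}_1 - {-,-}_0
  has degree -6, which is why leading forms see only {-,-}_0. The other obstacle is stability of the
  relations under brackets with all invariants: the flows cover only traces of powers of one matrix,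
  and one bracket of two of these yields the trace of X^a Y^b. Other words have to be reduced to
  these, and the remainder must be harmless in brackets too; hence the reduction is done modulo
  functions whose brackets with invariants also vanish on V.\<close>

lemma cst_add: "cst (c + d) = cst c + cst d"
  by (simp add: cst_def single_add)

lemma cst_mult: "cst (c * d) = cst c * cst d"
  by (simp add: cst_def mult_single)

lemma cst_0 [simp]: "cst 0 = 0" and cst_1 [simp]: "cst 1 = 1"
  by (simp_all add: cst_def)

lemma cst_uminus: "cst (- c) = - cst c"
  by (simp add: cst_def single_uminus)

lemma cst_diff: "cst (c - d) = cst c - cst d"
  by (simp add: cst_def single_diff)

lemma cst_of_nat: "cst (of_nat n) = of_nat n"
  by (induction n) (auto simp: cst_add)

lemma cst_numeral: "cst (numeral n) = numeral n"
  using cst_of_nat[of "numeral n"] by simp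

lemma cst_eq_iff [simp]: "cst c = cst d \<longleftrightarrow> c = d"
  by (metis cst_def lookup_single_eq)

lemma cst_inverse_cancel: "c \<noteq> 0 \<Longrightarrow> cst (1 / c) * (cst c * p) = p"
  by (simp add: mult.assoc[symmetric] cst_mult[symmetric])

lemma single_split_var:
  fixes m :: "'x \<Rightarrow>\<^sub>0 nat"
  assumes "i \<in> keys m"
  shows "Poly_Mapping.single m c = \<a> i * Poly_Mapping.single (m - Poly_Mapping.single i 1) c"
proof -
  have "m = Poly_Mapping.single i 1 + (m - Poly_Mapping.single i 1)"
    using assms by (intro poly_mapping_eqI)
      (auto simp: lookup_add lookup_minus lookup_single when_def in_keys_iff)
  then show ?thesis
    by (metis \<a>_def mult_single mult_1)
qed

lemma keys_diff_single_subset: "keys (m - Poly_Mapping.single i (1::nat)) \<subseteq> keys m"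
  by (auto simp: in_keys_iff lookup_minus)

text \<open>Weights 1 give the total degree, the measure of the inductions on monomials; the weights
  \<open>wt\<close> give the grading by word length.\<close>

definition mdeg :: "('x \<Rightarrow> nat) \<Rightarrow> ('x \<Rightarrow>\<^sub>0 nat) \<Rightarrow> nat" where
  "mdeg w m = (\<Sum>i\<in>keys m. w i * lookup m i)"

lemma mdeg_superset: "finite S \<Longrightarrow> keys m \<subseteq> S \<Longrightarrow> mdeg w m = (\<Sum>i\<in>S. w i * lookup m i)"
  unfolding mdeg_def by (rule sum.mono_neutral_left) (auto simp: in_keys_iff)

lemma mdeg_0 [simp]: "mdeg w 0 = 0"
  by (simp add: mdeg_def)

lemma mdeg_single [simp]: "mdeg w (Poly_Mapping.single i n) = w i * n"
  by (subst mdeg_superset[of "{i}"]) auto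

lemma mdeg_add: "mdeg w (m + n) = mdeg w m + mdeg w n"
  by (subst (1 2 3) mdeg_superset[of "keys m \<union> keys n"])
    (auto simp: keys_add lookup_add algebra_simps sum.distrib dest: set_mp[OF keys_add])

lemma mdeg_diff_single:
  assumes "i \<in> keys m"
  shows "mdeg w m = w i + mdeg w (m - Poly_Mapping.single i 1)"
proof -
  have "m = Poly_Mapping.single i 1 + (m - Poly_Mapping.single i 1)"
    using assms by (intro poly_mapping_eqI)
      (auto simp: lookup_add lookup_minus lookup_single when_def in_keys_iff)
  then show ?thesis
    by (metis mdeg_add mdeg_single mult_1_right)
qed

lemma monomial_induct [consumes 1, case_names const var]:
  assumes "keys m \<subseteq> V"
    and "P (cst c)"
    and "\<And>i m. i \<in> V \<Longrightarrow> keys m \<subseteq> V \<Longrightarrow> P (Poly_Mapping.single m c) \<Longrightarrow> P (\<a> i * Poly_Mapping.single m c)"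
  shows "P (Poly_Mapping.single m c)"
  using assms(1)
proof (induction "mdeg (\<lambda>_. 1) m" arbitrary: m)
  case 0
  then have "m = 0"
    by (auto simp: mdeg_def in_keys_iff intro!: poly_mapping_eqI)
  then show ?case using assms(2) by (simp add: cst_def)
next
  case (Suc d)
  have "keys m \<noteq> {}" using Suc(2) by (auto simp: mdeg_def)
  then obtain i where i: "i \<in> keys m" by blast
  let ?n = "m - Poly_Mapping.single i 1"
  have "mdeg (\<lambda>_. 1) ?n = d" using mdeg_diff_single[OF i, of "\<lambda>_. 1"] Suc(2) by simp
  moreover have "keys ?n \<subseteq> V" using Suc(3) keys_diff_single_subset by fastforce
  ultimately have "P (Poly_Mapping.single ?n c)" using Suc(1) by simp
  then show ?case using assms(3) i Suc(3) \<open>keys ?n \<subseteq> V\<close> by (auto simp: single_split_var[OF i])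
qed

lemma polys_in_induct [consumes 1, case_names const var add mult]:
  assumes p: "p \<in> polys_in V"
    and c: "\<And>c. P (cst c)"
    and v: "\<And>i. i \<in> V \<Longrightarrow> P (\<a> i)"
    and add: "\<And>p q. P p \<Longrightarrow> P q \<Longrightarrow> P (p + q)"
    and mult: "\<And>p q. P p \<Longrightarrow> P q \<Longrightarrow> P (p * q)"
  shows "P p"
proof -
  have "P (Poly_Mapping.single m c)" if "keys m \<subseteq> V" for m c
    using that by (induction rule: monomial_induct) (auto intro: c v mult)
  moreover have "P (\<Sum>m\<in>S. f m)" if "finite S" "\<And>m. m \<in> S \<Longrightarrow> P (f m)" for S and f :: "('a \<Rightarrow>\<^sub>0 nat) \<Rightarrow> 'a mpoly"
    using that c[of 0] by (induction S rule: finite_induct) (auto intro: add)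
  ultimately have "P (\<Sum>m\<in>keys p. Poly_Mapping.single m (lookup p m))"
    using p by (auto simp: polys_in_def)
  then show ?thesis by (simp add: sum_monomials)
qed

lemma mpoly_induct [case_names const var add mult]:
  assumes "\<And>c. P (cst c)" "\<And>i. P (\<a> i)"
    and "\<And>p q. P p \<Longrightarrow> P q \<Longrightarrow> P (p + q)" "\<And>p q. P p \<Longrightarrow> P q \<Longrightarrow> P (p * q)"
  shows "P p"
proof -
  have "p \<in> polys_in UNIV" by (simp add: polys_in_def)
  then show ?thesis using assms by (induction rule: polys_in_induct) auto
qed

lemma polys_in_cst [simp]: "cst c \<in> polys_in V"
  by (auto simp: polys_in_def cst_def split: if_splits)

lemma polys_in_0 [simp]: "0 \<in> polys_in V" and polys_in_1 [simp]: "1 \<in> polys_in V"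
  using polys_in_cst[of 0 V] polys_in_cst[of 1 V] by simp_all

lemma polys_in_numeral [simp]: "numeral n \<in> polys_in V"
  by (metis cst_numeral polys_in_cst)

lemma polys_in_var [simp]: "\<a> i \<in> polys_in V \<longleftrightarrow> i \<in> V"
  by (auto simp: polys_in_def \<a>_def)

lemma polys_in_add: "p \<in> polys_in V \<Longrightarrow> q \<in> polys_in V \<Longrightarrow> p + q \<in> polys_in V"
  using keys_add[of p q] by (auto simp: polys_in_def)

lemma polys_in_uminus: "p \<in> polys_in V \<Longrightarrow> - p \<in> polys_in V"
  by (simp add: polys_in_def)

lemma polys_in_diff: "p \<in> polys_in V \<Longrightarrow> q \<in> polys_in V \<Longrightarrow> p - q \<in> polys_in V"
  using polys_in_add[of p V "- q"] by (simp add: polys_in_uminus)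

lemma polys_in_mult: "p \<in> polys_in V \<Longrightarrow> q \<in> polys_in V \<Longrightarrow> p * q \<in> polys_in V"
  unfolding polys_in_def by (auto dest!: subsetD[OF keys_add] subsetD[OF keys_mult])

lemma polys_in_power: "p \<in> polys_in V \<Longrightarrow> p ^ n \<in> polys_in V"
  by (induction n) (auto intro: polys_in_mult)

lemma polys_in_sum: "(\<And>i. i \<in> A \<Longrightarrow> f i \<in> polys_in V) \<Longrightarrow> sum f A \<in> polys_in V"
  by (induction A rule: infinite_finite_induct) (auto intro: polys_in_add)

lemma polys_in_mono: "p \<in> polys_in V \<Longrightarrow> V \<subseteq> W \<Longrightarrow> p \<in> polys_in W"
  by (auto simp: polys_in_def)

lemma polys_in_single: "keys m \<subseteq> V \<Longrightarrow> Poly_Mapping.single m c \<in> polys_in V"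
  by (auto simp: polys_in_def split: if_splits)

lemmas polys_in_intros = polys_in_add polys_in_uminus polys_in_diff polys_in_mult polys_in_power polys_in_sum

lemma polys_in_pdiff: "p \<in> polys_in V \<Longrightarrow> pdiff i p \<in> polys_in V"
  unfolding pdiff_def
  by (intro polys_in_sum polys_in_single order.trans[OF keys_diff_single_subset]) (auto simp: polys_in_def)

subsection \<open>Substitution homomorphisms\<close>

text \<open>As a predicate it lets one set of rules serve constants, evaluations and substitutions
  alike.\<close>

definition ring_map :: "('a::comm_ring_1 \<Rightarrow> 'b::comm_ring_1) \<Rightarrow> bool" where
  "ring_map \<iota> \<longleftrightarrow> \<iota> 1 = 1 \<and> (\<forall>a b. \<iota> (a + b) = \<iota> a + \<iota> b) \<and> (\<forall>a b. \<iota> (a * b) = \<iota> a * \<iota> b)"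

lemma ring_map_add: "ring_map \<iota> \<Longrightarrow> \<iota> (a + b) = \<iota> a + \<iota> b"
  and ring_map_mult: "ring_map \<iota> \<Longrightarrow> \<iota> (a * b) = \<iota> a * \<iota> b"
  and ring_map_1: "ring_map \<iota> \<Longrightarrow> \<iota> 1 = 1"
  by (auto simp: ring_map_def)

lemma ring_map_0: assumes "ring_map \<iota>" shows "\<iota> 0 = 0"
  using ring_map_add[OF assms, of 0 0] by simp

lemma ring_map_uminus: assumes "ring_map \<iota>" shows "\<iota> (- a) = - \<iota> a"
  using ring_map_add[OF assms, of a "-a"] ring_map_0[OF assms] by (simp add: eq_neg_iff_add_eq_0 add.commute)

lemma ring_map_diff: assumes "ring_map \<iota>" shows "\<iota> (a - b) = \<iota> a - \<iota> b"
  using ring_map_add[OF assms, of a "-b"] ring_map_uminus[OF assms] by simp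

lemma ring_map_of_nat: assumes "ring_map \<iota>" shows "\<iota> (of_nat n) = of_nat n"
  by (induction n) (auto simp: ring_map_0[OF assms] ring_map_1[OF assms] ring_map_add[OF assms])

lemma ring_map_numeral: assumes "ring_map \<iota>" shows "\<iota> (numeral n) = numeral n"
  using ring_map_of_nat[OF assms, of "numeral n"] by simp

lemma ring_map_sum: assumes "ring_map \<iota>" shows "\<iota> (\<Sum>i\<in>A. f i) = (\<Sum>i\<in>A. \<iota> (f i))"
  by (induction A rule: infinite_finite_induct) (auto simp: ring_map_0[OF assms] ring_map_add[OF assms])

lemma ring_map_prod: assumes "ring_map \<iota>" shows "\<iota> (\<Prod>i\<in>A. f i) = (\<Prod>i\<in>A. \<iota> (f i))"
  by (induction A rule: infinite_finite_induct) (auto simp: ring_map_1[OF assms] ring_map_mult[OF assms])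

lemma ring_map_power: assumes "ring_map \<iota>" shows "\<iota> (a ^ n) = \<iota> a ^ n"
  by (induction n) (auto simp: ring_map_1[OF assms] ring_map_mult[OF assms])

lemmas ring_map_simps = ring_map_0 ring_map_1 ring_map_add ring_map_mult ring_map_uminus ring_map_diff
  ring_map_numeral ring_map_power

lemma ring_map_id [simp]: "ring_map (\<lambda>c. c)" and ring_map_cst [simp]: "ring_map cst"
  by (auto simp: ring_map_def cst_add cst_mult)

text \<open>Enlarging the index set lets several polynomials be summed over one common set of
  monomials.\<close>

lemma poly_subst_superset:
  assumes "ring_map \<iota>" "finite S" "keys p \<subseteq> S"
  shows "poly_subst \<iota> x p = (\<Sum>m\<in>S. \<iota> (lookup p m) * (\<Prod>i\<in>keys m. x i ^ lookup m i))"
  unfolding poly_subst_def using assms(2,3)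
  by (intro sum.mono_neutral_left) (auto simp: in_keys_iff ring_map_0[OF assms(1)])

lemma poly_subst_single:
  "ring_map \<iota> \<Longrightarrow> poly_subst \<iota> x (Poly_Mapping.single m c) = \<iota> c * (\<Prod>i\<in>keys m. x i ^ lookup m i)"
  by (subst poly_subst_superset[of _ "{m}"]) auto

lemma poly_subst_add:
  assumes "ring_map \<iota>" shows "poly_subst \<iota> x (p + q) = poly_subst \<iota> x p + poly_subst \<iota> x q"
  by (subst (1 2 3) poly_subst_superset[OF assms, of "keys p \<union> keys q"])
    (auto simp: keys_add lookup_add algebra_simps ring_map_add[OF assms] sum.distrib
      dest: set_mp[OF keys_add])

lemma prod_power_superset:
  "finite S \<Longrightarrow> keys m \<subseteq> S \<Longrightarrow> (\<Prod>i\<in>keys m. x i ^ lookup m i) = (\<Prod>i\<in>S. (x i :: 'b::comm_ring_1) ^ lookup m i)"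
  by (rule prod.mono_neutral_left) (auto simp: in_keys_iff)

lemma poly_subst_sum:
  assumes "ring_map \<iota>" shows "poly_subst \<iota> x (\<Sum>i\<in>A. f i) = (\<Sum>i\<in>A. poly_subst \<iota> x (f i))"
  by (induction A rule: infinite_finite_induct)
    (auto simp: poly_subst_add[OF assms] poly_subst_def[of _ _ 0])

lemma poly_subst_mult:
  assumes "ring_map \<iota>" shows "poly_subst \<iota> x (p * q) = poly_subst \<iota> x p * poly_subst \<iota> x q"
proof -
  let ?t = "\<lambda>p m. Poly_Mapping.single m (lookup p m)"
  have s: "poly_subst \<iota> x (Poly_Mapping.single m c * Poly_Mapping.single n d) =
     poly_subst \<iota> x (Poly_Mapping.single m c) * poly_subst \<iota> x (Poly_Mapping.single n d)" for m n c d
  proof -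
    let ?S = "keys m \<union> keys n"
    have *: "(\<Prod>i\<in>keys (m + n). x i ^ lookup (m + n) i) = (\<Prod>i\<in>?S. x i ^ lookup (m + n) i)"
      by (rule prod_power_superset) (simp_all add: keys_add)
    show ?thesis
      unfolding mult_single poly_subst_single[OF assms] ring_map_mult[OF assms] *
      by (simp add: prod_power_superset[of ?S m] prod_power_superset[of ?S n]
        lookup_add power_add prod.distrib mult_ac)
  qed
  have "poly_subst \<iota> x ((\<Sum>m\<in>keys p. ?t p m) * (\<Sum>n\<in>keys q. ?t q n)) =
    poly_subst \<iota> x (\<Sum>m\<in>keys p. ?t p m) * poly_subst \<iota> x (\<Sum>n\<in>keys q. ?t q n)"
    by (simp only: sum_product poly_subst_sum[OF assms] s)
  then show ?thesis by (simp only: sum_monomials)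
qed

lemma poly_subst_cst: "ring_map \<iota> \<Longrightarrow> poly_subst \<iota> x (cst c) = \<iota> c"
  by (simp add: cst_def poly_subst_single)

lemma poly_subst_var: "ring_map \<iota> \<Longrightarrow> poly_subst \<iota> x (\<a> i) = x i"
  by (simp add: \<a>_def poly_subst_single ring_map_1)

lemma ring_map_poly_subst:
  assumes "ring_map \<iota>" shows "ring_map (poly_subst \<iota> x)"
  unfolding ring_map_def using poly_subst_cst[OF assms, of x 1] ring_map_1[OF assms]
  by (auto simp: poly_subst_add[OF assms] poly_subst_mult[OF assms])

lemmas poly_subst_simps = poly_subst_cst poly_subst_var
  ring_map_simps[OF ring_map_poly_subst] ring_map_sum[OF ring_map_poly_subst]

lemmas peval_simps = poly_subst_simps[OF ring_map_id]
lemmas csubst_simps = poly_subst_simps[OF ring_map_cst]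

lemma ring_map_comp: "ring_map f \<Longrightarrow> ring_map g \<Longrightarrow> ring_map (\<lambda>x. f (g x))"
  by (auto simp: ring_map_def)

lemma ring_map_poly_subst_eq:
  assumes "ring_map f" "ring_map \<iota>"
  shows "f (poly_subst \<iota> x p) = poly_subst (\<lambda>c. f (\<iota> c)) (\<lambda>i. f (x i)) p"
  by (induction p rule: mpoly_induct)
    (simp_all add: poly_subst_simps assms ring_map_comp ring_map_simps[OF assms(1)])

lemma peval_csubst: "peval x (poly_subst cst f p) = peval (\<lambda>i. peval x (f i)) p"
  by (subst ring_map_poly_subst_eq) (auto simp: peval_simps intro: ring_map_poly_subst)

lemma csubst_id: "poly_subst cst \<a> p = p"
  by (induction p rule: mpoly_induct) (simp_all add: csubst_simps)

lemma poly_subst_cong: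
  assumes "ring_map \<iota>" "p \<in> polys_in V" "\<And>i. i \<in> V \<Longrightarrow> x i = y i"
  shows "poly_subst \<iota> x p = poly_subst \<iota> y p"
  using assms(2) by (induction rule: polys_in_induct) (simp_all add: poly_subst_simps[OF assms(1)] assms(3))

subsection \<open>Derivatives and the identity principle\<close>

lemma pdiff_0 [simp]: "pdiff i 0 = 0"
  by (simp add: pdiff_def)

lemma pdiff_uminus: "pdiff i (- p) = - pdiff i p"
  using pdiff_add[of i p "- p"] by (simp add: eq_neg_iff_add_eq_0 add.commute)

lemma pdiff_diff: "pdiff i (p - q) = pdiff i p - pdiff i q"
  using pdiff_add[of i p "- q"] by (simp add: pdiff_uminus)

lemma pdiff_1 [simp]: "pdiff i 1 = 0"
  using pdiff_cst[of i 1] by simp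

lemma pdiff_numeral [simp]: "pdiff i (numeral n) = 0"
  by (metis cst_numeral pdiff_cst)

lemma pdiff_polys_in_0: "p \<in> polys_in V \<Longrightarrow> i \<notin> V \<Longrightarrow> pdiff i p = 0"
  by (induction rule: polys_in_induct) (auto simp: pdiff_cst pdiff_var pdiff_add pdiff_mult)

text \<open>The chain rule along a complex line. Besides the identity principle below it serves the
  Hamiltonian flows, which move a pair of matrices along a line in the space of entries.\<close>

lemma peval_line_deriv:
  assumes "finite A" "p \<in> polys_in A"
  shows "((\<lambda>t. peval (\<lambda>i. x i + t * v i) p) has_field_derivative
    (\<Sum>i\<in>A. v i * peval (\<lambda>i. x i + t * v i) (pdiff i p))) (at t)"
  using assms(2)
proof (induction rule: polys_in_induct)
  case (const c)
  then show ?case by (simp add: peval_simps pdiff_cst)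
next
  case (var j)
  have "(\<Sum>i\<in>A. v i * peval (\<lambda>i. x i + t * v i) (pdiff i (\<a> j))) = (\<Sum>i\<in>A. if i = j then v j else 0)"
    by (rule sum.cong) (auto simp: pdiff_var peval_simps)
  then show ?case using var assms(1)
    by (auto simp: peval_simps intro!: derivative_eq_intros)
next
  case (add p q)
  show ?case
    by (simp add: peval_simps pdiff_add algebra_simps sum.distrib DERIV_add[OF add])
next
  case (mult p q)
  show ?case
    using DERIV_mult[OF mult]
    by (simp add: peval_simps pdiff_mult algebra_simps sum.distrib sum_distrib_left)
qed

lemma finite_support: "\<exists>A. finite A \<and> p \<in> polys_in A"
  by (rule exI[of _ "\<Union>m\<in>keys p. keys m"]) (auto simp: polys_in_def)

text \<open>Among exponent vectors containing i, lowering the exponent of i is injective, so the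
  terms of the derivative cannot cancel, and the factor coming from the exponent is nonzero in
  characteristic 0.\<close>

lemma pdiff_zero_imp_cst:
  assumes "\<And>i. pdiff i p = 0"
  shows "p = cst (lookup p 0)"
proof -
  have "m = 0" if m: "m \<in> keys p" for m
  proof (rule ccontr)
    assume "m \<noteq> 0"
    then obtain i where i: "lookup m i \<noteq> 0" by (metis poly_mapping_eqI lookup_zero)
    let ?e = "Poly_Mapping.single i (1::nat)"
    have inj: "n = m" if "n - ?e = m - ?e" "lookup n i \<noteq> 0" for n
    proof (rule poly_mapping_eqI)
      fix k
      have "lookup (n - ?e) k = lookup (m - ?e) k" using that by simp
      then show "lookup n k = lookup m k"
        using i that(2) by (cases "k = i") (auto simp: lookup_minus lookup_single when_def)
    qed
    have "lookup (pdiff i p) (m - ?e) = (\<Sum>n\<in>keys p. if n = m then of_nat (lookup m i) * lookup p m else 0)"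
      unfolding pdiff_def lookup_sum
      using inj by (intro sum.cong refl) (auto simp: lookup_single when_def)
    also have "\<dots> = of_nat (lookup m i) * lookup p m" using m by simp
    finally show False using assms i m by (simp add: in_keys_iff)
  qed
  then have "keys p \<subseteq> {0}" by auto
  then show ?thesis
    by (intro poly_mapping_eqI) (auto simp: cst_def lookup_single when_def in_keys_iff)
qed

lemma pdiff_mdeg_less:
  assumes "m \<in> keys (pdiff i p)"
  shows "\<exists>n\<in>keys p. mdeg (\<lambda>_. 1) n = Suc (mdeg (\<lambda>_. 1) m)"
proof -
  obtain n where n: "n \<in> keys p"
      "m \<in> keys (Poly_Mapping.single (n - Poly_Mapping.single i 1) (of_nat (lookup n i) * lookup p n))"
    using assms keys_sum unfolding pdiff_def by fastforce
  then have "m = n - Poly_Mapping.single i 1" "i \<in> keys n"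
    by (auto split: if_splits simp: in_keys_iff)
  then show ?thesis using n mdeg_diff_single[of i n "\<lambda>_. 1"] by auto
qed

text \<open>Induction on the total degree: the partial derivatives vanish on the same box, hence are
  0, and a constant that vanishes somewhere is 0. A box instead of the whole space makes the
  principle applicable to matrices near the identity, which are invertible.\<close>

lemma peval_zero_on_box:
  assumes "r > 0" "\<And>x. (\<And>i. dist (x i) (x0 i) < r) \<Longrightarrow> peval x p = 0"
  shows "p = 0"
proof -
  have "\<forall>p. (\<forall>m\<in>keys p. mdeg (\<lambda>_. 1) m < d) \<longrightarrow> (\<forall>x. (\<forall>i. dist (x i) (x0 i) < r) \<longrightarrow> peval x p = 0) \<longrightarrow> p = 0" for d
  proof (induction d)
    case 0
    then show ?case by auto
  next
    case (Suc d)
    show ?case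
    proof (intro allI impI)
      fix p :: "'a mpoly"
      assume d: "\<forall>m\<in>keys p. mdeg (\<lambda>_. 1) m < Suc d" and z: "\<forall>x. (\<forall>i. dist (x i) (x0 i) < r) \<longrightarrow> peval x p = 0"
      have "pdiff i p = 0" for i
      proof -
        have "peval x (pdiff i p) = 0" if x: "\<forall>i. dist (x i) (x0 i) < r" for x
        proof -
          obtain A where A: "finite A" "p \<in> polys_in A" using finite_support by blast
          let ?v = "\<lambda>j. if j = i then 1 else 0 :: complex"
          \<comment> \<open>Moving coordinate i by less than this amount stays inside the
            box.\<close>
          let ?s = "r - dist (x i) (x0 i)"
          have A': "finite (insert i A)" "p \<in> polys_in (insert i A)" using A by (auto elim: polys_in_mono)
          have "((\<lambda>t. peval (\<lambda>i. x i + t * ?v i) p) has_field_derivative peval x (pdiff i p)) (at 0)"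
            using peval_line_deriv[OF A', of x ?v 0] A'(1)
            by (simp add: if_distrib[of "\<lambda>u. u * _"] sum.delta cong: if_cong)
          moreover have "((\<lambda>t. peval (\<lambda>i. x i + t * ?v i) p) has_field_derivative 0) (at 0)"
          proof (rule has_field_derivative_transform_within_open[of "\<lambda>_. 0" 0 0 "ball 0 ?s"])
            fix t :: complex assume t: "t \<in> ball 0 ?s"
            have "dist (x j + t * ?v j) (x0 j) < r" for j
            proof (cases "j = i")
              case True
              have "dist (x i + t) (x0 i) \<le> dist (x i + t) (x i) + dist (x i) (x0 i)" by (rule dist_triangle)
              then show ?thesis using t True by (simp add: dist_norm)
            qed (use x in auto)
            then show "0 = peval (\<lambda>i. x i + t * ?v i) p" using z by simp
          qed (use x in \<open>auto\<close>)
          ultimately show ?thesis by (rule DERIV_unique)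
        qed
        moreover have "\<forall>m\<in>keys (pdiff i p). mdeg (\<lambda>_. 1) m < d"
          using d pdiff_mdeg_less by fastforce
        ultimately show ?thesis using Suc by blast
      qed
      then have p: "p = cst (lookup p 0)" by (rule pdiff_zero_imp_cst)
      have "peval x0 p = 0" using z assms(1) by simp
      then have "lookup p 0 = 0" by (subst (asm) p) (simp add: peval_simps)
      then show "p = 0" using p by simp
    qed
  qed
  note * = this
  define d where "d = Suc (\<Sum>m\<in>keys p. mdeg (\<lambda>_. 1) m)"
  have "\<forall>m\<in>keys p. mdeg (\<lambda>_. 1) m < d"
    unfolding d_def by (auto simp: less_Suc_eq_le intro: member_le_sum)
  then show ?thesis using * assms(2) by blast
qed

lemma peval_zero_imp_zero: "(\<And>x. peval x p = 0) \<Longrightarrow> p = 0"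
  by (rule peval_zero_on_box[of 1]) auto

section \<open>The bracket on generators\<close>

lemma map_of_hit: "k = k' \<Longrightarrow> map_of ((k', v) # xs) k = Some v" by simp

lemma map_of_miss: "k \<noteq> k' \<Longrightarrow> map_of ((k', v) # xs) k = map_of xs k" by simp

lemma swap_index_simps: "swap_index 3 = 5" "swap_index 4 = 4" "swap_index 5 = 3" "swap_index 6 = 9"
  "swap_index 7 = 8" "swap_index 8 = 7" "swap_index 9 = 6" "swap_index 10 = 14" "swap_index 11 = 13"
  "swap_index 12 = 12" "swap_index 13 = 11" "swap_index 14 = 10" "swap_index 1 = 1" "swap_index 2 = 2"
  by (simp_all add: swap_index_def)

lemma swap_simps: "swap (\<a> i) = \<a> (swap_index i)" "swap (p + q) = swap p + swap q" "swap (p * q) = swap p * swap q"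
  "swap (p - q) = swap p - swap q" "swap (- p) = - swap p" "swap (numeral n) = numeral n" "swap (cst c) = cst c"
  "swap (p ^ k) = swap p ^ k" "swap 0 = 0"
  by (simp_all add: swap_def csubst_simps)

text \<open>Only table lookups and the involution are rewritten, so the entries keep their shape,
  with \<epsilon> as a parameter.\<close>

lemmas gen_bracket_eval = map_of_hit map_of_miss map_of.simps(1) prod.inject HOL.simp_thms option.case
  num.inject num.distinct numeral_eq_iff numeral_eq_one_iff one_eq_numeral_iff swap_index_simps swap_simps

lemma gen_bracket_3:
  "gen_bracket \<epsilon> 3 4 = 2 * \<a> 3"
  "gen_bracket \<epsilon> 3 5 = 4 * \<a> 4"
  "gen_bracket \<epsilon> 3 6 = 0"
  "gen_bracket \<epsilon> 3 7 = 2 * \<a> 6"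
  "gen_bracket \<epsilon> 3 8 = 4 * \<a> 7"
  "gen_bracket \<epsilon> 3 9 = 6 * \<a> 8"
  "gen_bracket \<epsilon> 3 10 = 0"
  "gen_bracket \<epsilon> 3 11 = 2 * \<a> 10"
  "gen_bracket \<epsilon> 3 12 = 4 * \<a> 11"
  "gen_bracket \<epsilon> 3 13 = 6 * \<a> 12 + cst (12 * \<epsilon>)"
  "gen_bracket \<epsilon> 3 14 = 8 * \<a> 13"
  unfolding gen_bracket_def bracket_table_def Let_def
  by (simp_all only: gen_bracket_eval minus_zero)

text \<open>The double minus signs are the literal outcome of the rule {s p, s q} = - s {p,
  q}.\<close>

lemma gen_bracket_4:
  "gen_bracket \<epsilon> 4 5 = 2 * \<a> 5"
  "gen_bracket \<epsilon> 4 6 = -3 * \<a> 6"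
  "gen_bracket \<epsilon> 4 7 = - \<a> 7"
  "gen_bracket \<epsilon> 4 8 = - (- \<a> 8)"
  "gen_bracket \<epsilon> 4 9 = - (-3 * \<a> 9)"
  "gen_bracket \<epsilon> 4 10 = -4 * \<a> 10"
  "gen_bracket \<epsilon> 4 11 = -2 * \<a> 11"
  "gen_bracket \<epsilon> 4 12 = 0"
  "gen_bracket \<epsilon> 4 13 = - (-2 * \<a> 13)"
  "gen_bracket \<epsilon> 4 14 = - (-4 * \<a> 14)"
  unfolding gen_bracket_def bracket_table_def Let_def
  by (simp_all only: gen_bracket_eval minus_zero)

lemma gen_bracket_5:
  "gen_bracket \<epsilon> 5 6 = - (6 * \<a> 7)"
  "gen_bracket \<epsilon> 5 7 = - (4 * \<a> 8)"
  "gen_bracket \<epsilon> 5 8 = - (2 * \<a> 9)"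
  "gen_bracket \<epsilon> 5 9 = 0"
  "gen_bracket \<epsilon> 5 10 = - (8 * \<a> 11)"
  "gen_bracket \<epsilon> 5 11 = - (6 * \<a> 12 + cst (12 * \<epsilon>))"
  "gen_bracket \<epsilon> 5 12 = - (4 * \<a> 13)"
  "gen_bracket \<epsilon> 5 13 = - (2 * \<a> 14)"
  "gen_bracket \<epsilon> 5 14 = 0"
  unfolding gen_bracket_def bracket_table_def Let_def
  by (simp_all only: gen_bracket_eval minus_zero)

lemma gen_bracket_6:
  "gen_bracket \<epsilon> 6 7 = 3 * \<a> 10 - cst (3/4) * \<a> 3 ^ 2"
  "gen_bracket \<epsilon> 6 8 = 6 * \<a> 11 - cst (3/2) * \<a> 3 * \<a> 4"
  "gen_bracket \<epsilon> 6 9 = 9 * \<a> 12 - cst (9/4) * \<a> 3 * \<a> 5"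
  "gen_bracket \<epsilon> 6 10 = 0"
  "gen_bracket \<epsilon> 6 11 = cst (7/4) * \<a> 3 * \<a> 6"
  "gen_bracket \<epsilon> 6 12 = 2 * \<a> 4 * \<a> 6 + cst (3/2) * \<a> 3 * \<a> 7"
  "gen_bracket \<epsilon> 6 13 = cst (3/4) * \<a> 5 * \<a> 6 + cst (9/2) * \<a> 4 * \<a> 7"
  "gen_bracket \<epsilon> 6 14 = 6 * \<a> 4 * \<a> 8 + 3 * \<a> 5 * \<a> 7 - 2 * \<a> 3 * \<a> 9"
  unfolding gen_bracket_def bracket_table_def Let_def
  by (simp_all only: gen_bracket_eval minus_zero)

lemma gen_bracket_7:
  "gen_bracket \<epsilon> 7 8 = 3 * \<a> 12 + cst (12 * \<epsilon>) - \<a> 4 ^ 2 + cst (1/4) * \<a> 3 * \<a> 5"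
  "gen_bracket \<epsilon> 7 9 = 6 * \<a> 13 - cst (3/2) * \<a> 5 * \<a> 4"
  "gen_bracket \<epsilon> 7 10 = - cst (7/3) * \<a> 3 * \<a> 6"
  "gen_bracket \<epsilon> 7 11 = - cst (5/6) * \<a> 4 * \<a> 6 + cst (1/4) * \<a> 3 * \<a> 7"
  "gen_bracket \<epsilon> 7 12 = \<a> 3 * \<a> 8 + cst (1/6) * \<a> 5 * \<a> 6"
  "gen_bracket \<epsilon> 7 13 = cst (2/3) * \<a> 3 * \<a> 9 + \<a> 4 * \<a> 8 + cst (5/4) * \<a> 5 * \<a> 7"
  "gen_bracket \<epsilon> 7 14 = 4 * \<a> 5 * \<a> 8 + cst (2/3) * \<a> 4 * \<a> 9"
  unfolding gen_bracket_def bracket_table_def Let_def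
  by (simp_all only: gen_bracket_eval minus_zero)

lemma gen_bracket_8:
  "gen_bracket \<epsilon> 8 9 = 3 * \<a> 14 - cst (3/4) * \<a> 5 ^ 2"
  "gen_bracket \<epsilon> 8 10 = - (4 * \<a> 3 * \<a> 7 + cst (2/3) * \<a> 4 * \<a> 6)"
  "gen_bracket \<epsilon> 8 11 = - (cst (2/3) * \<a> 5 * \<a> 6 + \<a> 4 * \<a> 7 + cst (5/4) * \<a> 3 * \<a> 8)"
  "gen_bracket \<epsilon> 8 12 = - (\<a> 5 * \<a> 7 + cst (1/6) * \<a> 3 * \<a> 9)"
  "gen_bracket \<epsilon> 8 13 = - (- cst (5/6) * \<a> 4 * \<a> 9 + cst (1/4) * \<a> 5 * \<a> 8)"
  "gen_bracket \<epsilon> 8 14 = - (- cst (7/3) * \<a> 5 * \<a> 9)"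
  unfolding gen_bracket_def bracket_table_def Let_def
  by (simp_all only: gen_bracket_eval minus_zero)

lemma gen_bracket_9:
  "gen_bracket \<epsilon> 9 10 = - (6 * \<a> 4 * \<a> 7 + 3 * \<a> 3 * \<a> 8 - 2 * \<a> 5 * \<a> 6)"
  "gen_bracket \<epsilon> 9 11 = - (cst (3/4) * \<a> 3 * \<a> 9 + cst (9/2) * \<a> 4 * \<a> 8)"
  "gen_bracket \<epsilon> 9 12 = - (2 * \<a> 4 * \<a> 9 + cst (3/2) * \<a> 5 * \<a> 8)"
  "gen_bracket \<epsilon> 9 13 = - (cst (7/4) * \<a> 5 * \<a> 9)"
  "gen_bracket \<epsilon> 9 14 = 0"
  unfolding gen_bracket_def bracket_table_def Let_def
  by (simp_all only: gen_bracket_eval minus_zero)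

lemma gen_bracket_10:
  "gen_bracket \<epsilon> 10 11 = - cst (1/2) * \<a> 3 ^ 3 + cst (1/3) * \<a> 6 ^ 2 + 3 * \<a> 3 * \<a> 10"
  "gen_bracket \<epsilon> 10 12 = - (\<a> 3 ^ 2 * \<a> 4) + cst (2/3) * \<a> 6 * \<a> 7 + 4 * \<a> 3 * \<a> 11 + 2 * \<a> 4 * \<a> 10"
  "gen_bracket \<epsilon> 10 13 = cst (10 * \<epsilon>) * \<a> 3 - cst (3/2) * \<a> 3 ^ 2 * \<a> 5 + \<a> 6 * \<a> 8 + 6 * \<a> 3 * \<a> 12 + 3 * \<a> 5 * \<a> 10"
  "gen_bracket \<epsilon> 10 14 = - cst (4/5) * \<a> 4 * (cst (16 * \<epsilon>) + cst (3/2) * \<a> 3 * \<a> 5 + \<a> 4 ^ 2) + cst (4/15) * (18 * \<a> 7 * \<a> 8 - 13 * \<a> 6 * \<a> 9) + cst (12/5) * (\<a> 5 * \<a> 11 + 3 * \<a> 4 * \<a> 12 + \<a> 3 * \<a> 13)"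
  unfolding gen_bracket_def bracket_table_def Let_def
  by (simp_all only: gen_bracket_eval minus_zero)

lemma gen_bracket_11:
  "gen_bracket \<epsilon> 11 12 = cst (9 * \<epsilon>) * \<a> 3 - cst (1/2) * \<a> 3 ^ 2 * \<a> 5 + cst (11/6) * \<a> 6 * \<a> 8 - cst (3/2) * \<a> 7 ^ 2 + 2 * \<a> 3 * \<a> 12 + \<a> 5 * \<a> 10"
  "gen_bracket \<epsilon> 11 13 = cst (1/5) * \<a> 4 * (cst (53 * \<epsilon>) - 2 * \<a> 4 ^ 2 - 3 * \<a> 3 * \<a> 5) + cst (6/5) * (3 * \<a> 4 * \<a> 12 + \<a> 3 * \<a> 13 + \<a> 5 * \<a> 11) + cst (1/60) * (9 * \<a> 7 * \<a> 8 + 31 * \<a> 6 * \<a> 9)"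
  "gen_bracket \<epsilon> 11 14 = cst (10 * \<epsilon>) * \<a> 5 - cst (3/2) * \<a> 5 ^ 2 * \<a> 3 + \<a> 9 * \<a> 7 + 6 * \<a> 5 * \<a> 12 + 3 * \<a> 3 * \<a> 14"
  unfolding gen_bracket_def bracket_table_def Let_def
  by (simp_all only: gen_bracket_eval minus_zero)

lemma gen_bracket_12:
  "gen_bracket \<epsilon> 12 13 = cst (9 * \<epsilon>) * \<a> 5 - cst (1/2) * \<a> 5 ^ 2 * \<a> 3 + cst (11/6) * \<a> 9 * \<a> 7 - cst (3/2) * \<a> 8 ^ 2 + 2 * \<a> 5 * \<a> 12 + \<a> 3 * \<a> 14"
  "gen_bracket \<epsilon> 12 14 = - (\<a> 5 ^ 2 * \<a> 4) + cst (2/3) * \<a> 9 * \<a> 8 + 4 * \<a> 5 * \<a> 13 + 2 * \<a> 4 * \<a> 14"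
  unfolding gen_bracket_def bracket_table_def Let_def
  by (simp_all only: gen_bracket_eval minus_zero)

lemma gen_bracket_13:
  "gen_bracket \<epsilon> 13 14 = - cst (1/2) * \<a> 5 ^ 3 + cst (1/3) * \<a> 9 ^ 2 + 3 * \<a> 5 * \<a> 14"
  unfolding gen_bracket_def bracket_table_def Let_def
  by (simp_all only: gen_bracket_eval minus_zero)

section \<open>Bracket ideals and the grading\<close>

lemma poly_alg_simps [simp]:
  "carrier (poly_alg \<epsilon> V) = polys_in V" "mult (poly_alg \<epsilon> V) = (*)" "one (poly_alg \<epsilon> V) = 1"
  "zero (poly_alg \<epsilon> V) = 0" "add (poly_alg \<epsilon> V) = (+)" "smult (poly_alg \<epsilon> V) = (\<lambda>c p. cst c * p)"
  "pbr (poly_alg \<epsilon> V) = poly_bracket \<epsilon>"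
  by (simp_all add: poly_alg_def)

lemma cring_poly_alg: "cring (poly_alg \<epsilon> V)"
proof (rule cringI)
  show "abelian_group (poly_alg \<epsilon> V)"
    by (rule abelian_groupI) (auto simp: polys_in_intros algebra_simps intro: bexI[of _ "- x" for x] polys_in_uminus)
  show "comm_monoid (poly_alg \<epsilon> V)"
    by (rule comm_monoidI) (auto simp: polys_in_intros algebra_simps)
qed (auto simp: algebra_simps)

lemma ideal_poly_algI:
  assumes "I \<subseteq> polys_in V" "0 \<in> I" "\<And>p q. p \<in> I \<Longrightarrow> q \<in> I \<Longrightarrow> p + q \<in> I"
    "\<And>f p. f \<in> polys_in V \<Longrightarrow> p \<in> I \<Longrightarrow> f * p \<in> I"
  shows "ideal I (poly_alg \<epsilon> V)"
proof -
  interpret cring "poly_alg \<epsilon> V" by (rule cring_poly_alg)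
  have neg: "- p \<in> I" if "p \<in> I" for p
    using assms(4)[of "- 1" p] that polys_in_uminus[of 1 V] by simp
  have r: "p * f \<in> I" if "f \<in> polys_in V" "p \<in> I" for f p
    using assms(4)[OF that] by (simp add: mult.commute)
  have inv: "a_inv (poly_alg \<epsilon> V) p = - p" if "p \<in> polys_in V" for p
    using minus_equality[of "- p" p] that by (auto intro: polys_in_uminus)
  show ?thesis
  proof (rule idealI)
    show "subgroup I (add_monoid (poly_alg \<epsilon> V))"
    proof (rule group.subgroupI[OF a_group])
      show "inv\<^bsub>add_monoid (poly_alg \<epsilon> V)\<^esub> p \<in> I" if "p \<in> I" for p
        using neg[OF that] inv[of p] assms(1) that unfolding a_inv_def by auto
    qed (use assms in auto)
  qed (use assms(1,4) r in \<open>auto simp: ring_axioms\<close>)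
qed

lemma ideal_poly_algD:
  assumes "ideal I (poly_alg \<epsilon> V)"
  shows "I \<subseteq> polys_in V" "0 \<in> I" "p \<in> I \<Longrightarrow> q \<in> I \<Longrightarrow> p + q \<in> I"
    "f \<in> polys_in V \<Longrightarrow> p \<in> I \<Longrightarrow> f * p \<in> I"
proof -
  interpret ideal I "poly_alg \<epsilon> V" by fact
  show "I \<subseteq> polys_in V" using a_subset by simp
  show "0 \<in> I" using additive_subgroup.zero_closed[OF is_additive_subgroup] by simp
  show "p + q \<in> I" if "p \<in> I" "q \<in> I" using additive_subgroup.a_closed[OF is_additive_subgroup that] by simp
  show "f * p \<in> I" if "f \<in> polys_in V" "p \<in> I" using I_l_closed[of p f] that by simp
qed

lemma gen_bracket_self [simp]: "gen_bracket \<epsilon> i i = 0"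
proof -
  have "gen_bracket \<epsilon> i i + gen_bracket \<epsilon> i i = 0"
    by (subst gen_bracket_antisym) simp
  then have "2 * gen_bracket \<epsilon> i i = 0" by (simp only: mult_2)
  then show ?thesis by simp
qed

lemmas gen_bracket_values = gen_bracket_3 gen_bracket_4 gen_bracket_5 gen_bracket_6 gen_bracket_7
  gen_bracket_8 gen_bracket_9 gen_bracket_10 gen_bracket_11 gen_bracket_12 gen_bracket_13

lemma index_cases:
  assumes "i \<in> {3..14::nat}"
  obtains "i = 3" | "i = 4" | "i = 5" | "i = 6" | "i = 7" | "i = 8" | "i = 9" | "i = 10" | "i = 11"
    | "i = 12" | "i = 13" | "i = 14"
proof -
  have "i = 3 \<or> i = 4 \<or> i = 5 \<or> i = 6 \<or> i = 7 \<or> i = 8 \<or> i = 9 \<or> i = 10 \<or> i = 11 \<or> i = 12 \<or> i = 13 \<or> i = 14"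
    using assms unfolding atLeastAtMost_iff by presburger
  then show thesis using that by blast
qed

text \<open>The length of the word whose trace is a_i. The bracket {-,-}_0 lowers this degree by 2,
  since two letters disappear, and every \<epsilon> in the table lowers it by 4 more.\<close>

definition wt :: "nat \<Rightarrow> nat" where
  "wt i = (if i \<le> 2 then 1 else if i \<le> 5 then 2 else if i \<le> 9 then 3 else 4)"

definition homog :: "nat \<Rightarrow> nat mpoly set" where
  "homog d = {p. \<forall>m\<in>keys p. mdeg wt m = d}"

definition below :: "nat \<Rightarrow> nat mpoly set" where
  "below d = {p. \<forall>m\<in>keys p. mdeg wt m < d}"

lemma homog_0 [simp]: "0 \<in> homog d"
  by (simp add: homog_def)

lemma homog_add: "p \<in> homog d \<Longrightarrow> q \<in> homog d \<Longrightarrow> p + q \<in> homog d"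
  using keys_add[of p q] by (auto simp: homog_def)

lemma homog_uminus: "p \<in> homog d \<Longrightarrow> - p \<in> homog d"
  by (simp add: homog_def)

lemma homog_diff: "p \<in> homog d \<Longrightarrow> q \<in> homog d \<Longrightarrow> p - q \<in> homog d"
  using homog_add[of p d "- q"] by (simp add: homog_uminus)

lemma homog_mult: "p \<in> homog d \<Longrightarrow> q \<in> homog e \<Longrightarrow> d + e = n \<Longrightarrow> p * q \<in> homog n"
  using keys_mult[of p q] by (force simp: homog_def mdeg_add)

lemma homog_cst: "cst c \<in> homog 0"
  by (simp add: homog_def cst_def)

lemma homog_1: "1 \<in> homog 0" and homog_numeral: "numeral k \<in> homog 0"
  using homog_cst[of 1] homog_cst[of "numeral k"] by (simp_all add: cst_numeral)

lemma homog_cst_mult: "p \<in> homog d \<Longrightarrow> cst c * p \<in> homog d"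
  using homog_mult[OF homog_cst] by simp

lemma homog_mult_cst: "p \<in> homog d \<Longrightarrow> p * cst c \<in> homog d"
  using homog_mult[OF _ homog_cst] by simp

lemma homog_numeral_mult: "p \<in> homog d \<Longrightarrow> numeral c * p \<in> homog d"
  using homog_mult[OF homog_numeral] by simp

lemma homog_var: "wt i = n \<Longrightarrow> \<a> i \<in> homog n"
  by (simp add: homog_def \<a>_def)

lemma homog_power: "p \<in> homog d \<Longrightarrow> k * d = n \<Longrightarrow> p ^ k \<in> homog n"
  by (induction k arbitrary: n) (auto intro: homog_1 homog_mult)

lemma homog_sum: "(\<And>i. i \<in> A \<Longrightarrow> f i \<in> homog d) \<Longrightarrow> sum f A \<in> homog d"
  by (induction A rule: infinite_finite_induct) (auto intro: homog_add)

lemma keys_pdiffE: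
  assumes "m \<in> keys (pdiff i p)"
  obtains n where "n \<in> keys p" "m = n - Poly_Mapping.single i 1" "i \<in> keys n"
proof -
  from subsetD[OF keys_sum assms[unfolded pdiff_def]]
  show thesis using that by (auto split: if_splits simp: in_keys_iff)
qed

lemma homog_pdiff:
  assumes "p \<in> homog d" "q \<in> homog e" "d + e = n + wt i"
  shows "pdiff i p * q \<in> homog n"
proof -
  have "mdeg wt m + wt i = d" if m: "m \<in> keys (pdiff i p)" for m
  proof -
    obtain k where k: "k \<in> keys p" "m = k - Poly_Mapping.single i 1" "i \<in> keys k"
      using m by (rule keys_pdiffE) (rule that)
    show ?thesis using k mdeg_diff_single[of i k wt] assms(1) by (auto simp: homog_def)
  qed
  then show ?thesis
    using keys_mult[of "pdiff i p" q] assms by (force simp: homog_def mdeg_add)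
qed

lemma homog_consts: "0 = d \<Longrightarrow> cst c \<in> homog d" "0 = d \<Longrightarrow> 1 \<in> homog d" "0 = d \<Longrightarrow> numeral k \<in> homog d"
  using homog_cst homog_1 homog_numeral by auto

lemmas homog_intros = homog_0 homog_add homog_diff homog_uminus homog_cst_mult homog_mult_cst homog_numeral_mult
  homog_consts homog_var homog_power homog_mult

lemma wt_simps: "wt 3 = 2" "wt 4 = 2" "wt 5 = 2" "wt 6 = 3" "wt 7 = 3" "wt 8 = 3" "wt 9 = 3"
  "wt 10 = 4" "wt 11 = 4" "wt 12 = 4" "wt 13 = 4" "wt 14 = 4"
  by (simp_all add: wt_def)

lemma gen_bracket_less:
  assumes "i \<in> {3..14}" "j \<in> {3..14}" "i < j"
  shows "gen_bracket \<epsilon> i j \<in> polys_in {3..14}"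
  using assms
  by (elim index_cases) (simp_all add: gen_bracket_values polys_in_intros)

lemma gen_bracket_homog_less:
  assumes "i \<in> {3..14}" "j \<in> {3..14}" "i < j"
  shows "gen_bracket 0 i j \<in> homog (wt i + wt j - 2)"
  using assms
  by (elim index_cases) (simp_all add: gen_bracket_values wt_simps,
    (intro homog_intros | simp add: wt_simps)+)

text \<open>When the two weights add up to less than 6 the difference is 0, so the truncated
  subtraction is harmless.\<close>

lemma gen_bracket_tail_less:
  assumes "i \<in> {3..14}" "j \<in> {3..14}" "i < j"
  shows "gen_bracket 1 i j - gen_bracket 0 i j \<in> homog (wt i + wt j - 6)"
  using assms
  by (elim index_cases) (simp_all add: gen_bracket_values wt_simps algebra_simps,
    (intro homog_intros | simp add: wt_simps)+)

lemma gen_bracket_polys_in: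
  assumes "i \<in> {3..14}" "j \<in> {3..14}"
  shows "gen_bracket \<epsilon> i j \<in> polys_in {3..14}"
  using assms
proof (induction i j rule: linorder_wlog)
  case (sym i j)
  then show ?case using polys_in_uminus by (subst gen_bracket_antisym) blast
qed (metis gen_bracket_less gen_bracket_self linorder_neqE_nat not_less polys_in_0)

lemma gen_bracket_homog:
  assumes "i \<in> {3..14}" "j \<in> {3..14}"
  shows "gen_bracket 0 i j \<in> homog (wt i + wt j - 2)"
  using assms
proof (induction i j rule: linorder_wlog)
  case (sym i j)
  then show ?case using homog_uminus by (subst gen_bracket_antisym) (simp add: add.commute)
qed (metis gen_bracket_homog_less gen_bracket_self linorder_neqE_nat not_less homog_0)

lemma gen_bracket_tail:
  assumes "i \<in> {3..14}" "j \<in> {3..14}"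
  shows "gen_bracket 1 i j - gen_bracket 0 i j \<in> homog (wt i + wt j - 6)"
  using assms
proof (induction i j rule: linorder_wlog)
  case (sym i j)
  then have "- (gen_bracket 1 j i - gen_bracket 0 j i) \<in> homog (wt i + wt j - 6)"
    by (intro homog_uminus) (simp add: add.commute)
  then show ?case by (simp add: gen_bracket_antisym[of _ i j])
qed (metis gen_bracket_tail_less gen_bracket_self linorder_neqE_nat not_less homog_0 diff_self)

lemma bracket_ideal_in: "r \<in> bracket_ideal \<epsilon> r"
  by (auto simp: bracket_ideal_def)

lemma bracket_ideal_add: "p \<in> bracket_ideal \<epsilon> r \<Longrightarrow> q \<in> bracket_ideal \<epsilon> r \<Longrightarrow> p + q \<in> bracket_ideal \<epsilon> r"
  unfolding bracket_ideal_def by (auto intro: ideal_poly_algD(3))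

lemma bracket_ideal_mult: "f \<in> polys_in {3..14} \<Longrightarrow> p \<in> bracket_ideal \<epsilon> r \<Longrightarrow> f * p \<in> bracket_ideal \<epsilon> r"
  unfolding bracket_ideal_def by (auto intro: ideal_poly_algD(4))

lemma bracket_ideal_bracket:
  "p \<in> bracket_ideal \<epsilon> r \<Longrightarrow> f \<in> polys_in {3..14} \<Longrightarrow> poly_bracket \<epsilon> p f \<in> bracket_ideal \<epsilon> r"
  unfolding bracket_ideal_def by auto

lemma bracket_ideal_least:
  assumes "I \<subseteq> polys_in {3..14}" "0 \<in> I" "\<And>p q. p \<in> I \<Longrightarrow> q \<in> I \<Longrightarrow> p + q \<in> I"
    "\<And>f p. f \<in> polys_in {3..14} \<Longrightarrow> p \<in> I \<Longrightarrow> f * p \<in> I"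
    "r \<in> I" "\<And>p f. p \<in> I \<Longrightarrow> f \<in> polys_in {3..14} \<Longrightarrow> poly_bracket \<epsilon> p f \<in> I"
  shows "bracket_ideal \<epsilon> r \<subseteq> I"
  unfolding bracket_ideal_def using assms by (intro Inter_lower CollectI conjI ideal_poly_algI) auto

lemma poly_bracket_inner:
  assumes "p \<in> polys_in {3..14}" "q \<in> polys_in {3..14}"
  shows "poly_bracket \<epsilon> p q = (\<Sum>i\<in>{3..14}. \<Sum>j\<in>{3..14}. pdiff i p * (pdiff j q * gen_bracket \<epsilon> i j))"
proof -
  have z: "pdiff i p = 0" "pdiff i q = 0" if "i \<in> {1..14} - {3..14}" for i
    using that pdiff_polys_in_0[OF assms(1)] pdiff_polys_in_0[OF assms(2)] by (metis DiffD2)+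
  let ?f = "\<lambda>i j. pdiff i p * pdiff j q * gen_bracket \<epsilon> i j"
  have "poly_bracket \<epsilon> p q = (\<Sum>i\<in>{3..14}. \<Sum>j\<in>{1..14}. ?f i j)"
    unfolding poly_bracket_def
    by (rule sum.mono_neutral_right) (simp, simp, intro ballI sum.neutral, simp only: z mult_zero_left)
  also have "\<dots> = (\<Sum>i\<in>{3..14}. \<Sum>j\<in>{3..14}. ?f i j)"
    by (rule sum.cong[OF refl], rule sum.mono_neutral_right)
      (simp, simp, intro ballI, simp only: z mult_zero_left mult_zero_right)
  finally show ?thesis by (simp only: mult.assoc)
qed

lemma poly_bracket_polys_in:
  assumes "p \<in> polys_in {3..14}" "q \<in> polys_in {3..14}"
  shows "poly_bracket \<epsilon> p q \<in> polys_in {3..14}"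
  unfolding poly_bracket_inner[OF assms]
  using assms by (intro polys_in_sum polys_in_mult polys_in_pdiff gen_bracket_polys_in)

lemma bracket_ideal_subset:
  assumes "r \<in> polys_in {3..14}" shows "bracket_ideal \<epsilon> r \<subseteq> polys_in {3..14}"
  using assms by (intro bracket_ideal_least) (auto intro: polys_in_intros poly_bracket_polys_in)

lemma bracket_ideal_cst_mult: "p \<in> bracket_ideal \<epsilon> r \<Longrightarrow> cst c * p \<in> bracket_ideal \<epsilon> r"
  by (rule bracket_ideal_mult) auto

lemma bracket_ideal_0: "0 \<in> bracket_ideal \<epsilon> r"
  using bracket_ideal_cst_mult[OF bracket_ideal_in, of 0] by simp

lemma wt_ge_2: "i \<in> {3..14} \<Longrightarrow> 2 \<le> wt i"
  by (auto simp: wt_def)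

lemma poly_bracket_homog:
  assumes "p \<in> polys_in {3..14}" "q \<in> polys_in {3..14}" "p \<in> homog d" "q \<in> homog e" "2 \<le> d + e"
  shows "poly_bracket 0 p q \<in> homog (d + e - 2)"
  unfolding poly_bracket_inner[OF assms(1,2)]
proof (intro homog_sum)
  fix i j :: nat assume ij: "i \<in> {3..14}" "j \<in> {3..14}"
  note w = wt_ge_2[OF ij(1)] wt_ge_2[OF ij(2)]
  have "pdiff j q * gen_bracket 0 i j \<in> homog (e + wt i - 2)"
    by (rule homog_pdiff[OF assms(4) gen_bracket_homog[OF ij]]) (use w in simp)
  then show "pdiff i p * (pdiff j q * gen_bracket 0 i j) \<in> homog (d + e - 2)"
    by (rule homog_pdiff[OF assms(3)]) (use w assms(5) in simp)
qed

text \<open>Turns an identity of polynomials with rational coefficients into one between complex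
  numbers, where the simplifier computes with fractions.\<close>

lemma mpoly_eqI: "(\<And>x. peval x p = peval x q) \<Longrightarrow> p = q"
  using peval_zero_imp_zero[of "p - q"] by (simp add: peval_simps)

lemma poly_bracket_diff: "poly_bracket \<epsilon> (p - q) f = poly_bracket \<epsilon> p f - poly_bracket \<epsilon> q f"
  by (simp add: poly_bracket_def pdiff_diff left_diff_distrib sum_subtractf)

lemma poly_bracket_uminus: "poly_bracket \<epsilon> (- p) f = - poly_bracket \<epsilon> p f"
  by (simp add: poly_bracket_def pdiff_uminus sum_negf)

lemma poly_bracket_cst: "poly_bracket \<epsilon> (cst c) f = 0" "poly_bracket \<epsilon> (numeral n) f = 0"
  by (simp_all add: poly_bracket_def pdiff_cst)

lemma poly_bracket_power: "poly_bracket \<epsilon> (p ^ n) f = of_nat n * p ^ (n - 1) * poly_bracket \<epsilon> p f"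
proof (induction n)
  case 0
  then show ?case by (simp add: poly_bracket_def)
next
  case (Suc n)
  then show ?case by (cases n) (simp_all add: poly_bracket_mult algebra_simps)
qed

lemma gen_bracket_gt: "j < i \<Longrightarrow> gen_bracket \<epsilon> i j = - gen_bracket \<epsilon> j i"
  by (rule gen_bracket_antisym)

lemmas poly_bracket_simps = poly_bracket_add poly_bracket_diff poly_bracket_uminus poly_bracket_mult
  poly_bracket_cst poly_bracket_power poly_bracket_vars gen_bracket_gt gen_bracket_values

section \<open>A finite generating set modulo the bracket ideal\<close>

definition r\<^sub>0 :: "nat mpoly" where "r\<^sub>0 = r\<^sub>1 - 8 * \<a> 3"

lemma r0_eq: "r\<^sub>0 = \<a> 3 * \<a> 4 ^ 2 - \<a> 3 ^ 2 * \<a> 5 - 2 * \<a> 7 ^ 2 + 2 * \<a> 6 * \<a> 8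
    + 2 * \<a> 3 * \<a> 12 - 4 * \<a> 4 * \<a> 11 + 2 * \<a> 5 * \<a> 10"
  by (simp add: r\<^sub>0_def r\<^sub>1_def algebra_simps power2_eq_square)

definition relJ :: "nat mpoly set" where "relJ = bracket_ideal 0 r\<^sub>0"

text \<open>The traces of powers of a single matrix: a_3, a_6, a_10 belong to X and a_5, a_9, a_14
  to Y.\<close>

definition pvars :: "nat set" where "pvars = {3, 5, 6, 9, 10, 14}"

text \<open>Reduction modulo the ideal generated by the six power sums, with polynomials in the
  other variables as representatives.\<close>

definition low :: "nat mpoly \<Rightarrow> nat mpoly" where
  "low = poly_subst cst (\<lambda>i. if i \<in> pvars then 0 else \<a> i)"

lemma low_simps: "low (p + q) = low p + low q" "low (p * q) = low p * low q" "low (p - q) = low p - low q"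
  "low (cst c) = cst c" "low (- p) = - low p" "low (p ^ n) = low p ^ n" "low (numeral k) = numeral k" "low 1 = 1"
  "low 0 = 0" "low (sum f A) = (\<Sum>i\<in>A. low (f i))" "low (\<a> i) = (if i \<in> pvars then 0 else \<a> i)"
  by (simp_all add: low_def csubst_simps)

lemma peval_low: "peval x (low p) = peval (\<lambda>i. if i \<in> pvars then 0 else x i) p"
  by (auto simp: low_def peval_csubst peval_simps if_distrib intro!: poly_subst_cong[of _ _ UNIV] simp: polys_in_def)

lemma low_single: "low (Poly_Mapping.single m c) = (if keys m \<inter> pvars = {} then Poly_Mapping.single m c else 0)"
proof (cases "keys m \<inter> pvars = {}")
  case True
  then have "low (Poly_Mapping.single m c) = poly_subst cst \<a> (Poly_Mapping.single m c)"
    unfolding low_def poly_subst_single[OF ring_map_cst] by (auto intro!: arg_cong2[of _ _ _ _ "(*)"] prod.cong)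
  then show ?thesis using True by (simp add: csubst_id)
next
  case False
  then obtain i where i: "i \<in> keys m" "i \<in> pvars" by blast
  have "(\<Prod>i\<in>keys m. (if i \<in> pvars then 0 else \<a> i) ^ lookup m i) = (0 :: nat mpoly)"
    using i by (intro prod_zero) (auto simp: in_keys_iff intro!: bexI[of _ i])
  then show ?thesis using False by (simp add: low_def poly_subst_single)
qed

lemma r0_polys_in: "r\<^sub>0 \<in> polys_in {3..14}"
  by (simp add: r0_eq polys_in_intros)

lemma r0_homog: "r\<^sub>0 \<in> homog 6"
  unfolding r0_eq by ((intro homog_intros | simp add: wt_simps)+)

text \<open>The degree d part of J after setting the power sums to 0, that is, relations of the
  fibre over the origin.\<close>

definition jlow :: "nat \<Rightarrow> nat mpoly set" where "jlow d = low ` (relJ \<inter> homog d)"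

lemma jlow_add: "p \<in> jlow d \<Longrightarrow> q \<in> jlow d \<Longrightarrow> p + q \<in> jlow d"
  unfolding jlow_def relJ_def
  by (auto simp: low_simps(1)[symmetric] intro!: imageI bracket_ideal_add homog_add)

lemma jlow_mult:
  assumes "u \<in> polys_in ({3..14} - pvars)" "u \<in> homog e" "q \<in> jlow d" "n = e + d"
  shows "u * q \<in> jlow n"
proof -
  obtain p where p: "q = low p" "p \<in> relJ" "p \<in> homog d" using assms(3) by (auto simp: jlow_def)
  have u: "low u = u"
    unfolding low_def using assms(1) by (subst poly_subst_cong[of _ _ _ _ \<a>]) (auto simp: csubst_id)
  have "u * p \<in> relJ" using p(2) assms(1) unfolding relJ_def
    by (intro bracket_ideal_mult) (auto elim: polys_in_mono)
  moreover have "u * p \<in> homog n" using homog_mult p(3) assms by auto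
  ultimately show ?thesis unfolding jlow_def using u p(1) by (metis Int_iff imageI low_simps(2))
qed

lemma jlow_cst_mult: "q \<in> jlow d \<Longrightarrow> cst c * q \<in> jlow d"
  by (rule jlow_mult[OF _ homog_cst]) auto

text \<open>Each relation below is certified by writing a nonzero multiple of it as an explicit
  combination of known elements.\<close>

lemma jlow_combine:
  assumes "cst c * q = p" "p \<in> jlow d" "c \<noteq> 0"
  shows "q \<in> jlow d"
proof -
  have "q = cst (1 / c) * p" using assms(1,3) cst_inverse_cancel by metis
  then show ?thesis using jlow_cst_mult assms(2) by auto
qed

text \<open>The degree of the bracket is d + wt i - 2; the condition on n avoids truncated
  subtraction.\<close>

lemma low_bracket_jlow:
  assumes "p \<in> relJ" "p \<in> homog d" "i \<in> {3..14}" "n + 2 = d + wt i"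
  shows "poly_bracket 0 p (\<a> i) \<in> relJ \<inter> homog n"
proof -
  have "p \<in> polys_in {3..14}" using assms(1) bracket_ideal_subset[OF r0_polys_in] by (auto simp: relJ_def)
  moreover have "d + wt i - 2 = n" using assms(4) by simp
  ultimately show ?thesis using assms poly_bracket_homog[of p "\<a> i" d "wt i"]
    by (auto simp: relJ_def homog_var intro: bracket_ideal_bracket)
qed

lemma r0_relJ: "r\<^sub>0 \<in> relJ \<inter> homog 6"
  using r0_homog by (simp add: relJ_def bracket_ideal_in)

abbreviation "br \<equiv> poly_bracket 0"

lemmas br_relJ = low_bracket_jlow[OF IntD1 IntD2]

text \<open>Under the bracket a_3, a_4, a_5 span a copy of sl_2, and bracketing with a_5 turns an X
  into a Y: from the bidegree (4, 2) of \<open>r\<^sub>0\<close> it leads to (3, 3) and then to (2,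
  4).\<close>

lemma br5: "br r\<^sub>0 (\<a> 5) \<in> relJ \<inter> homog 6" and br7: "br r\<^sub>0 (\<a> 7) \<in> relJ \<inter> homog 7"
  by (rule br_relJ[OF r0_relJ r0_relJ]; simp add: wt_simps)+

lemma br5_eq: "br r\<^sub>0 (\<a> 5) = - 4 * \<a> 3 * \<a> 4 * \<a> 5 + 8 * \<a> 3 * \<a> 13 + 4 * \<a> 4 ^ 3 - 16 * \<a> 4 * \<a> 12
    + 8 * \<a> 5 * \<a> 11 + 4 * \<a> 6 * \<a> 9 - 4 * \<a> 7 * \<a> 8"
  by (rule mpoly_eqI) (simp add: poly_bracket_simps peval_simps r0_eq, simp add: field_simps power2_eq_square power3_eq_cube)

lemma br7_eq: "br r\<^sub>0 (\<a> 7) = cst (1/2) * \<a> 3 ^ 2 * \<a> 8 - \<a> 3 * \<a> 4 * \<a> 7 - cst (1/6) * \<a> 3 * \<a> 5 * \<a> 6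
    + cst (2/3) * \<a> 4 ^ 2 * \<a> 6 - 2 * \<a> 6 * \<a> 12 + 4 * \<a> 7 * \<a> 11 - 2 * \<a> 8 * \<a> 10"
  by (rule mpoly_eqI) (simp add: poly_bracket_simps peval_simps r0_eq, simp add: field_simps power2_eq_square power3_eq_cube)

lemma low_jlow: "p \<in> relJ \<inter> homog d \<Longrightarrow> low p \<in> jlow d"
  by (auto simp: jlow_def)

lemma jlow_br:
  assumes "p \<in> relJ \<inter> homog d" "i \<in> {3..14}" "n + 2 = d + wt i"
  shows "low (br p (\<a> i)) \<in> jlow n"
  using low_jlow[OF low_bracket_jlow[of p d i n]] assms by auto

text \<open>The three rules come from the elements of bidegree (4, 2), (3, 3) and (2, 4) that
  \<open>r\<^sub>0\<close> generates under bracketing with a_5, with the power sums set to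
  0.\<close>

lemma rules6:
  shows rule_77: "\<a> 7 * \<a> 7 + 2 * \<a> 4 * \<a> 11 \<in> jlow 6"
    and rule_78: "\<a> 7 * \<a> 8 + 4 * \<a> 4 * \<a> 12 - \<a> 4 ^ 3 \<in> jlow 6"
    and rule_88: "\<a> 8 * \<a> 8 + 2 * \<a> 4 * \<a> 13 \<in> jlow 6"
    and deg6: "low r\<^sub>0 \<in> jlow 6" "low (br r\<^sub>0 (\<a> 5)) \<in> jlow 6" "low (br (br r\<^sub>0 (\<a> 5)) (\<a> 5)) \<in> jlow 6"
proof -
  show *: "low r\<^sub>0 \<in> jlow 6" "low (br r\<^sub>0 (\<a> 5)) \<in> jlow 6" "low (br (br r\<^sub>0 (\<a> 5)) (\<a> 5)) \<in> jlow 6"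
    by (rule low_jlow[OF r0_relJ] low_jlow[OF br5] jlow_br[OF br5]; simp add: wt_simps)+
  show "\<a> 7 * \<a> 7 + 2 * \<a> 4 * \<a> 11 \<in> jlow 6"
    by (rule jlow_combine[OF _ *(1), of "-2"], rule mpoly_eqI)
      (simp_all add: peval_low poly_bracket_simps peval_simps pvars_def r0_eq power2_eq_square)
  show "\<a> 7 * \<a> 8 + 4 * \<a> 4 * \<a> 12 - \<a> 4 ^ 3 \<in> jlow 6"
    by (rule jlow_combine[OF _ *(2), of "-4"], rule mpoly_eqI)
      (simp_all add: peval_low poly_bracket_simps peval_simps pvars_def br5_eq power2_eq_square algebra_simps)
  show "\<a> 8 * \<a> 8 + 2 * \<a> 4 * \<a> 13 \<in> jlow 6"
    by (rule jlow_combine[OF _ *(3), of "-16"], rule mpoly_eqI)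
      (simp_all add: peval_low poly_bracket_simps peval_simps pvars_def br5_eq power2_eq_square algebra_simps)
qed

lemma rules7:
  shows "\<a> 7 * \<a> 11 \<in> jlow 7" "\<a> 7 * \<a> 12 \<in> jlow 7" "\<a> 7 * \<a> 13 + cst (1/2) * \<a> 4 ^ 2 * \<a> 8 \<in> jlow 7"
    "\<a> 8 * \<a> 11 + cst (1/2) * \<a> 4 ^ 2 * \<a> 7 \<in> jlow 7" "\<a> 8 * \<a> 12 \<in> jlow 7" "\<a> 8 * \<a> 13 \<in> jlow 7"
proof -
  have *: "low (br r\<^sub>0 (\<a> 7)) \<in> jlow 7" "low (br r\<^sub>0 (\<a> 8)) \<in> jlow 7" "low (br r\<^sub>0 (\<a> 9)) \<in> jlow 7"
    "low (br (br r\<^sub>0 (\<a> 5)) (\<a> 7)) \<in> jlow 7" "low (br (br r\<^sub>0 (\<a> 5)) (\<a> 8)) \<in> jlow 7"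
    "low (br (br r\<^sub>0 (\<a> 5)) (\<a> 9)) \<in> jlow 7"
    by (rule low_jlow[OF r0_relJ] jlow_br[OF r0_relJ] jlow_br[OF br5]; simp add: wt_simps)+
  note e = peval_low poly_bracket_simps peval_simps pvars_def r0_eq br5_eq power2_eq_square power3_eq_cube algebra_simps
  show "\<a> 7 * \<a> 11 \<in> jlow 7"
    by (rule jlow_combine[OF _ *(1), of 4], rule mpoly_eqI) (simp_all add: e)
  \<comment> \<open>\<open>*(2)\<close> and \<open>*(4)\<close> have bidegree (4, 3), where the
    monomials without power sums are a_7 a_12, a_8 a_11 and a_4^2 a_7; the coefficients come from
    eliminating between the two. \<open>*(3)\<close> and \<open>*(5)\<close> play the same role in
    bidegree (3, 4).\<close>
  show "\<a> 7 * \<a> 12 \<in> jlow 7"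
    by (rule jlow_combine[OF _ jlow_add[OF *(4) jlow_cst_mult[OF *(2), of 4]], of 12], rule mpoly_eqI) (simp_all add: e)
  show "\<a> 7 * \<a> 13 + cst (1/2) * \<a> 4 ^ 2 * \<a> 8 \<in> jlow 7"
    by (rule jlow_combine[OF _ jlow_add[OF jlow_cst_mult[OF *(5), of 15] jlow_cst_mult[OF *(3), of 14]], of 144], rule mpoly_eqI) (simp_all add: e)
  show "\<a> 8 * \<a> 11 + cst (1/2) * \<a> 4 ^ 2 * \<a> 7 \<in> jlow 7"
    by (rule jlow_combine[OF _ jlow_add[OF jlow_cst_mult[OF *(2), of 7] *(4)], of 24], rule mpoly_eqI) (simp_all add: e)
  show "\<a> 8 * \<a> 12 \<in> jlow 7"
    by (rule jlow_combine[OF _ jlow_add[OF jlow_cst_mult[OF *(3), of 4] jlow_cst_mult[OF *(5), of 3]], of 36], rule mpoly_eqI) (simp_all add: e)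
  show "\<a> 8 * \<a> 13 \<in> jlow 7"
    by (rule jlow_combine[OF _ *(6), of 24], rule mpoly_eqI) (simp_all add: e)
qed

lemma rules8:
  shows "\<a> 11 * \<a> 11 \<in> jlow 8" "\<a> 13 * \<a> 13 \<in> jlow 8"
    "\<a> 11 * \<a> 12 - \<a> 4 ^ 2 * \<a> 11 \<in> jlow 8" "\<a> 12 * \<a> 13 - \<a> 4 ^ 2 * \<a> 13 \<in> jlow 8"
    "\<a> 12 * \<a> 12 - 4 * \<a> 4 ^ 2 * \<a> 12 + \<a> 4 ^ 4 \<in> jlow 8"
    "\<a> 11 * \<a> 13 - cst (11/4) * \<a> 4 ^ 2 * \<a> 12 + cst (3/4) * \<a> 4 ^ 4 \<in> jlow 8"
proof -
  have *: "low (br r\<^sub>0 (\<a> 11)) \<in> jlow 8" "low (br r\<^sub>0 (\<a> 12)) \<in> jlow 8" "low (br r\<^sub>0 (\<a> 13)) \<in> jlow 8"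
    "low (br r\<^sub>0 (\<a> 14)) \<in> jlow 8" "low (br (br r\<^sub>0 (\<a> 5)) (\<a> 14)) \<in> jlow 8"
    "low (br (br r\<^sub>0 (\<a> 7)) (\<a> 9)) \<in> jlow 8"
    by (rule jlow_br[OF r0_relJ] jlow_br[OF br5] jlow_br[OF br7]; simp add: wt_simps)+
  \<comment> \<open>In degree 8 the products of a_4 with a_7 a_7, a_7 a_8 and a_8 a_8 occur as well;
    these multiples of the degree 6 relations serve to cancel them.\<close>
  have a: "\<a> 4 * low r\<^sub>0 \<in> jlow 8" "\<a> 4 * low (br r\<^sub>0 (\<a> 5)) \<in> jlow 8"
    "\<a> 4 * low (br (br r\<^sub>0 (\<a> 5)) (\<a> 5)) \<in> jlow 8"
    by (rule jlow_mult[OF _ _ deg6(1)] jlow_mult[OF _ _ deg6(2)] jlow_mult[OF _ _ deg6(3)];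
      auto simp: pvars_def wt_simps intro!: homog_var)+
  note e = peval_low poly_bracket_simps peval_simps pvars_def r0_eq br5_eq br7_eq power2_eq_square power3_eq_cube
    power4_eq_xxxx algebra_simps
  show "\<a> 11 * \<a> 11 \<in> jlow 8"
    by (rule jlow_combine[OF _ *(1), of 8], rule mpoly_eqI) (simp_all add: e)
  show "\<a> 13 * \<a> 13 \<in> jlow 8"
    by (rule jlow_combine[OF _ *(5), of 64], rule mpoly_eqI) (simp_all add: e)
  show "\<a> 11 * \<a> 12 - \<a> 4 ^ 2 * \<a> 11 \<in> jlow 8"
    by (rule jlow_combine[OF _ jlow_add[OF *(2) jlow_cst_mult[OF a(1), of 3]], of 8], rule mpoly_eqI) (simp_all add: e)
  show "\<a> 12 * \<a> 13 - \<a> 4 ^ 2 * \<a> 13 \<in> jlow 8"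
    by (rule jlow_combine[OF _ jlow_add[OF jlow_cst_mult[OF *(4), of 4] jlow_cst_mult[OF a(3), of 3]], of 64], rule mpoly_eqI) (simp_all add: e)
  show "\<a> 12 * \<a> 12 - 4 * \<a> 4 ^ 2 * \<a> 12 + \<a> 4 ^ 4 \<in> jlow 8"
    by (rule jlow_combine[OF _ jlow_add[OF jlow_add[OF jlow_cst_mult[OF *(3), of 30] jlow_cst_mult[OF *(6), of 10]]
      jlow_cst_mult[OF a(2), of 33]], of 180], rule mpoly_eqI) (simp_all add: e)
  show "\<a> 11 * \<a> 13 - cst (11/4) * \<a> 4 ^ 2 * \<a> 12 + cst (3/4) * \<a> 4 ^ 4 \<in> jlow 8"
    by (rule jlow_combine[OF _ jlow_add[OF jlow_add[OF jlow_cst_mult[OF *(3), of 30] jlow_cst_mult[OF *(6), of 20]]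
      jlow_cst_mult[OF a(2), of 33]], of 240], rule mpoly_eqI) (simp_all add: e)
qed

lemma jlow_uminus: "p \<in> jlow d \<Longrightarrow> - p \<in> jlow d"
  using jlow_cst_mult[of p d "-1"] by (simp add: cst_uminus)

lemma jlow_diff: "p \<in> jlow d \<Longrightarrow> q \<in> jlow d \<Longrightarrow> p - q \<in> jlow d"
  using jlow_add[of p d "- q"] jlow_uminus by simp

lemma jlow_var_mult: "i \<in> {3..14} - pvars \<Longrightarrow> p \<in> jlow d \<Longrightarrow> n = wt i + d \<Longrightarrow> \<a> i * p \<in> jlow n"
  by (rule jlow_mult[OF _ homog_var]) auto

lemma jlow_a4_power_mult: "p \<in> jlow d \<Longrightarrow> n = 2 * k + d \<Longrightarrow> \<a> 4 ^ k * p \<in> jlow n"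
  by (rule jlow_mult[OF _ homog_power[OF homog_var]]) (auto simp: pvars_def wt_simps intro!: polys_in_power)

definition free_vars :: "nat set" where "free_vars = {7, 8, 11, 12, 13}"

text \<open>Overlaps of the rewriting rules, as in a Groebner basis computation: a product is
  reduced in two ways, and the difference bounds the powers of a_4 that can occur.\<close>

lemma rules_corner:
  shows "\<a> 4 ^ 3 * \<a> 12 - cst (4/15) * \<a> 4 ^ 5 \<in> jlow 10" "\<a> 4 ^ 3 * \<a> 11 \<in> jlow 10" "\<a> 4 ^ 3 * \<a> 13 \<in> jlow 10"
    "\<a> 4 ^ 4 * \<a> 7 \<in> jlow 11" "\<a> 4 ^ 4 * \<a> 8 \<in> jlow 11" "\<a> 4 ^ 7 \<in> jlow 14"
proof -
  note J = jlow_var_mult[OF _ rule_78] jlow_var_mult[OF _ rules7(1)] jlow_var_mult[OF _ rules7(2)]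
    jlow_var_mult[OF _ rules7(5)] jlow_var_mult[OF _ rules7(6)]
    jlow_a4_power_mult[OF rules7(2), where k = 2] jlow_a4_power_mult[OF rules7(5), where k = 2]
    jlow_var_mult[OF _ rules8(5)] jlow_a4_power_mult[OF rules8(3), where k = 1]
    jlow_a4_power_mult[OF rules8(4), where k = 1] jlow_a4_power_mult[OF rules8(5), where k = 1]

  note e = peval_simps power2_eq_square power3_eq_cube power4_eq_xxxx algebra_simps
  have q: "\<a> 12 * (\<a> 7 * \<a> 8 + 4 * \<a> 4 * \<a> 12 - \<a> 4 ^ 3) \<in> jlow 10" "\<a> 7 * (\<a> 8 * \<a> 12) \<in> jlow 10"
    "\<a> 11 * (\<a> 7 * \<a> 8 + 4 * \<a> 4 * \<a> 12 - \<a> 4 ^ 3) \<in> jlow 10" "\<a> 8 * (\<a> 7 * \<a> 11) \<in> jlow 10"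
    "\<a> 13 * (\<a> 7 * \<a> 8 + 4 * \<a> 4 * \<a> 12 - \<a> 4 ^ 3) \<in> jlow 10" "\<a> 7 * (\<a> 8 * \<a> 13) \<in> jlow 10"
    "\<a> 7 * (\<a> 12 * \<a> 12 - 4 * \<a> 4 ^ 2 * \<a> 12 + \<a> 4 ^ 4) \<in> jlow 11"
    "\<a> 8 * (\<a> 12 * \<a> 12 - 4 * \<a> 4 ^ 2 * \<a> 12 + \<a> 4 ^ 4) \<in> jlow 11"
    "\<a> 12 * (\<a> 7 * \<a> 12) \<in> jlow 11" "\<a> 12 * (\<a> 8 * \<a> 12) \<in> jlow 11"
    "\<a> 4 ^ 2 * (\<a> 7 * \<a> 12) \<in> jlow 11" "\<a> 4 ^ 2 * (\<a> 8 * \<a> 12) \<in> jlow 11"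
    "\<a> 4 ^ 1 * (\<a> 12 * \<a> 12 - 4 * \<a> 4 ^ 2 * \<a> 12 + \<a> 4 ^ 4) \<in> jlow 10"
    "\<a> 4 ^ 1 * (\<a> 11 * \<a> 12 - \<a> 4 ^ 2 * \<a> 11) \<in> jlow 10"
    "\<a> 4 ^ 1 * (\<a> 12 * \<a> 13 - \<a> 4 ^ 2 * \<a> 13) \<in> jlow 10"
    by (rule J; simp add: pvars_def wt_simps)+
  \<comment> \<open>The overlap a_7 a_8 a_12 leaves 4 a_4 a_12^2 - a_4^3 a_12; eliminating a_12^2
    turns this into 15 a_4^3 a_12 - 4 a_4^5.\<close>
  show D1: "\<a> 4 ^ 3 * \<a> 12 - cst (4/15) * \<a> 4 ^ 5 \<in> jlow 10"
    by (rule jlow_combine[OF _ jlow_diff[OF jlow_diff[OF q(1) q(2)] jlow_cst_mult[OF q(13), of 4]], of 15], rule mpoly_eqI)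
      (simp_all add: e eval_nat_numeral)
  show "\<a> 4 ^ 3 * \<a> 11 \<in> jlow 10"
    by (rule jlow_combine[OF _ jlow_diff[OF jlow_diff[OF q(3) q(4)] jlow_cst_mult[OF q(14), of 4]], of 3], rule mpoly_eqI)
      (simp_all add: e)
  show "\<a> 4 ^ 3 * \<a> 13 \<in> jlow 10"
    by (rule jlow_combine[OF _ jlow_diff[OF jlow_diff[OF q(5) q(6)] jlow_cst_mult[OF q(15), of 4]], of 3], rule mpoly_eqI)
      (simp_all add: e)
  show "\<a> 4 ^ 4 * \<a> 7 \<in> jlow 11"
    by (rule jlow_combine[OF _ jlow_add[OF jlow_diff[OF q(7) q(9)] jlow_cst_mult[OF q(11), of 4]], of 1], rule mpoly_eqI)
      (simp_all add: e)
  show "\<a> 4 ^ 4 * \<a> 8 \<in> jlow 11"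
    by (rule jlow_combine[OF _ jlow_add[OF jlow_diff[OF q(8) q(10)] jlow_cst_mult[OF q(12), of 4]], of 1], rule mpoly_eqI)
      (simp_all add: e)
  have s: "\<a> 12 * (\<a> 4 ^ 3 * \<a> 12 - cst (4/15) * \<a> 4 ^ 5) \<in> jlow 14"
    by (rule jlow_var_mult[OF _ D1]) (auto simp: pvars_def wt_simps)
  have t: "\<a> 4 ^ 2 * (\<a> 4 ^ 3 * \<a> 12 - cst (4/15) * \<a> 4 ^ 5) \<in> jlow 14"
    by (rule jlow_a4_power_mult[OF D1]) simp
  have u: "\<a> 4 ^ 3 * (\<a> 12 * \<a> 12 - 4 * \<a> 4 ^ 2 * \<a> 12 + \<a> 4 ^ 4) \<in> jlow 14"
    by (rule jlow_a4_power_mult[OF rules8(5)]) simp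
  \<comment> \<open>Reducing a_4^3 a_12^2 in two ways leaves 56/15 a_4^5 a_12 - a_4^7. Since a_4^5
    a_12 reduces to 4/15 a_4^7, the coefficient 224/225 - 1 = -1/225 remains.\<close>
  show "\<a> 4 ^ 7 \<in> jlow 14"
    by (rule jlow_combine[OF _ jlow_diff[OF jlow_diff[OF s u] jlow_cst_mult[OF t, of "56/15"]], of "-1/225"], rule mpoly_eqI)
      (simp_all add: e eval_nat_numeral)
qed

text \<open>Normal forms in degree \<open>d\<close> modulo the ideal and modulo the power sums indexed by
  \<^const>\<open>pvars\<close>: products of two of the variables in \<^const>\<open>free_vars\<close> can be eliminated.\<close>

inductive_set nform :: "nat \<Rightarrow> nat mpoly set" for d where
  jlow: "p \<in> jlow d \<Longrightarrow> p \<in> nform d"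
| pow: "2 * k = d \<Longrightarrow> cst c * \<a> 4 ^ k \<in> nform d"
| pow_var: "v \<in> free_vars \<Longrightarrow> 2 * k + wt v = d \<Longrightarrow> cst c * (\<a> 4 ^ k * \<a> v) \<in> nform d"
| add: "p \<in> nform d \<Longrightarrow> q \<in> nform d \<Longrightarrow> p + q \<in> nform d"

lemma nform_0: "0 \<in> nform d"
proof -
  have "0 \<in> relJ \<inter> homog d" by (simp add: bracket_ideal_0 relJ_def)
  then have "low 0 \<in> jlow d" unfolding jlow_def by blast
  then show ?thesis by (auto simp: low_simps intro: nform.jlow)
qed

text \<open>One rewriting step for a product of two free variables. The right-hand side of a rule
  has at most one term of each shape, and a coefficient 0 marks an absent term.\<close>

lemma nform_product:
  assumes "p \<in> jlow d" "n = 2 * k + d"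
    and "\<a> v * \<a> w = p + cst \<alpha> * (\<a> 4 ^ i * \<a> x) + cst \<beta> * \<a> 4 ^ j"
    and "\<alpha> = 0 \<or> x \<in> free_vars \<and> 2 * i + wt x = d" "\<beta> = 0 \<or> 2 * j = d"
  shows "cst c * (\<a> 4 ^ k * (\<a> v * \<a> w)) \<in> nform n"
proof -
  have "cst (c * \<alpha>) * (\<a> 4 ^ (k + i) * \<a> x) \<in> nform n"
    using assms(2,4) nform_0 by (auto intro: nform.pow_var)
  moreover have "cst (c * \<beta>) * \<a> 4 ^ (k + j) \<in> nform n"
    using assms(2,5) nform_0 by (auto intro: nform.pow)
  moreover have "cst c * (\<a> 4 ^ k * p) \<in> nform n"
    by (intro nform.jlow jlow_cst_mult jlow_a4_power_mult[OF assms(1)] assms(2))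
  moreover have "cst c * (\<a> 4 ^ k * (\<a> v * \<a> w)) = cst c * (\<a> 4 ^ k * p) +
      cst (c * \<alpha>) * (\<a> 4 ^ (k + i) * \<a> x) + cst (c * \<beta>) * \<a> 4 ^ (k + j)"
    unfolding assms(3) by (simp add: cst_mult power_add algebra_simps)
  ultimately show ?thesis by (simp add: nform.add)
qed

text \<open>The fifteen rules correspond to the unordered pairs from five variables, repetitions
  included.\<close>

lemma products_nform:
  assumes "v \<in> free_vars" "w \<in> free_vars" "n = 2 * k + wt v + wt w"
  shows "cst c * (\<a> 4 ^ k * (\<a> v * \<a> w)) \<in> nform n"
proof -
  have *: "cst c * (\<a> 4 ^ k * (\<a> v * \<a> w)) \<in> nform n"
    if "v \<in> free_vars" "w \<in> free_vars" "n = 2 * k + wt v + wt w" "v \<le> w" for v w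
  proof -
    note vw = that
    consider "v = 7" "w = 7" | "v = 7" "w = 8" | "v = 8" "w = 8" | "v = 7" "w = 11" | "v = 7" "w = 12"
      | "v = 7" "w = 13" | "v = 8" "w = 11" | "v = 8" "w = 12" | "v = 8" "w = 13" | "v = 11" "w = 11"
      | "v = 13" "w = 13" | "v = 11" "w = 12" | "v = 12" "w = 13" | "v = 12" "w = 12" | "v = 11" "w = 13"
      using vw(1,2,4) unfolding free_vars_def insert_iff empty_iff by (elim disjE) simp_all
    then show ?thesis
    proof cases
      case 1
      show ?thesis unfolding 1
        by (rule nform_product[where \<alpha> = "- 2" and i = 1 and x = 11 and \<beta> = 0 and j = 0, OF rule_77])
          (simp_all add: vw(3) 1 wt_simps free_vars_def cst_uminus cst_numeral algebra_simps)
    next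
      case 2
      show ?thesis unfolding 2
        by (rule nform_product[where \<alpha> = "- 4" and i = 1 and x = 12 and \<beta> = 1 and j = 3, OF rule_78])
          (simp_all add: vw(3) 2 wt_simps free_vars_def cst_uminus cst_numeral algebra_simps)
    next
      case 3
      show ?thesis unfolding 3
        by (rule nform_product[where \<alpha> = "- 2" and i = 1 and x = 13 and \<beta> = 0 and j = 0, OF rule_88])
          (simp_all add: vw(3) 3 wt_simps free_vars_def cst_uminus cst_numeral algebra_simps)
    next
      case 4
      show ?thesis unfolding 4
        by (rule nform_product[where \<alpha> = 0 and i = 0 and x = 0 and \<beta> = 0 and j = 0, OF rules7(1)])
          (simp_all add: vw(3) 4 wt_simps free_vars_def cst_uminus cst_numeral algebra_simps)
    next
      case 5
      show ?thesis unfolding 5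
        by (rule nform_product[where \<alpha> = 0 and i = 0 and x = 0 and \<beta> = 0 and j = 0, OF rules7(2)])
          (simp_all add: vw(3) 5 wt_simps free_vars_def cst_uminus cst_numeral algebra_simps)
    next
      case 6
      show ?thesis unfolding 6
        by (rule nform_product[where \<alpha> = "- 1/2" and i = 2 and x = 8 and \<beta> = 0 and j = 0, OF rules7(3)])
          (simp_all add: vw(3) 6 wt_simps free_vars_def cst_uminus cst_numeral algebra_simps)
    next
      case 7
      show ?thesis unfolding 7
        by (rule nform_product[where \<alpha> = "- 1/2" and i = 2 and x = 7 and \<beta> = 0 and j = 0, OF rules7(4)])
          (simp_all add: vw(3) 7 wt_simps free_vars_def cst_uminus cst_numeral algebra_simps)
    next
      case 8
      show ?thesis unfolding 8
        by (rule nform_product[where \<alpha> = 0 and i = 0 and x = 0 and \<beta> = 0 and j = 0, OF rules7(5)])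
          (simp_all add: vw(3) 8 wt_simps free_vars_def cst_uminus cst_numeral algebra_simps)
    next
      case 9
      show ?thesis unfolding 9
        by (rule nform_product[where \<alpha> = 0 and i = 0 and x = 0 and \<beta> = 0 and j = 0, OF rules7(6)])
          (simp_all add: vw(3) 9 wt_simps free_vars_def cst_uminus cst_numeral algebra_simps)
    next
      case 10
      show ?thesis unfolding 10
        by (rule nform_product[where \<alpha> = 0 and i = 0 and x = 0 and \<beta> = 0 and j = 0, OF rules8(1)])
          (simp_all add: vw(3) 10 wt_simps free_vars_def cst_uminus cst_numeral algebra_simps)
    next
      case 11
      show ?thesis unfolding 11
        by (rule nform_product[where \<alpha> = 0 and i = 0 and x = 0 and \<beta> = 0 and j = 0, OF rules8(2)])
          (simp_all add: vw(3) 11 wt_simps free_vars_def cst_uminus cst_numeral algebra_simps)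
    next
      case 12
      show ?thesis unfolding 12
        by (rule nform_product[where \<alpha> = 1 and i = 2 and x = 11 and \<beta> = 0 and j = 0, OF rules8(3)])
          (simp_all add: vw(3) 12 wt_simps free_vars_def cst_uminus cst_numeral algebra_simps)
    next
      case 13
      show ?thesis unfolding 13
        by (rule nform_product[where \<alpha> = 1 and i = 2 and x = 13 and \<beta> = 0 and j = 0, OF rules8(4)])
          (simp_all add: vw(3) 13 wt_simps free_vars_def cst_uminus cst_numeral algebra_simps)
    next
      case 14
      show ?thesis unfolding 14
        by (rule nform_product[where \<alpha> = 4 and i = 2 and x = 12 and \<beta> = "- 1" and j = 4, OF rules8(5)])
          (simp_all add: vw(3) 14 wt_simps free_vars_def cst_uminus cst_numeral algebra_simps)
    next
      case 15
      show ?thesis unfolding 15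
        by (rule nform_product[where \<alpha> = "11/4" and i = 2 and x = 12 and \<beta> = "- 3/4" and j = 4, OF rules8(6)])
          (simp_all add: vw(3) 15 wt_simps free_vars_def cst_uminus cst_numeral algebra_simps)
    qed
  qed
  show ?thesis
  proof (cases "v \<le> w")
    case True then show ?thesis using *[OF assms] by simp
  next
    case False then show ?thesis using *[of w v] assms by (simp add: mult.commute)
  qed
qed

lemma nform_var_mult:
  assumes "p \<in> nform d" "v \<in> insert 4 free_vars" "n = wt v + d"
  shows "\<a> v * p \<in> nform n"
  using assms(1)
proof induction
  case (jlow p)
  show ?case using assms(2,3)
    by (intro nform.jlow jlow_var_mult[OF _ jlow]) (auto simp: free_vars_def pvars_def)
next
  case (pow k c)
  show ?case
  proof (cases "v = 4")
    case True
    then show ?thesis using nform.pow[of "Suc k" n c] pow assms(3) by (simp add: wt_simps algebra_simps)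
  next
    case False
    then show ?thesis using nform.pow_var[of v k n c] pow assms(2,3) by (simp add: algebra_simps)
  qed
next
  case (pow_var w k c)
  show ?case
  proof (cases "v = 4")
    case True
    then show ?thesis using nform.pow_var[of w "Suc k" n c] pow_var assms(3) by (simp add: wt_simps algebra_simps)
  next
    case False
    then show ?thesis using products_nform[of v w n k c] pow_var assms(2,3) by (simp add: algebra_simps)
  qed
next
  case (add p q)
  then show ?case using nform.add by (simp add: distrib_left)
qed

lemma monomial_nform:
  assumes "keys m \<subseteq> insert 4 free_vars" "mdeg wt m = d"
  shows "Poly_Mapping.single m c \<in> nform d"
proof -
  have "\<exists>p\<in>nform (mdeg wt m). Poly_Mapping.single m c = p" if "keys m \<subseteq> insert 4 free_vars" for m
    using that
  proof (induction "mdeg (\<lambda>_. 1) m" arbitrary: m)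
    case 0
    then have "m = 0"
      by (auto simp: mdeg_def in_keys_iff intro!: poly_mapping_eqI)
    then show ?case using nform.pow[of 0 0 c] by (simp add: cst_def)
  next
    case (Suc k)
    have "keys m \<noteq> {}" using Suc(2) by (auto simp: mdeg_def)
    then obtain i where i: "i \<in> keys m" by blast
    let ?n = "m - Poly_Mapping.single i 1"
    have "mdeg (\<lambda>_. 1) ?n = k" using mdeg_diff_single[OF i, of "\<lambda>_. 1"] Suc(2) by simp
    moreover have "keys ?n \<subseteq> insert 4 free_vars" using Suc(3) keys_diff_single_subset by fastforce
    ultimately have "Poly_Mapping.single ?n c \<in> nform (mdeg wt ?n)" using Suc(1) by metis
    then show ?case
      using nform_var_mult[of _ "mdeg wt ?n" i] i Suc(3) mdeg_diff_single[OF i, of wt]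
      by (auto simp: single_split_var[OF i])
  qed
  then show ?thesis using assms by blast
qed

text \<open>The pair (v, k) stands for a_4^k a_v, and (0, k) for a_4^k. The bounds stop just below
  the exponents treated in \<open>rules_corner\<close>, and 7 + 2 * 4 + 3 * 3 = 24.\<close>

definition basis_idx :: "(nat \<times> nat) set" where
  "basis_idx = {0} \<times> {..6} \<union> {7, 8} \<times> {..3} \<union> {11, 12, 13} \<times> {..2}"

definition basis :: "nat \<times> nat \<Rightarrow> nat mpoly" where
  "basis b = \<a> 4 ^ snd b * (if fst b = 0 then 1 else \<a> (fst b))"

definition spanned :: "nat mpoly set" where
  "spanned = {f. \<exists>p j. (\<forall>b. p b \<in> polys_in pvars) \<and> j \<in> relJ \<and> f = (\<Sum>b\<in>basis_idx. p b * basis b) + j}"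

lemma finite_basis_idx: "finite basis_idx"
  by (simp add: basis_idx_def)

lemma spanned_add:
  assumes "f \<in> spanned" "g \<in> spanned" shows "f + g \<in> spanned"
proof -
  obtain p j q k where *: "\<forall>b. p b \<in> polys_in pvars" "j \<in> relJ" "f = (\<Sum>b\<in>basis_idx. p b * basis b) + j"
    "\<forall>b. q b \<in> polys_in pvars" "k \<in> relJ" "g = (\<Sum>b\<in>basis_idx. q b * basis b) + k"
    using assms unfolding spanned_def by blast
  then show ?thesis unfolding spanned_def
    by (intro CollectI exI[of _ "\<lambda>b. p b + q b"] exI[of _ "j + k"])
      (auto simp: relJ_def bracket_ideal_add polys_in_add algebra_simps sum.distrib)
qed

lemma spanned_mult:
  assumes "f \<in> spanned" "g \<in> polys_in pvars" shows "g * f \<in> spanned"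
proof -
  obtain p j where *: "\<forall>b. p b \<in> polys_in pvars" "j \<in> relJ" "f = (\<Sum>b\<in>basis_idx. p b * basis b) + j"
    using assms unfolding spanned_def by blast
  have "g \<in> polys_in {3..14}" using assms(2) by (rule polys_in_mono) (auto simp: pvars_def)
  with * show ?thesis unfolding spanned_def
    by (intro CollectI exI[of _ "\<lambda>b. g * p b"] exI[of _ "g * j"])
      (auto simp: relJ_def bracket_ideal_mult polys_in_mult assms(2) algebra_simps sum_distrib_left)
qed

lemma spanned_relJ: "j \<in> relJ \<Longrightarrow> j \<in> spanned"
  unfolding spanned_def by (intro CollectI exI[of _ "\<lambda>b. 0"] exI[of _ j]) auto

lemma spanned_sum: "(\<And>i. i \<in> A \<Longrightarrow> f i \<in> spanned) \<Longrightarrow> sum f A \<in> spanned"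
  using spanned_relJ[of 0]
  by (induction A rule: infinite_finite_induct) (auto intro: spanned_add simp: relJ_def bracket_ideal_0)

lemma spanned_basis:
  assumes "b \<in> basis_idx" shows "basis b \<in> spanned"
proof -
  have "basis b = (\<Sum>b'\<in>basis_idx. (if b' = b then 1 else 0) * basis b')"
    using assms finite_basis_idx by (simp add: if_distrib[of "\<lambda>u. u * _"] cong: if_cong)
  then show ?thesis unfolding spanned_def
    by (intro CollectI exI[of _ "\<lambda>b'. if b' = b then 1 else 0"] exI[of _ 0]) (auto simp: relJ_def bracket_ideal_0)
qed

text \<open>A graded form of Nakayama's lemma: the normal forms span modulo the power sums, and the
  cofactor of a power sum has smaller degree, so the induction on the degree applies to it.\<close>

theorem all_spanned:
  assumes "f \<in> polys_in {3..14}"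
  shows "f \<in> spanned"
proof -
  have "\<forall>p\<in>homog d \<inter> polys_in {3..14}. p \<in> spanned" for d
  proof (induction d rule: less_induct)
    case (less d)
    have pmon: "Poly_Mapping.single m c \<in> spanned"
      if m: "keys m \<subseteq> {3..14}" "mdeg wt m = d" "keys m \<inter> pvars \<noteq> {}" for m c
    proof -
      obtain i where i: "i \<in> keys m" "i \<in> pvars" using m by blast
      let ?n = "m - Poly_Mapping.single i 1"
      have k: "keys ?n \<subseteq> {3..14}" using m(1) keys_diff_single_subset by fastforce
      have "mdeg wt ?n < d" using mdeg_diff_single[OF i(1), of wt] m(2) wt_ge_2[of i] i(1) m(1) by fastforce
      moreover have "Poly_Mapping.single ?n c \<in> homog (mdeg wt ?n) \<inter> polys_in {3..14}"
        using k by (auto simp: homog_def polys_in_single split: if_splits)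
      ultimately have "Poly_Mapping.single ?n c \<in> spanned" using less by blast
      then show ?thesis using spanned_mult i(2) by (simp add: single_split_var[OF i(1)])
    qed
    have low_rest: "p - low p \<in> spanned" if p: "p \<in> homog d" "p \<in> polys_in {3..14}" for p
    proof -
      have "low p = (\<Sum>m\<in>keys p. low (Poly_Mapping.single m (lookup p m)))"
        by (subst (1) sum_monomials[symmetric]) (rule low_simps)
      then have "p - low p = (\<Sum>m\<in>keys p. Poly_Mapping.single m (lookup p m) - low (Poly_Mapping.single m (lookup p m)))"
        using sum_monomials[of p] by (simp add: sum_subtractf)
      also have "\<dots> \<in> spanned"
      proof (rule spanned_sum)
        fix m assume m: "m \<in> keys p"
        show "Poly_Mapping.single m (lookup p m) - low (Poly_Mapping.single m (lookup p m)) \<in> spanned"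
        proof (cases "keys m \<inter> pvars = {}")
          case True then show ?thesis using spanned_relJ[of 0] by (simp add: low_single relJ_def bracket_ideal_0)
        next
          case False
          then show ?thesis using pmon[of m] p m by (auto simp: low_single homog_def polys_in_def)
        qed
      qed
      finally show ?thesis .
    qed
    have neg: "- p \<in> spanned" if "p \<in> spanned" for p
      using spanned_mult[OF that, of "- 1"] by (simp add: polys_in_uminus)
    \<comment> \<open>A preimage in J differs from its reduced form by multiples of power sums,
      which \<open>low_rest\<close> already covers.\<close>
    have jl: "q \<in> spanned" if q: "q \<in> jlow d" for q
    proof -
      obtain p where p: "q = low p" "p \<in> relJ" "p \<in> homog d" using q by (auto simp: jlow_def)
      then have "p \<in> polys_in {3..14}" using bracket_ideal_subset[OF r0_polys_in] by (auto simp: relJ_def)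
      then have "p + - (p - low p) \<in> spanned" using p by (intro spanned_add neg low_rest spanned_relJ)
      then show ?thesis using p by simp
    qed
    have c: "cst c * p \<in> spanned" if "p \<in> spanned" for c p
      using spanned_mult[OF that] by simp
    have split_pow: "\<a> 4 ^ (k - l) * \<a> 4 ^ l = (\<a> 4 :: nat mpoly) ^ k" if "l \<le> k" for k l
      using that by (simp flip: power_add)
    have jlp: "\<a> 4 ^ k * q \<in> jlow d" if "\<a> 4 ^ l * q \<in> jlow e" "l \<le> k" "d = 2 * (k - l) + e" for k l e q
      using jlow_a4_power_mult[OF that(1,3)] split_pow[OF that(2)] by (simp flip: mult.assoc)
    have pow: "\<a> 4 ^ k \<in> spanned" if "2 * k = d" for k
    proof (cases "k \<le> 6")
      case True
      then show ?thesis using spanned_basis[of "(0, k)"] by (simp add: basis_idx_def basis_def)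
    next
      case False
      then have "2 * (k - 7) + 14 = 2 * k" by simp
      then show ?thesis using jlp[of 7 1 14 k] rules_corner(6) that False by (intro jl) auto
    qed
    have pow_var: "\<a> 4 ^ k * \<a> v \<in> spanned" if v: "v \<in> free_vars" "2 * k + wt v = d" for k v
    proof -
      consider "(v, k) \<in> basis_idx" | "v = 7" "k \<ge> 4" | "v = 8" "k \<ge> 4" | "v = 11" "k \<ge> 3"
        | "v = 12" "k \<ge> 3" | "v = 13" "k \<ge> 3"
        using v(1) by (cases "k \<le> 2"; cases "k \<le> 3") (auto simp: free_vars_def basis_idx_def)
      then show ?thesis
      proof cases
        case 1
        then show ?thesis using spanned_basis[OF 1] v(1) by (auto simp: basis_def free_vars_def)
      next
        \<comment> \<open>The only case with a remainder: a_4^k a_12 becomes 4/15 times a_4 to the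
          power k + 2, a pure power of the same degree.\<close>
        case 5
        have "\<a> 4 ^ (k - 3) * (\<a> 4 ^ 3 * \<a> 12 - cst (4/15) * \<a> 4 ^ 5) \<in> jlow d"
          by (rule jlow_a4_power_mult[OF rules_corner(1)]) (use 5 v in \<open>simp add: wt_simps\<close>)
        moreover have "\<a> 4 ^ (k - 3) * (\<a> 4 ^ 3 * \<a> 12 - cst (4/15) * \<a> 4 ^ 5) =
            \<a> 4 ^ (k - 3) * \<a> 4 ^ 3 * \<a> 12 - cst (4/15) * (\<a> 4 ^ (k - 3) * (\<a> 4 :: nat mpoly) ^ 5)"
          by (simp only: right_diff_distrib mult_ac)
        moreover have "\<a> 4 ^ (k - 3) * (\<a> 4 :: nat mpoly) ^ 5 = \<a> 4 ^ (k + 2)"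
          using 5 by (simp flip: power_add)
        moreover note split_pow[of 3 k]
        ultimately have "(\<a> 4 ^ k * \<a> 12 - cst (4/15) * \<a> 4 ^ (k + 2)) + cst (4/15) * \<a> 4 ^ (k + 2) \<in> spanned"
          using 5 v by (intro spanned_add jl c pow) (auto simp: wt_simps)
        then show ?thesis using 5 by simp
      next
        case 2
        show ?thesis unfolding 2(1) by (rule jl, rule jlp[OF rules_corner(4)]) (use 2 v in \<open>simp_all add: wt_simps\<close>)
      next
        case 3
        show ?thesis unfolding 3(1) by (rule jl, rule jlp[OF rules_corner(5)]) (use 3 v in \<open>simp_all add: wt_simps\<close>)
      next
        case 4
        show ?thesis unfolding 4(1) by (rule jl, rule jlp[OF rules_corner(2)]) (use 4 v in \<open>simp_all add: wt_simps\<close>)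
      next
        case 6
        show ?thesis unfolding 6(1) by (rule jl, rule jlp[OF rules_corner(3)]) (use 6 v in \<open>simp_all add: wt_simps\<close>)
      qed
    qed
    have nf: "q \<in> spanned" if "q \<in> nform d" for q
      using that by induction (auto intro: jl c pow pow_var spanned_add)
    show ?case
    proof
      fix p assume p: "p \<in> homog d \<inter> polys_in {3..14}"
      have "low p = (\<Sum>m\<in>keys p. low (Poly_Mapping.single m (lookup p m)))"
        by (subst (1) sum_monomials[symmetric]) (rule low_simps)
      also have "\<dots> \<in> spanned"
      proof (rule spanned_sum)
        fix m assume m: "m \<in> keys p"
        show "low (Poly_Mapping.single m (lookup p m)) \<in> spanned"
        proof (cases "keys m \<inter> pvars = {}")
          case True
          have "x \<in> insert 4 free_vars" if "x \<in> {3..14}" "x \<notin> pvars" for x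
            using that by (elim index_cases) (simp_all add: free_vars_def pvars_def)
          then have "keys m \<subseteq> insert 4 free_vars" "mdeg wt m = d"
            using m p True unfolding homog_def polys_in_def by blast+
          then show ?thesis using True nf monomial_nform by (simp add: low_single)
        next
          case False then show ?thesis using spanned_relJ[of 0] by (simp add: low_single relJ_def bracket_ideal_0)
        qed
      qed
      finally have "low p + (p - low p) \<in> spanned" using p by (intro spanned_add low_rest) auto
      then show "p \<in> spanned" by simp
    qed
  qed
  note * = this
  have "(\<Sum>m\<in>keys f. Poly_Mapping.single m (lookup f m)) \<in> spanned"
  proof (rule spanned_sum)
    fix m assume "m \<in> keys f"
    then have "Poly_Mapping.single m (lookup f m) \<in> homog (mdeg wt m) \<inter> polys_in {3..14}"
      using assms by (auto simp: homog_def polys_in_def split: if_splits)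
    then show "Poly_Mapping.single m (lookup f m) \<in> spanned" using * by blast
  qed
  then show ?thesis by (simp add: sum_monomials)
qed

section \<open>Independence of the normal forms on diagonal pairs\<close>

text \<open>The numbers of letters X, and below of letters Y, in the word of a_i; position 0 of the
  lists is a filler, since the indices start at 1.\<close>

definition xdeg :: "nat \<Rightarrow> nat" where "xdeg i = [0, 1, 0, 2, 1, 0, 3, 2, 1, 0, 4, 3, 2, 1, 0] ! i"

definition ydeg :: "nat \<Rightarrow> nat" where "ydeg i = [0, 0, 1, 0, 1, 2, 0, 1, 2, 3, 0, 1, 2, 3, 4] ! i"

text \<open>The polarized power sums: values of the generators on pairs of diagonal matrices of
  trace 0 with diagonals x and y.\<close>

definition psum :: "(4 \<Rightarrow> 'b::comm_ring_1) \<Rightarrow> (4 \<Rightarrow> 'b) \<Rightarrow> nat \<Rightarrow> 'b" where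
  "psum x y i = (\<Sum>k\<in>UNIV. x k ^ xdeg i * y k ^ ydeg i)"

text \<open>A power sum of one set of eigenvalues ignores how x and y are matched; the 4! matchings
  form the fibre on which independence is tested.\<close>

lemma psum_pvars:
  assumes "i \<in> pvars" "bij \<sigma>" "bij \<tau>"
  shows "psum (x \<circ> \<sigma>) (y \<circ> \<tau>) i = psum x y i"
proof -
  have 1: "(\<Sum>k\<in>UNIV. f (\<sigma> k)) = (\<Sum>k\<in>UNIV. f k)" for f :: "4 \<Rightarrow> 'a"
    using sum.reindex_bij_betw[of \<sigma> UNIV UNIV f] assms(2) by simp
  have 2: "(\<Sum>k\<in>UNIV. f (\<tau> k)) = (\<Sum>k\<in>UNIV. f k)" for f :: "4 \<Rightarrow> 'a"
    using sum.reindex_bij_betw[of \<tau> UNIV UNIV f] assms(3) by simp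
  consider "xdeg i = 0" | "ydeg i = 0"
    using assms(1) unfolding pvars_def insert_iff empty_iff by (elim disjE) (simp_all add: xdeg_def ydeg_def)
  then show ?thesis
    by cases (simp_all add: psum_def 1[of "\<lambda>k. x k ^ _"] 2[of "\<lambda>k. y k ^ _"])
qed

text \<open>Newton's identities translate the prescribed power sums into a monic quartic without
  cubic term, and its complex roots are the required numbers.\<close>

lemma power_sums_surj:
  fixes w2 w3 w4 :: complex
  obtains x :: "4 \<Rightarrow> complex" where "(\<Sum>k\<in>UNIV. x k) = 0" "(\<Sum>k\<in>UNIV. x k ^ 2) = w2"
    "(\<Sum>k\<in>UNIV. x k ^ 3) = w3" "(\<Sum>k\<in>UNIV. x k ^ 4) = w4"
proof -
  \<comment> \<open>Newton's identities with e1 = 0 read p2 = - 2 e2, p3 = 3 e3 and p4 = 2 e2^2 - 4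
    e4.\<close>
  define e2 e3 e4 where e: "e2 = - w2 / 2" "e3 = w3 / 3" "e4 = (w2\<^sup>2 / 2 - w4) / 4"
  let ?p = "[:e4, - e3, e2, 0, 1:]"
  obtain A where A: "size A = degree ?p" "?p = Polynomial.smult (lead_coeff ?p) (\<Prod>x\<in>#A. [:-x, 1:])"
    using alg_closed_imp_factorization[of ?p] by auto
  then have "size A = 4" by simp
  moreover obtain a A1 where "A = add_mset a A1" using \<open>size A = 4\<close> size_eq_Suc_imp_eq_union[of A 3] by auto
  moreover from calculation obtain b A2 where "A1 = add_mset b A2" using size_eq_Suc_imp_eq_union[of A1 2] by auto
  moreover from calculation obtain c A3 where "A2 = add_mset c A3" using size_eq_Suc_imp_eq_union[of A2 1] by auto
  moreover from calculation obtain d A4 where "A3 = add_mset d A4" using size_eq_Suc_imp_eq_union[of A3 0] by auto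
  ultimately have abcd: "A = {#a, b, c, d#}" by simp
  have p: "?p = [:-a, 1:] * ([:-b, 1:] * ([:-c, 1:] * [:-d, 1:]))"
    using A(2) by (simp add: abcd)
  then have e1: "a + b + c + d = 0" and E: "e2 = a*b + a*c + a*d + b*c + b*d + c*d"
    "e3 = a*b*c + a*b*d + a*c*d + b*c*d" "e4 = a*b*c*d"
    by (simp_all add: algebra_simps)
  define x :: "4 \<Rightarrow> complex" where "x = (\<lambda>i. if i = 1 then a else if i = 2 then b else if i = 3 then c else d)"
  have x: "x 1 = a" "x 2 = b" "x 3 = c" "x 4 = d" by (simp_all add: x_def)
  have d: "d = - a - b - c" using e1 by (simp add: eq_neg_iff_add_eq_0 algebra_simps)
  show thesis
  proof (rule that[of x])
    show "(\<Sum>k\<in>UNIV. x k) = 0" using e1 by (simp add: sum_4 x)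
    have p2: "a ^ 2 + b ^ 2 + c ^ 2 + d ^ 2 = - 2 * e2"
      unfolding E(1) unfolding d by (simp add: algebra_simps power2_eq_square)
    then show "(\<Sum>k\<in>UNIV. x k ^ 2) = w2" by (simp add: sum_4 x e)
    have "a ^ 3 + b ^ 3 + c ^ 3 + d ^ 3 = 3 * e3"
      unfolding E(2) unfolding d by (simp add: algebra_simps power3_eq_cube)
    then show "(\<Sum>k\<in>UNIV. x k ^ 3) = w3" by (simp add: sum_4 x e)
    have "2 * (a ^ 4 + b ^ 4 + c ^ 4 + d ^ 4) = (a ^ 2 + b ^ 2 + c ^ 2 + d ^ 2) ^ 2 - 8 * e4"
      unfolding E(3) unfolding d by (simp add: algebra_simps power4_eq_xxxx power2_eq_square)
    also have "\<dots> = w2\<^sup>2 - 8 * e4" unfolding p2 e by simp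
    also have "\<dots> = 2 * w4" by (simp add: e field_simps)
    finally have "a ^ 4 + b ^ 4 + c ^ 4 + d ^ 4 = w4"
      by (subst (asm) mult_cancel_left) simp
    then show "(\<Sum>k\<in>UNIV. x k ^ 4) = w4" by (simp add: sum_4 x)
  qed
qed

subsection \<open>The fibre over a pair of regular points\<close>

text \<open>The fourth roots of unity are distinct with sum 0, and multiplication by \<i> permutes
  them cyclically; this symmetry breaks the linear algebra on their fibre into small pieces.\<close>

definition unit4 :: "4 \<Rightarrow> complex" where
  "unit4 i = (if i = 1 then 1 else if i = 2 then \<i> else if i = 3 then - 1 else - \<i>)"

definition bideg :: "nat \<times> nat \<Rightarrow> nat \<times> nat" where
  "bideg b = (if fst b = 0 then (snd b, snd b) else (snd b + xdeg (fst b), snd b + ydeg (fst b)))"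

lemma unit4_simps: "unit4 1 = 1" "unit4 2 = \<i>" "unit4 3 = - 1" "unit4 4 = - \<i>"
  by (simp_all add: unit4_def)

lemma basis_idx_eq: "basis_idx = {(0,0), (0,1), (0,2), (0,3), (0,4), (0,5), (0,6), (7,0), (7,1), (7,2), (7,3),
    (8,0), (8,1), (8,2), (8,3), (11,0), (11,1), (11,2), (12,0), (12,1), (12,2), (13,0), (13,1), (13,2)}"
proof -
  have "{..6::nat} = {0,1,2,3,4,5,6}" "{..3::nat} = {0,1,2,3}" "{..2::nat} = {0,1,2}" by auto
  then show ?thesis by (auto simp: basis_idx_def)
qed

lemma sum_basis_idx: "(\<Sum>b\<in>basis_idx. f b) = f (0, 0) + f (0, 1) + f (0, 2) + f (0, 3) + f (0, 4) + f (0, 5) + f (0, 6) + f (7, 0) + f (7, 1) + f (7, 2) + f (7, 3) + f (8, 0) + f (8, 1) + f (8, 2) + f (8, 3) + f (11, 0) + f (11, 1) + f (11, 2) + f (12, 0) + f (12, 1) + f (12, 2) + f (13, 0) + f (13, 1) + f (13, 2)"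
  unfolding basis_idx_eq by (simp add: add.assoc)

lemma psum_scale: "psum (\<lambda>k. s * x k) (\<lambda>k. t * y k) i = s ^ xdeg i * t ^ ydeg i * psum x y i"
  by (simp add: psum_def power_mult_distrib sum_distrib_left mult_ac)

lemma peval_basis: "peval w (basis b) = w 4 ^ snd b * (if fst b = 0 then 1 else w (fst b))"
  by (simp add: basis_def peval_simps)

lemma peval_basis_scale:
  "peval (psum (\<lambda>k. s * x k) (\<lambda>k. t * y k)) (basis b) = s ^ fst (bideg b) * t ^ snd (bideg b) * peval (psum x y) (basis b)"
  by (simp add: peval_basis bideg_def psum_scale xdeg_def[of 4] ydeg_def[of 4] power_add power_mult_distrib mult_ac)

text \<open>Orthogonality of the characters of the cyclic group of order 4.\<close>

lemma sum_unit_powers: "(\<Sum>k<4. \<i> ^ (k * n)) = (if 4 dvd n then 4 else 0)"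
proof -
  have 1: "(\<Sum>k<4. \<i> ^ (k * n)) = (\<Sum>k<4. (\<i> ^ n) ^ k)"
    by (intro sum.cong refl) (metis power_mult mult.commute)
  have 2: "(\<Sum>k<4. z ^ k) = 1 + z + z * z + z * z * z" for z :: complex
    by (simp add: eval_nat_numeral algebra_simps)
  have "\<i> ^ (4 * (n div 4) + n mod 4) = \<i> ^ (n mod 4)"
    unfolding power_add power_mult power4_eq_xxxx by simp
  then have 3: "\<i> ^ n = \<i> ^ (n mod 4)" by simp
  consider "n mod 4 = 0" | "n mod 4 = 1" | "n mod 4 = 2" | "n mod 4 = 3" by linarith
  then show ?thesis
    unfolding 1 2 by cases (simp_all only: 3 dvd_eq_mod_eq_0, simp_all add: power3_eq_cube)
qed

text \<open>Addition in the index type is modulo 4, so multiplication by \<i> becomes a shift of the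
  index, in particular a permutation.\<close>

lemma unit4_shift: "\<i> ^ k * unit4 i = unit4 (i + of_nat k)"
proof (induction k)
  case (Suc k)
  have "\<i> * unit4 j = unit4 (j + 1)" for j
    using exhaust_4[of j] by (auto simp: unit4_def)
  then show ?case using Suc by (simp add: algebra_simps)
qed simp

text \<open>Rotating x and y by independent powers of \<i> stays in the fibre, so averaging against
  characters splits a relation by bidegree modulo 4. Since 3 = -1 modulo 4, the divisibility
  conditions select the bidegrees congruent to (\<alpha>, \<beta>).\<close>

lemma fibre_class:
  assumes eq: "\<And>\<sigma> \<tau>. bij \<sigma> \<Longrightarrow> bij \<tau> \<Longrightarrow>
      (\<Sum>b\<in>basis_idx. c b * peval (psum (unit4 \<circ> \<sigma>) (unit4 \<circ> \<tau>)) (basis b)) = 0"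
    and "bij \<rho>"
  shows "(\<Sum>b\<in>basis_idx. if 4 dvd fst (bideg b) + 3 * \<alpha> \<and> 4 dvd snd (bideg b) + 3 * \<beta>
      then c b * peval (psum unit4 (unit4 \<circ> \<rho>)) (basis b) else 0) = 0"
proof -
  let ?B = "\<lambda>b. peval (psum unit4 (unit4 \<circ> \<rho>)) (basis b)"
  let ?u = "\<lambda>k::nat. \<lambda>i::4. i + of_nat k"
  have bij: "bij (?u k)" for k by (rule bijI') (auto intro: exI[of _ "_ - of_nat k"] simp: algebra_simps)
  have E: "(\<Sum>b\<in>basis_idx. c b * (\<i> ^ (k * fst (bideg b)) * \<i> ^ (l * snd (bideg b)) * ?B b)) = 0" for k l
  proof -
    have "unit4 \<circ> ?u k = (\<lambda>i. \<i> ^ k * unit4 i)" "unit4 \<circ> (?u l \<circ> \<rho>) = (\<lambda>i. \<i> ^ l * (unit4 \<circ> \<rho>) i)"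
      by (auto simp: unit4_shift)
    then have "peval (psum (unit4 \<circ> ?u k) (unit4 \<circ> (?u l \<circ> \<rho>))) (basis b) =
        \<i> ^ (k * fst (bideg b)) * \<i> ^ (l * snd (bideg b)) * ?B b" for b
      by (simp only: peval_basis_scale power_mult)
    then show ?thesis using eq[OF bij bij_comp[OF assms(2) bij], of k l] by (simp only:)
  qed
  let ?f = "\<lambda>b. \<Sum>k<4. \<i> ^ (k * (fst (bideg b) + 3 * \<alpha>))" and ?g = "\<lambda>b. \<Sum>l<4. \<i> ^ (l * (snd (bideg b) + 3 * \<beta>))"
  have "0 = (\<Sum>k<4. \<Sum>l<4. \<i> ^ (k * (3 * \<alpha>)) * \<i> ^ (l * (3 * \<beta>)) *
      (\<Sum>b\<in>basis_idx. c b * (\<i> ^ (k * fst (bideg b)) * \<i> ^ (l * snd (bideg b)) * ?B b)))"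
    by (simp only: E mult_zero_right sum.neutral_const)
  also have "\<dots> = (\<Sum>k<4. \<Sum>l<4. \<Sum>b\<in>basis_idx.
      \<i> ^ (k * (fst (bideg b) + 3 * \<alpha>)) * \<i> ^ (l * (snd (bideg b) + 3 * \<beta>)) * (c b * ?B b))"
    unfolding sum_distrib_left by (intro sum.cong refl) (simp add: distrib_left power_add)
  also have "\<dots> = (\<Sum>k<4. \<Sum>b\<in>basis_idx. \<Sum>l<4.
      \<i> ^ (k * (fst (bideg b) + 3 * \<alpha>)) * \<i> ^ (l * (snd (bideg b) + 3 * \<beta>)) * (c b * ?B b))"
    by (rule sum.cong[OF refl]) (rule sum.swap)
  also have "\<dots> = (\<Sum>b\<in>basis_idx. \<Sum>k<4. \<Sum>l<4.
      \<i> ^ (k * (fst (bideg b) + 3 * \<alpha>)) * \<i> ^ (l * (snd (bideg b) + 3 * \<beta>)) * (c b * ?B b))"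
    by (rule sum.swap)
  also have "\<dots> = (\<Sum>b\<in>basis_idx. ?f b * ?g b * (c b * ?B b))"
    unfolding sum_product by (simp only: sum_distrib_right)
  also have "\<dots> = 16 * (\<Sum>b\<in>basis_idx. if 4 dvd fst (bideg b) + 3 * \<alpha> \<and> 4 dvd snd (bideg b) + 3 * \<beta> then c b * ?B b else 0)"
    unfolding sum_unit_powers sum_distrib_left by (rule sum.cong[OF refl]) simp
  finally show ?thesis by simp
qed

text \<open>After the splitting, systems in at most three unknowns remain. The matchings used
  represent the three double cosets of the cyclic group of order 4 in the symmetric group; all
  others differ from them by rotations of x and y.\<close>

lemma fibre_independent:
  assumes eq: "\<And>\<sigma> \<tau>. bij \<sigma> \<Longrightarrow> bij \<tau> \<Longrightarrow>
      (\<Sum>b\<in>basis_idx. c b * peval (psum (unit4 \<circ> \<sigma>) (unit4 \<circ> \<tau>)) (basis b)) = 0"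
    and "b \<in> basis_idx"
  shows "c b = 0"
proof -
  have bij: "bij (id :: 4 \<Rightarrow> 4)" "bij (Transposition.transpose 2 4 :: 4 \<Rightarrow> 4)" "bij (Transposition.transpose 1 2 :: 4 \<Rightarrow> 4)"
    by simp_all
  let ?p = "\<lambda>\<rho>. psum unit4 (unit4 \<circ> \<rho>)"
  note d = psum_def sum_4 unit4_simps xdeg_def ydeg_def transpose_def power2_eq_square power3_eq_cube power4_eq_xxxx
  have 1: "?p id 4 = 0" "?p id 7 = 0" "?p id 8 = 0" "?p id 11 = 4" "?p id 12 = 4" "?p id 13 = 4"
    by (simp_all add: d)
  have 2: "?p (Transposition.transpose 2 4) 4 = 4" "?p (Transposition.transpose 2 4) 7 = 0" "?p (Transposition.transpose 2 4) 8 = 0"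
     "?p (Transposition.transpose 2 4) 11 = 0" "?p (Transposition.transpose 2 4) 12 = 4" "?p (Transposition.transpose 2 4) 13 = 0"
    by (simp_all add: d)
  have 3: "?p (Transposition.transpose 1 2) 4 = 2 * \<i>" "?p (Transposition.transpose 1 2) 7 = 2 * \<i> - 2" "?p (Transposition.transpose 1 2) 8 = 2 * \<i> - 2"
     "?p (Transposition.transpose 1 2) 11 = 2" "?p (Transposition.transpose 1 2) 12 = 0" "?p (Transposition.transpose 1 2) 13 = 2"
    by (simp_all add: d)
  note C = fibre_class[OF eq, unfolded peval_basis, OF _ _ bij(1)] fibre_class[OF eq, unfolded peval_basis, OF _ _ bij(2)]
    fibre_class[OF eq, unfolded peval_basis, OF _ _ bij(3)]
  have nd: "\<not> 4 dvd Suc 0" "\<not> 4 dvd Suc (Suc 0)" "\<not> 4 dvd Suc (Suc (Suc 0))" by presburger+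
  note e = sum_basis_idx bideg_def xdeg_def ydeg_def 1[unfolded comp_id] 2 3 nd
  have h00: "c (0, 0) = 0" "c (0, 4) = 0" "c (12, 2) = 0"
    using C(1)[of 0 0] C(2)[of 0 0] C(3)[of 0 0] by (simp_all add: e)
  have h01: "c (8, 3) = 0"
    using C(3)[of 0 1] by (simp_all add: e)
  have h02: "c (11, 1) = 0"
    using C(3)[of 0 2] by (simp_all add: e)
  have h03: "c (7, 2) = 0"
    using C(3)[of 0 3] by (simp_all add: e)
  have h10: "c (7, 3) = 0"
    using C(3)[of 1 0] by (simp_all add: e)
  have "c (0, 1) * 4 + c (0, 5) * 1024 = 0" using C(2)[of 1 1] by (simp add: e)
  then have h11a: "4 * c (0, 1) + c (0, 5) * 1024 = 0" by (simp only: mult.commute[of 4])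
  have "\<i> * (2 * c (0, 1)) + \<i> ^ 5 * (32 * c (0, 5)) = 0" using C(3)[of 1 1] by (simp add: e field_simps)
  moreover have "\<i> ^ 5 = \<i>" by (simp add: eval_nat_numeral)
  ultimately have "\<i> * (2 * c (0, 1) + 32 * c (0, 5)) = 0" by (simp only: distrib_left)
  then have h11b: "2 * c (0, 1) + 32 * c (0, 5) = 0" by simp
  have "960 * c (0, 5) = (4 * c (0, 1) + c (0, 5) * 1024) - 2 * (2 * c (0, 1) + 32 * c (0, 5))" by (simp add: algebra_simps)
  then have "c (0, 5) = 0" unfolding h11a h11b by simp
  with h11b have h11: "c (0, 1) = 0" "c (0, 5) = 0" by simp_all
  have h12: "c (8, 0) = 0"
    using C(3)[of 1 2] by (simp_all add: e)
  have h13: "c (11, 2) = 0" "c (13, 0) = 0"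
    using C(1)[of 1 3] C(2)[of 1 3] C(3)[of 1 3] by (simp_all add: e)
  have h20: "c (13, 1) = 0"
    using C(3)[of 2 0] by (simp_all add: e)
  have h21: "c (7, 0) = 0"
    using C(3)[of 2 1] by (simp_all add: e)
  have h22a: "c (12, 0) = 0" using C(1)[of 2 2] by (simp add: e)
  have h22b: "c (0, 2) * 4 ^ 2 + c (0, 6) * 4 ^ 6 = 0"
    using C(2)[of 2 2] by (simp add: e h22a)
  have "c (0, 2) * (2 * \<i>) ^ 2 + c (0, 6) * (2 * \<i>) ^ 6 = 0"
    by (rule trans[OF _ C(3)[of 2 2]]) (simp only: e h22a, simp add: h22a nd)
  moreover have "(2 * \<i>) ^ 2 = - 4" "(2 * \<i>) ^ 6 = - 64" by (simp_all add: eval_nat_numeral)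
  ultimately have h22c: "c (0, 2) * - 4 + c (0, 6) * - 64 = 0" by (simp only:)
  have "3840 * c (0, 6) = (c (0, 2) * 4 ^ 2 + c (0, 6) * 4 ^ 6) + 4 * (c (0, 2) * - 4 + c (0, 6) * - 64)"
    by (simp add: algebra_simps)
  then have h22d: "c (0, 6) = 0" unfolding h22b h22c by simp
  then have h22e: "c (0, 2) = 0" using h22b by simp
  note h22 = h22a h22d h22e
  have h23: "c (8, 1) = 0"
    using C(3)[of 2 3] by (simp_all add: e)
  have h30: "c (8, 2) = 0"
    using C(3)[of 3 0] by (simp_all add: e)
  have h31: "c (11, 0) = 0" "c (13, 2) = 0"
    using C(1)[of 3 1] C(2)[of 3 1] C(3)[of 3 1] by (simp_all add: e)
  have h32: "c (7, 1) = 0"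
    using C(3)[of 3 2] by (simp_all add: e)
  have h33: "c (0, 3) = 0" "c (12, 1) = 0"
  proof -
    have "c (0, 3) * (2 * \<i>) ^ 3 = 0"
      by (rule trans[OF _ C(3)[of 3 3]]) (simp only: e, simp add: nd 2 3)
    then show h: "c (0, 3) = 0" by simp
    have "c (0, 3) * 4 ^ 3 + c (12, 1) * 16 = 0"
      by (rule trans[OF _ C(2)[of 3 3]]) (simp only: e, simp add: nd 2 3)
    then show "c (12, 1) = 0" using h by simp
  qed
  show ?thesis using assms(2) unfolding basis_idx_eq insert_iff empty_iff
    by (elim disjE) (simp_all only: h00 h01 h02 h03 h10 h11 h12 h13 h20 h21 h22 h23 h30 h31 h32 h33)
qed


subsection \<open>Independence\<close>

text \<open>Along a line through the regular point the coefficients would be univariate polynomials;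
  dividing by the largest common power of the parameter leaves a nontrivial relation at the regular
  point itself.\<close>

theorem basis_independent:
  assumes p: "\<And>b. b \<in> basis_idx \<Longrightarrow> p b \<in> polys_in pvars"
    and zero: "\<And>x y. (\<Sum>k\<in>UNIV. x k) = 0 \<Longrightarrow> (\<Sum>k\<in>UNIV. y k) = 0 \<Longrightarrow>
      (\<Sum>b\<in>basis_idx. peval (psum x y) (p b) * peval (psum x y) (basis b)) = 0"
    and b: "b \<in> basis_idx"
  shows "p b = 0"
proof (rule ccontr)
  assume "p b \<noteq> 0"
  then obtain w where w: "peval w (p b) \<noteq> 0" using peval_zero_imp_zero by blast
  obtain x1 :: "4 \<Rightarrow> complex" where x1: "(\<Sum>k\<in>UNIV. x1 k) = 0" "(\<Sum>k\<in>UNIV. x1 k ^ 2) = w 3"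
    "(\<Sum>k\<in>UNIV. x1 k ^ 3) = w 6" "(\<Sum>k\<in>UNIV. x1 k ^ 4) = w 10" by (rule power_sums_surj)
  obtain y1 :: "4 \<Rightarrow> complex" where y1: "(\<Sum>k\<in>UNIV. y1 k) = 0" "(\<Sum>k\<in>UNIV. y1 k ^ 2) = w 5"
    "(\<Sum>k\<in>UNIV. y1 k ^ 3) = w 9" "(\<Sum>k\<in>UNIV. y1 k ^ 4) = w 14" by (rule power_sums_surj)
  have w1: "psum x1 y1 i = w i" if "i \<in> pvars" for i
    using that unfolding pvars_def insert_iff empty_iff
    by (elim disjE) (simp_all add: psum_def xdeg_def ydeg_def x1 y1)
  \<comment> \<open>Parameter 0 gives the regular point \<open>unit4\<close>, parameter 1 the point
    at which the power sums are those of w, so that the coefficient \<open>p b\<close> does not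
    vanish there.\<close>
  define X where "X k = [:unit4 k, x1 k - unit4 k:]" for k
  define Y where "Y k = [:unit4 k, y1 k - unit4 k:]" for k
  let ?ps = "poly_subst (\<lambda>c. [:c:])"
  have ev: "poly (?ps v q) t = peval (\<lambda>i. poly (v i) t) q" for v :: "nat \<Rightarrow> complex poly" and q t
    by (subst ring_map_poly_subst_eq[of "\<lambda>p. poly p t"]) (auto simp: ring_map_def one_pCons)
  have evp: "(\<lambda>i. poly (psum x y i) t) = psum (\<lambda>k. poly (x k) t) (\<lambda>k. poly (y k) t)" for x y t
    by (auto simp: psum_def poly_sum)
  have u0: "(\<Sum>k\<in>UNIV. unit4 k) = 0" by (simp add: sum_4 unit4_simps)
  define P where "P c = ?ps (psum X Y) (p c)" for c
  define B where "B \<sigma> \<tau> c = ?ps (psum (X \<circ> \<sigma>) (Y \<circ> \<tau>)) (basis c)" for \<sigma> \<tau> c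
  \<comment> \<open>Permuting x and y separately changes the normal forms but not the coefficients,
    which involve power sums only.\<close>
  have PB: "(\<Sum>c\<in>basis_idx. P c * B \<sigma> \<tau> c) = 0" if bij: "bij \<sigma>" "bij \<tau>" for \<sigma> \<tau>
  proof -
    have "poly (\<Sum>c\<in>basis_idx. P c * B \<sigma> \<tau> c) t = 0" for t
    proof -
      have s: "(\<Sum>k\<in>UNIV. f (\<sigma> k)) = (\<Sum>k\<in>UNIV. f k)" "(\<Sum>k\<in>UNIV. f (\<tau> k)) = (\<Sum>k\<in>UNIV. f k)" for f :: "4 \<Rightarrow> complex"
        using sum.reindex_bij_betw[of \<sigma> UNIV UNIV f] sum.reindex_bij_betw[of \<tau> UNIV UNIV f] bij by simp_all
      have c: "peval (psum (\<lambda>k. poly (X (\<sigma> k)) t) (\<lambda>k. poly (Y (\<tau> k)) t)) (p c) =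
          peval (psum (\<lambda>k. poly (X k) t) (\<lambda>k. poly (Y k) t)) (p c)" if "c \<in> basis_idx" for c
        using psum_pvars[OF _ bij, of _ "\<lambda>k. poly (X k) t" "\<lambda>k. poly (Y k) t"]
        by (intro poly_subst_cong[OF ring_map_id p[OF that]]) (simp add: comp_def)
      have "(\<Sum>k\<in>UNIV. poly (X (\<sigma> k)) t) = 0" "(\<Sum>k\<in>UNIV. poly (Y (\<tau> k)) t) = 0"
        unfolding s(1)[of "\<lambda>k. poly (X k) t"] s(2)[of "\<lambda>k. poly (Y k) t"]
        using u0 x1(1) y1(1) by (simp_all add: X_def Y_def sum.distrib sum_subtractf flip: sum_distrib_left)
      from zero[OF this] show ?thesis
        unfolding poly_sum poly_mult P_def B_def ev evp comp_def using c by simp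
    qed
    then show ?thesis using poly_eq_poly_eq_iff[of "\<Sum>c\<in>basis_idx. P c * B \<sigma> \<tau> c" 0] by auto
  qed
  have Pb: "P b \<noteq> 0"
  proof
    assume "P b = 0"
    then have "poly (P b) 1 = 0" by simp
    then have "peval (psum x1 y1) (p b) = 0" by (simp add: P_def ev evp X_def Y_def)
    moreover have "peval (psum x1 y1) (p b) = peval w (p b)"
      by (rule poly_subst_cong[OF ring_map_id p[OF b] w1])
    ultimately show False using w by simp
  qed
  define n where "n = Min ((\<lambda>c. Polynomial.order 0 (P c)) ` {c\<in>basis_idx. P c \<noteq> 0})"
  have fin: "finite ((\<lambda>c. Polynomial.order 0 (P c)) ` {c\<in>basis_idx. P c \<noteq> 0})" using finite_basis_idx by simp
  have "n \<in> (\<lambda>c. Polynomial.order 0 (P c)) ` {c\<in>basis_idx. P c \<noteq> 0}"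
    unfolding n_def by (rule Min_in[OF fin]) (use b Pb in blast)
  then obtain d where d: "d \<in> basis_idx" "P d \<noteq> 0" "Polynomial.order 0 (P d) = n" by auto
  have "[:0, 1:] ^ n dvd P c" if "c \<in> basis_idx" for c
  proof (cases "P c = 0")
    case False
    then have "n \<le> Polynomial.order 0 (P c)" unfolding n_def using fin that by (intro Min_le) auto
    then show ?thesis using False by (metis order_divides minus_zero)
  qed simp
  then have "\<exists>Q. \<forall>c\<in>basis_idx. P c = [:0, 1:] ^ n * Q c" by (auto simp: dvd_def intro!: bchoice)
  then obtain Q where Q: "\<And>c. c \<in> basis_idx \<Longrightarrow> P c = [:0, 1:] ^ n * Q c" by blast
  have "poly (Q c) 0 = 0" if "c \<in> basis_idx" for c
  proof (rule fibre_independent[OF _ that])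
    fix \<sigma> \<tau> :: "4 \<Rightarrow> 4" assume bij: "bij \<sigma>" "bij \<tau>"
    have "[:0, 1:] ^ n * (\<Sum>c\<in>basis_idx. Q c * B \<sigma> \<tau> c) = (\<Sum>c\<in>basis_idx. P c * B \<sigma> \<tau> c)"
      by (simp add: sum_distrib_left Q mult.assoc)
    then have "(\<Sum>c\<in>basis_idx. Q c * B \<sigma> \<tau> c) = 0" using PB[OF bij] by simp
    then have "poly (\<Sum>c\<in>basis_idx. Q c * B \<sigma> \<tau> c) 0 = 0" by simp
    then show "(\<Sum>c\<in>basis_idx. poly (Q c) 0 * peval (psum (unit4 \<circ> \<sigma>) (unit4 \<circ> \<tau>)) (basis c)) = 0"
      by (simp add: poly_sum B_def ev evp X_def Y_def comp_def)
  qed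
  \<comment> \<open>This gives \<open>P d\<close> one factor more than its order n at 0
    allows.\<close>
  then have "[:0, 1:] dvd Q d" using d(1) by (simp add: poly_eq_0_iff_dvd)
  then have "[:0, 1:] ^ Suc n dvd P d" unfolding Q[OF d(1)] power_Suc2 by (intro mult_dvd_mono) auto
  then show False using d order_divides[of 0 "Suc n" "P d"] by simp
qed

section \<open>Leading forms\<close>

lemma below_add: "p \<in> below d \<Longrightarrow> q \<in> below d \<Longrightarrow> p + q \<in> below d"
  using keys_add[of p q] by (auto simp: below_def)

lemma below_0 [simp]: "0 \<in> below d"
  by (simp add: below_def)

lemma below_uminus: "p \<in> below d \<Longrightarrow> - p \<in> below d"
  by (simp add: below_def)

lemma below_sum: "(\<And>i. i \<in> A \<Longrightarrow> f i \<in> below d) \<Longrightarrow> sum f A \<in> below d"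
  by (induction A rule: infinite_finite_induct) (auto intro: below_add)

lemma homog_below: "p \<in> homog d \<Longrightarrow> d < e \<Longrightarrow> p \<in> below e"
  by (auto simp: homog_def below_def)

lemma homog_mult_below: "p \<in> homog d \<Longrightarrow> q \<in> below e \<Longrightarrow> p * q \<in> below (d + e)"
  using keys_mult[of p q] by (force simp: homog_def below_def mdeg_add)

lemma homog_keys_pdiff: "p \<in> homog d \<Longrightarrow> m \<in> keys (pdiff i p) \<Longrightarrow> mdeg wt m + wt i = d"
  by (erule keys_pdiffE) (use mdeg_diff_single[of i _ wt] in \<open>auto simp: homog_def\<close>)

lemma below_pdiff:
  assumes "p \<in> homog d" "q \<in> below e" "d + e = n + wt i"
  shows "pdiff i p * q \<in> below n"
  using keys_mult[of "pdiff i p" q] homog_keys_pdiff[OF assms(1)] assms(2,3)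
  by (force simp: below_def mdeg_add)

lemma poly_bracket_tail:
  assumes "p \<in> polys_in {3..14}" "q \<in> polys_in {3..14}" "p \<in> homog d" "q \<in> homog e" "2 \<le> e"
  shows "poly_bracket 1 p q - poly_bracket 0 p q \<in> below (d + e - 2)"
proof -
  have "poly_bracket 1 p q - poly_bracket 0 p q =
    (\<Sum>i\<in>{3..14}. \<Sum>j\<in>{3..14}. pdiff i p * (pdiff j q * (gen_bracket 1 i j - gen_bracket 0 i j)))"
    unfolding poly_bracket_inner[OF assms(1,2)] by (simp only: right_diff_distrib sum_subtractf)
  also have "\<dots> \<in> below (d + e - 2)"
  proof (intro below_sum)
    fix i j :: nat assume ij: "i \<in> {3..14}" "j \<in> {3..14}"
    note w = wt_ge_2[OF ij(1)] wt_ge_2[OF ij(2)]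
    have "gen_bracket 1 i j - gen_bracket 0 i j \<in> below (wt i + wt j - 2)"
      by (rule homog_below[OF gen_bracket_tail[OF ij]]) (use w in linarith)
    then have "pdiff j q * (gen_bracket 1 i j - gen_bracket 0 i j) \<in> below (e + wt i - 2)"
      by (rule below_pdiff[OF assms(4)]) (use w in simp)
    then show "pdiff i p * (pdiff j q * (gen_bracket 1 i j - gen_bracket 0 i j)) \<in> below (d + e - 2)"
      by (rule below_pdiff[OF assms(3)]) (use w assms(5) in simp)
  qed
  finally show ?thesis .
qed

lemma monomial_homog: "Poly_Mapping.single m c \<in> homog (mdeg wt m)"
  by (auto simp: homog_def split: if_splits)

lemma poly_bracket_sum_left: "poly_bracket \<epsilon> (\<Sum>i\<in>A. f i) q = (\<Sum>i\<in>A. poly_bracket \<epsilon> (f i) q)"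
proof (induction A rule: infinite_finite_induct)
  case empty then show ?case by (simp add: poly_bracket_def)
next
  case infinite then show ?case by (simp add: poly_bracket_def)
qed (simp add: poly_bracket_add)

lemma poly_bracket_sum_right: "poly_bracket \<epsilon> q (\<Sum>i\<in>A. f i) = (\<Sum>i\<in>A. poly_bracket \<epsilon> q (f i))"
  by (simp add: poly_bracket_antisym[of _ q] poly_bracket_sum_left sum_negf)

lemma poly_bracket_below:
  assumes "p \<in> polys_in {3..14}" "q \<in> polys_in {3..14}" "p \<in> below d" "q \<in> homog e" "2 \<le> e"
  shows "poly_bracket 1 p q \<in> below (d + e - 2)"
proof -
  have "poly_bracket 1 (\<Sum>m\<in>keys p. Poly_Mapping.single m (lookup p m)) q =
      (\<Sum>m\<in>keys p. poly_bracket 1 (Poly_Mapping.single m (lookup p m)) q)"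
    by (rule poly_bracket_sum_left)
  also have "\<dots> \<in> below (d + e - 2)"
  proof (rule below_sum)
    fix m assume m: "m \<in> keys p"
    let ?s = "Poly_Mapping.single m (lookup p m)"
    have s: "?s \<in> polys_in {3..14}" using m assms(1) by (auto simp: polys_in_def)
    have d: "mdeg wt m < d" using m assms(3) by (auto simp: below_def)
    have "poly_bracket 0 ?s q \<in> below (d + e - 2)"
      by (rule homog_below[OF poly_bracket_homog[OF s assms(2) monomial_homog assms(4)]]) (use d assms(5) in auto)
    moreover have "poly_bracket 1 ?s q - poly_bracket 0 ?s q \<in> below (d + e - 2)"
      using poly_bracket_tail[OF s assms(2) monomial_homog assms(4,5)] d by (auto simp: below_def)
    ultimately show "poly_bracket 1 ?s q \<in> below (d + e - 2)" using below_add by fastforce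
  qed
  finally show ?thesis by (simp only: sum_monomials)
qed

text \<open>The span of the leading forms of I: p is a form of degree d that agrees with some g in I
  up to lower degree. Closure under sums is built in because forms of different degrees have to be
  added.\<close>

inductive_set leading :: "nat mpoly set" where
  top: "p \<in> homog d \<Longrightarrow> p \<in> polys_in {3..14} \<Longrightarrow> g \<in> bracket_ideal 1 r\<^sub>1 \<Longrightarrow> g - p \<in> below d \<Longrightarrow> p \<in> leading"
| add: "p \<in> leading \<Longrightarrow> q \<in> leading \<Longrightarrow> p + q \<in> leading"

lemma r1_polys_in: "r\<^sub>1 \<in> polys_in {3..14}"
  by (simp add: r\<^sub>1_def polys_in_intros)

lemma leading_0: "0 \<in> leading"
  by (rule leading.top[of 0 0 0]) (simp_all add: bracket_ideal_0)

lemma leading_sum: "(\<And>i. i \<in> A \<Longrightarrow> f i \<in> leading) \<Longrightarrow> sum f A \<in> leading"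
  by (induction A rule: infinite_finite_induct) (auto intro: leading.add leading_0)

lemma leading_polys_in: "p \<in> leading \<Longrightarrow> p \<in> polys_in {3..14}"
  by (induction rule: leading.induct) (auto intro: polys_in_add)

lemma leading_monomial_mult:
  assumes "p \<in> leading" "keys m \<subseteq> {3..14}"
  shows "Poly_Mapping.single m c * p \<in> leading"
  using assms(1)
proof induction
  case (top p d g)
  let ?s = "Poly_Mapping.single m c"
  have "?s * g - ?s * p \<in> below (mdeg wt m + d)"
    using homog_mult_below[OF monomial_homog top(4)] by (simp only: right_diff_distrib)
  then show ?case
    using top assms(2) by (intro leading.top[of _ "mdeg wt m + d" "?s * g"])
      (auto intro: homog_mult monomial_homog polys_in_mult polys_in_single bracket_ideal_mult)
qed (auto simp: distrib_left intro: leading.add)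

text \<open>If g has leading form p, then {g, s}_1 agrees with {p, s}_0 up to lower degree, because
  every \<epsilon> lowers the degree.\<close>

lemma leading_monomial_bracket:
  assumes "p \<in> leading" "keys m \<subseteq> {3..14}"
  shows "poly_bracket 0 p (Poly_Mapping.single m c) \<in> leading"
  using assms(1)
proof induction
  case (top p d g)
  let ?s = "Poly_Mapping.single m c"
  have s: "?s \<in> polys_in {3..14}" using assms(2) by (rule polys_in_single)
  have g: "g \<in> polys_in {3..14}" using bracket_ideal_subset[OF r1_polys_in] top(3) by blast
  show ?case
  proof (cases "m = 0")
    \<comment> \<open>A constant has bracket 0; any other monomial has degree at least 2, as the
      subtraction of 2 below requires.\<close>
    case True
    then show ?thesis using leading_0 by (simp add: poly_bracket_def pdiff_cst flip: cst_def)
  next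
    case False
    then obtain i where i: "i \<in> keys m" by (metis all_not_in_conv keys_eq_empty)
    then have e: "2 \<le> mdeg wt m" using mdeg_diff_single[OF i, of wt] wt_ge_2[of i] assms(2) by auto
    have "poly_bracket 1 (g - p) ?s \<in> below (d + mdeg wt m - 2)"
      using g top s by (intro poly_bracket_below monomial_homog e polys_in_diff)
    moreover have "poly_bracket 1 p ?s - poly_bracket 0 p ?s \<in> below (d + mdeg wt m - 2)"
      using top s by (intro poly_bracket_tail monomial_homog e)
    ultimately have "poly_bracket 1 g ?s - poly_bracket 0 p ?s \<in> below (d + mdeg wt m - 2)"
      using below_add by (fastforce simp: poly_bracket_diff)
    then show ?thesis
      using top s e by (intro leading.top[of _ "d + mdeg wt m - 2" "poly_bracket 1 g ?s"])
        (auto intro: poly_bracket_homog poly_bracket_polys_in monomial_homog bracket_ideal_bracket)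
  qed
qed (auto simp: poly_bracket_add intro: leading.add)

text \<open>The span of leading forms is an ideal stable under {-,-}_0 and contains the leading form
  \<open>r\<^sub>0\<close> of \<open>r\<^sub>1\<close>, so minimality of J applies.\<close>

lemma relJ_leading: "relJ \<subseteq> leading"
  unfolding relJ_def
proof (rule bracket_ideal_least)
  show "f * p \<in> leading" if "f \<in> polys_in {3..14}" "p \<in> leading" for f p
  proof -
    have "(\<Sum>m\<in>keys f. Poly_Mapping.single m (lookup f m) * p) \<in> leading"
      using that by (intro leading_sum leading_monomial_mult) (auto simp: polys_in_def)
    then show ?thesis by (simp only: sum_monomials flip: sum_distrib_right)
  qed
  show "poly_bracket 0 p f \<in> leading" if "p \<in> leading" "f \<in> polys_in {3..14}" for f p
  proof -
    have "(\<Sum>m\<in>keys f. poly_bracket 0 p (Poly_Mapping.single m (lookup f m))) \<in> leading"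
      using that by (intro leading_sum leading_monomial_bracket) (auto simp: polys_in_def)
    then show ?thesis by (simp only: sum_monomials flip: poly_bracket_sum_right)
  qed
  have "\<a> 3 \<in> homog 2" by (rule homog_var) (simp add: wt_simps)
  then have "8 * \<a> 3 \<in> below 6" by (intro homog_below[of _ 2] homog_numeral_mult) auto
  then show "r\<^sub>0 \<in> leading"
    by (intro leading.top[of _ 6 r\<^sub>1] r0_homog r0_polys_in bracket_ideal_in) (simp add: r\<^sub>0_def)
qed (auto intro: leading_polys_in leading.add leading_0)

definition hcomp :: "nat \<Rightarrow> nat mpoly \<Rightarrow> nat mpoly" where
  "hcomp d p = (\<Sum>m\<in>{m\<in>keys p. mdeg wt m = d}. Poly_Mapping.single m (lookup p m))"

lemma lookup_hcomp: "lookup (hcomp d p) m = (if mdeg wt m = d then lookup p m else 0)"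
proof -
  have "finite {m \<in> keys p. mdeg wt m = d}" by simp
  then show ?thesis by (auto simp: hcomp_def lookup_sum lookup_single when_def in_keys_iff)
qed

lemma hcomp_add: "hcomp d (p + q) = hcomp d p + hcomp d q"
  by (rule poly_mapping_eqI) (simp add: lookup_hcomp lookup_add)

lemma hcomp_homog: "p \<in> homog e \<Longrightarrow> hcomp d p = (if d = e then p else 0)"
  by (rule poly_mapping_eqI) (auto simp: lookup_hcomp homog_def in_keys_iff)

lemma hcomp_below: "p \<in> below (Suc d) \<Longrightarrow> p - hcomp d p \<in> below d"
  by (auto simp: below_def lookup_hcomp lookup_minus in_keys_iff less_Suc_eq split: if_splits)

text \<open>An element of the span is a sum of leading forms of various degrees; its component of
  degree d collects those of that degree, and the corresponding elements of I add up.\<close>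

lemma leading_hcomp:
  assumes "p \<in> leading" shows "\<exists>g\<in>bracket_ideal 1 r\<^sub>1. g - hcomp d p \<in> below d"
  using assms
proof induction
  case (top p e g)
  then show ?case by (cases "d = e") (auto simp: hcomp_homog intro: bexI[of _ 0] bracket_ideal_0)
next
  case (add p q)
  then obtain g h where "g \<in> bracket_ideal 1 r\<^sub>1" "h \<in> bracket_ideal 1 r\<^sub>1"
      "(g - hcomp d p) + (h - hcomp d q) \<in> below d" using below_add by metis
  then show ?case by (intro bexI[of _ "g + h"]) (auto simp: hcomp_add bracket_ideal_add algebra_simps)
qed

text \<open>An element of R is cancelled degree by degree: its top part lies in J, hence is the top
  part of an element of I, and subtracting that element stays in R.\<close>

theorem bracket_ideal_from_leading_forms:
  assumes "bracket_ideal 1 r\<^sub>1 \<subseteq> R" "\<And>p q. p \<in> R \<Longrightarrow> q \<in> R \<Longrightarrow> p - q \<in> R"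
    and lead: "\<And>f d. f \<in> R \<Longrightarrow> f \<in> below (Suc d) \<Longrightarrow> hcomp d f \<in> relJ"
  shows "R \<subseteq> bracket_ideal 1 r\<^sub>1"
proof
  fix f assume f: "f \<in> R"
  have "f \<in> below d \<Longrightarrow> f \<in> R \<Longrightarrow> f \<in> bracket_ideal 1 r\<^sub>1" for d f
  proof (induction d arbitrary: f)
    case 0
    then have "f = 0" by (simp add: below_def)
    then show ?case by (simp add: bracket_ideal_0)
  next
    case (Suc d)
    have h: "hcomp d f \<in> relJ" using lead Suc by blast
    then obtain g where g: "g \<in> bracket_ideal 1 r\<^sub>1" "g - hcomp d (hcomp d f) \<in> below d"
      using relJ_leading leading_hcomp by blast
    have "hcomp d (hcomp d f) = hcomp d f" by (rule poly_mapping_eqI) (simp add: lookup_hcomp)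
    then have "(f - hcomp d f) + - (g - hcomp d f) \<in> below d"
      using g(2) hcomp_below[OF Suc(2)] by (intro below_add below_uminus) simp_all
    then have "f - g \<in> below d" by simp
    then have "f - g \<in> bracket_ideal 1 r\<^sub>1" using Suc assms(1,2) g(1) by blast
    then show ?case using bracket_ideal_add[OF _ g(1), of "f - g"] by simp
  qed
  moreover have "f \<in> below (Suc (\<Sum>m\<in>keys f. mdeg wt m))"
    by (auto simp: below_def less_Suc_eq_le intro: member_le_sum)
  ultimately show "f \<in> bracket_ideal 1 r\<^sub>1" using f by blast
qed

section \<open>Words in matrices over a commutative ring\<close>

definition smat :: "'r::comm_ring_1 \<Rightarrow> 'r^'n^'m \<Rightarrow> 'r^'n^'m" where
  "smat c A = (\<chi> i j. c * A $ i $ j)"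

lemma smat_nth [simp]: "smat c A $ i $ j = c * A $ i $ j"
  by (simp add: smat_def)

lemma mat_eqI: "(\<And>i j. A $ i $ j = B $ i $ j) \<Longrightarrow> A = B"
  by (simp add: vec_eq_iff)

lemma mm_nth: "(A ** B) $ i $ j = (\<Sum>k\<in>UNIV. A $ i $ k * B $ k $ j)"
  by (simp add: matrix_matrix_mult_def)

lemma mat_nth: "mat c $ i $ j = (if i = j then c else 0)"
  by (simp add: mat_def)

lemma mm_rdistrib: "(A + B) ** C = A ** C + B ** (C :: 'r::comm_ring_1^'n^'n)"
  by (rule mat_eqI) (simp add: mm_nth algebra_simps sum.distrib)

lemma mm_diff_ldistrib: "A ** (B - C) = A ** B - A ** (C :: 'r::comm_ring_1^'n^'n)"
  by (rule mat_eqI) (simp add: mm_nth algebra_simps sum_subtractf)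

lemma mm_diff_rdistrib: "(A - B) ** C = A ** C - B ** (C :: 'r::comm_ring_1^'n^'n)"
  by (rule mat_eqI) (simp add: mm_nth algebra_simps sum_subtractf)

lemma mm_zero: "0 ** A = (0 :: 'r::comm_ring_1^'n^'n)" "A ** 0 = (0 :: 'r::comm_ring_1^'n^'n)"
  by (rule mat_eqI, simp add: mm_nth)+

lemma mm_uminus: "(- A) ** B = - (A ** (B :: 'r::comm_ring_1^'n^'n))" "A ** (- B) = - (A ** (B :: 'r::comm_ring_1^'n^'n))"
  by (rule mat_eqI, simp add: mm_nth sum_negf)+

lemma mm_smat: "smat c A ** B = smat c (A ** (B :: 'r::comm_ring_1^'n^'n))" "A ** smat c B = smat c (A ** (B :: 'r::comm_ring_1^'n^'n))"
  by (rule mat_eqI, simp add: mm_nth sum_distrib_left mult_ac)+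

lemma mm_sum_left: "(\<Sum>k\<in>S. f k) ** (B :: 'r::comm_ring_1^'n^'n) = (\<Sum>k\<in>S. f k ** B)"
  by (induction S rule: infinite_finite_induct) (auto simp: mm_zero mm_rdistrib)

lemma mm_sum_right: "(B :: 'r::comm_ring_1^'n^'n) ** (\<Sum>k\<in>S. f k) = (\<Sum>k\<in>S. B ** f k)"
  by (induction S rule: infinite_finite_induct) (auto simp: mm_zero matrix_add_ldistrib)

lemma mat_smat: "mat c = smat c (mat 1)"
  by (rule mat_eqI) (simp add: mat_nth)

lemma smat_smat: "smat c (smat d A) = smat (c * d) A"
  by (rule mat_eqI) (simp add: mult.assoc)

lemma smat_diff: "smat c (A - B) = smat c A - smat c B"
  by (rule mat_eqI) (simp add: right_diff_distrib)

lemma trace_smat: "trace (smat c A) = c * trace A"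
  by (simp add: trace_def sum_distrib_left)

lemma trace_zero: "trace (0 :: 'r::comm_ring_1^'n^'n) = 0"
  by (simp add: trace_def)

lemma trace_uminus: "trace (- A :: 'r::comm_ring_1^'n^'n) = - trace A"
  by (simp add: trace_def sum_negf)

lemma trace_sum: "trace (\<Sum>k\<in>S. f k :: 'r::comm_ring_1^'n^'n) = (\<Sum>k\<in>S. trace (f k))"
  by (induction S rule: infinite_finite_induct) (auto simp: trace_zero trace_add)

text \<open>Over an arbitrary commutative ring, because the entries are sometimes complex numbers
  and sometimes polynomials in the matrix entries.\<close>

definition wmat :: "(letter \<Rightarrow> 'r::comm_ring_1^'n^'n) \<Rightarrow> letter list \<Rightarrow> 'r^'n^'n" where
  "wmat A w = foldr (\<lambda>l M. A l ** M) w (mat 1)"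

lemma wmat_Nil [simp]: "wmat A [] = mat 1" and wmat_Cons [simp]: "wmat A (l # w) = A l ** wmat A w"
  by (simp_all add: wmat_def)

lemma wmat_append: "wmat A (u @ v) = wmat A u ** wmat A v"
  by (induction u) (auto simp: matrix_mul_assoc)

lemma word_trace_wmat: "word_trace w z = trace (wmat (letter_mat z) w)"
  by (simp add: word_trace_def wmat_def)

definition tw :: "(letter \<Rightarrow> 'r::comm_ring_1^'n^'n) \<Rightarrow> letter list \<Rightarrow> 'r" where
  "tw A w = trace (wmat A w)"

lemma tw_cyclic: "tw A (u @ v) = tw A (v @ u)"
  unfolding tw_def wmat_append by (rule trace_mul_sym)

definition mmap :: "('r \<Rightarrow> 's) \<Rightarrow> 'r::comm_ring_1^'n^'m \<Rightarrow> 's::comm_ring_1^'n^'m" where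
  "mmap h A = (\<chi> i j. h (A $ i $ j))"

lemma mmap_nth [simp]: "mmap h A $ i $ j = h (A $ i $ j)"
  by (simp add: mmap_def)

lemma mmap_mult:
  assumes "ring_map h" shows "mmap h (A ** B) = mmap h A ** mmap h B"
  by (rule mat_eqI) (simp add: mm_nth ring_map_sum[OF assms] ring_map_mult[OF assms])

lemma mmap_mat: 
  assumes "ring_map h" shows "mmap h (mat 1) = mat 1"
  by (rule mat_eqI) (simp add: mat_nth ring_map_0[OF assms] ring_map_1[OF assms])

lemma mmap_wmat: "ring_map h \<Longrightarrow> mmap h (wmat A w) = wmat (\<lambda>l. mmap h (A l)) w"
  by (induction w) (auto simp: mmap_mat mmap_mult)

lemma ring_map_trace:
  assumes "ring_map h" shows "h (trace A) = trace (mmap h A)"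
  by (simp add: trace_def ring_map_sum[OF assms])

lemma ring_map_tw: "ring_map h \<Longrightarrow> h (tw A w) = tw (\<lambda>l. mmap h (A l)) w"
  unfolding tw_def by (subst ring_map_trace) (simp_all add: mmap_wmat)

subsection \<open>Derivations applied to words\<close>

definition derivation :: "('r::comm_ring_1 \<Rightarrow> 'r) \<Rightarrow> bool" where
  "derivation D \<longleftrightarrow> (\<forall>a b. D (a + b) = D a + D b) \<and> (\<forall>a b. D (a * b) = a * D b + D a * b)"

lemma derivation_add: "derivation D \<Longrightarrow> D (a + b) = D a + D b"
  and derivation_mult: "derivation D \<Longrightarrow> D (a * b) = a * D b + D a * b"
  by (auto simp: derivation_def)

lemma derivation_0: "derivation D \<Longrightarrow> D 0 = 0"
  using derivation_add[of D 0 0] by simp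

lemma derivation_1: "derivation D \<Longrightarrow> D 1 = 0"
  using derivation_mult[of D 1 1] by simp

lemma derivation_sum: "derivation D \<Longrightarrow> D (\<Sum>i\<in>S. f i) = (\<Sum>i\<in>S. D (f i))"
  by (induction S rule: infinite_finite_induct) (simp_all add: derivation_0[of D] derivation_add[of D])

lemma derivation_uminus: "derivation D \<Longrightarrow> D (- a) = - D a"
  using derivation_add[of D a "- a"] by (simp add: derivation_0[of D] eq_neg_iff_add_eq_0 add.commute)

lemma derivation_diff: "derivation D \<Longrightarrow> D (a - b) = D a - D b"
  using derivation_add[of D a "- b"] by (simp add: derivation_uminus[of D])

lemma mmap_derivation_mult: "derivation D \<Longrightarrow> mmap D (A ** B) = mmap D A ** B + A ** mmap D B"
  by (rule mat_eqI) (simp add: mm_nth derivation_sum[of D] derivation_mult[of D] sum.distrib add.commute)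

lemma mmap_derivation_wmat:
  assumes "derivation D"
  shows "mmap D (wmat A w) = (\<Sum>k<length w. wmat A (take k w) ** mmap D (A (w ! k)) ** wmat A (drop (Suc k) w))"
proof (induction w)
  case Nil
  show ?case by (rule mat_eqI) (simp add: mat_nth derivation_0[OF assms] derivation_1[OF assms])
next
  case (Cons l w)
  show ?case
    by (simp add: mmap_derivation_mult[OF assms] Cons.IH sum.lessThan_Suc_shift mm_sum_right matrix_mul_assoc
      del: sum.lessThan_Suc)
qed

lemma derivation_trace: "derivation D \<Longrightarrow> D (trace A) = trace (mmap D A)"
  by (simp add: trace_def derivation_sum[of D])

definition wrest :: "letter list \<Rightarrow> nat \<Rightarrow> letter list" where
  "wrest w k = drop (Suc k) w @ take k w"

text \<open>The Leibniz rule along the word, each term rotated cyclically so that the differentiated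
  letter comes first.\<close>

lemma derivation_tw:
  assumes "derivation D"
  shows "D (tw A w) = (\<Sum>k<length w. trace (mmap D (A (w ! k)) ** wmat A (wrest w k)))"
proof -
  have "trace (wmat A (take k w) ** mmap D (A (w ! k)) ** wmat A (drop (Suc k) w)) =
      trace (mmap D (A (w ! k)) ** wmat A (wrest w k))" for k
    unfolding wrest_def wmat_append matrix_mul_assoc[symmetric]
    by (subst trace_mul_sym) (simp only: matrix_mul_assoc)
  then show ?thesis
    by (simp add: tw_def derivation_trace[OF assms] mmap_derivation_wmat[OF assms] trace_sum)
qed

section \<open>The bracket on polynomials in the matrix entries\<close>

type_synonym 'n epoly = "(letter \<times> 'n \<times> 'n) mpoly"

definition gmat :: "letter \<Rightarrow> (('n::finite) epoly)^'n^'n" where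
  "gmat l = (\<chi> i j. \<a> (l, i, j))"

lemma gmat_nth [simp]: "gmat l $ i $ j = \<a> (l, i, j)"
  by (simp add: gmat_def)

definition wpoly :: "letter list \<Rightarrow> ('n::finite) epoly" where
  "wpoly w = tw gmat w"

abbreviation ev :: "('n::finite) mpair \<Rightarrow> 'n epoly \<Rightarrow> complex" where
  "ev z \<equiv> peval (entry z)"

lemma ring_map_ev: "ring_map (ev z)"
  by (rule ring_map_poly_subst) simp

lemma mmap_ev_gmat: "mmap (ev z) (gmat l) = letter_mat z l"
  by (rule mat_eqI) (simp add: peval_simps entry_def)

lemma ev_wpoly: "ev z (wpoly w) = word_trace w z"
  unfolding wpoly_def ring_map_tw[OF ring_map_ev] mmap_ev_gmat by (simp add: tw_def word_trace_wmat)

text \<open>The indices are transposed so that \<open>trace (grad l p ** M)\<close> is the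
  derivative of p in the direction M.\<close>

definition grad :: "letter \<Rightarrow> ('n::finite) epoly \<Rightarrow> ('n epoly)^'n^'n" where
  "grad l p = (\<chi> i j. pdiff (l, j, i) p)"

text \<open>The canonical bracket on pairs of matrices, with X_ij conjugate to Y_ji;
  \<open>pb_wpoly\<close> identifies it with the word formula of the statement.\<close>

definition pb :: "('n::finite) epoly \<Rightarrow> 'n epoly \<Rightarrow> 'n epoly" where
  "pb p q = (\<Sum>i\<in>UNIV. \<Sum>j\<in>UNIV.
     pdiff (LX, i, j) p * pdiff (LY, j, i) q - pdiff (LY, i, j) p * pdiff (LX, j, i) q)"

lemma pb_grad: "pb p q = trace (grad LX p ** grad LY q) - trace (grad LY p ** grad LX q)"
  unfolding pb_def trace_def mm_nth grad_def
  by (subst sum.swap) (simp add: sum_subtractf)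

lemma derivation_pdiff: "derivation (pdiff i)"
  by (simp add: derivation_def pdiff_add pdiff_mult)

lemma sum_pair_delta:
  "(\<Sum>i\<in>UNIV. \<Sum>k\<in>UNIV. if i = a \<and> k = b then f i k else 0) = f (a :: 'a::finite) (b :: 'b::finite)"
proof -
  have "(\<Sum>k\<in>UNIV. if i = a \<and> k = b then f i k else 0) = (if i = a then f a b else 0)" for i
    by (cases "i = a") simp_all
  then show ?thesis by simp
qed

lemma trace_unit_mult:
  "trace ((\<chi> i j. if i = a \<and> j = b then 1 else 0) ** (M :: 'r::comm_ring_1^'n^'n)) = M $ b $ a"
proof -
  have "(\<chi> i j. if i = a \<and> j = b then 1 else 0) $ i $ k * M $ k $ i = (if i = a \<and> k = b then M $ k $ i else 0)" for i k
    by simp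
  then show ?thesis unfolding trace_def mm_nth by (simp only: sum_pair_delta)
qed

lemma grad_wpoly: "grad l (wpoly w) = (\<Sum>k\<in>{k. k < length w \<and> w ! k = l}. wmat gmat (wrest w k))"
proof (rule mat_eqI)
  fix i j
  have "mmap (pdiff (l, j, i)) (gmat l') = (if l' = l then \<chi> a b. if a = j \<and> b = i then 1 else 0 else 0)" for l'
    by (rule mat_eqI) (auto simp: pdiff_var)
  then have *: "trace (mmap (pdiff (l, j, i)) (gmat l') ** M) = (if l' = l then M $ i $ j else 0)" for l' M
    by (simp add: trace_unit_mult mm_zero trace_zero)
  have "grad l (wpoly w) $ i $ j = (\<Sum>k<length w. if w ! k = l then wmat gmat (wrest w k) $ i $ j else 0)"
    by (simp add: grad_def wpoly_def derivation_tw[OF derivation_pdiff] *)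
  also have "\<dots> = (\<Sum>k\<in>{k\<in>{..<length w}. w ! k = l}. wmat gmat (wrest w k) $ i $ j)"
    by (simp only: sum.inter_filter[OF finite_lessThan])
  also have "{k\<in>{..<length w}. w ! k = l} = {k. k < length w \<and> w ! k = l}" by auto
  finally show "grad l (wpoly w) $ i $ j = (\<Sum>k\<in>{k. k < length w \<and> w ! k = l}. wmat gmat (wrest w k)) $ i $ j"
    by simp
qed

lemma pb_wpoly: "pb (wpoly u) (wpoly v) =
    (\<Sum>k<length u. \<Sum>m<length v. cst (\<omega> (u ! k) (v ! m)) * wpoly (wrest u k @ wrest v m))"
proof -
  let ?t = "\<lambda>k m. trace (wmat gmat (wrest u k) ** wmat gmat (wrest v m))"
  have t: "trace (grad l (wpoly u) ** grad l' (wpoly v)) =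
      (\<Sum>k<length u. \<Sum>m<length v. if u ! k = l \<and> v ! m = l' then ?t k m else 0)" for l l'
  proof -
    have "trace (grad l (wpoly u) ** grad l' (wpoly v)) =
       (\<Sum>k\<in>{k\<in>{..<length u}. u ! k = l}. \<Sum>m\<in>{m\<in>{..<length v}. v ! m = l'}. ?t k m)"
      by (simp add: grad_wpoly mm_sum_left mm_sum_right trace_sum) (rule sum.swap)
    also have "\<dots> = (\<Sum>k<length u. \<Sum>m<length v. if u ! k = l \<and> v ! m = l' then ?t k m else 0)"
    proof -
      have "(\<Sum>k\<in>{k\<in>{..<length u}. u ! k = l}. \<Sum>m\<in>{m\<in>{..<length v}. v ! m = l'}. ?t k m) =
          (\<Sum>k<length u. if u ! k = l then \<Sum>m<length v. if v ! m = l' then ?t k m else 0 else 0)"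
        by (simp only: sum.inter_filter[OF finite_lessThan])
      also have "\<dots> = (\<Sum>k<length u. \<Sum>m<length v. if u ! k = l \<and> v ! m = l' then ?t k m else 0)"
        by (rule sum.cong[OF refl]) simp
      finally show ?thesis .
    qed
    finally show ?thesis .
  qed
  have w: "(if u ! k = LX \<and> v ! m = LY then ?t k m else 0) - (if u ! k = LY \<and> v ! m = LX then ?t k m else 0)
      = cst (\<omega> (u ! k) (v ! m)) * wpoly (wrest u k @ wrest v m)" for k m
    by (cases "u ! k"; cases "v ! m") (simp_all add: wpoly_def tw_def wmat_append cst_uminus)
  show ?thesis
    unfolding pb_grad t by (simp only: w flip: sum_subtractf)
qed

lemma pb_add_left: "pb (p + q) r = pb p r + pb q r"
  by (simp add: pb_def pdiff_add algebra_simps sum.distrib sum_subtractf)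

lemma pb_mult_left: "pb (p * q) r = p * pb q r + pb p r * q"
  by (simp add: pb_def pdiff_mult algebra_simps sum.distrib sum_subtractf sum_distrib_left)

lemma pb_antisym: "pb p q = - pb q p"
  unfolding pb_grad trace_mul_sym[of "grad LX q" "grad LY p"] trace_mul_sym[of "grad LY q" "grad LX p"] by simp

lemma derivation_pb: "derivation (pb p)"
  unfolding derivation_def
  by (subst (1 2 3 4 5 6) pb_antisym) (simp add: pb_add_left pb_mult_left)

lemma pb_add_right: "pb p (q + r) = pb p q + pb p r" and pb_mult_right: "pb p (q * r) = q * pb p r + pb p q * r"
  using derivation_pb[of p] by (auto simp: derivation_def)

lemma pb_cst: "pb (cst c) p = 0" "pb p (cst c) = 0"
  by (simp_all add: pb_def pdiff_cst)

lemma pb_var_const: "\<exists>c. pb (\<a> i) (\<a> j) = cst c"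
proof -
  have "pb (\<a> i) (\<a> j) \<in> polys_in {}"
    unfolding pb_def by (intro polys_in_sum polys_in_diff polys_in_mult) (auto simp: pdiff_var)
  then have "pdiff k (pb (\<a> i) (\<a> j)) = 0" for k by (rule pdiff_polys_in_0) simp
  then show ?thesis using pdiff_zero_imp_cst by blast
qed

definition jac :: "('n::finite) epoly \<Rightarrow> 'n epoly \<Rightarrow> 'n epoly \<Rightarrow> 'n epoly" where
  "jac p q r = pb p (pb q r) + pb q (pb r p) + pb r (pb p q)"

lemma jac_rotate: "jac p q r = jac q r p"
  by (simp add: jac_def)

lemma jac_add: "jac (p + p') q r = jac p q r + jac p' q r"
  by (simp add: jac_def pb_add_left pb_add_right)

lemma jac_mult: "jac (p * p') q r = p * jac p' q r + jac p q r * p'"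
  unfolding jac_def pb_mult_left pb_mult_right pb_add_left pb_add_right
  using pb_antisym[of p q] pb_antisym[of p' q] pb_antisym[of p r] pb_antisym[of p' r]
  by (simp add: algebra_simps)

lemma jac_cst: "jac (cst c) q r = 0"
  by (simp add: jac_def pb_cst derivation_0[OF derivation_pb])

text \<open>The Jacobi expression is a derivation in each argument, so it suffices to check
  coordinates, and their brackets are constants.\<close>

lemma jacobi: "jac p q r = 0"
proof -
  have 1: "jac (\<a> i) (\<a> j) (\<a> k) = 0" for i j k :: "letter \<times> 'a \<times> 'a"
    using pb_var_const[of i j] pb_var_const[of j k] pb_var_const[of k i] by (auto simp: jac_def pb_cst)
  have 2: "jac p (\<a> j) (\<a> k) = 0" for p and j k :: "letter \<times> 'a \<times> 'a"
    by (induction p rule: mpoly_induct) (simp_all add: jac_cst 1 jac_add jac_mult)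
  have 3: "jac p q (\<a> k) = 0" for p q and k :: "letter \<times> 'a \<times> 'a"
    unfolding jac_rotate[of p]
  proof (induction q rule: mpoly_induct)
    case (var i) show ?case using 2[of p] jac_rotate[of p] by metis
  qed (simp_all add: jac_cst jac_add jac_mult)
  show ?thesis
    unfolding jac_rotate[of p] jac_rotate[of q]
  proof (induction r rule: mpoly_induct)
    case (var i) show ?case using 3[of p q i] jac_rotate[of p] jac_rotate[of q] by metis
  qed (simp_all add: jac_cst jac_add jac_mult)
qed

subsection \<open>The algebra generated by the traces of words\<close>

inductive_set talg :: "('n::finite) epoly set" where
  cst: "cst c \<in> talg"
| wpoly: "wpoly w \<in> talg"
| add: "p \<in> talg \<Longrightarrow> q \<in> talg \<Longrightarrow> p + q \<in> talg"
| mult: "p \<in> talg \<Longrightarrow> q \<in> talg \<Longrightarrow> p * q \<in> talg"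

lemma talg_uminus: "p \<in> talg \<Longrightarrow> - p \<in> talg"
  using talg.mult[OF talg.cst[of "-1"], of p] by (simp add: cst_uminus)

lemma talg_diff: "p \<in> talg \<Longrightarrow> q \<in> talg \<Longrightarrow> p - q \<in> talg"
  using talg.add[of p "- q"] talg_uminus[of q] by simp

lemma talg_sum: "(\<And>i. i \<in> A \<Longrightarrow> f i \<in> talg) \<Longrightarrow> sum f A \<in> talg"
  using talg.cst[of 0] by (induction A rule: infinite_finite_induct) (auto intro: talg.add)

lemma talg_pb:
  assumes "p \<in> talg" "q \<in> talg" shows "pb p q \<in> talg"
  using assms
proof (induction p)
  case (wpoly u)
  from wpoly show ?case
  proof (induction q)
    case (wpoly v)
    then show ?case unfolding pb_wpoly by (intro talg_sum talg.mult talg.cst talg.wpoly)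
  qed (auto simp: pb_cst pb_add_right pb_mult_right intro: talg.intros talg.cst[of 0, simplified])
qed (auto simp: pb_cst pb_add_left pb_mult_left intro: talg.intros talg.cst[of 0, simplified])

subsection \<open>The commutator is conserved\<close>

definition comm :: "('n::finite) epoly^'n^'n" where
  "comm = gmat LX ** gmat LY - gmat LY ** gmat LX"

text \<open>Infinitesimal invariance of a trace under conjugation: the term of letter k is the
  difference between the rotations of the word at k and at k + 1, so the sum telescopes.\<close>

lemma grad_invariant: "(\<Sum>l\<in>{LX, LY}. gmat l ** grad l (wpoly w) - grad l (wpoly w) ** gmat l) = 0"
proof -
  let ?r = "\<lambda>k. wmat gmat (wrest w k)" and ?f = "\<lambda>k. wmat gmat (drop k w @ take k w)"
  have "(\<Sum>l\<in>{LX, LY}. gmat l ** grad l (wpoly w) - grad l (wpoly w) ** gmat l) =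
     (\<Sum>l\<in>{LX, LY}. \<Sum>k<length w. if w ! k = l then gmat l ** ?r k - ?r k ** gmat l else 0)"
  proof (rule sum.cong[OF refl])
    fix l
    have "{k. k < length w \<and> w ! k = l} = {k\<in>{..<length w}. w ! k = l}" by auto
    then show "gmat l ** grad l (wpoly w) - grad l (wpoly w) ** gmat l =
        (\<Sum>k<length w. if w ! k = l then gmat l ** ?r k - ?r k ** gmat l else 0)"
      by (simp only: grad_wpoly mm_sum_left mm_sum_right sum_subtractf[symmetric] sum.inter_filter[OF finite_lessThan])
        (rule sum.cong[OF refl], simp add: mm_zero)
  qed
  also have "\<dots> = (\<Sum>k<length w. gmat (w ! k) ** ?r k - ?r k ** gmat (w ! k))"
  proof -
    have "(if w ! k = LX then gmat LX ** ?r k - ?r k ** gmat LX else 0) +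
        (if w ! k = LY then gmat LY ** ?r k - ?r k ** gmat LY else 0) = gmat (w ! k) ** ?r k - ?r k ** gmat (w ! k)" for k
      by (cases "w ! k") auto
    note e = this
    have "(\<Sum>l\<in>{LX, LY}. \<Sum>k<length w. if w ! k = l then gmat l ** ?r k - ?r k ** gmat l else 0) =
        (\<Sum>k<length w. (if w ! k = LX then gmat LX ** ?r k - ?r k ** gmat LX else 0) +
          (if w ! k = LY then gmat LY ** ?r k - ?r k ** gmat LY else 0))"
      by (simp add: sum.distrib)
    then show ?thesis by (simp only: e)
  qed
  also have "\<dots> = (\<Sum>k<length w. ?f k - ?f (Suc k))"
  proof (rule sum.cong[OF refl])
    fix k assume k: "k \<in> {..<length w}"
    then have "drop k w = w ! k # drop (Suc k) w" "take (Suc k) w = take k w @ [w ! k]"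
      by (auto simp: Cons_nth_drop_Suc take_Suc_conv_app_nth)
    then show "gmat (w ! k) ** ?r k - ?r k ** gmat (w ! k) = ?f k - ?f (Suc k)"
      by (simp add: wrest_def wmat_append matrix_mul_assoc)
  qed
  also have "\<dots> = ?f 0 - ?f (length w)" by (rule sum_lessThan_telescope')
  finally show ?thesis by simp
qed

text \<open>Hamilton's equations in matrix form.\<close>

lemma mmap_pb_gmat: "mmap (pb p) (gmat LX) = - grad LY p" "mmap (pb p) (gmat LY) = grad LX p"
proof -
  note * = sum_pair_delta
  show "mmap (pb p) (gmat LX) = - grad LY p"
  proof (rule mat_eqI)
    fix i j
    have "pb p (\<a> (LX, i, j)) = (\<Sum>a\<in>UNIV. \<Sum>b\<in>UNIV. if a = j \<and> b = i then - pdiff (LY, a, b) p else 0)"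
      unfolding pb_def by (intro sum.cong refl) (auto simp: pdiff_var)
    then show "mmap (pb p) (gmat LX) $ i $ j = (- grad LY p) $ i $ j" by (simp add: * grad_def)
  qed
  show "mmap (pb p) (gmat LY) = grad LX p"
  proof (rule mat_eqI)
    fix i j
    have "pb p (\<a> (LY, i, j)) = (\<Sum>a\<in>UNIV. \<Sum>b\<in>UNIV. if a = j \<and> b = i then pdiff (LX, a, b) p else 0)"
      unfolding pb_def by (intro sum.cong refl) (auto simp: pdiff_var)
    then show "mmap (pb p) (gmat LY) $ i $ j = grad LX p $ i $ j" by (simp add: * grad_def)
  qed
qed

text \<open>The commutator is the moment map of the conjugation action, so it commutes with all
  invariants.\<close>

lemma pb_comm:
  assumes "p \<in> talg" shows "pb p (comm $ i $ j) = 0"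
  using assms
proof induction
  case (wpoly w)
  have "mmap (pb (wpoly w)) comm = mmap (pb (wpoly w)) (gmat LX ** gmat LY) - mmap (pb (wpoly w)) (gmat LY ** gmat LX)"
    unfolding comm_def by (rule mat_eqI) (simp add: derivation_diff[OF derivation_pb])
  also have "\<dots> = (\<Sum>l\<in>{LX, LY}. gmat l ** grad l (wpoly w) - grad l (wpoly w) ** gmat l)"
    by (simp add: mmap_derivation_mult[OF derivation_pb] mmap_pb_gmat mm_uminus algebra_simps)
  finally have "mmap (pb (wpoly w)) comm = 0" by (simp add: grad_invariant)
  from arg_cong[OF this, of "\<lambda>M. M $ i $ j"] show ?case by simp
qed (simp_all add: pb_cst pb_add_left pb_mult_left)

section \<open>Invariants of matrices are generated by traces of words\<close>

lemma sum_PiE_insert: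
  assumes "finite S" "s \<notin> S"
  shows "(\<Sum>f\<in>insert s S \<rightarrow>\<^sub>E (UNIV :: 'b::finite set). h f) = (\<Sum>y\<in>UNIV. \<Sum>g\<in>S \<rightarrow>\<^sub>E UNIV. h (g(s := y)))"
proof -
  have "(\<Sum>f\<in>insert s S \<rightarrow>\<^sub>E (UNIV :: 'b set). h f) = (\<Sum>p\<in>UNIV \<times> (S \<rightarrow>\<^sub>E UNIV). h ((\<lambda>(y, g). g(s := y)) p))"
    unfolding PiE_insert_eq by (rule sum.reindex_cong[OF inj_combinator[OF assms(2)] refl]) simp
  then show ?thesis by (simp add: sum.cartesian_product split_beta)
qed

lemma prod_sum_PiE:
  fixes f :: "'a \<Rightarrow> 'b::finite \<Rightarrow> 'c::comm_semiring_1"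
  assumes "finite S"
  shows "(\<Prod>k\<in>S. \<Sum>y\<in>UNIV. f k y) = (\<Sum>g\<in>S \<rightarrow>\<^sub>E UNIV. \<Prod>k\<in>S. f k (g k))"
  using assms
proof induction
  case (insert s S)
  have "(\<Prod>k\<in>S. f k (if k = s then y else g k)) = (\<Prod>k\<in>S. f k (g k))" for y g
    using insert.hyps by (intro prod.cong) auto
  then show ?case using insert by (simp add: sum_PiE_insert sum_product)
qed simp

subsection \<open>Orthogonal projections\<close>

text \<open>Induction on the coordinates replaces a basis of K: K' is the part of K vanishing at s,
  v is an element of K orthogonal to K', and the projection to K' is corrected by a multiple of
  v.\<close>

lemma orthogonal_projection:
  fixes K :: "('s \<Rightarrow> complex) set"
  assumes "finite S" "(\<lambda>_. 0) \<in> K" "\<And>f g. f \<in> K \<Longrightarrow> g \<in> K \<Longrightarrow> (\<lambda>s. f s + g s) \<in> K"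
    "\<And>c f. f \<in> K \<Longrightarrow> (\<lambda>s. c * f s) \<in> K"
  shows "\<exists>k\<in>K. \<forall>h\<in>K. (\<Sum>s\<in>S. (f s - k s) * cnj (h s)) = 0"
  using assms
proof (induction S arbitrary: K f rule: finite_induct)
  case empty
  then show ?case by auto
next
  case (insert s S)
  note K = insert.prems
  define K' where "K' = {k\<in>K. k s = 0}"
  have IH: "\<exists>k\<in>K'. \<forall>h\<in>K'. (\<Sum>t\<in>S. (f t - k t) * cnj (h t)) = 0" for f
    by (rule insert.IH) (use K in \<open>auto simp: K'_def\<close>)
  show ?case
  proof (cases "K = K'")
    case True
    then have "cnj (h s) = 0" if "h \<in> K" for h using that by (auto simp: K'_def)
    then have "(\<Sum>t\<in>insert s S. (f t - k t) * cnj (h t)) = (\<Sum>t\<in>S. (f t - k t) * cnj (h t))" if "h \<in> K" for h k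
      using that insert.hyps by simp
    then show ?thesis using IH[of f] True by metis
  next
    case False
    then obtain u where u: "u \<in> K" "u s \<noteq> 0" by (auto simp: K'_def)
    obtain w where w: "w \<in> K'" "\<forall>h\<in>K'. (\<Sum>t\<in>S. (u t - w t) * cnj (h t)) = 0" using IH by blast
    obtain k where k: "k \<in> K'" "\<forall>h\<in>K'. (\<Sum>t\<in>S. (f t - k t) * cnj (h t)) = 0" using IH by blast
    define v where "v t = u t - w t" for t
    let ?ip = "\<lambda>a b. \<Sum>t\<in>insert s S. a t * cnj (b t)"
    have v: "v \<in> K" unfolding v_def using K(2)[OF u(1), of "\<lambda>t. - 1 * w t"] K(3)[of w "-1"] w(1) by (auto simp: K'_def)
    have vs: "v s \<noteq> 0" using u w(1) by (simp add: v_def K'_def)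
    have orth: "?ip v h = 0" "?ip (\<lambda>t. f t - k t) h = 0" if "h \<in> K'" for h
      using that w k insert.hyps by (simp_all add: v_def K'_def)
    define N where "N = ?ip v v"
    have "N = of_real (\<Sum>t\<in>insert s S. (cmod (v t))\<^sup>2)"
      by (simp only: N_def of_real_sum complex_norm_square)
    moreover have "(\<Sum>t\<in>insert s S. (cmod (v t))\<^sup>2) > 0"
      using vs insert.hyps by (intro sum_pos2[of _ s]) auto
    ultimately have N: "N \<noteq> 0" by (metis less_irrefl of_real_eq_0_iff)
    define c where "c = ?ip (\<lambda>t. f t - k t) v / N"
    define p where "p t = k t + c * v t" for t
    have "p \<in> K" unfolding p_def using K(2)[of k "\<lambda>t. c * v t"] K(3)[OF v] k(1) by (auto simp: K'_def)
    moreover have "(\<Sum>t\<in>insert s S. (f t - p t) * cnj (h t)) = 0" if h: "h \<in> K" for h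
    proof -
      \<comment> \<open>Subtracting d times v from h lands in K', so orthogonality has to be tested
        on K' and on v only.\<close>
      define d where "d = h s / v s"
      have h': "(\<lambda>t. h t + - d * v t) \<in> K'"
        using K(2)[OF h K(3)[OF v, of "- d"]] vs by (simp add: K'_def d_def)
      have ip_diff: "?ip (\<lambda>t. f t - p t) g = ?ip (\<lambda>t. f t - k t) g - c * ?ip v g" for g
        unfolding p_def sum_distrib_left sum_subtractf[symmetric] by (intro sum.cong refl) (simp add: algebra_simps)
      have "?ip (\<lambda>t. f t - p t) v = 0" unfolding ip_diff using N by (simp add: c_def N_def)
      moreover have "?ip (\<lambda>t. f t - p t) (\<lambda>t. h t + - d * v t) = 0"
        unfolding ip_diff orth[OF h'] by simp
      moreover have "?ip (\<lambda>t. f t - p t) h = ?ip (\<lambda>t. f t - p t) (\<lambda>t. h t + - d * v t) + cnj d * ?ip (\<lambda>t. f t - p t) v"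
        unfolding sum_distrib_left sum.distrib[symmetric] by (intro sum.cong refl) (simp add: algebra_simps)
      ultimately show ?thesis by simp
    qed
    ultimately show ?thesis by blast
  qed
qed

lemma ip_self_zero:
  assumes "finite S" "(\<Sum>s\<in>S. f s * cnj (f s)) = 0" "s \<in> S"
  shows "f s = 0"
proof -
  have "complex_of_real (\<Sum>s\<in>S. (cmod (f s))\<^sup>2) = 0"
    using assms(2) by (simp only: of_real_sum complex_norm_square)
  then have "(\<Sum>s\<in>S. (cmod (f s))\<^sup>2) = 0" by (metis of_real_eq_0_iff)
  then show ?thesis using assms(1,3) by (simp add: sum_nonneg_eq_0_iff)
qed

subsection \<open>Contracting a permutation to words\<close>

text \<open>The sum factors into one trace per cycle of the permutation. Removing an index either
  splits off the trace of its own word or glues that word to the word of its predecessor.\<close>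

lemma permutation_sum_talg:
  fixes u :: "nat \<Rightarrow> letter list"
  assumes "finite S" "\<sigma> permutes S"
  shows "(\<Sum>I\<in>S \<rightarrow>\<^sub>E UNIV. \<Prod>k\<in>S. wmat gmat (u k) $ I k $ I (\<sigma> k)) \<in> (talg :: ('n::finite) epoly set)"
  using assms
proof (induction S arbitrary: u \<sigma> rule: finite_induct)
  case empty
  then show ?case using talg.cst[of 1] by simp
next
  case (insert s S)
  let ?M = "\<lambda>k. wmat gmat (u k) :: ('n epoly)^'n^'n"
  \<comment> \<open>The permutation that bypasses s: its predecessor is sent to its
    successor.\<close>
  define \<sigma>' where "\<sigma>' = Transposition.transpose s (\<sigma> s) \<circ> \<sigma>"
  have \<sigma>': "\<sigma>' permutes S" unfolding \<sigma>'_def by (rule permutes_insert_lemma[OF insert.prems])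
  have inj: "\<sigma> x = \<sigma> y \<longleftrightarrow> x = y" for x y using permutes_inj[OF insert.prems] by (auto dest: injD)
  have eq: "(\<Sum>I\<in>insert s S \<rightarrow>\<^sub>E UNIV. \<Prod>k\<in>insert s S. ?M k $ I k $ I (\<sigma> k)) =
    (\<Sum>I\<in>S \<rightarrow>\<^sub>E UNIV. \<Sum>i\<in>UNIV. ?M s $ i $ (I(s := i)) (\<sigma> s) * (\<Prod>k\<in>S. ?M k $ I k $ (I(s := i)) (\<sigma> k)))"
  proof -
    have "(\<Prod>k\<in>insert s S. ?M k $ (I(s := i)) k $ (I(s := i)) (\<sigma> k)) =
        ?M s $ i $ (I(s := i)) (\<sigma> s) * (\<Prod>k\<in>S. ?M k $ I k $ (I(s := i)) (\<sigma> k))" for I i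
    proof -
      have "(\<Prod>k\<in>S. ?M k $ (I(s := i)) k $ (I(s := i)) (\<sigma> k)) = (\<Prod>k\<in>S. ?M k $ I k $ (I(s := i)) (\<sigma> k))"
        using insert.hyps by (intro prod.cong) auto
      then show ?thesis using insert.hyps by simp
    qed
    then show ?thesis using insert.hyps by (subst sum_PiE_insert) (auto intro: sum.swap)
  qed
  show ?case
  proof (cases "\<sigma> s = s")
    case True
    then have "\<sigma> k \<noteq> s" if "k \<in> S" for k using that inj insert.hyps by metis
    then have *: "(\<Prod>k\<in>S. ?M k $ I k $ (I(s := i)) (\<sigma> k)) = (\<Prod>k\<in>S. ?M k $ I k $ I (\<sigma> k))" for I i
      by (intro prod.cong) auto
    have "\<sigma> permutes S" using \<sigma>' True by (simp add: \<sigma>'_def)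
    then have "(\<Sum>I\<in>S \<rightarrow>\<^sub>E UNIV. \<Prod>k\<in>S. ?M k $ I k $ I (\<sigma> k)) \<in> talg" by (rule insert.IH)
    moreover have "trace (?M s) \<in> talg" using talg.wpoly[of "u s"] by (simp add: wpoly_def tw_def)
    moreover have "(\<Sum>I\<in>insert s S \<rightarrow>\<^sub>E UNIV. \<Prod>k\<in>insert s S. ?M k $ I k $ I (\<sigma> k)) =
        trace (?M s) * (\<Sum>I\<in>S \<rightarrow>\<^sub>E UNIV. \<Prod>k\<in>S. ?M k $ I k $ I (\<sigma> k))"
      unfolding eq * by (simp add: True trace_def sum_product sum.swap[of _ UNIV])
    ultimately show ?thesis by (simp add: talg.mult)
  next
    case False
    define t where "t = \<sigma> s"
    \<comment> \<open>The predecessor of s in its cycle, whose word absorbs the word of s.\<close>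
    obtain p where sp: "\<sigma> p = s" using permutes_surj[OF insert.prems] by (metis surjD)
    have "p \<noteq> s" using False sp by metis
    moreover have "p \<in> insert s S" using sp permutes_in_image[OF insert.prems, of p] by simp
    ultimately have p: "p \<in> S" by simp
    have t: "t \<noteq> s" using False by (simp add: t_def)
    have \<sigma>'p: "\<sigma>' p = t" by (simp add: \<sigma>'_def sp t_def)
    have \<sigma>'k: "\<sigma>' k = \<sigma> k" "\<sigma> k \<noteq> s" if "k \<in> S - {p}" for k
    proof -
      show "\<sigma> k \<noteq> s" using that sp inj by (metis DiffE singletonI)
      moreover have "\<sigma> k \<noteq> \<sigma> s" using that inj insert.hyps by auto
      ultimately show "\<sigma>' k = \<sigma> k" by (simp add: \<sigma>'_def)
    qed
    let ?u = "u(p := u p @ u s)"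
    have "(\<Sum>I\<in>S \<rightarrow>\<^sub>E UNIV. \<Prod>k\<in>S. wmat gmat (?u k) $ I k $ I (\<sigma>' k)) \<in> (talg :: 'n epoly set)"
      by (rule insert.IH[OF \<sigma>'])
    moreover have "(\<Sum>i\<in>UNIV. ?M s $ i $ (I(s := i)) (\<sigma> s) * (\<Prod>k\<in>S. ?M k $ I k $ (I(s := i)) (\<sigma> k))) =
        (\<Prod>k\<in>S. wmat gmat (?u k) $ I k $ I (\<sigma>' k))" for I
    proof -
      let ?R = "\<Prod>k\<in>S-{p}. ?M k $ I k $ I (\<sigma> k)"
      have "(\<Prod>k\<in>S. ?M k $ I k $ (I(s := i)) (\<sigma> k)) = ?M p $ I p $ i * ?R" for i
      proof -
        have "(\<Prod>k\<in>S-{p}. ?M k $ I k $ (I(s := i)) (\<sigma> k)) = ?R"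
          using \<sigma>'k(2) by (intro prod.cong) auto
        then show ?thesis using prod.remove[OF insert.hyps(1) p, of "\<lambda>k. ?M k $ I k $ (I(s := i)) (\<sigma> k)"] by (simp add: sp)
      qed
      then have "(\<Sum>i\<in>UNIV. ?M s $ i $ (I(s := i)) (\<sigma> s) * (\<Prod>k\<in>S. ?M k $ I k $ (I(s := i)) (\<sigma> k))) =
          (\<Sum>i\<in>UNIV. ?M p $ I p $ i * ?M s $ i $ I t) * ?R"
        using t by (simp add: t_def[symmetric] sum_distrib_left sum_distrib_right mult_ac)
      also have "(\<Sum>i\<in>UNIV. ?M p $ I p $ i * ?M s $ i $ I t) = wmat gmat (?u p) $ I p $ I (\<sigma>' p)"
        by (simp add: wmat_append mm_nth \<sigma>'p)
      also have "?R = (\<Prod>k\<in>S-{p}. wmat gmat (?u k) $ I k $ I (\<sigma>' k))"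
        using \<sigma>'k(1) by (intro prod.cong) auto
      also have "wmat gmat (?u p) $ I p $ I (\<sigma>' p) * \<dots> = (\<Prod>k\<in>S. wmat gmat (?u k) $ I k $ I (\<sigma>' k))"
        by (rule prod.remove[OF insert.hyps(1) p, symmetric])
      finally show ?thesis .
    qed
    ultimately show ?thesis unfolding eq by simp
  qed
qed


subsection \<open>The double commutant of the symmetric group on tensors\<close>

abbreviation tens :: "nat \<Rightarrow> (nat \<Rightarrow> 'n) set" where "tens D \<equiv> {..<D} \<rightarrow>\<^sub>E UNIV"

lemma finite_tens [simp]: "finite (tens D :: (nat \<Rightarrow> 'n::finite) set)"
  by (simp add: finite_PiE)

lemma tens_comp:
  assumes "I \<in> tens D" "\<sigma> permutes {..<D}" shows "I \<circ> \<sigma> \<in> tens D"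
proof (rule PiE_I)
  fix x assume "x \<notin> {..<D}"
  then show "(I \<circ> \<sigma>) x = undefined" using assms by (auto simp: permutes_def PiE_def extensional_def)
qed simp

text \<open>Operators on tensors that commute with permuting the tensor factors.\<close>

definition symtens :: "nat \<Rightarrow> ((nat \<Rightarrow> 'n) \<Rightarrow> (nat \<Rightarrow> 'n) \<Rightarrow> complex) \<Rightarrow> bool" where
  "symtens D b \<longleftrightarrow> (\<forall>\<sigma> P Q. \<sigma> permutes {..<D} \<longrightarrow> P \<in> tens D \<longrightarrow> Q \<in> tens D \<longrightarrow> b (P \<circ> \<sigma>) (Q \<circ> \<sigma>) = b P Q)"

text \<open>The span of the operators that permute tensor factors, as matrices with row I and column
  J.\<close>

definition permspan :: "nat \<Rightarrow> ((nat \<Rightarrow> 'n::finite) \<times> (nat \<Rightarrow> 'n) \<Rightarrow> complex) set" where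
  "permspan D = {T. \<exists>c. \<forall>I\<in>tens D. \<forall>J\<in>tens D. T (I, J) = (\<Sum>\<sigma> | \<sigma> permutes {..<D}. c \<sigma> * (if J = I \<circ> \<sigma> then 1 else 0))}"

lemma permspan_0: "(\<lambda>_. 0) \<in> permspan D"
  unfolding permspan_def by (intro CollectI exI[of _ "\<lambda>_. 0"]) simp

lemma permspan_add: "f \<in> permspan D \<Longrightarrow> g \<in> permspan D \<Longrightarrow> (\<lambda>s. f s + g s) \<in> permspan D"
  unfolding permspan_def
  by (elim CollectE exE, rule CollectI, rule_tac x = "\<lambda>\<sigma>. c \<sigma> + ca \<sigma>" in exI) (simp add: sum.distrib distrib_right)

lemma permspan_scale: "f \<in> permspan D \<Longrightarrow> (\<lambda>s. a * f s) \<in> permspan D"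
  unfolding permspan_def
  by (elim CollectE exE, rule CollectI, rule_tac x = "\<lambda>\<sigma>. a * c \<sigma>" in exI) (simp add: sum_distrib_left mult.assoc)

lemma permspan_cnj: "f \<in> permspan D \<Longrightarrow> (\<lambda>s. cnj (f s)) \<in> permspan D"
  unfolding permspan_def
  by (elim CollectE exE, rule CollectI, rule_tac x = "\<lambda>\<sigma>. cnj (c \<sigma>)" in exI) (simp add: if_distrib cong: if_cong)

lemma permspan_id: "(\<lambda>(I, J). if J = I then 1 else 0) \<in> permspan D"
proof -
  have "(\<Sum>\<sigma> | \<sigma> permutes {..<D}. (if \<sigma> = id then 1 else 0) * (if J = I \<circ> \<sigma> then 1 else 0)) = (if J = I then 1 else 0 :: complex)"
    for I J :: "nat \<Rightarrow> 'a"
  proof -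
    have "(\<Sum>\<sigma> | \<sigma> permutes {..<D}. (if \<sigma> = id then 1 else 0) * (if J = I \<circ> \<sigma> then 1 else 0)) =
        (\<Sum>\<sigma> | \<sigma> permutes {..<D}. if \<sigma> = id then if J = I then 1 else 0 else (0 :: complex))"
      by (intro sum.cong) auto
    then show ?thesis by (simp add: finite_permutations permutes_id)
  qed
  then show ?thesis unfolding permspan_def by (intro CollectI exI[of _ "\<lambda>\<sigma>. if \<sigma> = id then 1 else 0"]) simp
qed

text \<open>Composing the row index with a permutation multiplies by a permutation operator, which
  only relabels the coefficients.\<close>

lemma permspan_shift:
  assumes "f \<in> permspan D" "\<rho> permutes {..<D}"
  shows "(\<lambda>(I, J). f (I \<circ> \<rho>, J)) \<in> permspan D"
proof -
  obtain c where c: "\<forall>I\<in>tens D. \<forall>J\<in>tens D. f (I, J) = (\<Sum>\<sigma> | \<sigma> permutes {..<D}. c \<sigma> * (if J = I \<circ> \<sigma> then 1 else 0))"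
    using assms(1) by (auto simp: permspan_def)
  have "f (I \<circ> \<rho>, J) = (\<Sum>\<sigma> | \<sigma> permutes {..<D}. c (inv_into UNIV \<rho> \<circ> \<sigma>) * (if J = I \<circ> \<sigma> then 1 else 0))"
    if "I \<in> tens D" "J \<in> tens D" for I J
  proof -
    have "f (I \<circ> \<rho>, J) = (\<Sum>\<sigma> | \<sigma> permutes {..<D}. c \<sigma> * (if J = I \<circ> (\<rho> \<circ> \<sigma>) then 1 else 0))"
      using c tens_comp[OF that(1) assms(2)] that(2) by (simp add: comp_assoc)
    also have "\<dots> = (\<Sum>\<sigma> | \<sigma> permutes {..<D}. c (inv_into UNIV \<rho> \<circ> \<sigma>) * (if J = I \<circ> \<sigma> then 1 else 0))"
    proof (rule sum.reindex_bij_witness[of _ "\<lambda>\<sigma>. inv_into UNIV \<rho> \<circ> \<sigma>" "\<lambda>\<sigma>. \<rho> \<circ> \<sigma>"])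
      have b: "bij \<rho>" using assms(2) by (rule permutes_bij)
      show "inv_into UNIV \<rho> \<circ> (\<rho> \<circ> \<sigma>) = \<sigma>" for \<sigma> using b by (auto simp: fun_eq_iff bij_def)
      show "\<rho> \<circ> (inv_into UNIV \<rho> \<circ> \<sigma>) = \<sigma>" for \<sigma> using b by (auto simp: fun_eq_iff bij_def surj_f_inv_f)
      then show "c (inv_into UNIV \<rho> \<circ> (\<rho> \<circ> \<sigma>)) * (if J = I \<circ> (\<rho> \<circ> \<sigma>) then 1 else 0) = c \<sigma> * (if J = I \<circ> (\<rho> \<circ> \<sigma>) then 1 else 0)" for \<sigma>
        by (simp only: \<open>\<And>\<sigma>. inv_into UNIV \<rho> \<circ> (\<rho> \<circ> \<sigma>) = \<sigma>\<close>)
    qed (auto intro: permutes_compose assms permutes_inv)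
    finally show ?thesis .
  qed
  then show ?thesis unfolding permspan_def
    by (intro CollectI exI[of _ "\<lambda>\<sigma>. c (inv_into UNIV \<rho> \<circ> \<sigma>)"]) auto
qed

text \<open>The easy half of the double commutant theorem.\<close>

lemma permspan_commutes:
  assumes "symtens D b" "f \<in> permspan D" "A \<in> tens D" "C \<in> tens D"
  shows "(\<Sum>B\<in>tens D. f (A, B) * b C B) = (\<Sum>I\<in>tens D. f (I, C) * b I A)"
proof -
  obtain c where c: "\<And>I J. I \<in> tens D \<Longrightarrow> J \<in> tens D \<Longrightarrow> f (I, J) = (\<Sum>\<sigma> | \<sigma> permutes {..<D}. c \<sigma> * (if J = I \<circ> \<sigma> then 1 else 0))"
    using assms(2) by (auto simp: permspan_def)
  have "(\<Sum>B\<in>tens D. f (A, B) * b C B) = (\<Sum>B\<in>tens D. \<Sum>\<sigma> | \<sigma> permutes {..<D}. c \<sigma> * (if B = A \<circ> \<sigma> then b C B else 0))"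
  proof (rule sum.cong[OF refl])
    fix B :: "nat \<Rightarrow> 'a" assume B: "B \<in> tens D"
    show "f (A, B) * b C B = (\<Sum>\<sigma> | \<sigma> permutes {..<D}. c \<sigma> * (if B = A \<circ> \<sigma> then b C B else 0))"
      unfolding c[OF assms(3) B] sum_distrib_right by (rule sum.cong) simp_all
  qed
  also have "\<dots> = (\<Sum>\<sigma> | \<sigma> permutes {..<D}. c \<sigma> * b C (A \<circ> \<sigma>))"
  proof (subst sum.swap, rule sum.cong[OF refl])
    fix \<sigma> assume "\<sigma> \<in> {\<sigma>. \<sigma> permutes {..<D}}"
    then have "A \<circ> \<sigma> \<in> tens D" using tens_comp assms(3) by blast
    then show "(\<Sum>B\<in>tens D. c \<sigma> * (if B = A \<circ> \<sigma> then b C B else 0)) = c \<sigma> * b C (A \<circ> \<sigma>)"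
      by (simp flip: sum_distrib_left)
  qed
  also have "\<dots> = (\<Sum>\<sigma> | \<sigma> permutes {..<D}. \<Sum>I\<in>tens D. c \<sigma> * (if C = I \<circ> \<sigma> then b I A else 0))"
  proof (rule sum.cong[OF refl])
    fix \<sigma> assume "\<sigma> \<in> {\<sigma>. \<sigma> permutes {..<D}}"
    then have s: "\<sigma> permutes {..<D}" by simp
    let ?C = "C \<circ> inv_into UNIV \<sigma>"
    have C: "?C \<in> tens D" by (intro tens_comp assms permutes_inv s)
    have CC: "?C \<circ> \<sigma> = C" using permutes_inv_o[OF s] by (simp add: comp_assoc)
    have "C = I \<circ> \<sigma> \<longleftrightarrow> I = ?C" for I
      using CC permutes_inv_o[OF s] by (metis comp_assoc comp_id)
    moreover have "b C (A \<circ> \<sigma>) = b ?C A"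
      using assms(1) s C assms(3) CC by (metis symtens_def)
    ultimately show "c \<sigma> * b C (A \<circ> \<sigma>) = (\<Sum>I\<in>tens D. c \<sigma> * (if C = I \<circ> \<sigma> then b I A else 0))"
      using C by (simp flip: sum_distrib_left)
  qed
  also have "\<dots> = (\<Sum>I\<in>tens D. \<Sum>\<sigma> | \<sigma> permutes {..<D}. c \<sigma> * (if C = I \<circ> \<sigma> then b I A else 0))"
    by (rule sum.swap)
  also have "\<dots> = (\<Sum>I\<in>tens D. f (I, C) * b I A)"
  proof (rule sum.cong[OF refl])
    fix I :: "nat \<Rightarrow> 'a" assume I: "I \<in> tens D"
    show "(\<Sum>\<sigma> | \<sigma> permutes {..<D}. c \<sigma> * (if C = I \<circ> \<sigma> then b I A else 0)) = f (I, C) * b I A"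
      unfolding c[OF I assms(4)] sum_distrib_right by (rule sum.cong) simp_all
  qed
  finally show ?thesis .
qed

text \<open>Let U be the part of T orthogonal to the span of the permutations and q (K, L) the
  projection of the matrix unit at (K, L) onto that span. By equivariance q is symmetric in suitable
  indices, so U commutes with it; summing over a diagonal then expresses every entry of U as a
  scalar product of U with some q, which is 0.\<close>

theorem double_commutant:
  fixes T :: "(nat \<Rightarrow> 'n::finite) \<times> (nat \<Rightarrow> 'n) \<Rightarrow> complex"
  assumes comm: "\<And>b A C. symtens D b \<Longrightarrow> A \<in> tens D \<Longrightarrow> C \<in> tens D \<Longrightarrow>
      (\<Sum>B\<in>tens D. T (A, B) * b C B) = (\<Sum>I\<in>tens D. T (I, C) * b I A)"
  shows "T \<in> permspan D"
proof -
  let ?S = "tens D \<times> tens D :: ((nat \<Rightarrow> 'n) \<times> (nat \<Rightarrow> 'n)) set"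
  have fin: "finite ?S" by simp
  note proj = orthogonal_projection[OF fin permspan_0 permspan_add permspan_scale]
  obtain a where a: "a \<in> permspan D" "\<forall>h\<in>permspan D. (\<Sum>s\<in>?S. (T s - a s) * cnj (h s)) = 0"
    using proj by blast
  define U where "U s = T s - a s" for s
  have U: "(\<Sum>B\<in>tens D. U (A, B) * b C B) = (\<Sum>I\<in>tens D. U (I, C) * b I A)"
    if "symtens D b" "A \<in> tens D" "C \<in> tens D" for b A C
    using comm[OF that] permspan_commutes[OF that(1) a(1) that(2,3)]
    by (simp add: U_def left_diff_distrib sum_subtractf)
  have U_orth: "(\<Sum>s\<in>?S. U s * h s) = 0" if "h \<in> permspan D" for h
    using bspec[OF a(2) permspan_cnj[OF that]] by (simp add: U_def)
  let ?e = "\<lambda>K L (I, J). if I = K \<and> J = L then 1 else 0 :: complex"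
  have "\<forall>KL. \<exists>k. k \<in> permspan D \<and> (\<forall>h\<in>permspan D. (\<Sum>s\<in>?S. (?e (fst KL) (snd KL) s - k s) * cnj (h s)) = 0)"
    using proj by blast
  from choice[OF this] obtain q where
    "\<forall>KL. q KL \<in> permspan D \<and> (\<forall>h\<in>permspan D. (\<Sum>s\<in>?S. (?e (fst KL) (snd KL) s - q KL s) * cnj (h s)) = 0)"
    by (rule exE)
  then have q: "\<And>KL. q KL \<in> permspan D"
    "\<And>KL h. h \<in> permspan D \<Longrightarrow> (\<Sum>s\<in>?S. (?e (fst KL) (snd KL) s - q KL s) * cnj (h s)) = 0"
    by blast+
  have uniq: "x s = y s" if "x \<in> permspan D" "y \<in> permspan D" "s \<in> ?S"
      "\<And>h. h \<in> permspan D \<Longrightarrow> (\<Sum>s\<in>?S. (g s - x s) * cnj (h s)) = 0"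
      "\<And>h. h \<in> permspan D \<Longrightarrow> (\<Sum>s\<in>?S. (g s - y s) * cnj (h s)) = 0" for x y g s
  proof -
    let ?d = "\<lambda>s. y s + - 1 * x s"
    have d: "?d \<in> permspan D" by (intro permspan_add permspan_scale that)
    have "(\<Sum>s\<in>?S. ?d s * cnj (?d s)) = (\<Sum>s\<in>?S. (g s - x s) * cnj (?d s)) - (\<Sum>s\<in>?S. (g s - y s) * cnj (?d s))"
      by (simp add: sum_subtractf[symmetric] left_diff_distrib algebra_simps)
    also have "\<dots> = 0" using that(4,5)[OF d] by simp
    finally show ?thesis using ip_self_zero[OF fin _ that(3), of ?d] by simp
  qed
  \<comment> \<open>By uniqueness of projections: relabelling rows by \<sigma> preserves the span
    and carries one matrix unit to another.\<close>
  have sym: "symtens D (\<lambda>I K. q (K, L) (I, J))" if LJ: "L \<in> tens D" "J \<in> tens D" for L J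
    unfolding symtens_def
  proof (intro allI impI)
    fix \<sigma> and I K :: "nat \<Rightarrow> 'n" assume s: "\<sigma> permutes {..<D}" and IK: "I \<in> tens D" "K \<in> tens D"
    let ?q = "\<lambda>(I, J). q (K \<circ> \<sigma>, L) (I \<circ> \<sigma>, J)"
    define \<tau> where "\<tau> = inv_into UNIV \<sigma>"
    have t: "\<tau> permutes {..<D}" unfolding \<tau>_def by (rule permutes_inv[OF s])
    have st: "(I \<circ> \<sigma>) \<circ> \<tau> = I" "(I \<circ> \<tau>) \<circ> \<sigma> = I" for I :: "nat \<Rightarrow> 'n"
      using permutes_inv_o[OF s] by (simp_all add: \<tau>_def comp_assoc)
    have in_tens: "I \<circ> \<sigma> \<in> tens D" "I \<circ> \<tau> \<in> tens D" if "I \<in> tens D" for I :: "nat \<Rightarrow> 'n"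
      using tens_comp[OF that s] tens_comp[OF that t] .
    have bij: "bij_betw (\<lambda>(I, J). (I \<circ> \<sigma>, J)) ?S ?S"
      by (rule bij_betwI[of _ _ _ "\<lambda>(I, J). (I \<circ> \<tau>, J)"]; clarsimp simp: st in_tens simp del: comp_apply)
    have "?q (I, J) = q (K, L) (I, J)"
    proof (rule uniq[of _ _ _ "?e K L"])
      show "?q \<in> permspan D" using permspan_shift[OF q(1) s] .
      fix h :: "(nat \<Rightarrow> 'n) \<times> (nat \<Rightarrow> 'n) \<Rightarrow> complex" assume h: "h \<in> permspan D"
      let ?h = "\<lambda>(I, J). h (I \<circ> \<tau>, J)"
      have h': "?h \<in> permspan D" using permspan_shift[OF h t] .
      have iK: "I \<circ> \<sigma> = K \<circ> \<sigma> \<longleftrightarrow> I = K" for I by (metis st(1))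
      have "(\<Sum>s\<in>?S. (?e K L s - ?q s) * cnj (h s)) =
          (\<Sum>s\<in>?S. (\<lambda>s. (?e (K \<circ> \<sigma>) L s - q (K \<circ> \<sigma>, L) s) * cnj (?h s)) ((\<lambda>(I, J). (I \<circ> \<sigma>, J)) s))"
        by (intro sum.cong refl) (simp add: split_beta st iK)
      also have "\<dots> = (\<Sum>s\<in>?S. (?e (K \<circ> \<sigma>) L s - q (K \<circ> \<sigma>, L) s) * cnj (?h s))"
        by (rule sum.reindex_bij_betw[OF bij])
      also have "\<dots> = 0" using q(2)[OF h', of "(K \<circ> \<sigma>, L)"] by simp
      finally show "(\<Sum>s\<in>?S. (?e K L s - ?q s) * cnj (h s)) = 0" .
    next
      show "(I, J) \<in> ?S" using IK LJ by simp
      show "(\<Sum>s\<in>?S. (?e K L s - q (K, L) s) * cnj (h s)) = 0" if "h \<in> permspan D" for h :: "(nat \<Rightarrow> 'n) \<times> (nat \<Rightarrow> 'n) \<Rightarrow> complex"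
        using q(2)[OF that, of "(K, L)"] by simp
    qed (rule q(1))
    then show "q (K \<circ> \<sigma>, L) (I \<circ> \<sigma>, J) = q (K, L) (I, J)" by simp
  qed
  \<comment> \<open>Obtained by pairing the projection with the identity operator, which lies in the
    span.\<close>
  have tr: "(\<Sum>J\<in>tens D. q (B, L) (J, J)) = (if B = L then 1 else 0)" if "B \<in> tens D" "L \<in> tens D" for B L
  proof -
    let ?i = "\<lambda>(I, J). if J = I then 1 else 0 :: complex"
    have diag: "(\<Sum>s\<in>?S. f s * cnj (?i s)) = (\<Sum>J\<in>tens D. f (J, J))" for f
      unfolding sum.cartesian_product' by (intro sum.cong refl) (simp add: if_distrib cong: if_cong)
    have "(\<Sum>s\<in>?S. (?e B L s - q (B, L) s) * cnj (?i s)) = 0" using q(2)[OF permspan_id, of "(B, L)"] by simp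
    then have "(\<Sum>J\<in>tens D. ?e B L (J, J) - q (B, L) (J, J)) = 0" unfolding diag .
    then have "(\<Sum>J\<in>tens D. q (B, L) (J, J)) = (\<Sum>J\<in>tens D. if J = B \<and> J = L then 1 else 0)"
      by (simp add: sum_subtractf)
    also have "\<dots> = (\<Sum>J\<in>tens D. if J = L then if B = L then 1 else 0 else 0)"
      by (rule sum.cong) auto
    also have "\<dots> = (if B = L then 1 else 0)" using that(2) by (simp only: sum.delta[OF finite_tens] if_True)
    finally show ?thesis .
  qed
  have U0: "U (A, L) = 0" if "A \<in> tens D" "L \<in> tens D" for A L
  proof -
    have "U (A, L) = (\<Sum>B\<in>tens D. U (A, B) * (\<Sum>J\<in>tens D. q (B, L) (J, J)))"
    proof -
      have "(\<Sum>B\<in>tens D. U (A, B) * (\<Sum>J\<in>tens D. q (B, L) (J, J))) = (\<Sum>B\<in>tens D. if B = L then U (A, B) else 0)"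
        by (rule sum.cong[OF refl]) (simp only: tr[OF _ that(2)], simp)
      then show ?thesis using that(2) by (simp only: sum.delta[OF finite_tens] if_True)
    qed
    also have "\<dots> = (\<Sum>J\<in>tens D. \<Sum>B\<in>tens D. U (A, B) * q (B, L) (J, J))"
      by (simp add: sum_distrib_left) (rule sum.swap)
    \<comment> \<open>Here the commutation of U with symmetric operators enters, applied to the
      operator given by q with L and J fixed.\<close>
    also have "\<dots> = (\<Sum>J\<in>tens D. \<Sum>I\<in>tens D. U (I, J) * q (A, L) (I, J))"
      by (rule sum.cong[OF refl], rule U[OF sym[OF that(2)] that(1)])
    also have "\<dots> = (\<Sum>s\<in>?S. U s * q (A, L) s)"
      unfolding sum.cartesian_product' by (rule sum.swap)
    also have "\<dots> = 0" by (rule U_orth[OF q(1)])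
    finally show ?thesis .
  qed
  then have "T (I, J) = a (I, J)" if "I \<in> tens D" "J \<in> tens D" for I J
    using that by (simp add: U_def)
  then show ?thesis using a(1) unfolding permspan_def by auto
qed

subsection \<open>Tensors commuting with the general linear group\<close>

text \<open>The exponent vector of a product of matrix entries; it remembers the pair of
  multi-indices up to a simultaneous permutation.\<close>

definition mon :: "nat \<Rightarrow> (nat \<Rightarrow> 'n) \<Rightarrow> (nat \<Rightarrow> 'n) \<Rightarrow> ('n \<times> 'n) \<Rightarrow>\<^sub>0 nat" where
  "mon D P Q = (\<Sum>k<D. Poly_Mapping.single (P k, Q k) 1)"

lemma mon_eq_imp_perm:
  assumes "mon D P Q = mon D P' Q'" "P \<in> tens D" "Q \<in> tens D" "P' \<in> tens D" "Q' \<in> tens D"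
  obtains \<sigma> where "\<sigma> permutes {..<D}" "P = P' \<circ> \<sigma>" "Q = Q' \<circ> \<sigma>"
proof -
  have c: "count (image_mset (\<lambda>k. (P k, Q k)) (mset_set {..<D})) e = lookup (mon D P Q) e" for P Q :: "nat \<Rightarrow> 'a" and e
    by (induction D) (auto simp: mon_def lookup_add lookup_single when_def lessThan_Suc)
  have "image_mset (\<lambda>k. (P k, Q k)) (mset_set {..<D}) = image_mset (\<lambda>k. (P' k, Q' k)) (mset_set {..<D})"
    by (rule multiset_eqI) (simp add: c assms(1))
  then obtain \<sigma> where s: "\<sigma> permutes {..<D}" "\<forall>x\<in>{..<D}. (P x, Q x) = (P' (\<sigma> x), Q' (\<sigma> x))"
    by (rule image_mset_eq_implies_permutes[rotated]) auto
  have "P = P' \<circ> \<sigma>" "Q = Q' \<circ> \<sigma>"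
    using s tens_comp[OF assms(4) s(1)] tens_comp[OF assms(5) s(1)] assms(2,3)
    by (auto intro!: PiE_ext[of _ "{..<D}" "\<lambda>_. UNIV"])
  then show thesis using that s(1) by blast
qed

lemma prod_var_mon: "(\<Prod>k<D. \<a> (P k, Q k)) = Poly_Mapping.single (mon D P Q) (1 :: complex)"
  by (induction D) (simp_all add: mon_def \<a>_def mult_single add.commute flip: single_one)

text \<open>Diagonal dominance: in a kernel vector, the entry of largest modulus would be at most
  half its own size.\<close>

lemma near_identity_invertible:
  fixes x :: "'n::finite \<times> 'n \<Rightarrow> complex"
  assumes "\<And>e. dist (x e) (if fst e = snd e then 1 else 0) < 1 / real (2 * CARD('n))"
  shows "invertible (\<chi> i j. x (i, j))"
proof -
  let ?A = "(\<chi> i j. x (i, j)) :: complex^'n^'n"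
  have "v = 0" if v: "?A *v v = 0" for v
  proof (rule ccontr)
    assume "v \<noteq> 0"
    obtain i where i: "\<And>j. cmod (v $ j) \<le> cmod (v $ i)"
    proof -
      have "Max (range (\<lambda>j. cmod (v $ j))) \<in> range (\<lambda>j. cmod (v $ j))" by (intro Max_in) auto
      then obtain i where "Max (range (\<lambda>j. cmod (v $ j))) = cmod (v $ i)" by (rule imageE)
      then show thesis using that Max_ge[of "range (\<lambda>j. cmod (v $ j))"] by (metis finite finite_imageI rangeI)
    qed
    have vi: "cmod (v $ i) > 0"
    proof (rule ccontr)
      assume "\<not> cmod (v $ i) > 0"
      then have "v $ j = 0" for j using i[of j] by (metis norm_le_zero_iff not_less order.trans)
      then show False using \<open>v \<noteq> 0\<close> by (simp add: vec_eq_iff)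
    qed
    let ?d = "\<lambda>j. x (i, j) - (if i = j then 1 else 0)"
    have "0 = (\<Sum>j\<in>UNIV. x (i, j) * v $ j)" using arg_cong[OF v, of "\<lambda>w. w $ i"] by (simp add: matrix_vector_mult_def)
    also have "\<dots> = (\<Sum>j\<in>UNIV. ?d j * v $ j) + v $ i"
      by (simp add: left_diff_distrib sum_subtractf if_distrib[of "\<lambda>u. u * _"] cong: if_cong)
    finally have "v $ i = - (\<Sum>j\<in>UNIV. ?d j * v $ j)" by (simp add: eq_neg_iff_add_eq_0 add.commute)
    then have "cmod (v $ i) \<le> (\<Sum>j\<in>UNIV. cmod (?d j * v $ j))" by (simp add: norm_sum)
    also have "\<dots> \<le> (\<Sum>j\<in>(UNIV :: 'n set). 1 / real (2 * CARD('n)) * cmod (v $ i))"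
    proof (rule sum_mono)
      fix j
      have "cmod (?d j) \<le> 1 / real (2 * CARD('n))" using assms[of "(i, j)"] by (simp add: dist_norm)
      then show "cmod (?d j * v $ j) \<le> 1 / real (2 * CARD('n)) * cmod (v $ i)"
        unfolding norm_mult by (intro mult_mono i) auto
    qed
    also have "\<dots> = cmod (v $ i) / 2" by simp
    finally show False using vi by simp
  qed
  then show ?thesis unfolding invertible_left_inverse matrix_left_invertible_ker by blast
qed

text \<open>The hypothesis on invertible g is a polynomial identity in the entries of g, so
  coefficients can be compared. A symmetric b is constant on the pairs sharing a monomial, hence the
  claim is a combination of these coefficient identities.\<close>

lemma commutes_symtens:
  fixes T :: "(nat \<Rightarrow> 'n::finite) \<times> (nat \<Rightarrow> 'n) \<Rightarrow> complex"
  assumes GL: "\<And>g A C. invertible (g :: complex^'n^'n) \<Longrightarrow> A \<in> tens D \<Longrightarrow> C \<in> tens D \<Longrightarrow>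
      (\<Sum>B\<in>tens D. T (A, B) * (\<Prod>k<D. g $ C k $ B k)) = (\<Sum>I\<in>tens D. T (I, C) * (\<Prod>k<D. g $ I k $ A k))"
    and b: "symtens D b" and AC: "A \<in> tens D" "C \<in> tens D"
  shows "(\<Sum>B\<in>tens D. T (A, B) * b C B) = (\<Sum>I\<in>tens D. T (I, C) * b I A)"
proof -
  define q where "q = (\<Sum>B\<in>tens D. cst (T (A, B)) * (\<Prod>k<D. \<a> (C k, B k))) -
      (\<Sum>I\<in>tens D. cst (T (I, C)) * (\<Prod>k<D. \<a> (I k, A k)))"
  have ev: "peval x q = (\<Sum>B\<in>tens D. T (A, B) * (\<Prod>k<D. x (C k, B k))) - (\<Sum>I\<in>tens D. T (I, C) * (\<Prod>k<D. x (I k, A k)))" for x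
    by (simp add: q_def peval_simps ring_map_prod[OF ring_map_poly_subst[OF ring_map_id]])
  have "q = 0"
  proof (rule peval_zero_on_box[where r = "1 / real (2 * CARD('n))" and ?x0.0 = "\<lambda>e. if fst e = snd e then 1 else 0"])
    fix x :: "'n \<times> 'n \<Rightarrow> complex"
    assume "\<And>e. dist (x e) (if fst e = snd e then 1 else 0) < 1 / real (2 * CARD('n))"
    then have "invertible ((\<chi> i j. x (i, j)) :: complex^'n^'n)" by (rule near_identity_invertible)
    from GL[OF this AC] show "peval x q = 0" by (simp add: ev)
  qed simp
  then have "lookup q m = 0" for m by simp
  then have z: "(\<Sum>B\<in>tens D. if mon D C B = m then T (A, B) else 0) = (\<Sum>I\<in>tens D. if mon D I A = m then T (I, C) else 0)" for m
    by (simp add: q_def prod_var_mon cst_def mult_single lookup_minus lookup_sum lookup_single when_def)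
  \<comment> \<open>The common value of b on the pairs with monomial m; that it does not depend on
    the choice is the symmetry of b.\<close>
  define \<beta> where "\<beta> m = (let (P, Q) = SOME (P, Q). P \<in> tens D \<and> Q \<in> tens D \<and> mon D P Q = m in b P Q)" for m
  have \<beta>: "\<beta> (mon D P Q) = b P Q" if PQ: "P \<in> tens D" "Q \<in> tens D" for P Q
  proof -
    let ?R = "SOME (P', Q'). P' \<in> tens D \<and> Q' \<in> tens D \<and> mon D P' Q' = mon D P Q"
    have "case ?R of (P', Q') \<Rightarrow> P' \<in> tens D \<and> Q' \<in> tens D \<and> mon D P' Q' = mon D P Q"
      by (rule someI[of _ "(P, Q)"]) (use PQ in auto)
    then obtain P' Q' where R: "?R = (P', Q')" "P' \<in> tens D" "Q' \<in> tens D" "mon D P' Q' = mon D P Q" by (cases ?R) auto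
    obtain \<sigma> where "\<sigma> permutes {..<D}" "P' = P \<circ> \<sigma>" "Q' = Q \<circ> \<sigma>"
      using mon_eq_imp_perm[OF R(4,2,3) PQ] .
    then have "b P' Q' = b P Q" using b PQ by (simp add: symtens_def)
    then show ?thesis by (simp add: \<beta>_def R(1))
  qed
  define M where "M = mon D C ` tens D \<union> (\<lambda>I. mon D I A) ` tens D"
  have fin: "finite M" by (simp add: M_def)
  have l: "(\<Sum>B\<in>tens D. T (A, B) * b C B) = (\<Sum>m\<in>M. \<beta> m * (\<Sum>B\<in>tens D. if mon D C B = m then T (A, B) else 0))"
  proof -
    have "(\<Sum>m\<in>M. \<beta> m * (\<Sum>B\<in>tens D. if mon D C B = m then T (A, B) else 0)) =
        (\<Sum>B\<in>tens D. \<Sum>m\<in>M. if m = mon D C B then \<beta> m * T (A, B) else 0)"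
      unfolding sum_distrib_left by (subst sum.swap) (intro sum.cong refl, auto)
    also have "\<dots> = (\<Sum>B\<in>tens D. T (A, B) * b C B)"
    proof (rule sum.cong[OF refl])
      fix B :: "nat \<Rightarrow> 'n" assume "B \<in> tens D"
      then show "(\<Sum>m\<in>M. if m = mon D C B then \<beta> m * T (A, B) else 0) = T (A, B) * b C B"
        using fin AC by (simp add: sum.delta M_def \<beta>)
    qed
    finally show ?thesis by simp
  qed
  have r: "(\<Sum>I\<in>tens D. T (I, C) * b I A) = (\<Sum>m\<in>M. \<beta> m * (\<Sum>I\<in>tens D. if mon D I A = m then T (I, C) else 0))"
  proof -
    have "(\<Sum>m\<in>M. \<beta> m * (\<Sum>I\<in>tens D. if mon D I A = m then T (I, C) else 0)) =
        (\<Sum>I\<in>tens D. \<Sum>m\<in>M. if m = mon D I A then \<beta> m * T (I, C) else 0)"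
      unfolding sum_distrib_left by (subst sum.swap) (intro sum.cong refl, auto)
    also have "\<dots> = (\<Sum>I\<in>tens D. T (I, C) * b I A)"
    proof (rule sum.cong[OF refl])
      fix I :: "nat \<Rightarrow> 'n" assume "I \<in> tens D"
      then show "(\<Sum>m\<in>M. if m = mon D I A then \<beta> m * T (I, C) else 0) = T (I, C) * b I A"
        using fin AC by (simp add: sum.delta M_def \<beta>)
    qed
    finally show ?thesis by simp
  qed
  show ?thesis unfolding l r z ..
qed


subsection \<open>The first fundamental theorem on conjugation-stable sets\<close>

text \<open>The letter \<^const>\<open>None\<close> stands for the identity matrix, so that polynomials of degree at most
  \<open>D\<close> are given by tensors of degree exactly \<open>D\<close>.\<close>

definition lmat :: "('n::finite) mpair \<Rightarrow> letter option \<Rightarrow> complex^'n^'n" where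
  "lmat z l = (case l of None \<Rightarrow> mat 1 | Some l \<Rightarrow> letter_mat z l)"

definition ent :: "('n::finite) mpair \<Rightarrow> letter option \<times> 'n \<times> 'n \<Rightarrow> complex" where
  "ent z e = lmat z (fst e) $ fst (snd e) $ snd (snd e)"

definition tfun :: "nat \<Rightarrow> ((nat \<Rightarrow> letter option \<times> 'n \<times> 'n) \<Rightarrow> complex) \<Rightarrow> ('n::finite) mpair \<Rightarrow> complex" where
  "tfun D T z = (\<Sum>L\<in>tens D. T L * (\<Prod>k<D. ent z (L k)))"

instantiation letter :: finite
begin
instance
proof
  have "(UNIV :: letter set) = {LX, LY}" using letter.exhaust by auto
  then show "finite (UNIV :: letter set)" by (metis finite.emptyI finite_insert)
qed
end

lemma monomial_as_product:
  assumes "mdeg (\<lambda>_. 1) m \<le> D"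
  shows "\<exists>L\<in>tens D. \<forall>z :: ('n::finite) mpair. ev z (Poly_Mapping.single m 1) = (\<Prod>k<D. ent z (L k))"
  using assms
proof (induction D arbitrary: m)
  case 0
  then have "m = 0" by (auto simp: mdeg_def in_keys_iff intro!: poly_mapping_eqI)
  then show ?case using peval_simps(1)[of "entry _" 1] by (auto simp: cst_def peval_simps)
next
  case (Suc D)
  have ext: "L(D := e) \<in> tens (Suc D)" if "L \<in> tens D" for L and e :: "letter option \<times> 'n \<times> 'n"
    using fun_upd_in_PiE that by (auto simp: lessThan_Suc PiE_def extensional_def)
  have prod: "(\<Prod>k<Suc D. ent z ((L(D := e)) k)) = (\<Prod>k<D. ent z (L k)) * ent z e" for z :: "'n mpair" and L e
    by (simp add: prod.lessThan_Suc cong: prod.cong_simp)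
  show ?case
  proof (cases "mdeg (\<lambda>_. 1) m \<le> D")
    case True
    then obtain L where L: "L \<in> tens D" "\<forall>z :: 'n mpair. ev z (Poly_Mapping.single m 1) = (\<Prod>k<D. ent z (L k))"
      using Suc.IH by blast
    \<comment> \<open>A diagonal entry of the identity matrix pads the product to the required
      degree.\<close>
    have "ent z (None, undefined, undefined) = 1" for z :: "'n mpair" by (simp add: ent_def lmat_def mat_nth)
    then show ?thesis using L ext[OF L(1)] prod by (intro bexI[of _ "L(D := (None, undefined, undefined))"]) auto
  next
    case False
    then have "keys m \<noteq> {}" by (auto simp: mdeg_def)
    then obtain i where i: "i \<in> keys m" by blast
    obtain L where L: "L \<in> tens D"
      "\<forall>z :: 'n mpair. ev z (Poly_Mapping.single (m - Poly_Mapping.single i 1) 1) = (\<Prod>k<D. ent z (L k))"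
      using Suc.IH[of "m - Poly_Mapping.single i 1"] mdeg_diff_single[OF i, of "\<lambda>_. 1"] Suc.prems by auto
    have "ev z (\<a> i) = ent z (Some (fst i), snd i)" for z :: "'n mpair"
      by (cases i) (simp add: ent_def lmat_def peval_simps entry_def)
    then show ?thesis using L ext[OF L(1)] prod
      by (intro bexI[of _ "L(D := (Some (fst i), snd i))"]) (auto simp: single_split_var[OF i] peval_simps mult.commute)
  qed
qed

lemma poly_as_tensor: "\<exists>D T. \<forall>z :: ('n::finite) mpair. ev z p = tfun D T z"
proof -
  define D where "D = (\<Sum>m\<in>keys p. mdeg (\<lambda>_. 1) m)"
  have "\<forall>m\<in>keys p. \<exists>L. L \<in> tens D \<and> (\<forall>z :: 'n mpair. ev z (Poly_Mapping.single m 1) = (\<Prod>k<D. ent z (L k)))"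
  proof
    fix m assume "m \<in> keys p"
    then have "mdeg (\<lambda>_. 1) m \<le> D" unfolding D_def by (intro member_le_sum) auto
    then show "\<exists>L. L \<in> tens D \<and> (\<forall>z :: 'n mpair. ev z (Poly_Mapping.single m 1) = (\<Prod>k<D. ent z (L k)))"
      using monomial_as_product by blast
  qed
  then obtain L where L: "\<forall>m\<in>keys p. L m \<in> tens D \<and> (\<forall>z :: 'n mpair. ev z (Poly_Mapping.single m 1) = (\<Prod>k<D. ent z (L m k)))"
    by (rule bchoice[THEN exE])
  then have L1: "ev z (Poly_Mapping.single m 1) = (\<Prod>k<D. ent z (L m k))" if "m \<in> keys p" for m and z :: "'n mpair"
    using that by blast
  define T where "T K = (\<Sum>m\<in>keys p. if K = L m then lookup p m else 0)" for K
  have "ev z p = tfun D T z" for z :: "'n mpair"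
  proof -
    have "ev z p = ev z (\<Sum>m\<in>keys p. cst (lookup p m) * Poly_Mapping.single m 1)"
      by (simp add: cst_def mult_single sum_monomials)
    also have "\<dots> = (\<Sum>m\<in>keys p. lookup p m * (\<Prod>k<D. ent z (L m k)))"
      by (simp add: peval_simps L1 cong: sum.cong)
    also have "\<dots> = (\<Sum>m\<in>keys p. \<Sum>K\<in>tens D. if K = L m then lookup p m * (\<Prod>k<D. ent z (K k)) else 0)"
      using L by (intro sum.cong refl) simp
    also have "\<dots> = (\<Sum>K\<in>tens D. \<Sum>m\<in>keys p. if K = L m then lookup p m * (\<Prod>k<D. ent z (K k)) else 0)"
      by (rule sum.swap)
    also have "\<dots> = tfun D T z"
      unfolding tfun_def T_def sum_distrib_right by (intro sum.cong refl) simp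
    finally show ?thesis .
  qed
  then show ?thesis by blast
qed

definition conj_coeff :: "complex^'n^'n \<Rightarrow> complex^'n^'n \<Rightarrow> letter option \<times> 'n \<times> 'n \<Rightarrow> letter option \<times> 'n \<times> 'n \<Rightarrow> complex" where
  "conj_coeff g h e e' = (if fst e = fst e' then g $ fst (snd e) $ fst (snd e') * h $ snd (snd e') $ snd (snd e) else 0)"

text \<open>The action on coefficient tensors dual to conjugating the matrices, with h as the
  inverse of g.\<close>

definition act :: "nat \<Rightarrow> complex^'n^'n \<Rightarrow> complex^'n^'n \<Rightarrow> ((nat \<Rightarrow> letter option \<times> 'n \<times> 'n) \<Rightarrow> complex) \<Rightarrow>
    (nat \<Rightarrow> letter option \<times> ('n::finite) \<times> 'n) \<Rightarrow> complex" where
  "act D g h T L' = (\<Sum>L\<in>tens D. T L * (\<Prod>k<D. conj_coeff g h (L k) (L' k)))"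

lemma ent_conj:
  assumes "g ** h = mat 1"
  shows "ent (g ** fst z ** h, g ** snd z ** h) e = (\<Sum>e'\<in>UNIV. conj_coeff g h e e' * ent z e')"
proof -
  obtain l i j where e: "e = (l, i, j)" by (cases e)
  have "lmat (g ** fst z ** h, g ** snd z ** h) l = g ** lmat z l ** h"
  proof (cases l)
    case (Some a)
    then show ?thesis by (cases a) (simp_all add: lmat_def)
  qed (simp add: lmat_def assms)
  then have "ent (g ** fst z ** h, g ** snd z ** h) e = (\<Sum>b\<in>UNIV. \<Sum>a\<in>UNIV. g $ i $ a * lmat z l $ a $ b * h $ b $ j)"
    by (simp add: ent_def e mm_nth sum_distrib_right)
  also have "\<dots> = (\<Sum>a\<in>UNIV. \<Sum>b\<in>UNIV. g $ i $ a * h $ b $ j * lmat z l $ a $ b)"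
    by (subst sum.swap) (simp add: mult_ac)
  also have "\<dots> = (\<Sum>l'\<in>UNIV. if l' = l then \<Sum>a\<in>UNIV. \<Sum>b\<in>UNIV. g $ i $ a * h $ b $ j * lmat z l' $ a $ b else 0)"
    by simp
  also have "\<dots> = (\<Sum>l'\<in>UNIV. \<Sum>a\<in>UNIV. \<Sum>b\<in>UNIV. conj_coeff g h e (l', a, b) * ent z (l', a, b))"
    by (intro sum.cong refl) (simp add: conj_coeff_def ent_def e)
  also have "\<dots> = (\<Sum>e'\<in>UNIV. conj_coeff g h e e' * ent z e')"
    by (simp add: sum.cartesian_product UNIV_Times_UNIV split_beta flip: UNIV_Times_UNIV)
  finally show ?thesis .
qed

lemma tfun_conj:
  assumes "g ** h = mat 1"
  shows "tfun D T (g ** fst z ** h, g ** snd z ** h) = tfun D (act D g h T) z"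
proof -
  have "tfun D T (g ** fst z ** h, g ** snd z ** h) =
      (\<Sum>L\<in>tens D. \<Sum>L'\<in>tens D. T L * ((\<Prod>k<D. conj_coeff g h (L k) (L' k)) * (\<Prod>k<D. ent z (L' k))))"
    by (simp add: tfun_def ent_conj[OF assms] prod_sum_PiE sum_distrib_left prod.distrib)
  also have "\<dots> = (\<Sum>L'\<in>tens D. \<Sum>L\<in>tens D. T L * ((\<Prod>k<D. conj_coeff g h (L k) (L' k)) * (\<Prod>k<D. ent z (L' k))))"
    by (rule sum.swap)
  also have "\<dots> = tfun D (act D g h T) z"
    unfolding tfun_def act_def sum_distrib_right by (simp only: mult.assoc)
  finally show ?thesis .
qed

definition adjoint :: "complex^'n^'n \<Rightarrow> complex^'n^('n::finite)" where
  "adjoint g = (\<chi> i j. cnj (g $ j $ i))"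

lemma adjoint_nth [simp]: "adjoint g $ i $ j = cnj (g $ j $ i)"
  by (simp add: adjoint_def)

lemma adjoint_inverse: "g ** h = mat 1 \<Longrightarrow> adjoint h ** adjoint g = mat 1"
  by (simp add: vec_eq_iff mm_nth mat_nth mult.commute flip: complex_cnj_mult cnj_sum)

text \<open>The general linear group is closed under conjugate transposes, which act as adjoints;
  this takes the place of averaging over the unitary group.\<close>

lemma act_adjoint:
  "(\<Sum>L\<in>tens D. act D g h T L * cnj (S L)) = (\<Sum>L\<in>tens D. T L * cnj (act D (adjoint g) (adjoint h) S L))"
proof -
  have "(\<Sum>L\<in>tens D. act D g h T L * cnj (S L)) =
      (\<Sum>L'\<in>tens D. \<Sum>L\<in>tens D. T L * (\<Prod>k<D. conj_coeff g h (L k) (L' k)) * cnj (S L'))"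
    by (simp add: act_def sum_distrib_right)
  also have "\<dots> = (\<Sum>L\<in>tens D. \<Sum>L'\<in>tens D. T L * (\<Prod>k<D. conj_coeff g h (L k) (L' k)) * cnj (S L'))"
    by (rule sum.swap)
  also have "\<dots> = (\<Sum>L\<in>tens D. T L * cnj (act D (adjoint g) (adjoint h) S L))"
  proof -
    have "conj_coeff g h e e' = cnj (conj_coeff (adjoint g) (adjoint h) e' e)" for e e'
      by (simp add: conj_coeff_def)
    then show ?thesis by (simp add: act_def sum_distrib_left mult_ac)
  qed
  finally show ?thesis .
qed


definition mk_tens :: "nat \<Rightarrow> (nat \<Rightarrow> 'a) \<Rightarrow> (nat \<Rightarrow> 'n) \<Rightarrow> (nat \<Rightarrow> 'n) \<Rightarrow> nat \<Rightarrow> 'a \<times> 'n \<times> 'n" where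
  "mk_tens D l I J = (\<lambda>k\<in>{..<D}. (l k, I k, J k))"

lemma mk_tens_in: "mk_tens D l I J \<in> tens D"
  by (simp add: mk_tens_def)

lemma sum_tens_triple:
  fixes F :: "(nat \<Rightarrow> 'a::finite \<times> 'b::finite \<times> 'b) \<Rightarrow> 'c::comm_monoid_add"
  shows "(\<Sum>L\<in>tens D. F L) = (\<Sum>l\<in>tens D. \<Sum>I\<in>tens D. \<Sum>J\<in>tens D. F (mk_tens D l I J))"
proof -
  have "(\<Sum>L\<in>tens D. F L) = (\<Sum>(l, I, J)\<in>tens D \<times> tens D \<times> tens D. F (mk_tens D l I J))"
  proof (rule sum.reindex_bij_witness[of _ "\<lambda>(l, I, J). mk_tens D l I J"
        "\<lambda>L. (\<lambda>k\<in>{..<D}. fst (L k), \<lambda>k\<in>{..<D}. fst (snd (L k)), \<lambda>k\<in>{..<D}. snd (snd (L k)))"])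
    fix L :: "nat \<Rightarrow> 'a \<times> 'b \<times> 'b" assume L: "L \<in> tens D"
    then show "(case (\<lambda>k\<in>{..<D}. fst (L k), \<lambda>k\<in>{..<D}. fst (snd (L k)), \<lambda>k\<in>{..<D}. snd (snd (L k))) of
        (l, I, J) \<Rightarrow> mk_tens D l I J) = L"
      by (auto simp: mk_tens_def fun_eq_iff PiE_def extensional_def)
    then show "(case (\<lambda>k\<in>{..<D}. fst (L k), \<lambda>k\<in>{..<D}. fst (snd (L k)), \<lambda>k\<in>{..<D}. snd (snd (L k))) of
        (l, I, J) \<Rightarrow> F (mk_tens D l I J)) = F L" by simp
  next
    fix x :: "(nat \<Rightarrow> 'a) \<times> (nat \<Rightarrow> 'b) \<times> (nat \<Rightarrow> 'b)" assume "x \<in> tens D \<times> tens D \<times> tens D"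
    then show "(\<lambda>k\<in>{..<D}. fst ((case x of (l, I, J) \<Rightarrow> mk_tens D l I J) k),
        \<lambda>k\<in>{..<D}. fst (snd ((case x of (l, I, J) \<Rightarrow> mk_tens D l I J) k)),
        \<lambda>k\<in>{..<D}. snd (snd ((case x of (l, I, J) \<Rightarrow> mk_tens D l I J) k))) = x"
      by (auto simp: mk_tens_def fun_eq_iff PiE_def extensional_def split: prod.splits)
  qed (auto simp: mk_tens_def)
  then show ?thesis by (simp add: sum.cartesian_product)
qed

lemma matrix_inv_eqI:
  fixes g h :: "complex^'n^'n"
  assumes "g ** h = mat 1" "h ** g = mat 1"
  shows "invertible g" "matrix_inv g = h"
proof -
  show "invertible g" using assms by (auto simp: invertible_def)
  have "g ** matrix_inv g = mat 1 \<and> matrix_inv g ** g = mat 1"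
    unfolding matrix_inv_def by (rule someI[of _ h]) (use assms in simp)
  then show "matrix_inv g = h" by (metis assms(2) matrix_mul_assoc matrix_mul_lid matrix_mul_rid)
qed

text \<open>A function invariant on V comes from a tensor that is invariant only modulo K, the
  tensors vanishing on V. The representative orthogonal to K is itself invariant, because K is
  stable under the group and its adjoints. The double commutant theorem writes it through
  permutations, and each of these gives products of traces of words.\<close>

theorem quotient_functions_talg:
  fixes V :: "('n::finite) mpair set"
  assumes stable: "\<And>g z. invertible g \<Longrightarrow> z \<in> V \<Longrightarrow> conj_pair g z \<in> V"
    and f: "f \<in> quotient_functions V"
  obtains q where "q \<in> talg" "f = (\<lambda>z\<in>V. ev z q)"
proof -
  obtain p where p: "f = (\<lambda>z\<in>V. ev z p)" and inv: "\<And>g z. z \<in> V \<Longrightarrow> invertible g \<Longrightarrow> f (conj_pair g z) = f z"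
    using f unfolding quotient_functions_def by auto
  obtain D T0 where T0: "\<And>z. ev z p = tfun D T0 z" using poly_as_tensor by metis
  define K where "K = {T. \<forall>z\<in>V. tfun D T z = 0}"
  have lin: "tfun D (\<lambda>L. S L + S' L) z = tfun D S z + tfun D S' z" "tfun D (\<lambda>L. c * S L) z = c * tfun D S z" for S S' c z
    by (simp_all add: tfun_def distrib_right sum.distrib sum_distrib_left mult.assoc)
  have K: "(\<lambda>_. 0) \<in> K" "\<And>f g. f \<in> K \<Longrightarrow> g \<in> K \<Longrightarrow> (\<lambda>s. f s + g s) \<in> K" "\<And>c f. f \<in> K \<Longrightarrow> (\<lambda>s. c * f s) \<in> K"
    unfolding K_def lin by (auto simp: tfun_def lin[unfolded tfun_def])
  obtain k where k: "k \<in> K" "\<forall>h\<in>K. (\<Sum>L\<in>tens D. (T0 L - k L) * cnj (h L)) = 0"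
    using orthogonal_projection[OF finite_tens K] by blast
  define T where "T L = T0 L + - 1 * k L" for L
  have Tf: "tfun D T z = f z" if "z \<in> V" for z
  proof -
    have "tfun D T z = tfun D T0 z + - 1 * tfun D k z"
      unfolding T_def[abs_def] lin ..
    then show ?thesis using k(1) that by (simp add: K_def p T0)
  qed
  have orth: "(\<Sum>L\<in>tens D. T L * cnj (h L)) = 0" if "h \<in> K" for h
    using k(2) that by (simp add: T_def)
  have conj: "(g ** fst z ** h, g ** snd z ** h) \<in> V" "f (g ** fst z ** h, g ** snd z ** h) = f z"
    if "g ** h = mat 1" "h ** g = mat 1" "z \<in> V" for g h z
    using stable[OF matrix_inv_eqI(1)[OF that(1,2)] that(3)] inv[OF that(3) matrix_inv_eqI(1)[OF that(1,2)]]
    by (simp_all add: conj_pair_def matrix_inv_eqI(2)[OF that(1,2)])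
  have actK: "act D g h S \<in> K" if "g ** h = mat 1" "h ** g = mat 1" "S \<in> K" for g h S
    unfolding K_def using conj[OF that(1,2)] that(3) by (simp add: K_def flip: tfun_conj[OF that(1)])
  \<comment> \<open>The difference lies in K, and it is orthogonal to K as well since the adjoint
    action preserves K.\<close>
  have fixT: "act D g h T L = T L" if gh: "g ** h = mat 1" "h ** g = mat 1" and L: "L \<in> tens D" for g h L
  proof -
    let ?d = "\<lambda>L. act D g h T L + - 1 * T L"
    have d: "?d \<in> K"
      unfolding K_def
    proof (intro CollectI ballI)
      fix z assume z: "z \<in> V"
      have "tfun D ?d z = tfun D (act D g h T) z + - 1 * tfun D T z" unfolding lin ..
      then show "tfun D ?d z = 0" using Tf[OF z] Tf[OF conj(1)[OF gh z]] conj(2)[OF gh z]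
        by (simp flip: tfun_conj[OF gh(1)])
    qed
    have "adjoint g ** adjoint h = mat 1" "adjoint h ** adjoint g = mat 1" using gh by (auto intro: adjoint_inverse)
    then have "(\<Sum>L\<in>tens D. act D g h T L * cnj (?d L)) = 0"
      unfolding act_adjoint by (intro orth actK d)
    moreover have "(\<Sum>L\<in>tens D. T L * cnj (?d L)) = 0" by (rule orth[OF d])
    moreover have "(\<Sum>L\<in>tens D. ?d L * cnj (?d L)) =
        (\<Sum>L\<in>tens D. act D g h T L * cnj (?d L)) - (\<Sum>L\<in>tens D. T L * cnj (?d L))"
      unfolding sum_subtractf[symmetric] by (intro sum.cong refl) (simp add: algebra_simps)
    ultimately have "(\<Sum>L\<in>tens D. ?d L * cnj (?d L)) = 0" by simp
    from ip_self_zero[OF finite_tens this L] show ?thesis by simp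
  qed
  \<comment> \<open>For a fixed sequence of letters the tensor is an operator on multi-indices, and
    invariance under conjugation becomes commutation with g.\<close>
  define \<tau> where "\<tau> l = (\<lambda>(I, J). T (mk_tens D l I J))" for l
  have "\<tau> l \<in> permspan D" if l: "l \<in> tens D" for l
  proof (rule double_commutant, rule commutes_symtens)
    fix g :: "complex^'n^'n" and A C :: "nat \<Rightarrow> 'n"
    assume "invertible g" and AC: "A \<in> tens D" "C \<in> tens D"
    then obtain h where gh: "g ** h = mat 1" "h ** g = mat 1" by (auto simp: invertible_def)
    have \<tau>: "\<tau> l (A, B) = (\<Sum>I\<in>tens D. \<Sum>J\<in>tens D. \<tau> l (I, J) * ((\<Prod>k<D. g $ I k $ A k) * (\<Prod>k<D. h $ B k $ J k)))" for B
    proof -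
      have "(\<Prod>k<D. conj_coeff g h (mk_tens D l' I J k) (mk_tens D l A B k)) =
          (if l' = l then (\<Prod>k<D. g $ I k $ A k) * (\<Prod>k<D. h $ B k $ J k) else 0)" if l': "l' \<in> tens D" for l' I J
      proof (cases "l' = l")
        case True
        then show ?thesis by (simp add: mk_tens_def conj_coeff_def flip: prod.distrib)
      next
        case False
        then obtain k where "k < D" "l' k \<noteq> l k" using PiE_ext[OF l' l] by auto
        then show ?thesis using False by (auto simp: mk_tens_def conj_coeff_def intro!: prod_zero bexI[of _ k])
      qed
      note c = this
      have "\<tau> l (A, B) = act D g h T (mk_tens D l A B)" by (simp add: \<tau>_def fixT[OF gh mk_tens_in])
      also have "\<dots> = (\<Sum>l'\<in>tens D. if l' = l then \<Sum>I\<in>tens D. \<Sum>J\<in>tens D. T (mk_tens D l' I J) *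
          ((\<Prod>k<D. g $ I k $ A k) * (\<Prod>k<D. h $ B k $ J k)) else 0)"
        unfolding act_def sum_tens_triple by (rule sum.cong[OF refl]) (simp add: c)
      finally show ?thesis using l by (simp add: \<tau>_def)
    qed
    have \<delta>: "(\<Sum>B\<in>tens D. (\<Prod>k<D. g $ C k $ B k) * (\<Prod>k<D. h $ B k $ J k)) = (if J = C then 1 else 0)" if J: "J \<in> tens D" for J
    proof -
      have "(\<Sum>B\<in>tens D. (\<Prod>k<D. g $ C k $ B k) * (\<Prod>k<D. h $ B k $ J k)) = (\<Prod>k<D. (g ** h) $ C k $ J k)"
        by (simp add: mm_nth prod_sum_PiE prod.distrib)
      also have "\<dots> = (\<Prod>k<D. if C k = J k then 1 else 0)" by (simp add: gh mat_nth)
      also have "\<dots> = (if J = C then 1 else 0)"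
      proof (cases "J = C")
        case False
        then obtain k where "k < D" "J k \<noteq> C k" using PiE_ext[OF J AC(2)] by auto
        then show ?thesis using False by (auto intro!: prod_zero bexI[of _ k])
      qed simp
      finally show ?thesis .
    qed
    have "(\<Sum>B\<in>tens D. \<tau> l (A, B) * (\<Prod>k<D. g $ C k $ B k)) =
        (\<Sum>B\<in>tens D. \<Sum>I\<in>tens D. \<Sum>J\<in>tens D. \<tau> l (I, J) * (\<Prod>k<D. g $ I k $ A k) *
          ((\<Prod>k<D. g $ C k $ B k) * (\<Prod>k<D. h $ B k $ J k)))"
      by (subst \<tau>) (simp add: sum_distrib_left sum_distrib_right mult_ac)
    also have "\<dots> = (\<Sum>I\<in>tens D. \<Sum>B\<in>tens D. \<Sum>J\<in>tens D. \<tau> l (I, J) * (\<Prod>k<D. g $ I k $ A k) *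
          ((\<Prod>k<D. g $ C k $ B k) * (\<Prod>k<D. h $ B k $ J k)))"
      by (rule sum.swap)
    also have "\<dots> = (\<Sum>I\<in>tens D. \<Sum>J\<in>tens D. \<Sum>B\<in>tens D. \<tau> l (I, J) * (\<Prod>k<D. g $ I k $ A k) *
          ((\<Prod>k<D. g $ C k $ B k) * (\<Prod>k<D. h $ B k $ J k)))"
      by (rule sum.cong[OF refl]) (rule sum.swap)
    also have "\<dots> = (\<Sum>I\<in>tens D. \<Sum>J\<in>tens D. if J = C then \<tau> l (I, J) * (\<Prod>k<D. g $ I k $ A k) else 0)"
      by (intro sum.cong refl) (simp only: sum_distrib_left[symmetric] \<delta>, simp)
    also have "\<dots> = (\<Sum>I\<in>tens D. \<tau> l (I, C) * (\<Prod>k<D. g $ I k $ A k))"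
      using AC by simp
    finally show "(\<Sum>B\<in>tens D. \<tau> l (A, B) * (\<Prod>k<D. g $ C k $ B k)) = (\<Sum>I\<in>tens D. \<tau> l (I, C) * (\<Prod>k<D. g $ I k $ A k))" .
  qed
  then have "\<forall>l\<in>tens D. \<exists>c. \<forall>I\<in>tens D. \<forall>J\<in>tens D. \<tau> l (I, J) = (\<Sum>\<sigma> | \<sigma> permutes {..<D}. c \<sigma> * (if J = I \<circ> \<sigma> then 1 else 0))"
    by (auto simp: permspan_def)
  then obtain c where c: "\<forall>l\<in>tens D. \<forall>I\<in>tens D. \<forall>J\<in>tens D. \<tau> l (I, J) = (\<Sum>\<sigma> | \<sigma> permutes {..<D}. c l \<sigma> * (if J = I \<circ> \<sigma> then 1 else 0))"
    by (rule bchoice[THEN exE])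
  \<comment> \<open>The letter standing for the identity matrix contributes the empty word.\<close>
  define u where "u l = (case l of None \<Rightarrow> [] | Some a \<Rightarrow> [a])" for l :: "letter option"
  define q :: "'n epoly" where "q = (\<Sum>l\<in>tens D. \<Sum>\<sigma> | \<sigma> permutes {..<D}. cst (c l \<sigma>) *
      (\<Sum>I\<in>tens D. \<Prod>k<D. wmat gmat (u (l k)) $ I k $ I (\<sigma> k)))"
  have "q \<in> talg" unfolding q_def
  proof (rule talg_sum, rule talg_sum, rule talg.mult[OF talg.cst])
    fix l :: "nat \<Rightarrow> letter option" and \<sigma> assume "\<sigma> \<in> {\<sigma>. \<sigma> permutes {..<D}}"
    then show "(\<Sum>I\<in>tens D. \<Prod>k<D. wmat gmat (u (l k)) $ I k $ I (\<sigma> k)) \<in> (talg :: 'n epoly set)"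
      using permutation_sum_talg[of "{..<D}" \<sigma> "\<lambda>k. u (l k)"] by simp
  qed
  moreover have "f = (\<lambda>z\<in>V. ev z q)"
  proof
    fix z
    show "f z = (\<lambda>z\<in>V. ev z q) z"
    proof (cases "z \<in> V")
      case True
      have u: "ev z (wmat gmat (u a) $ i $ j) = lmat z a $ i $ j" for a i j
      proof -
        have "mmap (ev z) (wmat gmat (u a)) = lmat z a"
          unfolding mmap_wmat[OF ring_map_ev] mmap_ev_gmat by (cases a) (simp_all add: u_def lmat_def)
        from arg_cong[OF this, of "\<lambda>M. M $ i $ j"] show ?thesis by simp
      qed
      have "f z = (\<Sum>l\<in>tens D. \<Sum>I\<in>tens D. \<Sum>J\<in>tens D. \<tau> l (I, J) * (\<Prod>k<D. lmat z (l k) $ I k $ J k))"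
        unfolding Tf[OF True, symmetric] tfun_def sum_tens_triple by (simp add: \<tau>_def mk_tens_def ent_def)
      also have "\<dots> = (\<Sum>l\<in>tens D. \<Sum>\<sigma> | \<sigma> permutes {..<D}. c l \<sigma> * (\<Sum>I\<in>tens D. \<Prod>k<D. lmat z (l k) $ I k $ I (\<sigma> k)))"
      proof (rule sum.cong[OF refl])
        fix l :: "nat \<Rightarrow> letter option" assume l: "l \<in> tens D"
        let ?P = "\<lambda>I J. \<Prod>k<D. lmat z (l k) $ I k $ J k"
        have "(\<Sum>J\<in>tens D. \<tau> l (I, J) * ?P I J) = (\<Sum>\<sigma> | \<sigma> permutes {..<D}. c l \<sigma> * ?P I (I \<circ> \<sigma>))" if I: "I \<in> tens D" for I
        proof -
          have "(\<Sum>J\<in>tens D. \<tau> l (I, J) * ?P I J) = (\<Sum>J\<in>tens D. \<Sum>\<sigma> | \<sigma> permutes {..<D}. if J = I \<circ> \<sigma> then c l \<sigma> * ?P I J else 0)"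
          proof (rule sum.cong[OF refl])
            fix J :: "nat \<Rightarrow> 'n" assume J: "J \<in> tens D"
            have "\<tau> l (I, J) = (\<Sum>\<sigma> | \<sigma> permutes {..<D}. c l \<sigma> * (if J = I \<circ> \<sigma> then 1 else 0))" using c l I J by blast
            then show "\<tau> l (I, J) * ?P I J = (\<Sum>\<sigma> | \<sigma> permutes {..<D}. if J = I \<circ> \<sigma> then c l \<sigma> * ?P I J else 0)"
              by (simp only: sum_distrib_right) (rule sum.cong, simp_all)
          qed
          also have "\<dots> = (\<Sum>\<sigma> | \<sigma> permutes {..<D}. \<Sum>J\<in>tens D. if J = I \<circ> \<sigma> then c l \<sigma> * ?P I J else 0)"
            by (rule sum.swap)
          also have "\<dots> = (\<Sum>\<sigma> | \<sigma> permutes {..<D}. c l \<sigma> * ?P I (I \<circ> \<sigma>))"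
          proof (rule sum.cong[OF refl])
            fix \<sigma> assume "\<sigma> \<in> {\<sigma>. \<sigma> permutes {..<D}}"
            then have "I \<circ> \<sigma> \<in> tens D" using tens_comp I by blast
            then show "(\<Sum>J\<in>tens D. if J = I \<circ> \<sigma> then c l \<sigma> * ?P I J else 0) = c l \<sigma> * ?P I (I \<circ> \<sigma>)"
              by (simp only: sum.delta[OF finite_tens] if_True)
          qed
          finally show ?thesis .
        qed
        then have "(\<Sum>I\<in>tens D. \<Sum>J\<in>tens D. \<tau> l (I, J) * ?P I J) = (\<Sum>I\<in>tens D. \<Sum>\<sigma> | \<sigma> permutes {..<D}. c l \<sigma> * ?P I (I \<circ> \<sigma>))"
          by (intro sum.cong refl)
        also have "\<dots> = (\<Sum>\<sigma> | \<sigma> permutes {..<D}. \<Sum>I\<in>tens D. c l \<sigma> * ?P I (I \<circ> \<sigma>))" by (rule sum.swap)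
        finally show "(\<Sum>I\<in>tens D. \<Sum>J\<in>tens D. \<tau> l (I, J) * ?P I J) =
            (\<Sum>\<sigma> | \<sigma> permutes {..<D}. c l \<sigma> * (\<Sum>I\<in>tens D. \<Prod>k<D. lmat z (l k) $ I k $ I (\<sigma> k)))"
          by (simp add: sum_distrib_left)
      qed
      also have "\<dots> = ev z q"
        by (simp add: q_def peval_simps ring_map_prod[OF ring_map_ev] u)
      finally show ?thesis using True by simp
    qed (simp add: p)
  qed
  ultimately show thesis by (rule that)
qed

section \<open>Reduction of words for almost commuting matrices\<close>

text \<open>Newton's identities express the characteristic polynomial by traces of powers; the
  factor 24 clears the denominators 2, 3, 4 and 8. With symbolic indices only one diagonal and one
  off-diagonal entry have to be expanded.\<close>

lemma cayley_hamilton_scalar: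
  fixes M :: "'i \<Rightarrow> 'i \<Rightarrow> 'r::comm_ring_1"
  assumes s: "\<And>f :: 'i \<Rightarrow> 'r. (\<Sum>k\<in>UNIV. f k) = f a + f b + f c + f d"
    and tr: "M d d = - (M a a + M b b + M c c)"
  defines "M2 \<equiv> \<lambda>i j. \<Sum>k\<in>UNIV. M i k * M k j"
  defines "M3 \<equiv> \<lambda>i j. \<Sum>k\<in>UNIV. M i k * M2 k j"
  defines "M4 \<equiv> \<lambda>i j. \<Sum>k\<in>UNIV. M i k * M3 k j"
  shows "24 * M4 a b = 12 * (\<Sum>k\<in>UNIV. M2 k k) * M2 a b + 8 * (\<Sum>k\<in>UNIV. M3 k k) * M a b"
    and "24 * M4 a a = 12 * (\<Sum>k\<in>UNIV. M2 k k) * M2 a a + 8 * (\<Sum>k\<in>UNIV. M3 k k) * M a a +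
      (6 * (\<Sum>k\<in>UNIV. M4 k k) - 3 * (\<Sum>k\<in>UNIV. M2 k k) * (\<Sum>k\<in>UNIV. M2 k k))"
  unfolding M4_def M3_def M2_def s tr by (simp_all add: algebra_simps)

lemma sum_4_perm:
  fixes f :: "4 \<Rightarrow> 'r::comm_monoid_add"
  assumes "distinct [a, b, c, d]"
  shows "(\<Sum>k\<in>UNIV. f k) = f a + f b + f c + f d"
proof -
  have "card {a, b, c, d} = 4" using assms by simp
  then have "{a, b, c, d} = UNIV" by (intro card_subset_eq) auto
  then have "(\<Sum>k\<in>UNIV. f k) = (\<Sum>k\<in>{a, b, c, d}. f k)" by simp
  then show ?thesis using assms by (simp add: add.assoc)
qed

theorem cayley_hamilton_4:
  fixes A :: "'r::comm_ring_1^4^4"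
  assumes "trace A = 0"
  shows "smat 24 (A ** (A ** (A ** A))) = smat (12 * trace (A ** A)) (A ** A) + smat (8 * trace (A ** (A ** A))) A
    + smat (6 * trace (A ** (A ** (A ** A))) - 3 * trace (A ** A) * trace (A ** A)) (mat 1)"
proof (rule mat_eqI)
  fix i j :: 4
  have tr: "A $ d $ d = - (A $ a $ a + A $ b $ b + A $ c $ c)" if "distinct [a, b, c, d]" for a b c d
    using assms sum_4_perm[OF that, of "\<lambda>k. A $ k $ k"] by (simp add: trace_def eq_neg_iff_add_eq_0 algebra_simps)
  have fresh: "\<exists>x. x \<notin> F" if "card F < 4" for F :: "4 set"
  proof (rule ccontr)
    assume "\<nexists>x. x \<notin> F"
    then have "F = UNIV" by auto
    then show False using that by simp
  qed
  note ch = cayley_hamilton_scalar[of _ _ _ _ "\<lambda>i j. A $ i $ j", folded mm_nth trace_def, OF sum_4_perm tr]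
  show "smat 24 (A ** (A ** (A ** A))) $ i $ j = (smat (12 * trace (A ** A)) (A ** A) + smat (8 * trace (A ** (A ** A))) A
    + smat (6 * trace (A ** (A ** (A ** A))) - 3 * trace (A ** A) * trace (A ** A)) (mat 1)) $ i $ j"
  proof (cases "i = j")
    case True
    obtain b where b: "b \<notin> {i}" using fresh[of "{i}"] by auto
    obtain c where c: "c \<notin> {i, b}" using fresh[of "{i, b}"] b by auto
    obtain d where d: "d \<notin> {i, b, c}" using fresh[of "{i, b, c}"] b c by auto
    have "distinct [i, b, c, d]" using b c d by auto
    then show ?thesis using ch(2)[of i b c d] True by (simp add: mat_nth)
  next
    case False
    obtain c where c: "c \<notin> {i, j}" using fresh[of "{i, j}"] False by auto
    obtain d where d: "d \<notin> {i, j, c}" using fresh[of "{i, j, c}"] c False by auto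
    have "distinct [i, j, c, d]" using False c d by auto
    then show ?thesis using ch(1)[of i j c d] False by (simp add: mat_nth)
  qed
qed

locale epoly_subalgebra =
  fixes S :: "('n::finite) epoly set"
  assumes S_cst: "cst c \<in> S" and S_add: "p \<in> S \<Longrightarrow> q \<in> S \<Longrightarrow> p + q \<in> S"
    and S_mult: "p \<in> S \<Longrightarrow> q \<in> S \<Longrightarrow> p * q \<in> S"
begin

lemma S_uminus: "p \<in> S \<Longrightarrow> - p \<in> S"
  using S_mult[OF S_cst[of "-1"]] by (simp add: cst_uminus)

lemma S_diff: "p \<in> S \<Longrightarrow> q \<in> S \<Longrightarrow> p - q \<in> S"
  using S_add[of p "- q"] S_uminus[of q] by simp

lemma S_diff_iff: "p - q \<in> S \<Longrightarrow> q \<in> S \<Longrightarrow> p \<in> S"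
  using S_add[of "p - q" q] by simp

lemma S_diff_sym: "p - q \<in> S \<Longrightarrow> q - p \<in> S"
  using S_uminus[of "p - q"] by simp

lemma S_diff_trans: "p - q \<in> S \<Longrightarrow> q - r \<in> S \<Longrightarrow> p - r \<in> S"
  using S_add[of "p - q" "q - r"] by simp

lemma S_sum: "(\<And>i. i \<in> A \<Longrightarrow> f i \<in> S) \<Longrightarrow> sum f A \<in> S"
  using S_cst[of 0] by (induction A rule: infinite_finite_induct) (auto intro: S_add)

lemma S_numeral: "numeral k \<in> S"
  by (metis S_cst cst_numeral)

lemma S_cancel: "cst c * p \<in> S \<Longrightarrow> c \<noteq> 0 \<Longrightarrow> p \<in> S"
  using S_mult[OF S_cst[of "1 / c"], of "cst c * p"] cst_inverse_cancel[of c p] by simp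

text \<open>Comparing t with 2 t removes the top coefficient and multiplies each other one by a
  nonzero difference of powers of 2.\<close>

lemma vandermonde:
  assumes "\<And>t. (\<Sum>b\<le>k. cst (t ^ b) * f b) \<in> S" "b \<le> k"
  shows "f b \<in> S"
  using assms
proof (induction k arbitrary: f b)
  case 0
  then show ?case by simp
next
  case (Suc k)
  let ?g = "\<lambda>b. cst (2 ^ b - 2 ^ Suc k) * f b"
  have "(\<Sum>b\<le>k. cst (t ^ b) * ?g b) \<in> S" for t
  proof -
    have "(\<Sum>b\<le>Suc k. cst ((2 * t) ^ b) * f b) - cst (2 ^ Suc k) * (\<Sum>b\<le>Suc k. cst (t ^ b) * f b) \<in> S"
      by (intro S_diff S_mult S_cst Suc.prems(1))
    also have "(\<Sum>b\<le>Suc k. cst ((2 * t) ^ b) * f b) - cst (2 ^ Suc k) * (\<Sum>b\<le>Suc k. cst (t ^ b) * f b) =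
        (\<Sum>b\<le>Suc k. cst (t ^ b) * ?g b)"
      unfolding sum_distrib_left sum_subtractf[symmetric]
      by (intro sum.cong refl) (simp only: power_mult_distrib cst_mult cst_diff algebra_simps)
    also have "\<dots> = (\<Sum>b\<le>k. cst (t ^ b) * ?g b)" by simp
    finally show ?thesis .
  qed
  note g = Suc.IH[OF this]
  have *: "f b \<in> S" if "b \<le> k" for b
  proof -
    have "(2 :: nat) ^ b < 2 ^ Suc k" using that by (intro power_strict_increasing) auto
    then have "(2 :: complex) ^ b - 2 ^ Suc k \<noteq> 0"
      using of_nat_eq_iff[of "2 ^ b" "2 ^ Suc k", where 'a = complex] by simp
    with g[OF that] show ?thesis using S_cancel by blast
  qed
  \<comment> \<open>At t = 1 the lower coefficients, already known to lie in S, are subtracted and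
    the top one remains.\<close>
  have "(\<Sum>b\<le>Suc k. cst (1 ^ b) * f b) - (\<Sum>b\<le>k. f b) \<in> S"
    by (intro S_diff Suc.prems(1) S_sum *) simp
  then have "f (Suc k) \<in> S" by simp
  then show ?case using * Suc.prems(2) by (cases "b = Suc k") auto
qed

definition ysort :: "letter list \<Rightarrow> letter list" where
  "ysort w = replicate (count_list w LX) LX @ replicate (count_list w LY) LY"

text \<open>Adjacent exchanges move every Y behind the letters X that follow it, and each exchange
  is harmless modulo S.\<close>

lemma sort_word:
  assumes swap: "\<And>u v. length u + length v + 2 = d \<Longrightarrow> x (u @ [LX, LY] @ v) - x (u @ [LY, LX] @ v) \<in> S"
    and "length w = d"
  shows "x w - x (ysort w) \<in> S"
proof -
  have 1: "x (u @ LY # replicate a LX @ v) - x (u @ replicate a LX @ LY # v) \<in> S" if "length u + a + length v + 1 = d" for u v a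
    using that
  proof (induction a arbitrary: u)
    case 0 then show ?case using S_cst[of 0] by simp
  next
    case (Suc a)
    have "x (u @ [LX, LY] @ replicate a LX @ v) - x (u @ [LY, LX] @ replicate a LX @ v) \<in> S"
      by (rule swap) (use Suc.prems in simp)
    then have A: "x (u @ LY # LX # replicate a LX @ v) - x (u @ LX # LY # replicate a LX @ v) \<in> S"
      using S_diff_sym by simp
    have B: "x (u @ LX # LY # replicate a LX @ v) - x (u @ LX # replicate a LX @ LY # v) \<in> S"
      using Suc.IH[of "u @ [LX]"] Suc.prems by simp
    show ?case using S_diff_trans[OF A B] by simp
  qed
  have "x (u @ w) - x (u @ ysort w) \<in> S" if "length u + length w = d" for u
    using that
  proof (induction w arbitrary: u)
    case Nil then show ?case using S_cst[of 0] by (simp add: ysort_def)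
  next
    case (Cons l w)
    have *: "x ((u @ [l]) @ w) - x ((u @ [l]) @ ysort w) \<in> S" by (rule Cons.IH) (use Cons.prems in simp)
    have len: "count_list w LX + count_list w LY = length w"
    proof (induction w)
      case (Cons a w) then show ?case by (cases a) auto
    qed simp
    show ?case
    proof (cases l)
      case LX then show ?thesis using * by (simp add: ysort_def)
    next
      case LY
      have "x (u @ LY # replicate (count_list w LX) LX @ replicate (count_list w LY) LY) -
          x (u @ replicate (count_list w LX) LX @ LY # replicate (count_list w LY) LY) \<in> S"
        by (rule 1) (use Cons.prems len in simp)
      moreover have "x (u @ l # w) - x (u @ LY # replicate (count_list w LX) LX @ replicate (count_list w LY) LY) \<in> S"
        using * LY by (simp add: ysort_def)
      ultimately show ?thesis using S_diff_trans LY by (simp add: ysort_def)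
    qed
  qed
  from this[of "[]"] assms(2) show ?thesis by simp
qed

lemma words_finite: "finite {w :: letter list. length w = k}"
  using finite_lists_length_eq[of "UNIV :: letter set" k] by simp

text \<open>Words with equally many letters Y agree modulo S, and comparing powers of t puts their
  sum into S; dividing by their number gives each single word.\<close>

lemma canonical_from_sums:
  assumes swap: "\<And>u v. length u + length v + 2 = d \<Longrightarrow> x (u @ [LX, LY] @ v) - x (u @ [LY, LX] @ v) \<in> S"
    and sums: "\<And>t. (\<Sum>w | length w = d. cst (t ^ count_list w LY) * x w) \<in> S"
    and w: "length w = d"
  shows "x w \<in> S"
proof -
  define W where "W b = {w. length w = d \<and> count_list w LY = b}" for b
  have fin: "finite (W b)" for b unfolding W_def by (rule finite_subset[OF _ words_finite[of d]]) auto
  let ?b = "count_list w LY"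
  have le: "count_list w LY \<le> d" if "length w = d" for w using count_le_length[of w LY] that by simp
  have "(\<Sum>b\<le>d. cst (t ^ b) * (\<Sum>w\<in>W b. x w)) = (\<Sum>w | length w = d. cst (t ^ count_list w LY) * x w)" for t
  proof -
    have "(\<Sum>b\<le>d. cst (t ^ b) * (\<Sum>w\<in>W b. x w)) = (\<Sum>b\<le>d. \<Sum>w\<in>{w \<in> {w. length w = d}. count_list w LY = b}. cst (t ^ count_list w LY) * x w)"
      by (intro sum.cong refl) (auto simp: W_def sum_distrib_left intro!: sum.cong)
    also have "\<dots> = (\<Sum>w | length w = d. cst (t ^ count_list w LY) * x w)"
      by (rule sum.group[OF words_finite]) (auto intro: count_le_length)
    finally show ?thesis .
  qed
  then have "(\<Sum>b\<le>d. cst (t ^ b) * (\<Sum>w\<in>W b. x w)) \<in> S" for t using sums[of t] by simp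
  then have f: "(\<Sum>v\<in>W ?b. x v) \<in> S" by (rule vandermonde) (use le w in auto)
  have len: "count_list w LX + count_list w LY = length w" for w
  proof (induction w)
    case (Cons a w) then show ?case by (cases a) auto
  qed simp
  have same: "x v - x w \<in> S" if "v \<in> W ?b" for v
  proof -
    have "length v = d" "count_list v LY = ?b" using that by (auto simp: W_def)
    then have "ysort v = ysort w" using len[of v] len[of w] w by (simp add: ysort_def)
    then show ?thesis
      using sort_word[of d x v, OF swap \<open>length v = d\<close>] S_diff_sym[OF sort_word[of d x w, OF swap w]] S_diff_trans by metis
  qed
  have "(\<Sum>v\<in>W ?b. x v) - (\<Sum>v\<in>W ?b. x v - x w) \<in> S" by (intro S_diff f S_sum same)
  then have "cst (of_nat (card (W ?b))) * x w \<in> S" by (simp add: sum_subtractf cst_of_nat)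
  moreover have "w \<in> W ?b" using w by (simp add: W_def)
  then have "card (W ?b) \<noteq> 0" using fin by auto
  ultimately show ?thesis using S_cancel by simp
qed

end

primrec zpow :: "'r::comm_ring_1^'n^'n \<Rightarrow> nat \<Rightarrow> 'r^'n^'n" where
  "zpow Z 0 = mat 1"
| "zpow Z (Suc k) = Z ** zpow Z k"

lemma zpow_add: "zpow Z (k + m) = zpow Z k ** zpow Z m"
  by (induction k) (auto simp: matrix_mul_assoc)

lemma zpow_commute: "zpow Z k ** Z = Z ** zpow Z k"
  using zpow_add[of Z k 1] zpow_add[of Z 1 k] by (simp add: add.commute)

lemma sum_lists_Suc:
  "(\<Sum>w | length w = Suc k. f w) = (\<Sum>w | length w = k. f (LX # w)) + (\<Sum>w | length w = k. f (LY # w))"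
proof -
  have eq: "{w :: letter list. length w = Suc k} = (#) LX ` {w. length w = k} \<union> (#) LY ` {w. length w = k}"
  proof (intro equalityI subsetI)
    fix w :: "letter list" assume "w \<in> {w. length w = Suc k}"
    then obtain l v where "w = l # v" "length v = k" by (cases w) auto
    then show "w \<in> (#) LX ` {w. length w = k} \<union> (#) LY ` {w. length w = k}" by (cases l) auto
  qed auto
  have fin: "finite {w :: letter list. length w = k}"
    using finite_lists_length_eq[of "UNIV :: letter set" k] by simp
  show ?thesis unfolding eq by (subst sum.union_disjoint) (auto simp: fin sum.reindex)
qed

text \<open>The noncommutative binomial expansion, graded by the number of letters Y.\<close>

lemma trace_zpow_expand:
  fixes A :: "letter \<Rightarrow> (('n::finite) epoly)^'n^'n"
  shows "trace (M ** zpow (A LX + smat (cst t) (A LY)) k) = (\<Sum>w | length w = k. cst (t ^ count_list w LY) * trace (M ** wmat A w))"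
proof (induction k arbitrary: M)
  case 0
  then show ?case by simp
next
  case (Suc k)
  have "trace (M ** zpow (A LX + smat (cst t) (A LY)) (Suc k)) =
      trace ((M ** A LX) ** zpow (A LX + smat (cst t) (A LY)) k) + cst t * trace ((M ** A LY) ** zpow (A LX + smat (cst t) (A LY)) k)"
    by (simp add: matrix_mul_assoc matrix_add_ldistrib mm_rdistrib mm_smat trace_add trace_smat)
  then show ?case
    by (simp add: Suc.IH sum_lists_Suc matrix_mul_assoc cst_mult sum_distrib_left mult.assoc)
qed

definition vanish :: "('n::finite) mpair set \<Rightarrow> 'n epoly set" where
  "vanish V = {p. \<forall>z\<in>V. ev z p = 0}"

text \<open>The commutator Poisson-commutes with all invariants, so its relations vanish on \<open>V\<close> to first order
  in this sense.\<close>

definition vanish1 :: "('n::finite) mpair set \<Rightarrow> 'n epoly set" where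
  "vanish1 V = {p \<in> vanish V. \<forall>f\<in>talg. pb f p \<in> vanish V}"

lemma vanish_add: "p \<in> vanish V \<Longrightarrow> q \<in> vanish V \<Longrightarrow> p + q \<in> vanish V"
  and vanish_mult: "p \<in> vanish V \<Longrightarrow> f * p \<in> vanish V" and vanish_0: "0 \<in> vanish V"
  and vanish_uminus: "p \<in> vanish V \<Longrightarrow> - p \<in> vanish V" and vanish_diff: "p \<in> vanish V \<Longrightarrow> q \<in> vanish V \<Longrightarrow> p - q \<in> vanish V"
  by (simp_all add: vanish_def peval_simps)

lemma vanish1_0: "0 \<in> vanish1 V"
  by (simp add: vanish1_def vanish_0 derivation_0[OF derivation_pb])

lemma vanish1_add: "p \<in> vanish1 V \<Longrightarrow> q \<in> vanish1 V \<Longrightarrow> p + q \<in> vanish1 V"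
  by (simp add: vanish1_def vanish_add pb_add_right)

lemma vanish1_mult: "p \<in> vanish1 V \<Longrightarrow> f * p \<in> vanish1 V"
proof -
  assume p: "p \<in> vanish1 V"
  have "f * pb g p + pb g f * p \<in> vanish V" if "g \<in> talg" for g
    using p that vanish_mult[of "pb g p" V f] vanish_mult[of p V "pb g f"] by (auto simp: vanish1_def intro: vanish_add)
  then show ?thesis using p by (simp add: vanish1_def vanish_mult pb_mult_right)
qed

lemma vanish1_sum: "(\<And>i. i \<in> A \<Longrightarrow> f i \<in> vanish1 V) \<Longrightarrow> sum f A \<in> vanish1 V"
  by (induction A rule: infinite_finite_induct) (auto intro: vanish1_add vanish1_0)

lemma vanish1_conserved:
  assumes "p \<in> vanish V" "\<And>f. f \<in> talg \<Longrightarrow> pb f p = 0"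
  shows "p \<in> vanish1 V"
  using assms vanish_0 by (auto simp: vanish1_def)

section \<open>Generators and relations on a reducible variety\<close>

definition cmat :: "letter \<Rightarrow> (4 epoly)^4^4" where
  "cmat l = gmat l - smat (cst (1/4) * trace (gmat l)) (mat 1)"

definition gword :: "nat \<Rightarrow> letter list" where
  "gword i = replicate (xdeg i) LX @ replicate (ydeg i) LY"

definition gpoly :: "nat \<Rightarrow> 4 epoly" where
  "gpoly i = (if i = 1 then trace (gmat LX) else if i = 2 then trace (gmat LY) else tw cmat (gword i))"

abbreviation gsub :: "nat mpoly \<Rightarrow> 4 epoly" where
  "gsub \<equiv> poly_subst cst gpoly"

lemma trace_mat_1: "trace (mat 1 :: (4 epoly)^4^4) = 4"
  by (simp add: trace_I)

lemma trace_cmat: "trace (cmat l) = 0"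
proof -
  have "cst (1/4) * trace (gmat l) * 4 = cst (1/4 * 4) * trace (gmat l)"
    unfolding cst_mult cst_numeral by (simp only: mult_ac)
  also have "\<dots> = trace (gmat l)" by simp
  finally have "trace (gmat l) = cst (1/4) * trace (gmat l) * 4" by (rule sym)
  then show ?thesis unfolding cmat_def trace_sub trace_smat trace_mat_1 by (rule iffD1[OF eq_iff_diff_eq_0])
qed

lemma cmat_comm: "cmat LX ** cmat LY - cmat LY ** cmat LX = comm"
  by (simp add: cmat_def comm_def mm_diff_ldistrib mm_diff_rdistrib mm_smat smat_smat smat_diff mult.commute)

lemma trace_zpow_recurrence:
  fixes Z :: "'r::comm_ring_1^4^4"
  assumes "trace Z = 0"
  shows "24 * trace (zpow Z (Suc (Suc (Suc (Suc k))))) = 12 * trace (Z ** Z) * trace (zpow Z (k + 2)) + 8 * trace (Z ** (Z ** Z)) * trace (zpow Z (k + 1))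
    + (6 * trace (Z ** (Z ** (Z ** Z))) - 3 * trace (Z ** Z) * trace (Z ** Z)) * trace (zpow Z k)"
proof -
  have "smat 24 (zpow Z (Suc (Suc (Suc (Suc k))))) = smat 24 (Z ** (Z ** (Z ** Z))) ** zpow Z k"
    unfolding mm_smat by (simp add: matrix_mul_assoc)
  also have "\<dots> = smat (12 * trace (Z ** Z)) (zpow Z (k + 2)) + smat (8 * trace (Z ** (Z ** Z))) (zpow Z (k + 1))
    + smat (6 * trace (Z ** (Z ** (Z ** Z))) - 3 * trace (Z ** Z) * trace (Z ** Z)) (zpow Z k)"
    unfolding cayley_hamilton_4[OF assms] mm_rdistrib mm_smat by (simp add: matrix_mul_assoc)
  finally show ?thesis unfolding trace_smat[symmetric] trace_add[symmetric] by (rule arg_cong)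
qed

text \<open>The polynomials that reduce to the 14 generators. The remainder is taken in
  \<open>vanish1\<close> and not just in \<open>vanish\<close>, because \<open>tangent_talg\<close>
  has to bracket it with invariants.\<close>

definition redset :: "4 mpair set \<Rightarrow> 4 epoly set" where
  "redset V = {p. \<exists>P\<in>polys_in {1..14}. p - gsub P \<in> vanish1 V}"

lemma redset_subalgebra: "epoly_subalgebra (redset V)"
proof
  show "cst c \<in> redset V" for c
    unfolding redset_def by (intro CollectI bexI[of _ "cst c"]) (simp_all add: csubst_simps vanish1_0)
next
  fix p q assume "p \<in> redset V" "q \<in> redset V"
  then obtain P Q where PQ: "P \<in> polys_in {1..14}" "p - gsub P \<in> vanish1 V" "Q \<in> polys_in {1..14}" "q - gsub Q \<in> vanish1 V"
    by (auto simp: redset_def)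
  have e: "p + q - gsub (P + Q) = (p - gsub P) + (q - gsub Q)" by (simp add: csubst_simps)
  have "p + q - gsub (P + Q) \<in> vanish1 V" unfolding e by (intro vanish1_add PQ)
  then show "p + q \<in> redset V" unfolding redset_def using polys_in_add[OF PQ(1,3)] by blast
  have e: "p * q - gsub (P * Q) = q * (p - gsub P) + gsub P * (q - gsub Q)" by (simp add: csubst_simps algebra_simps)
  have "p * q - gsub (P * Q) \<in> vanish1 V" unfolding e by (intro vanish1_add vanish1_mult PQ)
  then show "p * q \<in> redset V" unfolding redset_def using polys_in_mult[OF PQ(1,3)] by blast
qed

lemma vanish1_redset: "p \<in> vanish1 V \<Longrightarrow> p \<in> redset V"
  unfolding redset_def by (intro CollectI bexI[of _ 0]) (simp_all add: csubst_simps)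

lemma gpoly_redset: "i \<in> {1..14} \<Longrightarrow> gpoly i \<in> redset V"
  unfolding redset_def by (intro CollectI bexI[of _ "\<a> i"]) (simp_all add: csubst_simps vanish1_0)

lemma gword_eqs: "gword 3 = [LX, LX]" "gword 4 = [LX, LY]" "gword 5 = [LY, LY]" "gword 6 = [LX, LX, LX]"
  "gword 7 = [LX, LX, LY]" "gword 8 = [LX, LY, LY]" "gword 9 = [LY, LY, LY]" "gword 10 = [LX, LX, LX, LX]"
  "gword 11 = [LX, LX, LX, LY]" "gword 12 = [LX, LX, LY, LY]" "gword 13 = [LX, LY, LY, LY]" "gword 14 = [LY, LY, LY, LY]"
  by (simp_all add: gword_def xdeg_def ydeg_def numeral_eq_Suc)

text \<open>Treats both varieties at once. The shears are, up to rescaling t, the Hamiltonian flows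
  of the traces of powers of X and of Y; the words only serve to write these powers. The minors say
  that the shifted commutator has rank at most 1. Translations by scalars are what separates a_1 and
  a_2 from the other generators.\<close>

locale reducible_variety =
  fixes V :: "4 mpair set" and \<epsilon> :: complex
  assumes conj_stable: "invertible g \<Longrightarrow> z \<in> V \<Longrightarrow> conj_pair g z \<in> V"
    and flow_X: "(X, Y) \<in> V \<Longrightarrow> (X, Y + smat t (wmat (\<lambda>_. X) (replicate k LX))) \<in> V"
    and flow_Y: "(X, Y) \<in> V \<Longrightarrow> (X + smat t (wmat (\<lambda>_. Y) (replicate k LX)), Y) \<in> V"
    and translate: "(X, Y) \<in> V \<Longrightarrow> (X + smat s (mat 1), Y + smat t (mat 1)) \<in> V"
    and comm_cases: "\<epsilon> = 0 \<and> (\<forall>i j. comm $ i $ j \<in> vanish V) \<or>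
      \<epsilon> = 1 \<and> (\<forall>i j k l. (comm + mat 1) $ i $ j * (comm + mat 1) $ k $ l - (comm + mat 1) $ k $ j * (comm + mat 1) $ i $ l \<in> vanish V)"
begin

sublocale S: epoly_subalgebra "redset V"
  by (rule redset_subalgebra)

abbreviation "t \<equiv> tw cmat"

text \<open>The trace of the word against the commutator shifted by \<epsilon>, a matrix of rank at
  most 1 on V.\<close>

definition q :: "letter list \<Rightarrow> 4 epoly" where
  "q w = trace (comm ** wmat cmat w) + cst \<epsilon> * t w"

text \<open>With Z = X + s Y the commutator equals [Z, Y], and its trace against a power of Z
  vanishes by cyclicity.\<close>

lemma trace_comm_zpow: "trace (comm ** zpow (cmat LX + smat (cst s) (cmat LY)) k) = 0"
proof -
  let ?Z = "cmat LX + smat (cst s) (cmat LY)"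
  have "comm = ?Z ** cmat LY - cmat LY ** ?Z"
    by (simp add: cmat_comm[symmetric] mm_rdistrib matrix_add_ldistrib mm_smat)
  then have "trace (comm ** zpow ?Z k) = trace ((?Z ** cmat LY - cmat LY ** ?Z) ** zpow ?Z k)" by (rule arg_cong)
  also have "\<dots> = trace (?Z ** (cmat LY ** zpow ?Z k)) - trace (cmat LY ** (?Z ** zpow ?Z k))"
    unfolding mm_diff_rdistrib trace_sub matrix_mul_assoc ..
  also have "trace (?Z ** (cmat LY ** zpow ?Z k)) = trace (cmat LY ** (zpow ?Z k ** ?Z))"
    unfolding trace_mul_sym[of ?Z] matrix_mul_assoc[symmetric] ..
  finally show ?thesis unfolding zpow_commute by simp
qed

lemma t_swap: "t (u @ [LX, LY] @ v) - t (u @ [LY, LX] @ v) = q (v @ u) - cst \<epsilon> * t (v @ u)"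
proof -
  have "t (u @ [LX, LY] @ v) - t (u @ [LY, LX] @ v) = trace (wmat cmat u ** comm ** wmat cmat v)"
    by (simp add: tw_def wmat_append matrix_mul_assoc trace_sub[symmetric] mm_diff_ldistrib mm_diff_rdistrib flip: cmat_comm)
  also have "\<dots> = trace (comm ** wmat cmat (v @ u))"
    using trace_mul_sym[of "wmat cmat u" "comm ** wmat cmat v"] by (simp add: wmat_append matrix_mul_assoc)
  finally show ?thesis by (simp add: q_def)
qed

lemma comm_redset: "\<epsilon> = 0 \<Longrightarrow> trace (comm ** M) \<in> vanish1 V"
  using comm_cases unfolding trace_def mm_nth
  by (intro vanish1_sum) (auto simp: mult.commute[of "comm $ _ $ _"] intro!: vanish1_mult vanish1_conserved pb_comm)

text \<open>For a matrix Q of the form c b^T both traces are the product of b^T A c and b^T B c;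
  here the equality is read off from the minors of Q.\<close>

lemma trace_rank_one:
  assumes "\<epsilon> = 1"
  shows "trace ((comm + mat 1) ** A ** (comm + mat 1) ** B) - trace ((comm + mat 1) ** A) * trace ((comm + mat 1) ** B) \<in> vanish1 V"
proof -
  let ?Q = "comm + mat 1 :: (4 epoly)^4^4"
  have pbQ: "pb f (?Q $ i $ j) = 0" if "f \<in> talg" for f i j
    using pb_comm[OF that] pb_cst(2)[of f 1] pb_cst(2)[of f 0] by (simp add: pb_add_right mat_nth)
  have minor: "?Q $ i $ j * ?Q $ k $ l - ?Q $ k $ j * ?Q $ i $ l \<in> vanish1 V" for i j k l
  proof (rule vanish1_conserved)
    show "?Q $ i $ j * ?Q $ k $ l - ?Q $ k $ j * ?Q $ i $ l \<in> vanish V" using comm_cases assms by auto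
    show "pb f (?Q $ i $ j * ?Q $ k $ l - ?Q $ k $ j * ?Q $ i $ l) = 0" if "f \<in> talg" for f
      using pbQ[OF that] by (simp add: derivation_diff[OF derivation_pb] pb_mult_right del: vector_add_component)
  qed
  have 1: "trace (Q ** A ** Q ** B) = (\<Sum>i\<in>UNIV. \<Sum>l\<in>UNIV. \<Sum>k\<in>UNIV. \<Sum>j\<in>UNIV. Q $ i $ j * A $ j $ k * Q $ k $ l * B $ l $ i)"
    for Q :: "(4 epoly)^4^4"
    unfolding trace_def mm_nth sum_distrib_right ..
  have 2: "trace (Q ** A) * trace (Q ** B) = (\<Sum>i\<in>UNIV. \<Sum>l\<in>UNIV. \<Sum>k\<in>UNIV. \<Sum>j\<in>UNIV. (Q $ i $ l * B $ l $ i) * (Q $ k $ j * A $ j $ k))"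
    for Q :: "(4 epoly)^4^4"
  proof -
    have "trace (Q ** A) * trace (Q ** B) = trace (Q ** B) * trace (Q ** A)" by (rule mult.commute)
    then show ?thesis unfolding trace_def mm_nth sum_distrib_right unfolding sum_distrib_left .
  qed
  have "trace (?Q ** A ** ?Q ** B) - trace (?Q ** A) * trace (?Q ** B) =
      (\<Sum>i\<in>UNIV. \<Sum>l\<in>UNIV. \<Sum>k\<in>UNIV. \<Sum>j\<in>UNIV. A $ j $ k * B $ l $ i * (?Q $ i $ j * ?Q $ k $ l - ?Q $ k $ j * ?Q $ i $ l))"
    unfolding 1 2 sum_subtractf[symmetric] by (intro sum.cong refl) (simp only: algebra_simps)
  also have "\<dots> \<in> vanish1 V" by (intro vanish1_sum vanish1_mult minor)
  finally show ?thesis .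
qed

text \<open>Exchanging letters inside q produces products of shorter q by the rank one identity. The
  sums over all words of one length reduce to sums of t, since the commutator contributes nothing
  against powers of X + s Y.\<close>

lemma q_redset:
  assumes "\<And>v. length v \<le> length u \<Longrightarrow> t v \<in> redset V"
  shows "q u \<in> redset V"
proof (cases "\<epsilon> = 0")
  case True
  have "cst \<epsilon> * t u = 0" by (subst True) simp
  then have "q u = trace (comm ** wmat cmat u)" unfolding q_def by simp
  then show ?thesis using comm_redset[OF True] vanish1_redset by metis
next
  case False
  then have e: "\<epsilon> = 1" using comm_cases by auto
  have q: "q w = trace ((comm + mat 1) ** wmat cmat w)" for w
    unfolding q_def by (simp add: e tw_def mm_rdistrib trace_add)
  show ?thesis
    using assms
  proof (induction "length u" arbitrary: u rule: less_induct)
    case less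
    have IH: "q w \<in> redset V" if "length w < length u" for w
      by (rule less.hyps[OF that]) (use that less.prems in auto)
    show ?case
    proof (rule S.canonical_from_sums[of "length u" q])
      fix u' v :: "letter list" assume l: "length u' + length v + 2 = length u"
      let ?Q = "comm + mat 1 :: (4 epoly)^4^4"
      have "q (u' @ [LX, LY] @ v) - q (u' @ [LY, LX] @ v) = trace (?Q ** wmat cmat u' ** comm ** wmat cmat v)"
        by (simp add: q wmat_append matrix_mul_assoc trace_sub[symmetric] mm_diff_ldistrib mm_diff_rdistrib flip: cmat_comm)
      also have "\<dots> = trace (?Q ** wmat cmat u' ** ?Q ** wmat cmat v) - q (u' @ v)"
        by (simp add: q wmat_append matrix_mul_assoc trace_sub[symmetric] matrix_add_ldistrib mm_rdistrib)
      also have "\<dots> = (trace (?Q ** wmat cmat u' ** ?Q ** wmat cmat v) - q u' * q v) + (q u' * q v - q (u' @ v))"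
        by simp
      also have "\<dots> \<in> redset V"
        unfolding q[of u'] q[of v] using l
        by (intro S.S_add[OF vanish1_redset S.S_diff] trace_rank_one e S.S_mult) (auto simp flip: q intro: IH)
      finally show "q (u' @ [LX, LY] @ v) - q (u' @ [LY, LX] @ v) \<in> redset V" .
    next
      fix s
      let ?Z = "cmat LX + smat (cst s) (cmat LY)"
      have "(\<Sum>w | length w = length u. cst (s ^ count_list w LY) * q w) = trace ((comm + mat 1) ** zpow ?Z (length u))"
        by (simp only: trace_zpow_expand q)
      also have "\<dots> = trace (mat 1 ** zpow ?Z (length u))" by (simp add: mm_rdistrib trace_add trace_comm_zpow)
      also have "\<dots> = (\<Sum>w | length w = length u. cst (s ^ count_list w LY) * t w)"
        by (simp only: trace_zpow_expand) (simp add: tw_def)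
      also have "\<dots> \<in> redset V" by (intro S.S_sum S.S_mult S.S_cst less.prems) simp
      finally show "(\<Sum>w | length w = length u. cst (s ^ count_list w LY) * q w) \<in> redset V" .
    qed simp
  qed
qed

text \<open>The Cayley-Hamilton recurrence for the pencil X + s Y lowers the length of all words of
  that length at once.\<close>

lemma trace_zpow_redset:
  assumes "\<And>w. length w < d \<Longrightarrow> t w \<in> redset V" "d \<ge> 5"
  shows "trace (zpow (cmat LX + smat (cst s) (cmat LY)) d) \<in> redset V"
proof -
  let ?Z = "cmat LX + smat (cst s) (cmat LY)"
  have Z: "trace (zpow ?Z k) \<in> redset V" if "k < d" for k
  proof -
    have "trace (zpow ?Z k) = (\<Sum>w | length w = k. cst (s ^ count_list w LY) * t w)"
      using trace_zpow_expand[of "mat 1" cmat s k] by (simp add: tw_def)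
    also have "\<dots> \<in> redset V" using assms(1) that by (intro S.S_sum S.S_mult S.S_cst) auto
    finally show ?thesis .
  qed
  define k where "k = d - 4"
  have k: "d = Suc (Suc (Suc (Suc k)))" "k \<ge> 1" using assms(2) by (simp_all add: k_def)
  have trZ: "trace ?Z = 0" by (simp add: trace_add trace_smat trace_cmat)
  have p: "trace (?Z ** ?Z) \<in> redset V" "trace (?Z ** (?Z ** ?Z)) \<in> redset V" "trace (?Z ** (?Z ** (?Z ** ?Z))) \<in> redset V"
    using Z[of 2] Z[of 3] Z[of 4] assms(2) by (simp_all add: eval_nat_numeral)
  have "12 * trace (?Z ** ?Z) * trace (zpow ?Z (k + 2)) + 8 * trace (?Z ** (?Z ** ?Z)) * trace (zpow ?Z (k + 1))
    + (6 * trace (?Z ** (?Z ** (?Z ** ?Z))) - 3 * trace (?Z ** ?Z) * trace (?Z ** ?Z)) * trace (zpow ?Z k) \<in> redset V"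
    by (intro S.S_add S.S_diff S.S_mult S.S_numeral p Z) (use k in auto)
  then have "cst 24 * trace (zpow ?Z d) \<in> redset V"
    unfolding cst_numeral k(1) trace_zpow_recurrence[OF trZ] .
  then show ?thesis by (rule S.S_cancel) simp
qed

text \<open>Words of length at least 5 are eliminated through powers of the pencil; shorter ones
  only have to be sorted.\<close>

theorem t_redset: "t w \<in> redset V"
proof (induction "length w" arbitrary: w rule: less_induct)
  case less
  let ?d = "length w"
  have swap: "t (u @ [LX, LY] @ v) - t (u @ [LY, LX] @ v) \<in> redset V" if "length u + length v + 2 = ?d" for u v
    unfolding t_swap by (intro S.S_diff S.S_mult S.S_cst q_redset less) (use that in auto)
  show ?case
  proof (cases "?d \<ge> 5")
    case True
    show ?thesis
    proof (rule S.canonical_from_sums[of ?d t, OF swap])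
      fix s
      have "(\<Sum>w' | length w' = ?d. cst (s ^ count_list w' LY) * t w') = trace (zpow (cmat LX + smat (cst s) (cmat LY)) ?d)"
        using trace_zpow_expand[of "mat 1" cmat s ?d] by (simp add: tw_def)
      also have "\<dots> \<in> redset V" by (rule trace_zpow_redset[OF less True])
      finally show "(\<Sum>w' | length w' = ?d. cst (s ^ count_list w' LY) * t w') \<in> redset V" .
    qed auto
  next
    case False
    have len: "count_list w LX + count_list w LY = length w"
    proof (induction w)
      case (Cons a w) then show ?case by (cases a) auto
    qed simp
    have "t (S.ysort w) \<in> redset V"
    proof -
      define a b where ab: "a = count_list w LX" "b = count_list w LY"
      have y: "S.ysort w = replicate a LX @ replicate b LY" by (simp add: S.ysort_def ab)
      have "a + b < 5" using len False ab by simp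
      have "a = 0 \<or> a = 1 \<or> a = 2 \<or> a = 3 \<or> a = 4" "b = 0 \<or> b = 1 \<or> b = 2 \<or> b = 3 \<or> b = 4"
        using \<open>a + b < 5\<close> by linarith+
      \<comment> \<open>Below length 5 there are only the empty word, the two single letters, whose
        traces are 0, and the words of a_3 to a_14.\<close>
      then have "a = 0 \<and> b = 0 \<or> a = 0 \<and> b = 1 \<or> a = 1 \<and> b = 0 \<or> (\<exists>i\<in>{3,4,5,6,7,8,9,10,11,12,13,14}. xdeg i = a \<and> ydeg i = b)"
        using \<open>a + b < 5\<close> by (elim disjE) (simp_all add: xdeg_def ydeg_def)
      then consider "a = 0" "b = 0" | "a = 0" "b = 1" | "a = 1" "b = 0" | i where "i \<in> {3,4,5,6,7,8,9,10,11,12,13,14}" "xdeg i = a" "ydeg i = b"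
        by blast
      then show ?thesis
      proof cases
        case 1 then show ?thesis using S.S_numeral by (simp add: y tw_def trace_mat_1)
      next
        case 2 then show ?thesis using S.S_cst[of 0] by (simp add: y tw_def trace_cmat)
      next
        case 3 then show ?thesis using S.S_cst[of 0] by (simp add: y tw_def trace_cmat)
      next
        case (4 i)
        then have "t (S.ysort w) = gpoly i" by (auto simp add: y gpoly_def gword_def)
        then show ?thesis using gpoly_redset[of i V] 4(1) by auto
      qed
    qed
    with S.sort_word[of ?d t w, OF swap] show ?thesis using S.S_diff_iff by blast
  qed
qed

text \<open>Letters are replaced one at a time by their traceless parts plus a scalar; the prefix u
  holds those already replaced.\<close>

theorem wpoly_redset: "wpoly w \<in> redset V"
proof -
  have "trace (wmat cmat u ** wmat gmat w) \<in> redset V" for u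
  proof (induction w arbitrary: u)
    case Nil
    then show ?case using t_redset[of u] by (simp add: tw_def)
  next
    case (Cons l w)
    let ?c = "cst (1/4) * trace (gmat l)"
    have g: "gmat l = cmat l + smat ?c (mat 1)" by (simp add: cmat_def)
    have "wmat cmat u ** wmat gmat (l # w) = wmat cmat u ** ((cmat l + smat ?c (mat 1)) ** wmat gmat w)"
      unfolding wmat_Cons by (subst g) rule
    also have "\<dots> = wmat cmat (u @ [l]) ** wmat gmat w + smat ?c (wmat cmat u ** wmat gmat w)"
      by (simp add: wmat_append matrix_mul_assoc matrix_add_ldistrib mm_rdistrib mm_smat)
    finally have "trace (wmat cmat u ** wmat gmat (l # w)) = trace (wmat cmat (u @ [l]) ** wmat gmat w) + ?c * trace (wmat cmat u ** wmat gmat w)"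
      by (simp only: trace_add trace_smat)
    moreover have "trace (gmat l) \<in> redset V"
      using gpoly_redset[of 1 V] gpoly_redset[of 2 V] by (cases l) (simp_all add: gpoly_def)
    ultimately show ?case using Cons by (simp add: S.S_add S.S_mult S.S_cst)
  qed
  from this[of "[]"] show ?thesis by (simp add: wpoly_def tw_def)
qed

lemma talg_redset: "p \<in> talg \<Longrightarrow> p \<in> redset V"
  by (induction rule: talg.induct) (auto intro: S.S_cst wpoly_redset S.S_add S.S_mult)

end

lemma wmat_replicate: "wmat A (replicate k l) = zpow (A l) k"
  by (induction k) auto

text \<open>Shifted factors are expanded one at a time into unshifted ones, which the auxiliary
  exponents a' and b' collect.\<close>

lemma (in epoly_subalgebra) trace_shifted_powers:
  assumes "\<And>a b. trace (zpow G a ** zpow H b) \<in> S" "c \<in> S" "d \<in> S"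
  shows "trace (zpow (G - smat c (mat 1)) a ** zpow (H - smat d (mat 1)) b) \<in> S"
proof -
  have 1: "trace (zpow (G - smat c (mat 1)) a ** (zpow G a' ** zpow H b')) \<in> S" for a a' b'
  proof (induction a arbitrary: a')
    case 0
    then show ?case using assms(1) by simp
  next
    case (Suc a)
    let ?C = "G - smat c (mat 1)"
    have "zpow ?C (Suc a) ** (zpow G a' ** zpow H b') = zpow ?C a ** ((G - smat c (mat 1)) ** (zpow G a' ** zpow H b'))"
      unfolding zpow.simps(2) zpow_commute[symmetric] by (simp only: matrix_mul_assoc)
    also have "\<dots> = zpow ?C a ** (zpow G (Suc a') ** zpow H b') - smat c (zpow ?C a ** (zpow G a' ** zpow H b'))"
      unfolding mm_diff_rdistrib mm_diff_ldistrib mm_smat by (simp add: matrix_mul_assoc)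
    finally have "trace (zpow ?C (Suc a) ** (zpow G a' ** zpow H b')) =
        trace (zpow ?C a ** (zpow G (Suc a') ** zpow H b')) - c * trace (zpow ?C a ** (zpow G a' ** zpow H b'))"
      by (simp only: trace_sub trace_smat)
    then show ?case using Suc assms(2) by (simp only: S_diff S_mult)
  qed
  have "trace (zpow (G - smat c (mat 1)) a ** (zpow (H - smat d (mat 1)) b ** zpow H b')) \<in> S" for b'
  proof (induction b arbitrary: b')
    case 0
    then show ?case using 1[of a 0] by simp
  next
    case (Suc b)
    let ?C = "zpow (G - smat c (mat 1)) a" and ?D = "H - smat d (mat 1)"
    have "zpow ?D (Suc b) ** zpow H b' = zpow ?D b ** ((H - smat d (mat 1)) ** zpow H b')"
      unfolding zpow.simps(2) zpow_commute[symmetric] by (simp only: matrix_mul_assoc)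
    also have "\<dots> = zpow ?D b ** zpow H (Suc b') - smat d (zpow ?D b ** zpow H b')"
      unfolding mm_diff_rdistrib mm_diff_ldistrib mm_smat by (simp add: matrix_mul_assoc)
    finally have "trace (?C ** (zpow ?D (Suc b) ** zpow H b')) =
        trace (?C ** (zpow ?D b ** zpow H (Suc b'))) - d * trace (?C ** (zpow ?D b ** zpow H b'))"
      by (simp only: trace_sub trace_smat mm_diff_ldistrib mm_smat)
    then show ?case using Suc assms(3) by (simp only: S_diff S_mult)
  qed
  from this[of 0] show ?thesis by simp
qed

lemma talg_subalgebra: "epoly_subalgebra talg"
  by unfold_locales (auto intro: talg.intros)

lemma gpoly_closed:
  assumes "epoly_subalgebra S" "\<And>a b. wpoly (replicate a LX @ replicate b LY) \<in> S"
  shows "gpoly i \<in> S"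
proof -
  interpret epoly_subalgebra S by fact
  have t: "trace (zpow (gmat LX) a ** zpow (gmat LY) b) \<in> S" for a b
    using assms(2)[of a b] by (simp add: wpoly_def tw_def wmat_append wmat_replicate)
  have g: "trace (gmat l) \<in> S" for l :: letter using t[of 1 0] t[of 0 1] by (cases l) simp_all
  have "tw cmat (gword i) = trace (zpow (gmat LX - smat (cst (1/4) * trace (gmat LX)) (mat 1)) (xdeg i) **
      zpow (gmat LY - smat (cst (1/4) * trace (gmat LY)) (mat 1)) (ydeg i))"
    by (simp add: tw_def gword_def wmat_append wmat_replicate cmat_def)
  also have "\<dots> \<in> S" by (intro trace_shifted_powers t S_mult S_cst g)
  finally show ?thesis using g by (simp add: gpoly_def)
qed

lemma gpoly_talg: "gpoly i \<in> talg"
  by (rule gpoly_closed[OF talg_subalgebra]) (rule talg.wpoly)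

lemma gsub_closed:
  assumes "epoly_subalgebra S" "\<And>i. gpoly i \<in> S"
  shows "gsub P \<in> S"
proof -
  interpret epoly_subalgebra S by fact
  show ?thesis
    by (induction P rule: mpoly_induct) (simp_all add: csubst_simps S_cst assms(2) S_add S_mult)
qed

lemma gsub_talg: "gsub P \<in> talg"
  by (rule gsub_closed[OF talg_subalgebra gpoly_talg])

lemma wrest_replicate: "k < Suc a \<Longrightarrow> wrest (replicate (Suc a) l) k = replicate a l"
  by (simp add: wrest_def replicate_add[symmetric] del: replicate.simps)

text \<open>This is why flows of traces of powers suffice: one bracket of them yields, up to a
  nonzero factor, the trace of every sorted word.\<close>

lemma pb_wpoly_powers:
  "pb (wpoly (replicate (Suc a) LX)) (wpoly (replicate (Suc b) LY)) =
    cst (of_nat (Suc a * Suc b)) * wpoly (replicate a LX @ replicate b LY)"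
proof -
  have "pb (wpoly (replicate (Suc a) LX)) (wpoly (replicate (Suc b) LY)) =
      (\<Sum>k<Suc a. \<Sum>m<Suc b. cst 1 * wpoly (replicate a LX @ replicate b LY))"
    unfolding pb_wpoly length_replicate
    by (intro sum.cong refl) (simp del: replicate.simps add: wrest_replicate)
  then show ?thesis by (simp add: cst_of_nat cst_mult cst_add algebra_simps)
qed

lemma grad_power:
  "grad l (wpoly (replicate k l')) = (if l = l' then smat (of_nat k) (wmat gmat (replicate (k - 1) l)) else 0)"
proof (cases "l = l'")
  case True
  have "(\<Sum>m | m < k \<and> replicate k l ! m = l. wmat gmat (wrest (replicate k l) m)) =
      (\<Sum>m<k. wmat gmat (replicate (k - 1) l) :: ('a epoly)^'a^'a)"
  proof (rule sum.cong)
    fix m assume "m \<in> {..<k}"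
    then show "wmat gmat (wrest (replicate k l) m) = wmat gmat (replicate (k - 1) l)"
      by (cases k) (simp_all add: wrest_replicate del: replicate.simps)
  qed auto
  also have "\<dots> = smat (of_nat k) (wmat gmat (replicate (k - 1) l))" 
    by (rule mat_eqI) (unfold sum_component smat_nth, unfold sum_constant card_lessThan, rule refl)
  finally show ?thesis using True by (simp add: grad_wpoly)
next
  case False
  then have e: "{m. m < k \<and> replicate k l' ! m = l} = {}" by auto
  show ?thesis unfolding grad_wpoly length_replicate e using False by simp
qed

lemma mmap_ev_wmat: "mmap (ev z) (wmat gmat w) = wmat (letter_mat z) w"
  by (simp add: mmap_wmat[OF ring_map_ev] mmap_ev_gmat)

lemma ev_grad_trace:
  "ev z (trace (grad l p ** M)) = (\<Sum>i\<in>UNIV. \<Sum>j\<in>UNIV. ev z (M $ i $ j) * ev z (pdiff (l, i, j) p))"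
proof -
  have "trace (grad l p ** M) = (\<Sum>i\<in>UNIV. \<Sum>j\<in>UNIV. M $ i $ j * pdiff (l, i, j) p)"
    unfolding trace_def mm_nth grad_def by (subst sum.swap) (simp add: mult.commute)
  then show ?thesis
    by (simp add: ring_map_sum[OF ring_map_ev] ring_map_mult[OF ring_map_ev])
qed

lemma entry_line_deriv:
  fixes F :: "('n::finite) epoly"
  assumes "\<And>t. entry (w t) = (\<lambda>i. entry z i + t * v i)" "\<And>t. ev (w t) F = 0"
  shows "(\<Sum>i\<in>UNIV. v i * ev z (pdiff i F)) = 0"
proof -
  have "((\<lambda>t. peval (\<lambda>i. entry z i + t * v i) F) has_field_derivative
      (\<Sum>i\<in>UNIV. v i * peval (\<lambda>i. entry z i + 0 * v i) (pdiff i F))) (at 0)"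
    by (rule peval_line_deriv) (simp_all add: polys_in_def)
  then have "((\<lambda>t. 0) has_field_derivative (\<Sum>i\<in>UNIV. v i * ev z (pdiff i F))) (at 0)"
    by (simp flip: assms(1) add: assms(2))
  then show ?thesis using DERIV_unique DERIV_const by blast
qed

lemma sum_letter_triple:
  fixes f :: "letter \<times> ('n::finite) \<times> 'n \<Rightarrow> complex"
  shows "(\<Sum>i\<in>UNIV. f i) = (\<Sum>i\<in>UNIV. \<Sum>j\<in>UNIV. f (LX, i, j)) + (\<Sum>i\<in>UNIV. \<Sum>j\<in>UNIV. f (LY, i, j))"
proof -
  have U: "(UNIV :: letter set) = {LX, LY}" using letter.exhaust by auto
  have "(\<Sum>i\<in>UNIV. f i) = (\<Sum>l\<in>UNIV. \<Sum>i\<in>UNIV. \<Sum>j\<in>UNIV. f (l, i, j))"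
    unfolding UNIV_Times_UNIV[symmetric] sum.cartesian_product by (simp add: case_prod_unfold)
  then show ?thesis unfolding U by simp
qed

context reducible_variety
begin

text \<open>Bracketing with the trace of X^k differentiates along a shear of Y in the direction of a
  power of X, and this shear stays in V. For k = 0 the gradient carries the factor 0, so the
  truncated k - 1 is harmless.\<close>

lemma flow_X_vanish:
  assumes F: "F \<in> vanish V"
  shows "pb F (wpoly (replicate k LX)) \<in> vanish V"
  unfolding vanish_def
proof (intro CollectI ballI)
  fix z assume z: "z \<in> V"
  obtain X Y where zXY: "z = (X, Y)" by fastforce
  let ?M = "wmat (\<lambda>_. X) (replicate (k - 1) LX) :: complex^4^4"
  define v where "v = (\<lambda>(l, i, j). if l = LY then ?M $ i $ j else 0)"
  have "mmap (ev z) (wmat gmat (replicate (k - 1) LX)) = ?M"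
    unfolding mmap_ev_wmat by (simp add: wmat_replicate zXY)
  then have M: "?M $ i $ j = ev z (wmat gmat (replicate (k - 1) LX) $ i $ j)" for i j by (metis mmap_nth)
  have "(\<Sum>i\<in>UNIV. v i * ev z (pdiff i F)) = 0"
  proof (rule entry_line_deriv)
    show "entry (X, Y + smat t ?M) = (\<lambda>i. entry z i + t * v i)" for t
    proof
      fix i :: "letter \<times> 4 \<times> 4"
      obtain l a b where "i = (l, a, b)" by (metis surj_pair)
      then show "entry (X, Y + smat t ?M) i = entry z i + t * v i"
        by (cases l) (simp_all add: entry_def v_def zXY)
    qed
    show "ev (X, Y + smat t ?M) F = 0" for t
      using F flow_X z zXY by (auto simp: vanish_def)
  qed
  then have "ev z (trace (grad LY F ** wmat gmat (replicate (k - 1) LX))) = 0"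
    unfolding ev_grad_trace M[symmetric] by (simp add: sum_letter_triple v_def)
  then show "ev z (pb F (wpoly (replicate k LX))) = 0"
    by (simp add: pb_grad grad_power mm_zero trace_zero mm_smat trace_smat ring_map_uminus[OF ring_map_ev] ring_map_mult[OF ring_map_ev])
qed

lemma flow_Y_vanish:
  assumes F: "F \<in> vanish V"
  shows "pb F (wpoly (replicate k LY)) \<in> vanish V"
  unfolding vanish_def
proof (intro CollectI ballI)
  fix z assume z: "z \<in> V"
  obtain X Y where zXY: "z = (X, Y)" by fastforce
  let ?M = "wmat (\<lambda>_. Y) (replicate (k - 1) LX) :: complex^4^4"
  define v where "v = (\<lambda>(l, i, j). if l = LX then ?M $ i $ j else 0)"
  have "mmap (ev z) (wmat gmat (replicate (k - 1) LY)) = ?M"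
    unfolding mmap_ev_wmat by (simp add: wmat_replicate zXY)
  then have M: "?M $ i $ j = ev z (wmat gmat (replicate (k - 1) LY) $ i $ j)" for i j by (metis mmap_nth)
  have "(\<Sum>i\<in>UNIV. v i * ev z (pdiff i F)) = 0"
  proof (rule entry_line_deriv)
    show "entry (X + smat t ?M, Y) = (\<lambda>i. entry z i + t * v i)" for t
    proof
      fix i :: "letter \<times> 4 \<times> 4"
      obtain l a b where "i = (l, a, b)" by (metis surj_pair)
      then show "entry (X + smat t ?M, Y) i = entry z i + t * v i"
        by (cases l) (simp_all add: entry_def v_def zXY)
    qed
    show "ev (X + smat t ?M, Y) F = 0" for t
      using F flow_Y z zXY by (auto simp: vanish_def)
  qed
  then have "ev z (trace (grad LX F ** wmat gmat (replicate (k - 1) LY))) = 0"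
    unfolding ev_grad_trace M[symmetric] by (simp add: sum_letter_triple v_def)
  then show "ev z (pb F (wpoly (replicate k LY))) = 0"
    by (simp add: pb_grad grad_power mm_zero trace_zero mm_smat trace_smat ring_map_mult[OF ring_map_ev])
qed

text \<open>Contains the traces of the powers of \<open>X\<close> and of \<open>Y\<close> since \<open>V\<close> is stable under their
  Hamiltonian flows, and is closed under brackets by the Jacobi identity.\<close>

definition tangent :: "4 epoly set" where
  "tangent = {G \<in> talg. \<forall>F\<in>talg \<inter> vanish V. pb F G \<in> vanish V}"

lemma tangent_subalgebra: "epoly_subalgebra tangent"
proof
  show "cst c \<in> tangent" for c by (simp add: tangent_def talg.cst pb_cst vanish_0)
  fix p q assume pq: "p \<in> tangent" "q \<in> tangent"
  then show "p + q \<in> tangent" by (auto simp: tangent_def pb_add_right intro: talg.add vanish_add)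
  have "r * q \<in> vanish V" if "r \<in> vanish V" for q r using vanish_mult[OF that, of q] by (simp only: mult.commute)
  then show "p * q \<in> tangent" using pq
    by (auto simp: tangent_def pb_mult_right intro: talg.mult vanish_mult intro!: vanish_add)
qed

lemma tangent_pb:
  assumes "G \<in> tangent" "H \<in> tangent" shows "pb G H \<in> tangent"
proof -
  have GH: "G \<in> talg" "H \<in> talg" using assms by (auto simp: tangent_def)
  have "pb F (pb G H) \<in> vanish V" if F: "F \<in> talg \<inter> vanish V" for F
  proof -
    have 1: "pb F G \<in> talg \<inter> vanish V" "pb F H \<in> talg \<inter> vanish V"
      using assms F GH by (auto simp: tangent_def talg_pb)
    have "pb F (pb G H) + pb G (pb H F) + pb H (pb F G) = 0"
      using jacobi[of F G H] by (simp add: jac_def)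
    moreover have "pb G (pb H F) = pb (pb F H) G"
      using pb_antisym[of H F] pb_antisym[of "pb F H" G] by (simp add: derivation_uminus[OF derivation_pb])
    moreover have "pb H (pb F G) = - pb (pb F G) H" by (rule pb_antisym)
    ultimately have "pb F (pb G H) = pb (pb F G) H - pb (pb F H) G" by (simp add: algebra_simps eq_neg_iff_add_eq_0)
    moreover have "pb (pb F G) H \<in> vanish V" "pb (pb F H) G \<in> vanish V" using 1 assms by (auto simp: tangent_def)
    ultimately show ?thesis by (simp add: vanish_diff)
  qed
  then show ?thesis using GH by (auto simp: tangent_def talg_pb)
qed

lemma tangent_talg: "G \<in> talg \<Longrightarrow> G \<in> tangent"
proof -
  interpret T: epoly_subalgebra tangent by (rule tangent_subalgebra)
  have "wpoly (replicate k LX) \<in> tangent" "wpoly (replicate k LY) \<in> tangent" for k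
    using flow_X_vanish flow_Y_vanish by (auto simp: tangent_def talg.wpoly)
  from tangent_pb[OF this] have "cst (of_nat (Suc a * Suc b)) * wpoly (replicate a LX @ replicate b LY) \<in> tangent" for a b
    using pb_wpoly_powers[of a b] by metis
  then have w: "wpoly (replicate a LX @ replicate b LY) \<in> tangent" for a b
    by (rule T.S_cancel) (simp only: of_nat_eq_0_iff, simp)
  assume G: "G \<in> talg"
  \<comment> \<open>The remainder vanishes on V together with its brackets, and the reduced part is
    a polynomial in traces of sorted words; both are tangent.\<close>
  then obtain P where P: "G - gsub P \<in> vanish1 V" using talg_redset by (auto simp: redset_def)
  have "G - gsub P \<in> tangent"
    using P talg_diff[OF G gsub_talg] by (auto simp: tangent_def vanish1_def)
  moreover have "gsub P \<in> tangent" by (intro gsub_closed gpoly_closed tangent_subalgebra w)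
  ultimately show ?thesis by (rule T.S_diff_iff)
qed

theorem pb_vanish:
  assumes "F \<in> talg" "F \<in> vanish V" "G \<in> talg"
  shows "pb F G \<in> vanish V"
  using tangent_talg[OF assms(3)] assms by (auto simp: tangent_def)

end

section \<open>Traces of words at a point of the variety\<close>

lemma derivation_pderiv: "derivation (pderiv :: complex poly \<Rightarrow> complex poly)"
  by (simp add: derivation_def pderiv_add pderiv_mult mult.commute)

lemma ring_map_poly_at: "ring_map (\<lambda>p. poly p x)"
  by (simp add: ring_map_def)

lemma ring_map_pCons: "ring_map (\<lambda>c. [:c :: complex:])"
  by (simp add: ring_map_def one_pCons)

lemma mmap_smat_derivation: "derivation D \<Longrightarrow> mmap D (smat c A) = smat c (mmap D A) + smat (D c) A"
  by (rule mat_eqI) (simp add: derivation_mult[of D])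

lemma mmap_add_derivation: "derivation D \<Longrightarrow> mmap D (A + B) = mmap D A + mmap D B"
  by (rule mat_eqI) (simp add: derivation_add[of D])

lemma mmap_smat_ring: "ring_map h \<Longrightarrow> mmap h (smat c A) = smat (h c) (mmap h A)"
  by (rule mat_eqI) (simp add: ring_map_mult)

lemma mmap_add_ring: "ring_map h \<Longrightarrow> mmap h (A + B) = mmap h A + mmap h B"
  by (rule mat_eqI) (simp add: ring_map_add)

lemma smat_0: "smat 0 A = 0" "smat c 0 = 0" "mmap (\<lambda>p. poly p x) 0 = 0"
  by (rule mat_eqI, simp)+

text \<open>The directional derivative of the Cayley--Hamilton identity, obtained from the identity for
  \<open>A + x B\<close> over the polynomial ring in \<open>x\<close>.\<close>

lemma cayley_hamilton_4_polarized:
  fixes A B :: "complex^4^4"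
  assumes tr: "trace A = 0" "trace B = 0"
  shows "smat 24 (B ** (A ** (A ** A)) + A ** (B ** (A ** A)) + A ** (A ** (B ** A)) + A ** (A ** (A ** B))) =
    smat (24 * trace (A ** B)) (A ** A) + smat (12 * trace (A ** A)) (A ** B + B ** A)
    + smat (24 * trace (A ** (A ** B))) A + smat (8 * trace (A ** (A ** A))) B
    + smat (24 * trace (A ** (A ** (A ** B))) - 12 * trace (A ** A) * trace (A ** B)) (mat 1)"
proof -
  let ?c = "\<lambda>c :: complex. [:c:]" and ?h = "\<lambda>p :: complex poly. poly p 0"
  define M where "M = mmap ?c A + smat [:0, 1:] (mmap ?c B)"
  have "trace M = 0"
    using tr by (simp add: M_def trace_add trace_smat ring_map_trace[OF ring_map_pCons, symmetric])
  note ch = cayley_hamilton_4[OF this]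
  have dM: "mmap pderiv M = mmap ?c B" by (rule mat_eqI) (simp add: M_def pderiv_add pderiv_mult pderiv_pCons)
  have hM: "mmap ?h M = A" "mmap ?h (mmap ?c B) = B" by (rule mat_eqI, simp add: M_def)+
  note D = derivation_pderiv
  have tr': "pderiv (trace X) = trace (mmap pderiv X)" for X :: "(complex poly)^4^4" by (rule derivation_trace[OF D])
  have htr: "?h (trace X) = trace (mmap ?h X)" for X :: "(complex poly)^4^4" by (rule ring_map_trace[OF ring_map_poly_at])
  have num: "pderiv (numeral n) = (0 :: complex poly)" for n by (simp add: numeral_poly pderiv_pCons)
  have one: "mmap pderiv (mat 1 :: (complex poly)^4^4) = 0" by (rule mat_eqI) (simp add: mat_nth)
  note hs = mmap_mult[OF ring_map_poly_at] mmap_smat_ring[OF ring_map_poly_at] mmap_add_ring[OF ring_map_poly_at]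
    mmap_mat[OF ring_map_poly_at] htr hM
  from arg_cong[OF ch, of "\<lambda>X. mmap ?h (mmap pderiv X)"] 
  have "smat 24 (B ** (A ** (A ** A)) + A ** (B ** (A ** A) + A ** (B ** A + A ** B))) =
      smat (12 * trace (A ** A)) (B ** A + A ** B) + smat (12 * trace (B ** A + A ** B)) (A ** A)
      + (smat (8 * trace (A ** (A ** A))) B + smat (8 * trace (B ** (A ** A) + A ** (B ** A + A ** B))) A)
      + smat (6 * trace (B ** (A ** (A ** A)) + A ** (B ** (A ** A) + A ** (B ** A + A ** B)))
        - 6 * (trace (A ** A) * trace (B ** A + A ** B))) (mat 1)"
    unfolding mmap_smat_derivation[OF D] mmap_add_derivation[OF D] mmap_derivation_mult[OF D] pderiv_mult pderiv_diff tr' dM one num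
    by (simp add: hs smat_0)
  moreover have "trace (B ** A) = trace (A ** B)" "trace (B ** (A ** A)) = trace (A ** (A ** B))"
    "trace (A ** (B ** A)) = trace (A ** (A ** B))" "trace (B ** (A ** (A ** A))) = trace (A ** (A ** (A ** B)))"
    "trace (A ** (B ** (A ** A))) = trace (A ** (A ** (A ** B)))" "trace (A ** (A ** (B ** A))) = trace (A ** (A ** (A ** B)))"
    using trace_mul_sym[of B A] trace_mul_sym[of B "A ** A"] trace_mul_sym[of "A ** B" A] trace_mul_sym[of B "A ** (A ** A)"]
      trace_mul_sym[of "A ** B" "A ** A"] trace_mul_sym[of "A ** (A ** B)" A] by (simp_all only: matrix_mul_assoc[symmetric])
  ultimately show ?thesis
    by (simp add: matrix_add_ldistrib trace_add add_ac mult.assoc)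
qed

text \<open>Models a point of either variety: A gives the traceless parts of X and Y, and Q is the
  shifted commutator. Traces of words are now numbers, so their reduction can be carried out
  explicitly.\<close>

locale word_traces =
  fixes A :: "letter \<Rightarrow> complex^4^4" and Q :: "complex^4^4" and \<epsilon> :: complex
  assumes traceless: "trace (A l) = 0"
    and commutator: "A LX ** A LY - A LY ** A LX = Q - mat \<epsilon>"
    and trace_Q: "trace Q = 4 * \<epsilon>"
    and rank_one: "trace (Q ** M ** Q ** N) = trace (Q ** M) * trace (Q ** N)"
    and eps: "\<epsilon> = 0 \<or> \<epsilon> = 1"
begin

definition T :: "letter list \<Rightarrow> complex" where "T w = tw A w"
definition q :: "letter list \<Rightarrow> complex" where "q w = trace (Q ** wmat A w)"

lemma YX: "A LY ** A LX = A LX ** A LY - Q + smat \<epsilon> (mat 1)"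
  using commutator unfolding mat_smat[of \<epsilon>] by (simp add: algebra_simps)

lemma T_swap: "T (u @ LY # LX # v) = T (u @ LX # LY # v) - q (v @ u) + \<epsilon> * T (v @ u)"
proof -
  have "T (u @ LY # LX # v) = trace (wmat A u ** (A LY ** A LX) ** wmat A v)"
    by (simp add: T_def tw_def wmat_append matrix_mul_assoc)
  also have "\<dots> = T (u @ LX # LY # v) - trace (wmat A u ** (Q ** wmat A v)) + \<epsilon> * trace (wmat A u ** wmat A v)"
    unfolding YX by (simp add: T_def tw_def wmat_append matrix_mul_assoc matrix_add_ldistrib mm_rdistrib
      mm_diff_ldistrib mm_diff_rdistrib mm_smat trace_add trace_sub trace_smat)
  finally show ?thesis
    unfolding trace_mul_sym[of "wmat A u"] T_def q_def tw_def wmat_append matrix_mul_assoc[symmetric] .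
qed

lemma q_swap: "q (u @ LY # LX # v) = q (u @ LX # LY # v) - q u * q v + \<epsilon> * q (u @ v)"
proof -
  have "q (u @ LY # LX # v) = trace (Q ** wmat A u ** (A LY ** A LX) ** wmat A v)"
    by (simp add: q_def wmat_append matrix_mul_assoc)
  also have "\<dots> = q (u @ LX # LY # v) - trace (Q ** wmat A u ** Q ** wmat A v) + \<epsilon> * q (u @ v)"
    unfolding YX by (simp add: q_def wmat_append matrix_mul_assoc matrix_add_ldistrib mm_rdistrib
      mm_diff_ldistrib mm_diff_rdistrib mm_smat trace_add trace_sub trace_smat)
  finally show ?thesis by (simp add: rank_one) (simp add: q_def)
qed

text \<open>Instances for short prefixes, oriented so that rewriting sorts a word with the letters X
  first.\<close>

lemmas swaps = T_swap[of "[]", simplified] T_swap[of "[a]" for a, simplified] T_swap[of "[a, b]" for a b, simplified]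
  T_swap[of "[a, b, c]" for a b c, simplified] T_swap[of "[a, b, c, d]" for a b c d, simplified]
  q_swap[of "[]", simplified] q_swap[of "[a]" for a, simplified] q_swap[of "[a, b]" for a b, simplified]

lemma rotate: "T (l # w) = T (w @ [l])"
  using tw_cyclic[of A "[l]" w] by (simp add: T_def)

lemma eps_mult: "\<epsilon> * \<epsilon> = \<epsilon>" "\<epsilon> * (\<epsilon> * x) = \<epsilon> * x"
  using eps by auto

lemma T_01: "T [] = 4" "T [l] = 0"
  by (simp_all add: T_def tw_def trace_I traceless)

lemma q_0: "q [] = 4 * \<epsilon>"
  by (simp add: q_def trace_Q)

text \<open>A leading Y is rotated to the end of the word and both sides are sorted; the comparison
  is a linear equation for one value of q. The same method determines the values for longer words
  below.\<close>

lemma q_1: "q [l] = 0"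
  using rotate[of LY "[LX, LX]"] rotate[of LY "[LX, LY]"] by (cases l) (simp_all add: swaps T_01)

lemma q_2: "q [LX, LX] = \<epsilon> * T [LX, LX]"
  "q [LX, LY] = \<epsilon> * (T [LX, LY] + 6)"
  "q [LY, LY] = \<epsilon> * T [LY, LY]"
proof -
  have "3 * q [LX, LX] = 3 * (\<epsilon> * T [LX, LX])"
    using rotate[of LY "[LX, LX, LX]"] by (simp add: swaps T_01 q_0 q_1 eps_mult algebra_simps)
  then show "q [LX, LX] = \<epsilon> * T [LX, LX]" by (simp only: mult_cancel_left) simp
  have "2 * q [LX, LY] = 2 * (\<epsilon> * (T [LX, LY] + 6))"
    using rotate[of LY "[LX, LX, LY]"] by (simp add: swaps T_01 q_0 q_1 eps_mult algebra_simps)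
  then show "q [LX, LY] = \<epsilon> * (T [LX, LY] + 6)" by (simp only: mult_cancel_left) simp
  have "1 * q [LY, LY] = 1 * (\<epsilon> * T [LY, LY])"
    using rotate[of LY "[LX, LY, LY]"] by (simp add: swaps T_01 q_0 q_1 eps_mult algebra_simps)
  then show "q [LY, LY] = \<epsilon> * T [LY, LY]" by (simp only: mult_cancel_left) simp
qed

lemma q_3: "q [LX, LX, LX] = \<epsilon> * T [LX, LX, LX]"
  "q [LX, LX, LY] = \<epsilon> * T [LX, LX, LY]"
  "q [LX, LY, LY] = \<epsilon> * T [LX, LY, LY]"
  "q [LY, LY, LY] = \<epsilon> * T [LY, LY, LY]"
proof -
  have "4 * q [LX, LX, LX] = 4 * (\<epsilon> * T [LX, LX, LX])"
    using rotate[of LY "[LX, LX, LX, LX]"] by (simp add: swaps T_01 q_0 q_1 q_2 eps_mult algebra_simps)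
  then show "q [LX, LX, LX] = \<epsilon> * T [LX, LX, LX]" by (simp only: mult_cancel_left) simp
  have "3 * q [LX, LX, LY] = 3 * (\<epsilon> * T [LX, LX, LY])"
    using rotate[of LY "[LX, LX, LX, LY]"] by (simp add: swaps T_01 q_0 q_1 q_2 eps_mult algebra_simps)
  then show "q [LX, LX, LY] = \<epsilon> * T [LX, LX, LY]" by (simp only: mult_cancel_left) simp
  have "2 * q [LX, LY, LY] = 2 * (\<epsilon> * T [LX, LY, LY])"
    using rotate[of LY "[LX, LX, LY, LY]"] by (simp add: swaps T_01 q_0 q_1 q_2 eps_mult algebra_simps)
  then show "q [LX, LY, LY] = \<epsilon> * T [LX, LY, LY]" by (simp only: mult_cancel_left) simp
  have "1 * q [LY, LY, LY] = 1 * (\<epsilon> * T [LY, LY, LY])"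
    using rotate[of LY "[LX, LY, LY, LY]"] by (simp add: swaps T_01 q_0 q_1 q_2 eps_mult algebra_simps)
  then show "q [LY, LY, LY] = \<epsilon> * T [LY, LY, LY]" by (simp only: mult_cancel_left) simp
qed

lemma q_4: "q [LX, LX, LX, LX] = \<epsilon> * T [LX, LX, LX, LX]"
  "q [LY, LY, LY, LY] = \<epsilon> * T [LY, LY, LY, LY]"
  "q [LX, LX, LX, LY] = \<epsilon> * (T [LX, LX, LX, LY] + 5/2 * T [LX, LX])"
  "q [LX, LX, LY, LY] = \<epsilon> * (T [LX, LX, LY, LY] + 2 * T [LX, LY] + 4)"
  "q [LX, LY, LY, LY] = \<epsilon> * (T [LX, LY, LY, LY] + 5/2 * T [LY, LY])"
proof -
  have "5 * q [LX, LX, LX, LX] = 5 * (\<epsilon> * T [LX, LX, LX, LX])"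
    using rotate[of LY "[LX, LX, LX, LX, LX]"] by (simp add: swaps T_01 q_0 q_1 q_2 q_3 eps_mult algebra_simps)
  then show "q [LX, LX, LX, LX] = \<epsilon> * T [LX, LX, LX, LX]" by (simp only: mult_cancel_left) simp
  have "1 * q [LY, LY, LY, LY] = 1 * (\<epsilon> * T [LY, LY, LY, LY])"
    using rotate[of LY "[LX, LY, LY, LY, LY]"] by (simp add: swaps T_01 q_0 q_1 q_2 q_3 eps_mult algebra_simps)
  then show "q [LY, LY, LY, LY] = \<epsilon> * T [LY, LY, LY, LY]" by (simp only: mult_cancel_left) simp
  have "4 * q [LX, LX, LX, LY] = 4 * (\<epsilon> * (T [LX, LX, LX, LY] + 5/2 * T [LX, LX]))"
    using rotate[of LY "[LX, LX, LX, LX, LY]"] by (simp add: swaps T_01 q_0 q_1 q_2 q_3 eps_mult algebra_simps)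
  then show "q [LX, LX, LX, LY] = \<epsilon> * (T [LX, LX, LX, LY] + 5/2 * T [LX, LX])" by (simp only: mult_cancel_left) simp
  have "3 * q [LX, LX, LY, LY] = 3 * (\<epsilon> * (T [LX, LX, LY, LY] + 2 * T [LX, LY] + 4))"
    using rotate[of LY "[LX, LX, LX, LY, LY]"] by (simp add: swaps T_01 q_0 q_1 q_2 q_3 eps_mult algebra_simps)
  then show "q [LX, LX, LY, LY] = \<epsilon> * (T [LX, LX, LY, LY] + 2 * T [LX, LY] + 4)" by (simp only: mult_cancel_left) simp
  have "2 * q [LX, LY, LY, LY] = 2 * (\<epsilon> * (T [LX, LY, LY, LY] + 5/2 * T [LY, LY]))"
    using rotate[of LY "[LX, LX, LY, LY, LY]"] by (simp add: swaps T_01 q_0 q_1 q_2 q_3 eps_mult algebra_simps)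
  then show "q [LX, LY, LY, LY] = \<epsilon> * (T [LX, LY, LY, LY] + 5/2 * T [LY, LY])" by (simp only: mult_cancel_left) simp
qed

lemmas q_vals = T_01 q_0 q_1 q_2 q_3 q_4 eps_mult

lemma T_ch:
  "24 * T (l # l # l # l # w) = 12 * T [l, l] * T (l # l # w) + 8 * T [l, l, l] * T (l # w)
    + (6 * T [l, l, l, l] - 3 * T [l, l] * T [l, l]) * T w"
proof -
  have "trace (smat 24 (A l ** (A l ** (A l ** A l))) ** wmat A w) = 12 * T [l, l] * T (l # l # w) + 8 * T [l, l, l] * T (l # w)
    + (6 * T [l, l, l, l] - 3 * T [l, l] * T [l, l]) * T w"
    unfolding cayley_hamilton_4[OF traceless] mm_rdistrib mm_smat trace_add trace_smat
    by (simp add: T_def tw_def matrix_mul_assoc[symmetric])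
  then show ?thesis by (simp add: mm_smat trace_smat T_def tw_def matrix_mul_assoc[symmetric])
qed

lemma T_ch_polarized:
  "24 * (T (l' # l # l # l # w) + T (l # l' # l # l # w) + T (l # l # l' # l # w) + T (l # l # l # l' # w)) =
    24 * T [l, l'] * T (l # l # w) + 12 * T [l, l] * (T (l # l' # w) + T (l' # l # w))
    + 24 * T [l, l, l'] * T (l # w) + 8 * T [l, l, l] * T (l' # w)
    + (24 * T [l, l, l, l'] - 12 * T [l, l] * T [l, l']) * T w"
proof -
  have "trace (smat 24 (A l' ** (A l ** (A l ** A l)) + A l ** (A l' ** (A l ** A l)) + A l ** (A l ** (A l' ** A l)) + A l ** (A l ** (A l ** A l'))) ** wmat A w) =
    24 * T [l, l'] * T (l # l # w) + 12 * T [l, l] * (T (l # l' # w) + T (l' # l # w))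
    + 24 * T [l, l, l'] * T (l # w) + 8 * T [l, l, l] * T (l' # w)
    + (24 * T [l, l, l, l'] - 12 * T [l, l] * T [l, l']) * T w"
    unfolding cayley_hamilton_4_polarized[OF traceless traceless] mm_rdistrib mm_smat trace_add trace_smat
    by (simp add: T_def tw_def matrix_mul_assoc[symmetric])
  then show ?thesis by (simp add: mm_rdistrib mm_smat trace_smat trace_add T_def tw_def matrix_mul_assoc[symmetric])
qed

lemma eq_divideI: "k * d * x = k * y \<Longrightarrow> k \<noteq> 0 \<Longrightarrow> d \<noteq> 0 \<Longrightarrow> x = y / (d :: complex)"
  by (simp add: eq_divide_eq mult_ac)

text \<open>Words with four equal letters come from the Cayley-Hamilton identity times a short word,
  the others from its polarization; likewise in length 6.\<close>

lemma T_words_5: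
  "T [LX, LX, LX, LX, LX] = (5 * T [LX, LX] * T [LX, LX, LX]) / 6"
  "T [LX, LX, LX, LX, LY] = (3 * T [LX, LX] * T [LX, LX, LY] + 2 * T [LX, LY] * T [LX, LX, LX]) / 6"
  "T [LX, LX, LX, LY, LY] = (3 * T [LX, LX] * T [LX, LY, LY] + 6 * T [LX, LY] * T [LX, LX, LY] + T [LY, LY] * T [LX, LX, LX]) / 12"
  "T [LX, LX, LY, LY, LY] = (T [LX, LX] * T [LY, LY, LY] + 6 * T [LX, LY] * T [LX, LY, LY] + 3 * T [LY, LY] * T [LX, LX, LY]) / 12"
  "T [LX, LY, LY, LY, LY] = (2 * T [LX, LY] * T [LY, LY, LY] + 3 * T [LY, LY] * T [LX, LY, LY]) / 6"
  "T [LY, LY, LY, LY, LY] = (5 * T [LY, LY] * T [LY, LY, LY]) / 6"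
proof -
  have "4 * 6 * T [LX, LX, LX, LX, LX] = 4 * (5 * T [LX, LX] * T [LX, LX, LX])"
    using T_ch[of LX "[LX]"] by (simp add: swaps q_vals algebra_simps)
  then show "T [LX, LX, LX, LX, LX] = (5 * T [LX, LX] * T [LX, LX, LX]) / 6" by (rule eq_divideI) simp_all
  have "4 * 6 * T [LX, LX, LX, LX, LY] = 4 * (3 * T [LX, LX] * T [LX, LX, LY] + 2 * T [LX, LY] * T [LX, LX, LX])"
    using T_ch[of LX "[LY]"] by (simp add: swaps q_vals algebra_simps)
  then show "T [LX, LX, LX, LX, LY] = (3 * T [LX, LX] * T [LX, LX, LY] + 2 * T [LX, LY] * T [LX, LX, LX]) / 6" by (rule eq_divideI) simp_all
  have "8 * 12 * T [LX, LX, LX, LY, LY] = 8 * (3 * T [LX, LX] * T [LX, LY, LY] + 6 * T [LX, LY] * T [LX, LX, LY] + T [LY, LY] * T [LX, LX, LX])"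
    using T_ch_polarized[of LY LX "[LY]"] by (simp add: swaps q_vals algebra_simps)
  then show "T [LX, LX, LX, LY, LY] = (3 * T [LX, LX] * T [LX, LY, LY] + 6 * T [LX, LY] * T [LX, LX, LY] + T [LY, LY] * T [LX, LX, LX]) / 12" by (rule eq_divideI) simp_all
  have "8 * 12 * T [LX, LX, LY, LY, LY] = 8 * (T [LX, LX] * T [LY, LY, LY] + 6 * T [LX, LY] * T [LX, LY, LY] + 3 * T [LY, LY] * T [LX, LX, LY])"
    using T_ch_polarized[of LX LY "[LX]"] by (simp add: swaps q_vals algebra_simps)
  then show "T [LX, LX, LY, LY, LY] = (T [LX, LX] * T [LY, LY, LY] + 6 * T [LX, LY] * T [LX, LY, LY] + 3 * T [LY, LY] * T [LX, LX, LY]) / 12" by (rule eq_divideI) simp_all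
  have "4 * 6 * T [LX, LY, LY, LY, LY] = 4 * (2 * T [LX, LY] * T [LY, LY, LY] + 3 * T [LY, LY] * T [LX, LY, LY])"
    using T_ch[of LY "[LX]"] by (simp add: swaps q_vals algebra_simps)
  then show "T [LX, LY, LY, LY, LY] = (2 * T [LX, LY] * T [LY, LY, LY] + 3 * T [LY, LY] * T [LX, LY, LY]) / 6" by (rule eq_divideI) simp_all
  have "4 * 6 * T [LY, LY, LY, LY, LY] = 4 * (5 * T [LY, LY] * T [LY, LY, LY])"
    using T_ch[of LY "[LY]"] by (simp add: swaps q_vals algebra_simps)
  then show "T [LY, LY, LY, LY, LY] = (5 * T [LY, LY] * T [LY, LY, LY]) / 6" by (rule eq_divideI) simp_all
qed

lemma T_words_6:
  "T [LX, LX, LX, LX, LX, LX] = (- 3 * T [LX, LX] * T [LX, LX] * T [LX, LX] + 18 * T [LX, LX] * T [LX, LX, LX, LX] + 8 * T [LX, LX, LX] * T [LX, LX, LX]) / 24"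
  "T [LX, LX, LX, LX, LX, LY] = (- 3 * T [LX, LX] * T [LX, LX] * T [LX, LY] + 12 * T [LX, LX] * T [LX, LX, LX, LY] + 6 * T [LX, LY] * T [LX, LX, LX, LX] + 8 * T [LX, LX, LX] * T [LX, LX, LY]) / 24"
  "T [LX, LX, LX, LX, LY, LY] = (- 3 * T [LX, LX] * T [LX, LX] * T [LY, LY] + 12 * T [LX, LX] * T [LX, LX, LY, LY] + 6 * T [LY, LY] * T [LX, LX, LX, LX] + 8 * T [LX, LX, LX] * T [LX, LY, LY]) / 24"
  "T [LX, LX, LX, LY, LY, LY] = (- 3 * T [LX, LX] * T [LX, LY] * T [LY, LY] + 6 * T [LX, LX] * T [LX, LY, LY, LY] + 6 * T [LX, LY] * T [LX, LX, LY, LY] - 24 * T [LX, LY] * \<epsilon> + 6 * T [LY, LY] * T [LX, LX, LX, LY] + 2 * T [LX, LX, LX] * T [LY, LY, LY] + 6 * T [LX, LX, LY] * T [LX, LY, LY]) / 24"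
  "T [LX, LX, LY, LY, LY, LY] = (- 3 * T [LX, LX] * T [LY, LY] * T [LY, LY] + 6 * T [LX, LX] * T [LY, LY, LY, LY] + 12 * T [LY, LY] * T [LX, LX, LY, LY] + 8 * T [LX, LX, LY] * T [LY, LY, LY]) / 24"
  "T [LX, LY, LY, LY, LY, LY] = (- 3 * T [LX, LY] * T [LY, LY] * T [LY, LY] + 6 * T [LX, LY] * T [LY, LY, LY, LY] + 12 * T [LY, LY] * T [LX, LY, LY, LY] + 8 * T [LX, LY, LY] * T [LY, LY, LY]) / 24"
  "T [LY, LY, LY, LY, LY, LY] = (- 3 * T [LY, LY] * T [LY, LY] * T [LY, LY] + 18 * T [LY, LY] * T [LY, LY, LY, LY] + 8 * T [LY, LY, LY] * T [LY, LY, LY]) / 24"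
proof -
  have "1 * 24 * T [LX, LX, LX, LX, LX, LX] = 1 * (- 3 * T [LX, LX] * T [LX, LX] * T [LX, LX] + 18 * T [LX, LX] * T [LX, LX, LX, LX] + 8 * T [LX, LX, LX] * T [LX, LX, LX])"
    using T_ch[of LX "[LX, LX]"] by (simp add: swaps q_vals T_words_5 algebra_simps)
  then show "T [LX, LX, LX, LX, LX, LX] = (- 3 * T [LX, LX] * T [LX, LX] * T [LX, LX] + 18 * T [LX, LX] * T [LX, LX, LX, LX] + 8 * T [LX, LX, LX] * T [LX, LX, LX]) / 24" by (rule eq_divideI) simp_all
  have "1 * 24 * T [LX, LX, LX, LX, LX, LY] = 1 * (- 3 * T [LX, LX] * T [LX, LX] * T [LX, LY] + 12 * T [LX, LX] * T [LX, LX, LX, LY] + 6 * T [LX, LY] * T [LX, LX, LX, LX] + 8 * T [LX, LX, LX] * T [LX, LX, LY])"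
    using T_ch[of LX "[LX, LY]"] by (simp add: swaps q_vals T_words_5 algebra_simps)
  then show "T [LX, LX, LX, LX, LX, LY] = (- 3 * T [LX, LX] * T [LX, LX] * T [LX, LY] + 12 * T [LX, LX] * T [LX, LX, LX, LY] + 6 * T [LX, LY] * T [LX, LX, LX, LX] + 8 * T [LX, LX, LX] * T [LX, LX, LY]) / 24" by (rule eq_divideI) simp_all
  have "1 * 24 * T [LX, LX, LX, LX, LY, LY] = 1 * (- 3 * T [LX, LX] * T [LX, LX] * T [LY, LY] + 12 * T [LX, LX] * T [LX, LX, LY, LY] + 6 * T [LY, LY] * T [LX, LX, LX, LX] + 8 * T [LX, LX, LX] * T [LX, LY, LY])"
    using T_ch[of LX "[LY, LY]"] by (simp add: swaps q_vals T_words_5 algebra_simps)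
  then show "T [LX, LX, LX, LX, LY, LY] = (- 3 * T [LX, LX] * T [LX, LX] * T [LY, LY] + 12 * T [LX, LX] * T [LX, LX, LY, LY] + 6 * T [LY, LY] * T [LX, LX, LX, LX] + 8 * T [LX, LX, LX] * T [LX, LY, LY]) / 24" by (rule eq_divideI) simp_all
  have "4 * 24 * T [LX, LX, LX, LY, LY, LY] = 4 * (- 3 * T [LX, LX] * T [LX, LY] * T [LY, LY] + 6 * T [LX, LX] * T [LX, LY, LY, LY] + 6 * T [LX, LY] * T [LX, LX, LY, LY] - 24 * T [LX, LY] * \<epsilon> + 6 * T [LY, LY] * T [LX, LX, LX, LY] + 2 * T [LX, LX, LX] * T [LY, LY, LY] + 6 * T [LX, LX, LY] * T [LX, LY, LY])"
    using T_ch_polarized[of LY LX "[LY, LY]"] by (simp add: swaps q_vals T_words_5 algebra_simps)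
  then show "T [LX, LX, LX, LY, LY, LY] = (- 3 * T [LX, LX] * T [LX, LY] * T [LY, LY] + 6 * T [LX, LX] * T [LX, LY, LY, LY] + 6 * T [LX, LY] * T [LX, LX, LY, LY] - 24 * T [LX, LY] * \<epsilon> + 6 * T [LY, LY] * T [LX, LX, LX, LY] + 2 * T [LX, LX, LX] * T [LY, LY, LY] + 6 * T [LX, LX, LY] * T [LX, LY, LY]) / 24" by (rule eq_divideI) simp_all
  have "1 * 24 * T [LX, LX, LY, LY, LY, LY] = 1 * (- 3 * T [LX, LX] * T [LY, LY] * T [LY, LY] + 6 * T [LX, LX] * T [LY, LY, LY, LY] + 12 * T [LY, LY] * T [LX, LX, LY, LY] + 8 * T [LX, LX, LY] * T [LY, LY, LY])"
    using T_ch[of LY "[LX, LX]"] by (simp add: swaps q_vals T_words_5 algebra_simps)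
  then show "T [LX, LX, LY, LY, LY, LY] = (- 3 * T [LX, LX] * T [LY, LY] * T [LY, LY] + 6 * T [LX, LX] * T [LY, LY, LY, LY] + 12 * T [LY, LY] * T [LX, LX, LY, LY] + 8 * T [LX, LX, LY] * T [LY, LY, LY]) / 24" by (rule eq_divideI) simp_all
  have "1 * 24 * T [LX, LY, LY, LY, LY, LY] = 1 * (- 3 * T [LX, LY] * T [LY, LY] * T [LY, LY] + 6 * T [LX, LY] * T [LY, LY, LY, LY] + 12 * T [LY, LY] * T [LX, LY, LY, LY] + 8 * T [LX, LY, LY] * T [LY, LY, LY])"
    using T_ch[of LY "[LX, LY]"] by (simp add: swaps q_vals T_words_5 algebra_simps)
  then show "T [LX, LY, LY, LY, LY, LY] = (- 3 * T [LX, LY] * T [LY, LY] * T [LY, LY] + 6 * T [LX, LY] * T [LY, LY, LY, LY] + 12 * T [LY, LY] * T [LX, LY, LY, LY] + 8 * T [LX, LY, LY] * T [LY, LY, LY]) / 24" by (rule eq_divideI) simp_all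
  have "1 * 24 * T [LY, LY, LY, LY, LY, LY] = 1 * (- 3 * T [LY, LY] * T [LY, LY] * T [LY, LY] + 18 * T [LY, LY] * T [LY, LY, LY, LY] + 8 * T [LY, LY, LY] * T [LY, LY, LY])"
    using T_ch[of LY "[LY, LY]"] by (simp add: swaps q_vals T_words_5 algebra_simps)
  then show "T [LY, LY, LY, LY, LY, LY] = (- 3 * T [LY, LY] * T [LY, LY] * T [LY, LY] + 18 * T [LY, LY] * T [LY, LY, LY, LY] + 8 * T [LY, LY, LY] * T [LY, LY, LY]) / 24" by (rule eq_divideI) simp_all
qed

text \<open>The trace of X^4 Y^2 was obtained above from the Cayley-Hamilton identity for X times Y
  Y. The polarized identity times X Y computes it a second time, and the discrepancy is the
  relation.\<close>

lemma T_r1: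
  "8 * \<epsilon> * T [LX, LX] + T [LX, LX] * (T [LX, LY] ^ 2 - T [LX, LX] * T [LY, LY]) - 2 * (T [LX, LX, LY] ^ 2 - T [LX, LX, LX] * T [LX, LY, LY])
    + 2 * (T [LX, LX] * T [LX, LX, LY, LY] - 2 * T [LX, LY] * T [LX, LX, LX, LY] + T [LY, LY] * T [LX, LX, LX, LX]) = 0" (is "?r = 0")
proof -
  have "12 * ?r = 0"
    using T_ch_polarized[of LY LX "[LX, LY]"]
    by (simp add: swaps q_vals T_words_5 T_words_6 algebra_simps power2_eq_square)
  then show ?thesis by (simp only: mult_eq_0_iff zero_neq_numeral[symmetric] HOL.simp_thms)
qed

text \<open>The bracket of two traces of words in the traceless parts; the products with factor 1/4
  arise from differentiating the subtracted trace.\<close>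

definition br :: "letter list \<Rightarrow> letter list \<Rightarrow> complex" where
  "br u v = (\<Sum>k<length u. \<Sum>m<length v. \<omega> (u ! k) (v ! m) *
    (T (wrest u k @ wrest v m) - 1/4 * (T (wrest u k) * T (wrest v m))))"

end

text \<open>Up to a factor the bracket of the defining relation with \<open>a\<^sub>5\<close>; the tabulated brackets of
  \<open>a\<^sub>1\<^sub>0\<close> with \<open>a\<^sub>1\<^sub>4\<close> and of \<open>a\<^sub>1\<^sub>1\<close> with \<open>a\<^sub>1\<^sub>3\<close> hold only modulo this relation.\<close>

definition r\<^sub>3\<^sub>3 :: "complex \<Rightarrow> nat mpoly" where
  "r\<^sub>3\<^sub>3 \<epsilon> = \<a> 4 ^ 3 - \<a> 3 * \<a> 4 * \<a> 5 + 2 * \<a> 3 * \<a> 13 - 4 * \<a> 4 * \<a> 12 - cst (4 * \<epsilon>) * \<a> 4 + 2 * \<a> 5 * \<a> 11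
    + \<a> 6 * \<a> 9 - \<a> 7 * \<a> 8"

context word_traces
begin

definition pv :: "nat \<Rightarrow> complex" where "pv i = T (gword i)"

lemmas pv_eqs = pv_def[of 3, unfolded gword_eqs] pv_def[of 4, unfolded gword_eqs] pv_def[of 5, unfolded gword_eqs]
  pv_def[of 6, unfolded gword_eqs] pv_def[of 7, unfolded gword_eqs] pv_def[of 8, unfolded gword_eqs]
  pv_def[of 9, unfolded gword_eqs] pv_def[of 10, unfolded gword_eqs] pv_def[of 11, unfolded gword_eqs]
  pv_def[of 12, unfolded gword_eqs] pv_def[of 13, unfolded gword_eqs] pv_def[of 14, unfolded gword_eqs]

lemmas br_simps = wrest_def swaps q_vals T_words_5 T_words_6

lemmas poly_norm = peval_simps algebra_simps power2_eq_square power3_eq_cube add_divide_distrib diff_divide_distrib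

lemma br_3:
  "br (gword 3) (gword 4) = peval pv (gen_bracket \<epsilon> 3 4)"
  "br (gword 3) (gword 5) = peval pv (gen_bracket \<epsilon> 3 5)"
  "br (gword 3) (gword 6) = peval pv (gen_bracket \<epsilon> 3 6)"
  "br (gword 3) (gword 7) = peval pv (gen_bracket \<epsilon> 3 7)"
  "br (gword 3) (gword 8) = peval pv (gen_bracket \<epsilon> 3 8)"
  "br (gword 3) (gword 9) = peval pv (gen_bracket \<epsilon> 3 9)"
  "br (gword 3) (gword 10) = peval pv (gen_bracket \<epsilon> 3 10)"
  "br (gword 3) (gword 11) = peval pv (gen_bracket \<epsilon> 3 11)"
  "br (gword 3) (gword 12) = peval pv (gen_bracket \<epsilon> 3 12)"
  "br (gword 3) (gword 13) = peval pv (gen_bracket \<epsilon> 3 13)"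
  "br (gword 3) (gword 14) = peval pv (gen_bracket \<epsilon> 3 14)"
  unfolding br_def gword_eqs gen_bracket_3 by (simp_all add: pv_eqs br_simps poly_norm)

lemma br_4:
  "br (gword 4) (gword 5) = peval pv (gen_bracket \<epsilon> 4 5)"
  "br (gword 4) (gword 6) = peval pv (gen_bracket \<epsilon> 4 6)"
  "br (gword 4) (gword 7) = peval pv (gen_bracket \<epsilon> 4 7)"
  "br (gword 4) (gword 8) = peval pv (gen_bracket \<epsilon> 4 8)"
  "br (gword 4) (gword 9) = peval pv (gen_bracket \<epsilon> 4 9)"
  "br (gword 4) (gword 10) = peval pv (gen_bracket \<epsilon> 4 10)"
  "br (gword 4) (gword 11) = peval pv (gen_bracket \<epsilon> 4 11)"
  "br (gword 4) (gword 12) = peval pv (gen_bracket \<epsilon> 4 12)"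
  "br (gword 4) (gword 13) = peval pv (gen_bracket \<epsilon> 4 13)"
  "br (gword 4) (gword 14) = peval pv (gen_bracket \<epsilon> 4 14)"
  unfolding br_def gword_eqs gen_bracket_4 by (simp_all add: pv_eqs br_simps poly_norm)

lemma br_5:
  "br (gword 5) (gword 6) = peval pv (gen_bracket \<epsilon> 5 6)"
  "br (gword 5) (gword 7) = peval pv (gen_bracket \<epsilon> 5 7)"
  "br (gword 5) (gword 8) = peval pv (gen_bracket \<epsilon> 5 8)"
  "br (gword 5) (gword 9) = peval pv (gen_bracket \<epsilon> 5 9)"
  "br (gword 5) (gword 10) = peval pv (gen_bracket \<epsilon> 5 10)"
  "br (gword 5) (gword 11) = peval pv (gen_bracket \<epsilon> 5 11)"
  "br (gword 5) (gword 12) = peval pv (gen_bracket \<epsilon> 5 12)"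
  "br (gword 5) (gword 13) = peval pv (gen_bracket \<epsilon> 5 13)"
  "br (gword 5) (gword 14) = peval pv (gen_bracket \<epsilon> 5 14)"
  unfolding br_def gword_eqs gen_bracket_5 by (simp_all add: pv_eqs br_simps poly_norm)

lemma br_6:
  "br (gword 6) (gword 7) = peval pv (gen_bracket \<epsilon> 6 7)"
  "br (gword 6) (gword 8) = peval pv (gen_bracket \<epsilon> 6 8)"
  "br (gword 6) (gword 9) = peval pv (gen_bracket \<epsilon> 6 9)"
  "br (gword 6) (gword 10) = peval pv (gen_bracket \<epsilon> 6 10)"
  "br (gword 6) (gword 11) = peval pv (gen_bracket \<epsilon> 6 11)"
  "br (gword 6) (gword 12) = peval pv (gen_bracket \<epsilon> 6 12)"
  "br (gword 6) (gword 13) = peval pv (gen_bracket \<epsilon> 6 13)"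
  "br (gword 6) (gword 14) = peval pv (gen_bracket \<epsilon> 6 14)"
  unfolding br_def gword_eqs gen_bracket_6 by (simp_all add: pv_eqs br_simps poly_norm)

lemma br_7:
  "br (gword 7) (gword 8) = peval pv (gen_bracket \<epsilon> 7 8)"
  "br (gword 7) (gword 9) = peval pv (gen_bracket \<epsilon> 7 9)"
  "br (gword 7) (gword 10) = peval pv (gen_bracket \<epsilon> 7 10)"
  "br (gword 7) (gword 11) = peval pv (gen_bracket \<epsilon> 7 11)"
  "br (gword 7) (gword 12) = peval pv (gen_bracket \<epsilon> 7 12)"
  "br (gword 7) (gword 13) = peval pv (gen_bracket \<epsilon> 7 13)"
  "br (gword 7) (gword 14) = peval pv (gen_bracket \<epsilon> 7 14)"
  unfolding br_def gword_eqs gen_bracket_7 by (simp_all add: pv_eqs br_simps poly_norm)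

lemma br_8:
  "br (gword 8) (gword 9) = peval pv (gen_bracket \<epsilon> 8 9)"
  "br (gword 8) (gword 10) = peval pv (gen_bracket \<epsilon> 8 10)"
  "br (gword 8) (gword 11) = peval pv (gen_bracket \<epsilon> 8 11)"
  "br (gword 8) (gword 12) = peval pv (gen_bracket \<epsilon> 8 12)"
  "br (gword 8) (gword 13) = peval pv (gen_bracket \<epsilon> 8 13)"
  "br (gword 8) (gword 14) = peval pv (gen_bracket \<epsilon> 8 14)"
  unfolding br_def gword_eqs gen_bracket_8 by (simp_all add: pv_eqs br_simps poly_norm)

lemma br_9:
  "br (gword 9) (gword 10) = peval pv (gen_bracket \<epsilon> 9 10)"
  "br (gword 9) (gword 11) = peval pv (gen_bracket \<epsilon> 9 11)"
  "br (gword 9) (gword 12) = peval pv (gen_bracket \<epsilon> 9 12)"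
  "br (gword 9) (gword 13) = peval pv (gen_bracket \<epsilon> 9 13)"
  "br (gword 9) (gword 14) = peval pv (gen_bracket \<epsilon> 9 14)"
  unfolding br_def gword_eqs gen_bracket_9 by (simp_all add: pv_eqs br_simps poly_norm)

lemma br_10:
  "br (gword 10) (gword 11) = peval pv (gen_bracket \<epsilon> 10 11)"
  "br (gword 10) (gword 12) = peval pv (gen_bracket \<epsilon> 10 12)"
  "br (gword 10) (gword 13) = peval pv (gen_bracket \<epsilon> 10 13)"
  unfolding br_def gword_eqs gen_bracket_10 by (simp_all add: pv_eqs br_simps poly_norm)

lemma br_11:
  "br (gword 11) (gword 12) = peval pv (gen_bracket \<epsilon> 11 12)"
  "br (gword 11) (gword 14) = peval pv (gen_bracket \<epsilon> 11 14)"
  unfolding br_def gword_eqs gen_bracket_11 by (simp_all add: pv_eqs br_simps poly_norm)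

lemma br_12:
  "br (gword 12) (gword 13) = peval pv (gen_bracket \<epsilon> 12 13)"
  "br (gword 12) (gword 14) = peval pv (gen_bracket \<epsilon> 12 14)"
  unfolding br_def gword_eqs gen_bracket_12 by (simp_all add: pv_eqs br_simps poly_norm)

lemma br_13:
  "br (gword 13) (gword 14) = peval pv (gen_bracket \<epsilon> 13 14)"
  unfolding br_def gword_eqs gen_bracket_13 by (simp_all add: pv_eqs br_simps poly_norm)

lemma br_10_14:
  assumes "peval pv (r\<^sub>3\<^sub>3 \<epsilon>) = 0"
  shows "br (gword 10) (gword 14) = peval pv (gen_bracket \<epsilon> 10 14)"
proof -
  have "br (gword 10) (gword 14) = peval pv (gen_bracket \<epsilon> 10 14) + 4/5 * peval pv (r\<^sub>3\<^sub>3 \<epsilon>)"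
    unfolding br_def gword_eqs gen_bracket_10 r\<^sub>3\<^sub>3_def by (simp add: pv_eqs br_simps poly_norm)
  then show ?thesis using assms by simp
qed

lemma br_11_13:
  assumes "peval pv (r\<^sub>3\<^sub>3 \<epsilon>) = 0"
  shows "br (gword 11) (gword 13) = peval pv (gen_bracket \<epsilon> 11 13)"
proof -
  have "br (gword 11) (gword 13) = peval pv (gen_bracket \<epsilon> 11 13) + 2/5 * peval pv (r\<^sub>3\<^sub>3 \<epsilon>)"
    unfolding br_def gword_eqs gen_bracket_11 r\<^sub>3\<^sub>3_def by (simp add: pv_eqs br_simps poly_norm)
  then show ?thesis using assms by simp
qed

end

section \<open>Brackets of the generators on the variety\<close>

definition cproj :: "(4 epoly)^4^4 \<Rightarrow> (4 epoly)^4^4" where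
  "cproj M = M - smat (cst (1/4) * trace M) (mat 1)"

lemma quarter: "cst (1/4) * p * 4 = p" "4 * (cst (1/4) * p) = p"
proof -
  have "cst (1/4 * 4) * p = p" by simp
  then show "cst (1/4) * p * 4 = p" "4 * (cst (1/4) * p) = p"
    unfolding cst_mult cst_numeral by (simp_all only: mult_ac)
qed

lemma trace_cproj: "trace (cproj M) = 0"
  unfolding cproj_def trace_sub trace_smat trace_mat_1 quarter by simp

lemma cproj_cproj: "cproj (cproj M) = cproj M"
  unfolding cproj_def[of "cproj M"] trace_cproj by (rule mat_eqI) simp

lemma cproj_sum: "cproj (\<Sum>k\<in>S. f k) = (\<Sum>k\<in>S. cproj (f k))"
proof -
  have "cproj (A + B) = cproj A + cproj B" for A B
    unfolding cproj_def trace_add distrib_left by (rule mat_eqI) (simp add: algebra_simps)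
  moreover have "cproj 0 = 0" unfolding cproj_def trace_zero by (rule mat_eqI) simp
  ultimately show ?thesis by (induction S rule: infinite_finite_induct) auto
qed

lemma cproj_smat: "cproj (smat c M) = smat c (cproj M)"
  unfolding cproj_def trace_smat by (rule mat_eqI) (simp add: algebra_simps)

lemma trace_cproj_mult: "trace (cproj M ** N) = trace (M ** N) - cst (1/4) * (trace M * trace N)"
  by (simp add: cproj_def mm_diff_rdistrib mm_smat trace_sub trace_smat mult.assoc)

lemma mmap_derivation_cmat:
  assumes D: "derivation D" and "\<And>c. D (cst c) = 0"
  shows "mmap D (cmat l) = cproj (mmap D (gmat l))"
proof (rule mat_eqI)
  fix i j
  show "mmap D (cmat l) $ i $ j = cproj (mmap D (gmat l)) $ i $ j"
    by (simp add: cmat_def cproj_def derivation_diff[OF D] derivation_mult[OF D] assms(2) mat_nth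
      derivation_trace[OF D] derivation_0[OF D] derivation_1[OF D])
qed

text \<open>The derivative of centring is the projection to trace 0; being self-adjoint for the
  trace form, it can be moved to the other factor.\<close>

lemma grad_tw_cmat: "grad l (tw cmat u) = (\<Sum>k<length u. if u ! k = l then cproj (wmat cmat (wrest u k)) else 0)"
proof (rule mat_eqI)
  fix i j
  have *: "trace (mmap (pdiff (l, j, i)) (cmat l') ** M) = (if l' = l then cproj M $ i $ j else 0)" for l' M
  proof -
    have "mmap (pdiff (l, j, i)) (gmat l') = (if l' = l then \<chi> a b. if a = j \<and> b = i then 1 else 0 else 0)"
      by (rule mat_eqI) (auto simp: pdiff_var)
    moreover have "trace ((\<chi> a b. if a = j \<and> b = i then 1 else 0) :: (4 epoly)^4^4) = (if i = j then 1 else 0)"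
      using trace_unit_mult[of j i "mat 1"] by (simp add: mat_nth)
    ultimately show ?thesis
      unfolding mmap_derivation_cmat[OF derivation_pdiff pdiff_cst]
      by (simp add: trace_cproj_mult trace_unit_mult mm_zero trace_zero cproj_def[of M] mat_nth)
  qed
  have "grad l (tw cmat u) $ i $ j = (\<Sum>k<length u. if u ! k = l then cproj (wmat cmat (wrest u k)) $ i $ j else 0)"
    by (simp add: grad_def derivation_tw[OF derivation_pdiff] *)
  also have "\<dots> = (\<Sum>k<length u. if u ! k = l then cproj (wmat cmat (wrest u k)) else 0) $ i $ j"
    unfolding sum_component by (intro sum.cong refl) simp
  finally show "grad l (tw cmat u) $ i $ j = \<dots>" .
qed

lemma mmap_pb_cmat:
  "mmap (pb (tw cmat u)) (cmat l) = (\<Sum>k<length u. smat (cst (\<omega> (u ! k) l)) (cproj (wmat cmat (wrest u k))))"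
proof -
  have if_cproj: "cproj (if b then cproj M else 0) = (if b then cproj M else 0)" for b M
    using cproj_smat[of 0 0] by (auto simp: cproj_cproj smat_def) (rule mat_eqI, simp add: cproj_def trace_zero)
  have neg: "cproj (- M) = - cproj M" for M
    unfolding cproj_def trace_uminus by (rule mat_eqI) simp
  have D: "mmap (pb (tw cmat u)) (cmat l) = cproj (mmap (pb (tw cmat u)) (gmat l))" for l
    by (intro mmap_derivation_cmat derivation_pb pb_cst)
  have m1: "smat (- 1) M = - M" for M :: "(4 epoly)^4^4" by (rule mat_eqI) simp
  have e: "smat (cst (\<omega> (u ! k) LX)) M = - (if u ! k = LY then M else 0)"
    "smat (cst (\<omega> (u ! k) LY)) M = (if u ! k = LX then M else 0)" for k and M :: "(4 epoly)^4^4"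
    by (cases "u ! k"; rule mat_eqI; simp add: cst_uminus)+
  show ?thesis
  proof (cases l)
    case LX
    then show ?thesis by (simp add: D mmap_pb_gmat grad_tw_cmat neg cproj_sum if_cproj e sum_negf)
  next
    case LY
    then show ?thesis by (simp add: D mmap_pb_gmat grad_tw_cmat cproj_sum if_cproj e)
  qed
qed

lemma pb_tw_cmat: "pb (tw cmat u) (tw cmat v) = (\<Sum>k<length u. \<Sum>m<length v. cst (\<omega> (u ! k) (v ! m)) *
    (tw cmat (wrest u k @ wrest v m) - cst (1/4) * (tw cmat (wrest u k) * tw cmat (wrest v m))))"
  unfolding derivation_tw[OF derivation_pb] mmap_pb_cmat mm_sum_left trace_sum mm_smat trace_smat trace_cproj_mult
  unfolding tw_def wmat_append by (rule sum.swap)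

lemma pb_trace_gmat:
  "pb (trace (gmat l)) (tw cmat v) = 0" "pb (trace (gmat LX)) (trace (gmat LY)) = (4 :: 4 epoly)"
proof -
  have w: "trace (gmat l) = wpoly [l]" for l by (simp add: wpoly_def tw_def)
  have g: "grad l' (trace (gmat l)) = (if l = l' then mat 1 else 0 :: (4 epoly)^4^4)" for l l'
  proof -
    have "smat 1 M = M" for M :: "(4 epoly)^4^4" by (rule mat_eqI) simp
    then show ?thesis using grad_power[of l' 1 l, where 'a = 4] by (simp add: w)
  qed
  have p1: "cproj (mat 1) = 0" "cproj 0 = 0" "cproj (- mat 1) = 0"
    unfolding cproj_def trace_uminus trace_mat_1 trace_zero by (rule mat_eqI, simp add: quarter(1)[of 1, simplified])+
  have "mmap (pb (trace (gmat l))) (cmat l') = 0" for l'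
    unfolding mmap_derivation_cmat[OF derivation_pb pb_cst(2)]
    by (cases l'; cases l) (simp_all add: mmap_pb_gmat g p1)
  then show "pb (trace (gmat l)) (tw cmat v) = 0"
    by (simp add: derivation_tw[OF derivation_pb] mm_zero trace_zero)
  show "pb (trace (gmat LX)) (trace (gmat LY)) = (4 :: 4 epoly)"
    unfolding derivation_trace[OF derivation_pb] mmap_pb_gmat g by (simp add: trace_mat_1)
qed

lemma pb_numeral: "pb p (numeral n) = 0"
  using pb_cst(2)[of p "numeral n"] by (simp add: cst_numeral)

lemma pb_self: "pb p p = 0"
proof -
  have "pb p p + pb p p = 0" by (subst pb_antisym) simp
  then have "cst 2 * pb p p = cst 2 * 0" by (simp add: cst_numeral)
  then show ?thesis using cst_inverse_cancel[of 2 "pb p p"] by (metis mult_zero_right zero_neq_numeral)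
qed

lemma derivation_csubst:
  assumes D: "derivation D" "\<And>c. D (cst c) = 0" and A: "finite A" "P \<in> polys_in A"
  shows "D (poly_subst cst x P) = (\<Sum>i\<in>A. poly_subst cst x (pdiff i P) * D (x i))"
  using A(2)
proof (induction rule: polys_in_induct)
  case (const c)
  then show ?case by (simp add: csubst_simps pdiff_cst D(2))
next
  case (var j)
  have "(\<Sum>i\<in>A. poly_subst cst x (pdiff i (\<a> j)) * D (x i)) = (\<Sum>i\<in>A. if i = j then D (x j) else 0)"
    by (rule sum.cong) (auto simp: pdiff_var csubst_simps)
  then show ?case using var A(1) by (simp add: csubst_simps)
next
  case (add p q)
  then show ?case by (simp add: csubst_simps pdiff_add derivation_add[OF D(1)] distrib_right sum.distrib)
next
  case (mult p q)
  then show ?case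
    by (simp add: csubst_simps pdiff_mult derivation_mult[OF D(1)] algebra_simps sum.distrib sum_distrib_left)
qed

lemma pb_gsub:
  assumes "P \<in> polys_in {1..14}" "R \<in> polys_in {1..14}"
  shows "pb (gsub P) (gsub R) = (\<Sum>i\<in>{1..14}. \<Sum>j\<in>{1..14}. gsub (pdiff i P) * gsub (pdiff j R) * pb (gpoly i) (gpoly j))"
proof -
  have 1: "pb p (gsub R) = (\<Sum>j\<in>{1..14}. gsub (pdiff j R) * pb p (gpoly j))" for p
    by (rule derivation_csubst[OF derivation_pb pb_cst(2) _ assms(2)]) simp
  have 2: "pb p (gsub P) = (\<Sum>j\<in>{1..14}. gsub (pdiff j P) * pb p (gpoly j))" for p
    by (rule derivation_csubst[OF derivation_pb pb_cst(2) _ assms(1)]) simp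
  have "pb (gsub P) (gpoly j) = (\<Sum>i\<in>{1..14}. gsub (pdiff i P) * pb (gpoly i) (gpoly j))" for j
    unfolding pb_antisym[of "gsub P"] pb_antisym[of _ "gpoly j"] 2 by (simp add: sum_negf)
  then show ?thesis unfolding 1 by (subst sum.swap) (simp add: sum_distrib_left mult_ac)
qed

lemma trace_minors:
  fixes Q M N :: "'r::comm_ring_1^'n^'n"
  assumes "\<And>i j k l. Q $ i $ j * Q $ k $ l = Q $ k $ j * Q $ i $ l"
  shows "trace (Q ** M ** Q ** N) = trace (Q ** M) * trace (Q ** N)"
proof -
  have 1: "trace (Q ** M ** Q ** N) = (\<Sum>i\<in>UNIV. \<Sum>l\<in>UNIV. \<Sum>k\<in>UNIV. \<Sum>j\<in>UNIV. Q $ i $ j * M $ j $ k * Q $ k $ l * N $ l $ i)"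
    unfolding trace_def mm_nth sum_distrib_right ..
  have 2: "trace (Q ** N) * trace (Q ** M) = (\<Sum>i\<in>UNIV. \<Sum>l\<in>UNIV. \<Sum>k\<in>UNIV. \<Sum>j\<in>UNIV. (Q $ i $ l * N $ l $ i) * (Q $ k $ j * M $ j $ k))"
    unfolding trace_def mm_nth sum_distrib_right unfolding sum_distrib_left ..
  have "Q $ i $ j * M $ j $ k * Q $ k $ l * N $ l $ i = (Q $ i $ l * N $ l $ i) * (Q $ k $ j * M $ j $ k)" for i j k l
  proof -
    have "Q $ i $ j * M $ j $ k * Q $ k $ l * N $ l $ i = (Q $ i $ j * Q $ k $ l) * (M $ j $ k * N $ l $ i)" by (simp only: mult_ac)
    then show ?thesis unfolding assms[of i j k l] by (simp only: mult_ac)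
  qed
  then show ?thesis unfolding mult.commute[of "trace (Q ** M)"] 1 2 by (simp only:)
qed

lemma gen_bracket_1_2: "gen_bracket \<epsilon> 1 2 = 4"
  unfolding gen_bracket_def bracket_table_def Let_def by (simp only: gen_bracket_eval)

lemma gen_bracket_linear: "i = 1 \<or> i = 2 \<Longrightarrow> j \<in> {3..14} \<Longrightarrow> gen_bracket \<epsilon> i j = 0"
proof -
  have N: "map_of (bracket_table \<epsilon>) (k, l) = None" "map_of (bracket_table \<epsilon>) (l, k) = None" if "k = 1 \<or> k = 2" "3 \<le> l" for k l
    using that unfolding map_of_eq_None_iff bracket_table_def by auto
  assume ij: "i = 1 \<or> i = 2" "j \<in> {3..14}"
  have "3 \<le> swap_index j" using ij(2) by (elim index_cases) (simp_all add: swap_index_simps)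
  moreover have "swap_index i = i" using ij(1) by (elim disjE) (simp_all only: swap_index_simps)
  moreover have "3 \<le> j" using ij(2) by simp
  ultimately show ?thesis using N[of i j] N[of i "swap_index j"] ij(1) by (simp add: gen_bracket_def)
qed

lemma pb_linear:
  assumes "i = 1 \<or> i = 2" "j \<in> {3..14}" shows "pb (gpoly i) (gpoly j) = 0"
  using assms by (auto simp: gpoly_def pb_trace_gmat)

text \<open>One formula for the generator of I at \<epsilon> = 1 and the generator of J at
  \<epsilon> = 0.\<close>

definition rel :: "complex \<Rightarrow> nat mpoly" where
  "rel \<epsilon> = r\<^sub>0 + cst (8 * \<epsilon>) * \<a> 3"

lemma rel_polys_in: "rel \<epsilon> \<in> polys_in {3..14}"
  unfolding rel_def by (intro polys_in_intros r0_polys_in) auto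

context reducible_variety
begin

lemma eps_cases: "\<epsilon> = 0 \<or> \<epsilon> = 1"
  using comm_cases by auto

lemma word_traces_at:
  assumes z: "z \<in> V"
  shows "word_traces (\<lambda>l. mmap (ev z) (cmat l)) (mmap (ev z) comm + mat \<epsilon>) \<epsilon>"
proof
  note rm = ring_map_ev[of z]
  show "trace (mmap (ev z) (cmat l)) = 0" for l
    unfolding ring_map_trace[OF rm, symmetric] trace_cmat by (rule ring_map_0[OF rm])
  have "mmap (ev z) (cmat LX) ** mmap (ev z) (cmat LY) - mmap (ev z) (cmat LY) ** mmap (ev z) (cmat LX) = mmap (ev z) comm"
    unfolding cmat_comm[symmetric] mmap_mult[OF rm, symmetric] by (rule mat_eqI) (simp add: ring_map_diff[OF rm])
  then show "mmap (ev z) (cmat LX) ** mmap (ev z) (cmat LY) - mmap (ev z) (cmat LY) ** mmap (ev z) (cmat LX) =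
      mmap (ev z) comm + mat \<epsilon> - mat \<epsilon>" by simp
  have "trace (comm :: (4 epoly)^4^4) = 0"
    by (simp add: comm_def trace_sub trace_mul_sym[of "gmat LX"])
  then show "trace (mmap (ev z) comm + mat \<epsilon>) = 4 * \<epsilon>"
    by (simp add: trace_add ring_map_trace[OF rm, symmetric] ring_map_0[OF rm] mat_smat[of \<epsilon>] trace_smat trace_I)
  show "\<epsilon> = 0 \<or> \<epsilon> = 1" by (rule eps_cases)
  let ?Q = "mmap (ev z) comm + mat \<epsilon>"
  have "?Q $ i $ j * ?Q $ k $ l = ?Q $ k $ j * ?Q $ i $ l" for i j k l
    using comm_cases
  proof (elim disjE conjE)
    assume e: "\<epsilon> = 0" and c: "\<forall>i j. comm $ i $ j \<in> vanish V"
    have "?Q $ i $ j = 0" for i j using c z by (simp add: e vanish_def mat_nth)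
    then show ?thesis by simp
  next
    assume e: "\<epsilon> = 1" and c: "\<forall>i j k l. (comm + mat 1) $ i $ j * (comm + mat 1) $ k $ l - (comm + mat 1) $ k $ j * (comm + mat 1) $ i $ l \<in> vanish V"
    have "?Q $ i $ j = ev z ((comm + mat 1) $ i $ j)" for i j
      by (simp add: e mat_nth ring_map_add[OF rm] ring_map_0[OF rm] ring_map_1[OF rm])
    moreover have "ev z ((comm + mat 1) $ i $ j * (comm + mat 1) $ k $ l - (comm + mat 1) $ k $ j * (comm + mat 1) $ i $ l) = 0"
      using c z unfolding vanish_def by blast
    ultimately show ?thesis by (simp only: ring_map_diff[OF rm] ring_map_mult[OF rm] right_minus_eq)
  qed
  then show "trace (?Q ** M ** ?Q ** N) = trace (?Q ** M) * trace (?Q ** N)" for M N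
    by (rule trace_minors)
qed

text \<open>The alternative in the last hypothesis breaks a circle: two tabulated brackets rely on
  the vanishing of \<open>r\<^sub>3\<^sub>3\<close>, which \<open>r33_vanish\<close> derives from
  brackets with a_5 only.\<close>

lemma gen_bracket_table:
  assumes z: "z \<in> V" and ij: "i \<in> {3..14}" "j \<in> {3..14}"
    and r33: "ev z (gsub (r\<^sub>3\<^sub>3 \<epsilon>)) = 0 \<or> {i, j} \<notin> {{10, 14}, {11, 13}}"
  shows "ev z (pb (gpoly i) (gpoly j)) = ev z (gsub (gen_bracket \<epsilon> i j))"
proof -
  interpret W: word_traces "\<lambda>l. mmap (ev z) (cmat l)" "mmap (ev z) comm + mat \<epsilon>" \<epsilon>
    by (rule word_traces_at[OF z])
  note rm = ring_map_ev[of z]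
  have T: "ev z (tw cmat w) = W.T w" for w by (simp add: W.T_def ring_map_tw[OF rm])
  have pv: "W.pv i = ev z (gpoly i)" if "i \<in> {3..14}" for i
    using that by (auto simp: W.pv_def gpoly_def T)
  have sub: "ev z (gsub P) = peval W.pv P" if "P \<in> polys_in {3..14}" for P
    unfolding peval_csubst by (rule poly_subst_cong[OF ring_map_id that]) (simp add: pv)
  have br: "ev z (pb (gpoly i) (gpoly j)) = W.br (gword i) (gword j)" if "i \<in> {3..14}" "j \<in> {3..14}" for i j
    using that by (auto simp: gpoly_def pb_tw_cmat W.br_def T peval_simps ring_map_sum[OF rm])
  have r: "peval W.pv (r\<^sub>3\<^sub>3 \<epsilon>) = 0" if "ev z (gsub (r\<^sub>3\<^sub>3 \<epsilon>)) = 0"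
    using that sub[of "r\<^sub>3\<^sub>3 \<epsilon>"] unfolding r\<^sub>3\<^sub>3_def by (simp add: polys_in_intros)
  have less: "W.br (gword i) (gword j) = peval W.pv (gen_bracket \<epsilon> i j)"
    if "i \<in> {3..14}" "j \<in> {3..14}" "i < j" "ev z (gsub (r\<^sub>3\<^sub>3 \<epsilon>)) = 0 \<or> {i, j} \<notin> {{10, 14}, {11, 13}}" for i j
    using that(1,2)
    by (elim index_cases; use that(3,4) in \<open>simp add: W.br_3 W.br_4 W.br_5 W.br_6 W.br_7 W.br_8 W.br_9 W.br_10 W.br_11 W.br_12 W.br_13
      W.br_10_14 W.br_11_13 r doubleton_eq_iff\<close>)
  consider "i < j" | "i = j" | "j < i" by linarith
  then show ?thesis
  proof cases
    case 1
    then show ?thesis using less[OF ij 1 r33] br[OF ij] sub[OF gen_bracket_polys_in[OF ij]] by simp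
  next
    case 2
    then show ?thesis by (simp add: pb_self csubst_simps)
  next
    case 3
    have "ev z (pb (gpoly j) (gpoly i)) = ev z (gsub (gen_bracket \<epsilon> j i))"
      using less[OF ij(2,1) 3] r33 br[OF ij(2,1)] sub[OF gen_bracket_polys_in[OF ij(2,1)]] by (simp add: insert_commute)
    then show ?thesis unfolding pb_antisym[of "gpoly i"] gen_bracket_antisym[of _ i]
      by (simp add: peval_simps csubst_simps)
  qed
qed

lemma rel_vanish: "gsub (rel \<epsilon>) \<in> vanish V"
  unfolding vanish_def
proof (intro CollectI ballI)
  fix z assume z: "z \<in> V"
  interpret W: word_traces "\<lambda>l. mmap (ev z) (cmat l)" "mmap (ev z) comm + mat \<epsilon>" \<epsilon>
    by (rule word_traces_at[OF z])
  have "ev z (gpoly i) = W.T (gword i)" if "i \<in> {3..14}" for i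
    using that by (auto simp: gpoly_def W.T_def ring_map_tw[OF ring_map_ev])
  then show "ev z (gsub (rel \<epsilon>)) = 0"
    unfolding peval_csubst rel_def r0_eq using W.T_r1
    by (simp add: peval_simps gword_eqs algebra_simps power2_eq_square)
qed

text \<open>Bracketing the relation \<open>rel \<epsilon>\<close> with a_5 gives 4 times
  \<open>r\<^sub>3\<^sub>3\<close> on V, and brackets of relations with invariants vanish on
  V.\<close>

lemma r33_vanish: "z \<in> V \<Longrightarrow> ev z (gsub (r\<^sub>3\<^sub>3 \<epsilon>)) = 0"
proof -
  assume z: "z \<in> V"
  have "pb (gsub (rel \<epsilon>)) (gpoly 5) \<in> vanish V"
    by (rule pb_vanish[OF gsub_talg rel_vanish gpoly_talg])
  then have 0: "ev z (pb (gpoly 5) (gsub (rel \<epsilon>))) = 0"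
    using z unfolding pb_antisym[of "gpoly 5"] vanish_def by (simp add: peval_simps)
  have g: "ev z (pb (gpoly 5) (gpoly j)) = ev z (gsub (gen_bracket \<epsilon> 5 j))" if "j \<in> {3..14}" for j
    by (rule gen_bracket_table[OF z _ that]) (auto simp: doubleton_eq_iff)
  have "4 * ev z (gsub (r\<^sub>3\<^sub>3 \<epsilon>)) = - ev z (pb (gpoly 5) (gsub (rel \<epsilon>)))"
    by (simp add: rel_def r0_eq r\<^sub>3\<^sub>3_def csubst_simps pb_add_right pb_mult_right derivation_diff[OF derivation_pb] pb_cst
      power2_eq_square power3_eq_cube peval_simps pb_numeral g gen_bracket_antisym[of \<epsilon> 5 3] gen_bracket_antisym[of \<epsilon> 5 4] gen_bracket_values algebra_simps)
  then show ?thesis using 0 by simp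
qed

theorem pb_gpoly:
  assumes z: "z \<in> V" and ij: "i \<in> {1..14}" "j \<in> {1..14}"
  shows "ev z (pb (gpoly i) (gpoly j)) = ev z (gsub (gen_bracket \<epsilon> i j))"
proof -
  have split: "k = 1 \<or> k = 2 \<or> k \<in> {3..14}" if "k \<in> {1..14}" for k :: nat using that by auto
  have anti: "ev z (pb (gpoly i) (gpoly j)) = ev z (gsub (gen_bracket \<epsilon> i j))"
    if "ev z (pb (gpoly j) (gpoly i)) = ev z (gsub (gen_bracket \<epsilon> j i))" for i j
    unfolding pb_antisym[of "gpoly i"] gen_bracket_antisym[of _ i] using that by (simp add: peval_simps csubst_simps)
  have 12: "ev z (pb (gpoly 1) (gpoly 2)) = ev z (gsub (gen_bracket \<epsilon> 1 2))"
    unfolding gen_bracket_1_2 by (simp add: gpoly_def pb_trace_gmat csubst_simps)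
  have lin: "ev z (pb (gpoly k) (gpoly l)) = ev z (gsub (gen_bracket \<epsilon> k l))" if "k = 1 \<or> k = 2" "l \<in> {3..14}" for k l
    using that by (simp only: pb_linear gen_bracket_linear) (simp add: csubst_simps)
  have same: "ev z (pb (gpoly k) (gpoly k)) = ev z (gsub (gen_bracket \<epsilon> k k))" for k
    by (simp add: pb_self csubst_simps)
  show ?thesis
  proof (cases "i \<in> {3..14}"; cases "j \<in> {3..14}")
    assume "i \<in> {3..14}" "j \<in> {3..14}"
    then show ?thesis using gen_bracket_table[OF z] r33_vanish[OF z] by blast
  next
    assume "i \<in> {3..14}" "j \<notin> {3..14}"
    then show ?thesis using anti[OF lin] split[OF ij(2)] by blast
  next
    assume "i \<notin> {3..14}" "j \<in> {3..14}"
    then show ?thesis using lin split[OF ij(1)] by blast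
  next
    assume "i \<notin> {3..14}" "j \<notin> {3..14}"
    then have "i = 1 \<or> i = 2" "j = 1 \<or> j = 2" using split ij by blast+
    then show ?thesis using 12 anti[OF 12] same by blast
  qed
qed

theorem pb_gsub_bracket:
  assumes "z \<in> V" "P \<in> polys_in {1..14}" "R \<in> polys_in {1..14}"
  shows "ev z (pb (gsub P) (gsub R)) = ev z (gsub (poly_bracket \<epsilon> P R))"
  unfolding pb_gsub[OF assms(2,3)] poly_bracket_def
  by (simp add: ring_map_sum[OF ring_map_poly_subst[OF ring_map_cst]] csubst_simps ring_map_sum[OF ring_map_ev] peval_simps pb_gpoly[OF assms(1)])

end

section \<open>Calogero-Moser pairs and commuting pairs as reducible varieties\<close>

lemma rank_1_iff:
  fixes M :: "complex^'n^'m"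
  shows "rank M = 1 \<longleftrightarrow> M \<noteq> 0 \<and> (\<exists>c b. \<forall>i j. M $ i $ j = c i * b j)"
proof
  assume r: "rank M = 1"
  obtain B where B: "B \<subseteq> rows M" "vec.independent B" "rows M \<subseteq> vec.span B" "card B = vec.dim (rows M)"
    using vec.basis_exists by blast
  then obtain b where b: "B = {b}" using r by (auto simp: row_rank_def_gen card_1_singleton_iff)
  have "\<exists>k. row i M = k *s b" for i
    using B(3) by (auto simp: b vec.span_singleton rows_def)
  then obtain c where c: "\<And>i. row i M = c i *s b" by metis
  have "M $ i $ j = c i * b $ j" for i j
    using arg_cong[OF c[of i], of "\<lambda>v. v $ j"] by (simp add: row_def)
  moreover have "M \<noteq> 0"
  proof
    assume "M = 0"
    then have "rows M \<subseteq> {0}" by (auto simp: rows_def row_def vec_eq_iff)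
    then have "b = 0" using B(1) by (auto simp: b)
    then show False using B(2) vec.dependent_zero by (auto simp: b)
  qed
  ultimately show "M \<noteq> 0 \<and> (\<exists>c b. \<forall>i j. M $ i $ j = c i * b j)" by blast
next
  assume "M \<noteq> 0 \<and> (\<exists>c b. \<forall>i j. M $ i $ j = c i * b j)"
  then obtain c b where M: "M \<noteq> 0" "\<And>i j. M $ i $ j = c i * b j" by blast
  have "rows M \<subseteq> vec.span {vec_lambda b}"
  proof
    fix v assume "v \<in> rows M"
    then obtain i where "v = c i *s vec_lambda b" by (auto simp: rows_def row_def M(2) vec_eq_iff)
    then show "v \<in> vec.span {vec_lambda b}" by (auto simp: vec.span_singleton)
  qed
  then have "vec.dim (rows M) \<le> 1" using vec.dim_le_card[of "rows M" "{vec_lambda b}"] by simp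
  moreover have "vec.dim (rows M) \<noteq> 0"
  proof
    assume "vec.dim (rows M) = 0"
    then have "row i M = 0" for i using vec.dim_eq_0[of "rows M"] by (auto simp: rows_def)
    then show False using M(1) by (simp add: row_def vec_eq_iff)
  qed
  ultimately show "rank M = 1" unfolding row_rank_def_gen by linarith
qed

lemma rank_1_conj:
  fixes M :: "complex^'n^'n"
  assumes "rank M = 1" "g ** h = mat 1" "h ** g = mat 1"
  shows "rank (g ** M ** h) = 1"
proof -
  obtain c b where M: "M \<noteq> 0" "\<And>i j. M $ i $ j = c i * b j" using assms(1) rank_1_iff by blast
  have "(g ** M ** h) $ i $ j = (\<Sum>k\<in>UNIV. g $ i $ k * c k) * (\<Sum>l\<in>UNIV. b l * h $ l $ j)" for i j
    unfolding mm_nth M(2) sum_distrib_right unfolding sum_distrib_left sum_distrib_right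
    by (subst sum.swap) (simp add: mult_ac)
  moreover have "g ** M ** h \<noteq> 0"
  proof
    assume "g ** M ** h = 0"
    then have "h ** (g ** M ** h) ** g = 0" by (simp add: mm_zero)
    moreover have "h ** (g ** M ** h) ** g = (h ** g) ** M ** (h ** g)" by (simp only: matrix_mul_assoc)
    ultimately show False using M(1) assms(3) by simp
  qed
  ultimately show ?thesis unfolding rank_1_iff by (intro conjI exI allI)
qed

lemma matrix_inv_cancel:
  fixes g :: "complex^'n^'n"
  assumes "invertible g" shows "g ** matrix_inv g = mat 1" "matrix_inv g ** g = mat 1"
  using assms matrix_inv_eqI by (metis invertible_def)+

definition bracket_of :: "('n::finite) mpair \<Rightarrow> complex^'n^'n" where
  "bracket_of z = fst z ** snd z - snd z ** fst z"

lemma bracket_of_conj: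
  assumes "invertible g"
  shows "bracket_of (conj_pair g z) = g ** bracket_of z ** matrix_inv g"
proof -
  have "matrix_inv g ** g = mat 1" using assms by (rule matrix_inv_cancel)
  then have "g ** A ** matrix_inv g ** (g ** B ** matrix_inv g) = g ** (A ** B) ** matrix_inv g" for A B
    by (metis matrix_mul_assoc matrix_mul_rid)
  then show ?thesis
    by (simp add: bracket_of_def conj_pair_def mm_diff_ldistrib mm_diff_rdistrib)
qed

lemma power_commute: "X ** wmat (\<lambda>_. X) w = wmat (\<lambda>_. X) w ** X"
proof (induction w)
  case (Cons l w)
  then have "X ** (X ** wmat (\<lambda>_. X) w) = X ** (wmat (\<lambda>_. X) w ** X)" by (rule arg_cong)
  then show ?case by (simp only: wmat_Cons matrix_mul_assoc)
qed simp

lemma bracket_of_shear: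
  "bracket_of (X, Y + smat t (wmat (\<lambda>_. X) w)) = bracket_of (X, Y)"
  "bracket_of (X + smat t (wmat (\<lambda>_. Y) w), Y) = bracket_of (X, Y)"
  by (simp_all add: bracket_of_def matrix_add_ldistrib mm_rdistrib mm_smat power_commute)

lemma bracket_of_translate:
  "bracket_of (X + smat s (mat 1), Y + smat t (mat 1)) = bracket_of (X, Y)"
  by (rule mat_eqI) (simp add: bracket_of_def matrix_add_ldistrib mm_rdistrib mm_smat algebra_simps)

lemma ev_comm: "ev z (comm $ i $ j) = bracket_of z $ i $ j"
proof -
  have "mmap (ev z) comm = bracket_of z"
    unfolding comm_def bracket_of_def
    by (rule mat_eqI) (simp add: mm_nth ring_map_sum[OF ring_map_ev] peval_simps entry_def)
  from arg_cong[OF this, of "\<lambda>M. M $ i $ j"] show ?thesis by simp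
qed

lemma CM_pairs_eq: "CM_pairs = {z. rank (bracket_of z + mat 1) = 1}"
  and commuting_pairs_eq: "commuting_pairs = {z. bracket_of z = 0}"
  by (auto simp: CM_pairs_def commuting_pairs_def bracket_of_def)

lemma reducible_CM: "reducible_variety CM_pairs 1"
proof
  show "conj_pair g z \<in> CM_pairs" if g: "invertible g" and z: "z \<in> CM_pairs" for g and z :: "4 mpair"
  proof -
    have gi: "g ** matrix_inv g = mat 1" "matrix_inv g ** g = mat 1" using g by (rule matrix_inv_cancel)+
    have "bracket_of (conj_pair g z) + mat 1 = g ** (bracket_of z + mat 1) ** matrix_inv g"
      unfolding bracket_of_conj[OF g] by (simp add: matrix_add_ldistrib mm_rdistrib gi)
    then show ?thesis using rank_1_conj[OF _ gi] z by (simp add: CM_pairs_eq)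
  qed
  have minor: "ev z ((comm + mat 1) $ i $ j * (comm + mat 1) $ k $ l - (comm + mat 1) $ k $ j * (comm + mat 1) $ i $ l) = 0"
    if z: "z \<in> CM_pairs" for z :: "4 mpair" and i j k l
  proof -
    obtain c b where "\<And>i j. (bracket_of z + mat 1) $ i $ j = c i * b j"
      using z unfolding CM_pairs_eq mem_Collect_eq rank_1_iff by blast
    moreover have "ev z ((comm + mat 1) $ i $ j) = (bracket_of z + mat 1) $ i $ j" for i j
      by (simp add: peval_simps ev_comm mat_nth)
    ultimately have e: "ev z ((comm + mat 1) $ i $ j) = c i * b j" for i j by simp
    show ?thesis unfolding ring_map_diff[OF ring_map_ev] ring_map_mult[OF ring_map_ev] e by simp
  qed
  show "(1::complex) = 0 \<and> (\<forall>i j. comm $ i $ j \<in> vanish (CM_pairs :: 4 mpair set)) \<or> (1::complex) = 1 \<and>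
      (\<forall>i j k l. (comm + mat 1) $ i $ j * (comm + mat 1) $ k $ l - (comm + mat 1) $ k $ j * (comm + mat 1) $ i $ l \<in> vanish (CM_pairs :: 4 mpair set))"
    unfolding vanish_def using minor by (simp del: vector_add_component)
qed (simp_all add: CM_pairs_eq bracket_of_shear bracket_of_translate)

lemma reducible_Com: "reducible_variety commuting_pairs 0"
proof
  show "conj_pair g z \<in> commuting_pairs" if g: "invertible g" and z: "z \<in> commuting_pairs" for g and z :: "4 mpair"
    using z by (simp add: commuting_pairs_eq bracket_of_conj[OF g] mm_zero)
  show "(0::complex) = 0 \<and> (\<forall>i j. comm $ i $ j \<in> vanish (commuting_pairs :: 4 mpair set)) \<or> (0::complex) = 1 \<and>
      (\<forall>i j k l. (comm + mat 1) $ i $ j * (comm + mat 1) $ k $ l - (comm + mat 1) $ k $ j * (comm + mat 1) $ i $ l \<in> vanish (commuting_pairs :: 4 mpair set))"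
    by (simp add: vanish_def ev_comm commuting_pairs_eq)
qed (simp_all add: commuting_pairs_eq bracket_of_shear bracket_of_translate)

lemma ev_gpoly: "i \<in> {1..14} \<Longrightarrow> ev z (gpoly i) = generator i z"
proof -
  assume i: "i \<in> {1..14}"
  obtain X Y where z: "z = (X, Y)" by fastforce
  let ?z = "(X - mat (trace X / 4), Y - mat (trace Y / 4))"
  have tr: "ev z (trace (gmat l)) = trace (letter_mat z l)" for l
    unfolding ring_map_trace[OF ring_map_ev] mmap_ev_gmat ..
  have "ev z (cmat l $ i $ j) = letter_mat z l $ i $ j - 1/4 * trace (letter_mat z l) * (if i = j then 1 else 0)" for l i j
    unfolding cmat_def by (simp add: peval_simps tr mat_nth) (simp add: entry_def)
  then have "mmap (ev z) (cmat l) = letter_mat ?z l" for l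
    by (cases l; intro mat_eqI; simp add: z mat_nth)
  then have "ev z (tw cmat w) = word_trace w ?z" for w
    by (simp only: ring_map_tw[OF ring_map_ev] word_trace_wmat) (simp only: tw_def)
  note w = this[unfolded z]
  have "i = 1 \<or> i = 2 \<or> i \<in> {3..14}" using i by auto
  then show ?thesis
  proof (elim disjE)
    assume "i \<in> {3..14}"
    then show ?thesis
      by (elim index_cases) (simp_all add: gpoly_def gword_eqs w generator_def z Let_def)
  qed (use tr[unfolded z] in \<open>simp_all add: gpoly_def generator_def z Let_def\<close>)
qed

lemma ev_gsub: "P \<in> polys_in {1..14} \<Longrightarrow> ev z (gsub P) = peval (\<lambda>i. generator i z) P"
  unfolding peval_csubst by (rule poly_subst_cong[OF ring_map_id]) (use ev_gpoly in blast)+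

lemma polys_in_inner: "P \<in> polys_in {3..14} \<Longrightarrow> P \<in> polys_in {1..14 :: nat}"
  by (erule polys_in_mono) auto

lemma relations_ideal_iff: "p \<in> relations_ideal V \<longleftrightarrow> p \<in> polys_in {3..14} \<and> gsub p \<in> vanish V"
  unfolding relations_ideal_def vanish_def using ev_gsub[OF polys_in_inner] by auto

text \<open>The relations form an ideal containing the generator, and \<open>pb_vanish\<close> makes
  it stable under the bracket, so minimality applies.\<close>

lemma (in reducible_variety) bracket_ideal_relations: "bracket_ideal \<epsilon> (rel \<epsilon>) \<subseteq> relations_ideal V"
proof (rule bracket_ideal_least)
  fix p f :: "nat mpoly" assume p: "p \<in> relations_ideal V" and f: "f \<in> polys_in {3..14}"
  have "ev z (gsub (poly_bracket \<epsilon> p f)) = 0" if z: "z \<in> V" for z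
  proof -
    have "pb (gsub p) (gsub f) \<in> vanish V" using p by (intro pb_vanish gsub_talg) (simp add: relations_ideal_iff)
    moreover have "p \<in> polys_in {1..14}" "f \<in> polys_in {1..14}"
      using p f polys_in_inner unfolding relations_ideal_iff by blast+
    ultimately show ?thesis using pb_gsub_bracket[OF z, of p f] z unfolding vanish_def by simp
  qed
  then show "poly_bracket \<epsilon> p f \<in> relations_ideal V"
    using p f by (simp add: relations_ideal_iff vanish_def poly_bracket_polys_in)
qed (auto simp: relations_ideal_iff csubst_simps vanish_0 rel_polys_in rel_vanish vanish_add vanish_mult intro: polys_in_intros)

lemma rel_eqs: "rel 1 = r\<^sub>1" "rel 0 = r\<^sub>1 - 8 * \<a> 3" "rel 0 = r\<^sub>0"
  by (simp_all add: rel_def r\<^sub>0_def cst_numeral)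

section \<open>Diagonal pairs and the two ideals of relations\<close>

definition dmat :: "('n \<Rightarrow> complex) \<Rightarrow> complex^'n^'n" where
  "dmat x = (\<chi> i j. if i = j then x i else 0)"

lemma dmat_nth [simp]: "dmat x $ i $ j = (if i = j then x i else 0)"
  by (simp add: dmat_def)

lemma dmat_mult: "(dmat x ** M) $ i $ j = x i * M $ i $ j" "(M ** dmat x) $ i $ j = M $ i $ j * x j"
proof -
  have "(\<Sum>k\<in>UNIV. (if i = k then x i else 0) * M $ k $ j) = (\<Sum>k\<in>UNIV. if k = i then x i * M $ i $ j else 0)"
    by (intro sum.cong refl) auto
  then show "(dmat x ** M) $ i $ j = x i * M $ i $ j" by (simp add: mm_nth)
  have "(\<Sum>k\<in>UNIV. M $ i $ k * (if k = j then x k else 0)) = (\<Sum>k\<in>UNIV. if k = j then M $ i $ j * x j else 0)"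
    by (intro sum.cong refl) auto
  then show "(M ** dmat x) $ i $ j = M $ i $ j * x j" by (simp add: mm_nth)
qed

lemma zpow_dmat: "zpow (dmat x) k = dmat (\<lambda>i. x i ^ k)"
  by (induction k) (auto intro!: mat_eqI simp: mat_nth dmat_mult)

lemma word_trace_dmat: "word_trace (gword i) (dmat x, dmat y) = psum x y i"
proof -
  have "wmat (letter_mat (dmat x, dmat y)) (gword i) = dmat (\<lambda>k. x k ^ xdeg i * y k ^ ydeg i)"
    by (rule mat_eqI) (simp add: gword_def wmat_append wmat_replicate zpow_dmat dmat_mult)
  then show ?thesis by (simp add: word_trace_wmat trace_def psum_def)
qed

lemma generator_traceless:
  assumes "i \<in> {3..14}" "trace X = 0" "trace Y = 0"
  shows "generator i (X, Y) = word_trace (gword i) (X, Y)"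
proof -
  have "mat 0 = (0 :: complex^4^4)" by (rule mat_eqI) (simp add: mat_nth)
  then show ?thesis
    using assms by (elim index_cases) (simp_all add: generator_def gword_eqs Let_def)
qed

lemma trace_dmat: "trace (dmat x) = (\<Sum>k\<in>UNIV. x k)"
  by (simp add: trace_def)

lemma peval_psum_relations:
  assumes "f \<in> relations_ideal commuting_pairs" "(\<Sum>k\<in>UNIV. x k) = 0" "(\<Sum>k\<in>UNIV. y k) = 0"
  shows "peval (psum x y) f = 0"
proof -
  have "(dmat x, dmat y) \<in> commuting_pairs"
    by (simp add: commuting_pairs_eq bracket_of_def) (rule mat_eqI, simp add: dmat_mult)
  then have "peval (\<lambda>i. generator i (dmat x, dmat y)) f = 0" "f \<in> polys_in {3..14}"
    using assms(1) by (auto simp: relations_ideal_def)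
  moreover have "generator i (dmat x, dmat y) = psum x y i" if "i \<in> {3..14}" for i
    using generator_traceless[OF that] assms(2,3) by (simp add: trace_dmat word_trace_dmat)
  ultimately show ?thesis using poly_subst_cong[OF ring_map_id, of f "{3..14}" "\<lambda>i. generator i (dmat x, dmat y)" "psum x y"] by simp
qed

lemma relJ_relations: "relJ \<subseteq> relations_ideal commuting_pairs"
  using reducible_variety.bracket_ideal_relations[OF reducible_Com] unfolding relJ_def rel_eqs(3) .

text \<open>In the normal form of f modulo J, the combination of the 24 basis elements vanishes on
  diagonal pairs together with f, so its coefficients are 0.\<close>

theorem relJ_criterion:
  assumes f: "f \<in> polys_in {3..14}"
    and zero: "\<And>x y. (\<Sum>k\<in>UNIV. x k) = 0 \<Longrightarrow> (\<Sum>k\<in>UNIV. y k) = 0 \<Longrightarrow> peval (psum x y) f = 0"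
  shows "f \<in> relJ"
proof -
  obtain p j where p: "\<And>b. p b \<in> polys_in pvars" and j: "j \<in> relJ" and f_eq: "f = (\<Sum>b\<in>basis_idx. p b * basis b) + j"
    using all_spanned[OF f] unfolding spanned_def by blast
  have "p b = 0" if "b \<in> basis_idx" for b
  proof (rule basis_independent[OF p _ that])
    fix x y :: "4 \<Rightarrow> complex" assume xy: "(\<Sum>k\<in>UNIV. x k) = 0" "(\<Sum>k\<in>UNIV. y k) = 0"
    have "peval (psum x y) j = 0" using j relJ_relations xy by (intro peval_psum_relations) auto
    moreover have "peval (psum x y) f = (\<Sum>b\<in>basis_idx. peval (psum x y) (p b) * peval (psum x y) (basis b)) + peval (psum x y) j"
      unfolding f_eq by (simp add: peval_simps ring_map_sum[OF ring_map_poly_subst[OF ring_map_id]])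
    ultimately show "(\<Sum>b\<in>basis_idx. peval (psum x y) (p b) * peval (psum x y) (basis b)) = 0"
      using zero[OF xy] by simp
  qed
  then show ?thesis using j by (simp add: f_eq)
qed

theorem relations_commuting: "bracket_ideal 0 (r\<^sub>1 - 8 * \<a> 3) = relations_ideal commuting_pairs"
proof -
  have "relations_ideal commuting_pairs \<subseteq> relJ"
    using peval_psum_relations by (auto intro!: relJ_criterion simp: relations_ideal_def)
  then show ?thesis using relJ_relations unfolding relJ_def r\<^sub>0_def by blast
qed

lemma isCont_peval:
  assumes "\<And>i. isCont (\<lambda>s. g s i) a"
  shows "isCont (\<lambda>s. peval (g s) f) (a :: complex)"
  by (induction f rule: mpoly_induct) (simp_all add: peval_simps assms)

lemma isCont_wmat:
  fixes M :: "complex \<Rightarrow> letter \<Rightarrow> complex^'n^'n"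
  assumes "\<And>l i j. isCont (\<lambda>s. M s l $ i $ j) a"
  shows "isCont (\<lambda>s. wmat (M s) w $ i $ j) a"
proof (induction w arbitrary: i j)
  case (Cons l w)
  have "isCont (\<lambda>s. \<Sum>k\<in>UNIV. M s l $ i $ k * wmat (M s) w $ k $ j) a"
    by (intro continuous_intros assms Cons)
  then show ?case by (simp add: mm_nth)
qed (simp add: mat_nth)

lemma isCont_zero_limit:
  fixes h :: "complex \<Rightarrow> complex"
  assumes "isCont h 0" "\<And>s. s \<noteq> 0 \<Longrightarrow> norm s < r \<Longrightarrow> h s = 0" "r > 0"
  shows "h 0 = 0"
proof -
  have "(h \<longlongrightarrow> h 0) (at 0)" using assms(1) by (simp add: isCont_def)
  moreover have "eventually (\<lambda>s. h s = 0) (at 0)"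
    unfolding eventually_at using assms(2,3) by (intro exI[of _ r]) (auto simp: dist_norm)
  then have "(h \<longlongrightarrow> 0) (at 0)" using tendsto_eventually by blast
  ultimately show ?thesis using LIM_unique by blast
qed

lemma word_trace_scale: "trace (wmat (\<lambda>l. smat t (M l)) w) = t ^ length w * trace (wmat M w)"
proof -
  have "wmat (\<lambda>l. smat t (M l)) w = smat (t ^ length w) (wmat M w)"
  proof (induction w)
    case Nil show ?case by (rule mat_eqI) simp
  next
    case (Cons l w)
    then show ?case by (simp add: mm_smat smat_smat mult.commute)
  qed
  then show ?thesis by (simp add: trace_smat)
qed

lemma wt_gword: "i \<in> {3..14} \<Longrightarrow> length (gword i) = wt i"
  by (elim index_cases) (simp_all add: gword_eqs wt_def)

text \<open>The leading form of a relation on the Calogero--Moser space vanishes at commuting diagonal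
  pairs: they are limits of the rescaled Calogero--Moser pairs.\<close>

lemma CM_leading_form:
  assumes f: "f \<in> relations_ideal CM_pairs" "f \<in> below (Suc d)"
    and x: "inj x" "(\<Sum>k\<in>UNIV. x k) = 0" and y: "(\<Sum>k\<in>UNIV. y k) = 0"
  shows "peval (psum x y) (hcomp d f) = 0"
proof -
  \<comment> \<open>The off-diagonal part of the classical Calogero-Moser matrix Y: it solves (x_i -
    x_j) N_ij = 1 for distinct i, j.\<close>
  define N :: "complex^4^4" where "N = (\<chi> i j. if i = j then 0 else 1 / (x i - x j))"
  define M where "M s l = (case l of LX \<Rightarrow> dmat x | LY \<Rightarrow> dmat y + smat s N)" for s l
  define g where "g s i = trace (wmat (M s) (gword i))" for s i
  have fin: "f \<in> polys_in {3..14}" using f(1) by (simp add: relations_ideal_def)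
  have k: "keys m \<subseteq> {3..14}" "mdeg wt m \<le> d" if "m \<in> keys f" for m
    using that fin f(2) by (auto simp: polys_in_def below_def less_Suc_eq_le)
  \<comment> \<open>For nonzero u this is u^d times the value of f at the pair scaled by 1/u; terms
    of degree below d keep a positive power of u.\<close>
  define G where "G u = (\<Sum>m\<in>keys f. lookup f m * u ^ (d - mdeg wt m) * (\<Prod>i\<in>keys m. g (u ^ 2) i ^ lookup m i))" for u
  have zero: "G u = 0" if u: "u \<noteq> 0" for u
  proof -
    \<comment> \<open>The two factors 1/u cancel against u^2, which is why N enters with u^2: off
      the diagonal the commutator is 1, and adding the identity gives the matrix of ones.\<close>
    let ?X = "smat (1 / u) (dmat x)" and ?Y = "smat (1 / u) (dmat y + smat (u ^ 2) N)"
    have "bracket_of (?X, ?Y) + mat 1 = (\<chi> i j. 1)"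
    proof (rule mat_eqI)
      fix i j
      have "x i - x j \<noteq> 0" if "i \<noteq> j" using x(1) that by (auto dest: injD)
      then show "(bracket_of (?X, ?Y) + mat 1) $ i $ j = (\<chi> i j. 1) $ i $ j"
        using u by (simp add: bracket_of_def mm_smat smat_smat dmat_mult mat_nth N_def)
          (simp add: power2_eq_square divide_simps)
    qed
    moreover have "rank ((\<chi> i j. 1) :: complex^4^4) = 1"
      unfolding rank_1_iff by (auto simp: vec_eq_iff intro!: exI[of _ "\<lambda>_. 1"])
    ultimately have "(?X, ?Y) \<in> CM_pairs" by (simp add: CM_pairs_eq)
    then have "peval (\<lambda>i. generator i (?X, ?Y)) f = 0" using f(1) by (simp add: relations_ideal_def)
    moreover have "generator i (?X, ?Y) = (1 / u) ^ wt i * g (u ^ 2) i" if i: "i \<in> {3..14}" for i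
    proof -
      have "trace N = 0" by (simp add: trace_def N_def)
      then have "generator i (?X, ?Y) = word_trace (gword i) (?X, ?Y)"
        using x(2) y by (intro generator_traceless i) (simp_all add: trace_smat trace_add trace_dmat)
      moreover have "letter_mat (?X, ?Y) = (\<lambda>l. smat (1 / u) (M (u ^ 2) l))"
      proof
        fix l show "letter_mat (?X, ?Y) l = smat (1 / u) (M (u ^ 2) l)" by (cases l) (simp_all add: M_def)
      qed
      then have "word_trace (gword i) (?X, ?Y) = (1 / u) ^ wt i * g (u ^ 2) i"
        unfolding word_trace_wmat by (simp only: word_trace_scale wt_gword[OF i] g_def)
      ultimately show ?thesis by simp
    qed
    ultimately have "peval (\<lambda>i. (1 / u) ^ wt i * g (u ^ 2) i) f = 0"
      using poly_subst_cong[OF ring_map_id fin, of "\<lambda>i. generator i (?X, ?Y)" "\<lambda>i. (1 / u) ^ wt i * g (u ^ 2) i"] by simp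
    then have "u ^ d * (\<Sum>m\<in>keys f. lookup f m * (\<Prod>i\<in>keys m. ((1 / u) ^ wt i * g (u ^ 2) i) ^ lookup m i)) = 0"
      by (simp add: poly_subst_def)
    moreover have "u ^ d * (lookup f m * (\<Prod>i\<in>keys m. ((1 / u) ^ wt i * g (u ^ 2) i) ^ lookup m i)) =
        lookup f m * u ^ (d - mdeg wt m) * (\<Prod>i\<in>keys m. g (u ^ 2) i ^ lookup m i)" if "m \<in> keys f" for m
    proof -
      have "(\<Prod>i\<in>keys m. ((1 / u) ^ wt i * g (u ^ 2) i) ^ lookup m i) = (1 / u) ^ mdeg wt m * (\<Prod>i\<in>keys m. g (u ^ 2) i ^ lookup m i)"
        by (simp only: power_mult_distrib prod.distrib mdeg_def power_sum power_mult)
      moreover have "u ^ d * (1 / u) ^ mdeg wt m = u ^ (d - mdeg wt m)"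
        using u k(2)[OF that] by (simp add: power_diff power_one_over)
      ultimately show ?thesis by (simp add: mult_ac)
    qed
    ultimately show ?thesis unfolding G_def sum_distrib_left by simp
  qed
  have "isCont (\<lambda>u. M (u ^ 2) l $ i $ j) 0" for l i j
    by (cases l) (simp_all add: M_def)
  then have "isCont (\<lambda>u. wmat (M (u ^ 2)) w $ i $ j) 0" for w i j by (rule isCont_wmat)
  then have "isCont (\<lambda>u. g (u ^ 2) i) 0" for i
    unfolding g_def trace_def by (rule continuous_sum)
  then have "isCont G 0" unfolding G_def by (intro continuous_intros) auto
  then have "G 0 = 0" by (rule isCont_zero_limit[of _ 1]) (use zero in auto)
  have g0: "g 0 i = psum x y i" for i
  proof -
    have "M 0 = letter_mat (dmat x, dmat y)"
    proof
      fix l show "M 0 l = letter_mat (dmat x, dmat y) l"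
        by (cases l) (simp_all add: M_def smat_0 vec_eq_iff)
    qed
    then show ?thesis using word_trace_dmat by (simp add: g_def word_trace_wmat)
  qed
  have "peval (psum x y) (hcomp d f) = (\<Sum>m\<in>keys f. lookup (hcomp d f) m * (\<Prod>i\<in>keys m. psum x y i ^ lookup m i))"
    by (rule poly_subst_superset) (auto simp: lookup_hcomp in_keys_iff split: if_splits)
  also have "\<dots> = G 0"
    unfolding G_def
  proof (intro sum.cong refl)
    fix m assume "m \<in> keys f"
    \<comment> \<open>At u = 0 the convention 0^0 = 1 selects exactly the terms of degree d.\<close>
    then have "mdeg wt m = d \<or> mdeg wt m < d" using k(2) by (simp add: order_le_less disj_commute)
    then show "lookup (hcomp d f) m * (\<Prod>i\<in>keys m. psum x y i ^ lookup m i) =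
        lookup f m * 0 ^ (d - mdeg wt m) * (\<Prod>i\<in>keys m. g (0\<^sup>2) i ^ lookup m i)"
      by (auto simp: lookup_hcomp g0)
  qed
  finally show ?thesis using \<open>G 0 = 0\<close> by simp
qed

lemma unit4_inj: "inj unit4"
  unfolding inj_def forall_4 unit4_simps by (simp add: complex_eq_iff)

theorem relations_CM: "bracket_ideal 1 r\<^sub>1 = relations_ideal CM_pairs"
proof
  show sub: "bracket_ideal 1 r\<^sub>1 \<subseteq> relations_ideal CM_pairs"
    using reducible_variety.bracket_ideal_relations[OF reducible_CM] unfolding rel_eqs(1) .
  show "relations_ideal CM_pairs \<subseteq> bracket_ideal 1 r\<^sub>1"
  proof (rule bracket_ideal_from_leading_forms[OF sub])
    show "p - q \<in> relations_ideal CM_pairs" if "p \<in> relations_ideal CM_pairs" "q \<in> relations_ideal CM_pairs" for p q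
      using that by (auto simp: relations_ideal_def peval_simps polys_in_diff)
  next
    fix f d assume f: "f \<in> relations_ideal CM_pairs" "f \<in> below (Suc d)"
    show "hcomp d f \<in> relJ"
    proof (rule relJ_criterion)
      show "hcomp d f \<in> polys_in {3..14}"
      proof -
        have "keys (hcomp d f) \<subseteq> keys f" by (auto simp: in_keys_iff lookup_hcomp split: if_splits)
        then show ?thesis using f(1) unfolding relations_ideal_def polys_in_def by blast
      qed
    next
      fix x y :: "4 \<Rightarrow> complex" assume xy: "(\<Sum>k\<in>UNIV. x k) = 0" "(\<Sum>k\<in>UNIV. y k) = 0"
      \<comment> \<open>\<open>CM_leading_form\<close> asks for distinct eigenvalues; a small shift
        along the distinct numbers \<open>unit4\<close> separates those of x and keeps their
        sum.\<close>
      let ?x = "\<lambda>s k. x k + s * unit4 k"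
      \<comment> \<open>The shift at which the eigenvalues i and j collide. The value 0, which
        includes the quotients 0/0 for i = j, is removed in B.\<close>
      define F where "F = (\<lambda>(i, j). (x j - x i) / (unit4 i - unit4 j))"
      define B where "B = range F - {0}"
      have "finite B" unfolding B_def by (rule finite_Diff, rule finite_imageI, rule finite)
      define r where "r = Min (insert 1 (norm ` B))"
      have r: "r > 0" "\<And>b. b \<in> B \<Longrightarrow> r \<le> norm b"
        using \<open>finite B\<close> unfolding r_def by (auto simp: B_def)
      have inj: "inj (?x s)" if s: "s \<noteq> 0" "norm s < r" for s
      proof (rule injI, rule ccontr)
        fix i j assume e: "x i + s * unit4 i = x j + s * unit4 j" and "i \<noteq> j"
        then have "unit4 i - unit4 j \<noteq> 0" using unit4_inj by (auto dest: injD)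
        then have "s = F (i, j)" using e by (simp add: F_def eq_divide_eq algebra_simps)
        then have "s \<in> B" using s(1) unfolding B_def by blast
        then show False using r(2) s(2) by force
      qed
      have "(\<Sum>k\<in>UNIV. unit4 k) = 0" unfolding sum_4 by (simp add: unit4_simps)
      then have tr: "(\<Sum>k\<in>UNIV. ?x s k) = 0" for s
        using xy(1) by (simp add: sum.distrib flip: sum_distrib_left)
      have "isCont (\<lambda>s. peval (psum (?x s) y) (hcomp d f)) 0"
        unfolding psum_def by (intro isCont_peval continuous_intros)
      then have "peval (psum (?x 0) y) (hcomp d f) = 0"
        by (rule isCont_zero_limit[OF _ _ r(1)]) (intro CM_leading_form f inj tr xy)
      then show "peval (psum x y) (hcomp d f) = 0" by simp
    qed
  qed
qed

section \<open>Quotients of Poisson algebras by the kernel of a homomorphism\<close>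

lemma cring_complex: "cring complex_ring"
  by (rule cringI; (rule abelian_groupI comm_monoidI)?)
    (auto simp: complex_ring_def algebra_simps intro: exI[of _ "- x" for x])

lemma complex_ring_simps [simp]: "carrier complex_ring = UNIV" "add complex_ring = (+)" "mult complex_ring = (*)"
  "one complex_ring = 1" "zero complex_ring = 0"
  by (simp_all add: complex_ring_def)

text \<open>The cosets of \<open>K\<close> are the fibres of \<open>\<Phi>\<close>, so \<open>P\<close> itself need not satisfy the ring axioms.\<close>

locale pquotient =
  fixes P :: "('a::ab_group_add) poisson" and R :: "'c poisson" and K :: "'a set" and \<Phi> :: "'a \<Rightarrow> 'c"
  assumes add_P: "add P = (+)" and zero_P: "zero P = 0"
    and zero_closed: "0 \<in> carrier P" and add_closed: "a \<in> carrier P \<Longrightarrow> b \<in> carrier P \<Longrightarrow> a + b \<in> carrier P"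
    and diff_closed: "a \<in> carrier P \<Longrightarrow> b \<in> carrier P \<Longrightarrow> a - b \<in> carrier P"
    and one_closed: "\<one>\<^bsub>P\<^esub> \<in> carrier P"
    and mult_closed: "a \<in> carrier P \<Longrightarrow> b \<in> carrier P \<Longrightarrow> a \<otimes>\<^bsub>P\<^esub> b \<in> carrier P"
    and smult_closed: "a \<in> carrier P \<Longrightarrow> c \<odot>\<^bsub>P\<^esub> a \<in> carrier P"
    and pbr_closed: "a \<in> carrier P \<Longrightarrow> b \<in> carrier P \<Longrightarrow> \<lbrace>a, b\<rbrace>\<^bsub>P\<^esub> \<in> carrier P"
    and K_subset: "K \<subseteq> carrier P" and K_add: "a \<in> K \<Longrightarrow> b \<in> K \<Longrightarrow> a + b \<in> K"
    and kernel: "a \<in> carrier P \<Longrightarrow> b \<in> carrier P \<Longrightarrow> \<Phi> a = \<Phi> b \<longleftrightarrow> a - b \<in> K"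
    and \<Phi>_closed: "a \<in> carrier P \<Longrightarrow> \<Phi> a \<in> carrier R"
    and \<Phi>_one: "\<Phi> \<one>\<^bsub>P\<^esub> = \<one>\<^bsub>R\<^esub>" and \<Phi>_zero: "\<Phi> 0 = \<zero>\<^bsub>R\<^esub>"
    and \<Phi>_add: "a \<in> carrier P \<Longrightarrow> b \<in> carrier P \<Longrightarrow> \<Phi> (a + b) = \<Phi> a \<oplus>\<^bsub>R\<^esub> \<Phi> b"
    and \<Phi>_mult: "a \<in> carrier P \<Longrightarrow> b \<in> carrier P \<Longrightarrow> \<Phi> (a \<otimes>\<^bsub>P\<^esub> b) = \<Phi> a \<otimes>\<^bsub>R\<^esub> \<Phi> b"
    and \<Phi>_smult: "a \<in> carrier P \<Longrightarrow> \<Phi> (c \<odot>\<^bsub>P\<^esub> a) = c \<odot>\<^bsub>R\<^esub> \<Phi> a"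
    and \<Phi>_pbr: "a \<in> carrier P \<Longrightarrow> b \<in> carrier P \<Longrightarrow> \<Phi> \<lbrace>a, b\<rbrace>\<^bsub>P\<^esub> = \<lbrace>\<Phi> a, \<Phi> b\<rbrace>\<^bsub>R\<^esub>"
begin

definition fiber :: "'c \<Rightarrow> 'a set" where
  "fiber f = {x \<in> carrier P. \<Phi> x = f}"

definition cos :: "'a \<Rightarrow> 'a set" where
  "cos a = fiber (\<Phi> a)"

lemma in_cos: "a \<in> carrier P \<Longrightarrow> a \<in> cos a"
  by (simp add: cos_def fiber_def)

lemma cosD: "x \<in> cos a \<Longrightarrow> x \<in> carrier P" "x \<in> cos a \<Longrightarrow> \<Phi> x = \<Phi> a"
  by (simp_all add: cos_def fiber_def)

lemma coset_eq: "a \<in> carrier P \<Longrightarrow> K +>\<^bsub>P\<^esub> a = cos a"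
proof -
  assume a: "a \<in> carrier P"
  have "x \<in> K +>\<^bsub>P\<^esub> a \<longleftrightarrow> x - a \<in> K" for x
    by (force simp: a_r_coset_def' add_P algebra_simps)
  moreover have "x \<in> carrier P" if "x - a \<in> K" for x
    using add_closed[of "x - a" a] that K_subset a by auto
  ultimately show ?thesis using kernel a by (auto simp: cos_def fiber_def)
qed

lemma cos_eqI: "\<Phi> a = \<Phi> b \<Longrightarrow> cos a = cos b"
  by (simp add: cos_def)

lemma carrier_pquot: "carrier (pquot P K) = cos ` carrier P"
  by (auto simp: pquot_def FactRing_def A_RCOSETS_def' coset_eq)

lemma mult_pquot: "a \<in> carrier P \<Longrightarrow> b \<in> carrier P \<Longrightarrow> cos a \<otimes>\<^bsub>pquot P K\<^esub> cos b = cos (a \<otimes>\<^bsub>P\<^esub> b)"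
proof -
  assume ab: "a \<in> carrier P" "b \<in> carrier P"
  have "K +>\<^bsub>P\<^esub> (x \<otimes>\<^bsub>P\<^esub> y) = cos (a \<otimes>\<^bsub>P\<^esub> b)" if "x \<in> cos a" "y \<in> cos b" for x y
    using that ab cosD by (auto simp: coset_eq mult_closed \<Phi>_mult intro!: cos_eqI)
  then show ?thesis using in_cos[OF ab(1)] in_cos[OF ab(2)]
    by (auto simp: pquot_def FactRing_def rcoset_mult_def)
qed

lemma pbr_pquot: "a \<in> carrier P \<Longrightarrow> b \<in> carrier P \<Longrightarrow> \<lbrace>cos a, cos b\<rbrace>\<^bsub>pquot P K\<^esub> = cos \<lbrace>a, b\<rbrace>\<^bsub>P\<^esub>"
proof -
  assume ab: "a \<in> carrier P" "b \<in> carrier P"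
  have "K +>\<^bsub>P\<^esub> \<lbrace>x, y\<rbrace>\<^bsub>P\<^esub> = cos \<lbrace>a, b\<rbrace>\<^bsub>P\<^esub>" if "x \<in> cos a" "y \<in> cos b" for x y
    using that ab cosD by (auto simp: coset_eq pbr_closed \<Phi>_pbr intro!: cos_eqI)
  then show ?thesis using in_cos[OF ab(1)] in_cos[OF ab(2)] by (auto simp: pquot_def)
qed

lemma smult_pquot: "a \<in> carrier P \<Longrightarrow> c \<odot>\<^bsub>pquot P K\<^esub> cos a = cos (c \<odot>\<^bsub>P\<^esub> a)"
proof -
  assume a: "a \<in> carrier P"
  have "K +>\<^bsub>P\<^esub> (c \<odot>\<^bsub>P\<^esub> x) = cos (c \<odot>\<^bsub>P\<^esub> a)" if "x \<in> cos a" for x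
    using that a cosD by (auto simp: coset_eq smult_closed \<Phi>_smult intro!: cos_eqI)
  then show ?thesis using in_cos[OF a] by (auto simp: pquot_def)
qed

lemma add_pquot: "a \<in> carrier P \<Longrightarrow> b \<in> carrier P \<Longrightarrow> cos a \<oplus>\<^bsub>pquot P K\<^esub> cos b = cos (a + b)"
proof (intro equalityI subsetI)
  fix x assume ab: "a \<in> carrier P" "b \<in> carrier P" and "x \<in> cos a \<oplus>\<^bsub>pquot P K\<^esub> cos b"
  then obtain y z where "x = y + z" "y \<in> cos a" "z \<in> cos b"
    by (auto simp: pquot_def FactRing_def set_add_def' add_P)
  then show "x \<in> cos (a + b)" using ab by (simp add: cos_def fiber_def \<Phi>_add add_closed)
next
  fix x assume ab: "a \<in> carrier P" "b \<in> carrier P" and x: "x \<in> cos (a + b)"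
  then have "x - (a + b) \<in> K" using kernel[of x "a + b"] cosD[OF x] by (simp add: add_closed)
  then have "(x - b) - a \<in> K" by (simp add: algebra_simps)
  then have "x - b \<in> cos a" using kernel[of "x - b" a] ab cosD[OF x] by (simp add: cos_def fiber_def diff_closed)
  moreover have "x = (x - b) + b" by simp
  ultimately show "x \<in> cos a \<oplus>\<^bsub>pquot P K\<^esub> cos b"
    using in_cos[OF ab(2)] unfolding pquot_def FactRing_def by (force simp: set_add_def' add_P)
qed

lemma one_pquot: "\<one>\<^bsub>pquot P K\<^esub> = cos \<one>\<^bsub>P\<^esub>"
  by (simp add: pquot_def FactRing_def coset_eq one_closed)

lemma zero_pquot: "\<zero>\<^bsub>pquot P K\<^esub> = cos 0"
proof -
  have "K = cos 0"
    using kernel[of _ 0] K_subset zero_closed by (auto simp: cos_def fiber_def)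
  then show ?thesis by (simp add: pquot_def FactRing_def)
qed

lemmas pquot_simps = mult_pquot add_pquot pbr_pquot smult_pquot one_pquot zero_pquot

text \<open>The axioms for the quotient are carried over from R along the bijection that sends an
  element of R to its fibre.\<close>

theorem poisson_isomorphic_pquot:
  assumes R: "poisson_algebra R" and onto: "carrier R \<subseteq> \<Phi> ` carrier P"
  shows "R \<cong>\<^sub>P pquot P K"
proof -
  interpret R: poisson_algebra R by fact
  let ?Q = "pquot P K"
  have fib: "\<exists>a\<in>carrier P. f = \<Phi> a \<and> fiber f = cos a" if "f \<in> carrier R" for f
    using onto that by (auto simp: cos_def)
  have carrier: "carrier ?Q = fiber ` carrier R"
    unfolding carrier_pquot cos_def using onto \<Phi>_closed by (auto simp: image_iff)
  have inj: "f = g" if "f \<in> carrier R" "g \<in> carrier R" "fiber f = fiber g" for f g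
    using fib[OF that(1)] in_cos that(3) unfolding fiber_def by blast
  have ops: "fiber f \<otimes>\<^bsub>?Q\<^esub> fiber g = fiber (f \<otimes>\<^bsub>R\<^esub> g)" "fiber f \<oplus>\<^bsub>?Q\<^esub> fiber g = fiber (f \<oplus>\<^bsub>R\<^esub> g)"
    "\<lbrace>fiber f, fiber g\<rbrace>\<^bsub>?Q\<^esub> = fiber \<lbrace>f, g\<rbrace>\<^bsub>R\<^esub>" "c \<odot>\<^bsub>?Q\<^esub> fiber f = fiber (c \<odot>\<^bsub>R\<^esub> f)"
    if fc: "f \<in> carrier R" and gc: "g \<in> carrier R" for f g c
  proof -
    obtain a where a: "a \<in> carrier P" "f = \<Phi> a" using fib[OF fc] by blast
    obtain b where b: "b \<in> carrier P" "g = \<Phi> b" using fib[OF gc] by blast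
    note ab = a(1) b(1) and fg = a(2) b(2)
    show "fiber f \<otimes>\<^bsub>?Q\<^esub> fiber g = fiber (f \<otimes>\<^bsub>R\<^esub> g)" "fiber f \<oplus>\<^bsub>?Q\<^esub> fiber g = fiber (f \<oplus>\<^bsub>R\<^esub> g)"
      "\<lbrace>fiber f, fiber g\<rbrace>\<^bsub>?Q\<^esub> = fiber \<lbrace>f, g\<rbrace>\<^bsub>R\<^esub>" "c \<odot>\<^bsub>?Q\<^esub> fiber f = fiber (c \<odot>\<^bsub>R\<^esub> f)"
      using mult_pquot[OF ab] add_pquot[OF ab] pbr_pquot[OF ab] smult_pquot[OF ab(1), of c]
      unfolding cos_def fg by (simp_all only: \<Phi>_mult \<Phi>_add \<Phi>_pbr \<Phi>_smult ab)
  qed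
  have unit_ops: "\<one>\<^bsub>?Q\<^esub> = fiber \<one>\<^bsub>R\<^esub>" "\<zero>\<^bsub>?Q\<^esub> = fiber \<zero>\<^bsub>R\<^esub>"
    by (simp_all add: one_pquot zero_pquot cos_def \<Phi>_one \<Phi>_zero)
  have cl: "f \<in> carrier R \<Longrightarrow> fiber f \<in> carrier ?Q" for f by (simp add: carrier)
  have cringQ: "cring ?Q"
  proof (rule cringI)
    show "abelian_group ?Q"
    proof (rule abelian_groupI)
      fix x assume "x \<in> carrier ?Q"
      then obtain f where f: "x = fiber f" "f \<in> carrier R" by (auto simp: carrier)
      then show "\<exists>y\<in>carrier ?Q. y \<oplus>\<^bsub>?Q\<^esub> x = \<zero>\<^bsub>?Q\<^esub>"
        by (intro bexI[of _ "fiber (\<ominus>\<^bsub>R\<^esub> f)"]) (auto simp: ops unit_ops cl R.l_neg)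
    qed (auto simp: carrier ops unit_ops R.a_ac)
    show "comm_monoid ?Q"
      by (rule comm_monoidI) (auto simp: carrier ops unit_ops R.m_ac)
  qed (auto simp: carrier ops R.l_distr)
  have "algebra complex_ring ?Q"
    by (rule algebraI[OF cring_complex cringQ])
      (auto simp: carrier ops R.smult_l_distr[simplified] R.smult_r_distr[simplified] R.smult_assoc1[simplified] R.smult_assoc2[simplified]
        R.smult_one[simplified] R.smult_closed[simplified])
  then interpret Q: algebra complex_ring ?Q .
  have neg: "\<ominus>\<^bsub>?Q\<^esub> fiber f = fiber (\<ominus>\<^bsub>R\<^esub> f)" if f: "f \<in> carrier R" for f
    by (rule Q.minus_equality) (auto simp: ops unit_ops cl f R.l_neg)
  have "poisson_algebra ?Q"
    by unfold_locales (auto simp: carrier ops unit_ops neg R.pbr_closed R.pbr_antisym[symmetric] R.pbr_add R.pbr_smult R.pbr_leibniz R.pbr_jacobi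
      R.smult_closed[simplified])
  moreover have "fiber \<in> poisson_iso R ?Q"
    unfolding poisson_iso_def ring_iso_def ring_hom_def bij_betw_def
    by (auto simp: carrier ops unit_ops inj_on_def inj)
  ultimately show ?thesis using R unfolding poisson_isomorphic_def by auto
qed

end

section \<open>Coordinate algebras and the trace bracket\<close>

definition phi :: "('n::finite) mpair set \<Rightarrow> 'n epoly \<Rightarrow> 'n mpair \<Rightarrow> complex" where
  "phi V q = (\<lambda>z\<in>V. ev z q)"

lemma wmat_conj:
  assumes "invertible g"
  shows "wmat (letter_mat (conj_pair g z)) w = g ** wmat (letter_mat z) w ** matrix_inv g"
proof (induction w)
  case Nil
  then show ?case by (simp add: matrix_inv_cancel[OF assms])
next
  case (Cons l w)
  have "letter_mat (conj_pair g z) l = g ** letter_mat z l ** matrix_inv g"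
    by (cases l) (simp_all add: conj_pair_def)
  then have "wmat (letter_mat (conj_pair g z)) (l # w) = g ** letter_mat z l ** (matrix_inv g ** g) ** wmat (letter_mat z) w ** matrix_inv g"
    using Cons by (simp add: matrix_mul_assoc)
  then show ?case by (simp add: matrix_inv_cancel[OF assms] matrix_mul_assoc)
qed

lemma ev_conj_talg:
  assumes "q \<in> talg" "invertible g"
  shows "ev (conj_pair g z) q = ev z q"
  using assms(1)
proof induction
  case (wpoly w)
  have "trace (g ** wmat (letter_mat z) w ** matrix_inv g) = trace (matrix_inv g ** (g ** wmat (letter_mat z) w))"
    by (rule trace_mul_sym)
  then show ?case
    by (simp add: ev_wpoly word_trace_wmat wmat_conj[OF assms(2)] matrix_mul_assoc matrix_inv_cancel[OF assms(2)])
qed (simp_all add: peval_simps)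

definition conj_stable :: "('n::finite) mpair set \<Rightarrow> bool" where
  "conj_stable V \<longleftrightarrow> (\<forall>g z. invertible g \<longrightarrow> z \<in> V \<longrightarrow> conj_pair g z \<in> V)"

lemma quotient_functions_eq:
  assumes "conj_stable V"
  shows "quotient_functions V = phi V ` talg"
proof (intro equalityI subsetI)
  fix f assume "f \<in> quotient_functions V"
  then show "f \<in> phi V ` talg"
    using quotient_functions_talg[of V f] assms unfolding conj_stable_def phi_def by blast
next
  fix f assume "f \<in> phi V ` talg"
  then obtain q where q: "q \<in> talg" "f = phi V q" by blast
  then show "f \<in> quotient_functions V"
    using assms ev_conj_talg[OF q(1)] by (auto simp: quotient_functions_def phi_def conj_stable_def)
qed

lemma talg_0: "0 \<in> talg" and talg_1: "1 \<in> talg"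
  using talg.cst[of 0] talg.cst[of 1] by simp_all

lemma phi_ops:
  "phi V p \<otimes>\<^bsub>quotient_alg V b\<^esub> phi V q = phi V (p * q)"
  "phi V p \<oplus>\<^bsub>quotient_alg V b\<^esub> phi V q = phi V (p + q)"
  "c \<odot>\<^bsub>quotient_alg V b\<^esub> phi V p = phi V (cst c * p)"
  "\<one>\<^bsub>quotient_alg V b\<^esub> = phi V 1" "\<zero>\<^bsub>quotient_alg V b\<^esub> = phi V 0"
  "\<lbrace>f, g\<rbrace>\<^bsub>quotient_alg V b\<^esub> = b f g"
  by (auto simp: quotient_alg_def phi_def peval_simps fun_eq_iff)

text \<open>Every element is the restriction of a polynomial in traces of words, so all axioms, the
  Jacobi identity included, descend from those of \<open>pb\<close>.\<close>

theorem poisson_algebra_quotient_alg: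
  assumes V: "conj_stable V"
    and b: "\<And>p q. p \<in> talg \<Longrightarrow> q \<in> talg \<Longrightarrow> b (phi V p) (phi V q) = phi V (pb p q)"
  shows "poisson_algebra (quotient_alg V b)"
proof -
  let ?Q = "quotient_alg V b"
  have carrier: "carrier ?Q = phi V ` talg"
    using quotient_functions_eq[OF V] by (simp add: quotient_alg_def)
  have cringQ: "cring ?Q"
  proof (rule cringI)
    show "abelian_group ?Q"
    proof (rule abelian_groupI)
      fix x assume "x \<in> carrier ?Q"
      then obtain p where "x = phi V p" "p \<in> talg" by (auto simp: carrier)
      then show "\<exists>y\<in>carrier ?Q. y \<oplus>\<^bsub>?Q\<^esub> x = \<zero>\<^bsub>?Q\<^esub>"
        by (intro bexI[of _ "phi V (- p)"]) (auto simp: carrier phi_ops talg_uminus)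
    qed (auto simp: carrier phi_ops talg.add talg_0 algebra_simps)
    show "comm_monoid ?Q"
      by (rule comm_monoidI) (auto simp: carrier phi_ops talg.mult talg_1 algebra_simps)
  qed (auto simp: carrier phi_ops algebra_simps)
  have "algebra complex_ring ?Q"
    by (rule algebraI[OF cring_complex cringQ])
      (auto simp: carrier phi_ops algebra_simps cst_add cst_mult talg.mult talg.cst)
  then interpret Q: algebra complex_ring ?Q .
  have neg: "\<ominus>\<^bsub>?Q\<^esub> phi V p = phi V (- p)" if "p \<in> talg" for p
    by (rule Q.minus_equality) (auto simp: phi_ops carrier that talg_uminus)
  have jac: "pb p (pb q r) + pb q (pb r p) + pb r (pb p q) = 0" for p q r
    using jacobi[of p q r] by (simp add: jac_def)
  show ?thesis
    by unfold_locales
      (auto simp: carrier phi_ops b neg talg_pb talg.add talg.mult talg.cst pb_add_left pb_mult_left pb_cst jac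
        pb_antisym[symmetric])
qed

lemma phi_UNIV_inj: "phi UNIV p = phi UNIV q \<Longrightarrow> p = q"
proof -
  assume e: "phi UNIV p = phi UNIV q"
  have "peval x (p - q) = 0" for x
  proof -
    \<comment> \<open>Any assignment of values to the variables is the entry function of a pair of
      matrices.\<close>
    let ?z = "(\<chi> i j. x (LX, i, j), \<chi> i j. x (LY, i, j))"
    have "entry ?z k = x k" for k
    proof -
      obtain l i j where "k = (l, i, j)" by (metis surj_pair)
      then show ?thesis by (cases l) (simp_all add: entry_def)
    qed
    then have "entry ?z = x" by (rule ext)
    then show ?thesis using fun_cong[OF e, of ?z] by (simp add: phi_def peval_simps)
  qed
  then have "p - q = 0" by (rule peval_zero_imp_zero)
  then show ?thesis by simp
qed

lemma conj_stable_UNIV: "conj_stable UNIV"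
  by (simp add: conj_stable_def)

lemma phi_wpoly: "phi UNIV (wpoly w) = word_trace w"
  by (simp add: phi_def ev_wpoly fun_eq_iff)

lemma phi_pb_wpoly: "phi UNIV (pb (wpoly u) (wpoly v)) = (\<lambda>z. \<Sum>i<length u. \<Sum>j<length v.
    \<omega> (u ! i) (v ! j) * word_trace (drop (Suc i) u @ take i u @ drop (Suc j) v @ take j v) z)"
  by (simp add: phi_def pb_wpoly ring_map_sum[OF ring_map_ev] peval_simps ev_wpoly wrest_def fun_eq_iff)

text \<open>The choices are unambiguous by \<open>phi_UNIV_inj\<close>, since a polynomial is
  determined by its values on all pairs. Outside the invariants the value is the one that
  \<open>is_trace_bracket\<close> prescribes.\<close>

definition tbr :: "(('n::finite) mpair \<Rightarrow> complex) \<Rightarrow> ('n mpair \<Rightarrow> complex) \<Rightarrow> 'n mpair \<Rightarrow> complex" where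
  "tbr f g = (if f \<in> quotient_functions UNIV \<and> g \<in> quotient_functions UNIV
     then phi UNIV (pb (SOME p. p \<in> talg \<and> phi UNIV p = f) (SOME q. q \<in> talg \<and> phi UNIV q = g)) else undefined)"

lemma tbr_phi:
  assumes "p \<in> talg" "q \<in> talg" shows "tbr (phi UNIV p) (phi UNIV q) = phi UNIV (pb p q)"
proof -
  have "(SOME p'. p' \<in> talg \<and> phi UNIV p' = phi UNIV p) = p" if "p \<in> talg" for p :: "'a epoly"
    by (rule some_equality) (use that phi_UNIV_inj in auto)
  then show ?thesis using assms by (simp add: tbr_def quotient_functions_eq[OF conj_stable_UNIV])
qed

lemma is_trace_bracket_tbr: "is_trace_bracket tbr"
  unfolding is_trace_bracket_def
proof (intro conjI allI impI)
  show "poisson_algebra (quotient_alg UNIV tbr)"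
    by (rule poisson_algebra_quotient_alg[OF conj_stable_UNIV tbr_phi])
  show "tbr (word_trace u) (word_trace v) = (\<lambda>z. \<Sum>i<length u. \<Sum>j<length v.
    \<omega> (u ! i) (v ! j) * word_trace (drop (Suc i) u @ take i u @ drop (Suc j) v @ take j v) z)" for u v
    using tbr_phi[OF talg.wpoly talg.wpoly, of u v] by (simp only: phi_wpoly phi_pb_wpoly)
qed (auto simp: tbr_def)

text \<open>Constants and traces of words generate the invariants; linearity and the Leibniz rule
  carry the bracket from words to the left argument, and antisymmetry then to the right one.\<close>

lemma is_trace_bracket_phi:
  fixes p q :: "('n::finite) epoly"
  assumes b: "is_trace_bracket b" and "p \<in> talg" "q \<in> talg"
  shows "b (phi UNIV p) (phi UNIV q) = phi UNIV (pb p q)"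
proof -
  let ?Q = "quotient_alg UNIV b" and ?\<phi> = "phi (UNIV :: 'n mpair set)"
  interpret Q: poisson_algebra ?Q using b by (simp add: is_trace_bracket_def)
  have carrier: "carrier ?Q = ?\<phi> ` talg"
    using quotient_functions_eq[OF conj_stable_UNIV] by (simp add: quotient_alg_def)
  have cl: "?\<phi> p \<in> carrier ?Q" if "p \<in> talg" for p using that by (simp add: carrier)
  have ev_eq: "(\<And>z. f z = g z) \<Longrightarrow> f = g" for f g :: "'n mpair \<Rightarrow> complex" by (rule ext)
  have neg: "\<ominus>\<^bsub>?Q\<^esub> ?\<phi> p = ?\<phi> (- p)" if "p \<in> talg" for p
    by (rule Q.minus_equality) (auto simp: phi_ops cl that talg_uminus)
  have hadd: "b (?\<phi> (p + q)) (?\<phi> r) = ?\<phi> s" if "b (?\<phi> p) (?\<phi> r) = ?\<phi> s1" "b (?\<phi> q) (?\<phi> r) = ?\<phi> s2" "s = s1 + s2"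
    "p \<in> talg" "q \<in> talg" "r \<in> talg" for p q r s s1 s2
    using Q.pbr_add[of "?\<phi> p" "?\<phi> q" "?\<phi> r"] that by (simp add: phi_ops cl)
  have hmult: "b (?\<phi> (p * q)) (?\<phi> r) = ?\<phi> s" if "b (?\<phi> p) (?\<phi> r) = ?\<phi> s1" "b (?\<phi> q) (?\<phi> r) = ?\<phi> s2" "s = p * s2 + s1 * q"
    "p \<in> talg" "q \<in> talg" "r \<in> talg" for p q r s s1 s2
    using Q.pbr_leibniz[of "?\<phi> p" "?\<phi> q" "?\<phi> r"] that by (simp add: phi_ops cl)
  \<comment> \<open>The Leibniz rule for 1 * 1 makes this bracket equal to its double.\<close>
  have one: "b (?\<phi> 1) (?\<phi> r) = ?\<phi> 0" if "r \<in> talg" for r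
  proof -
    have "b (?\<phi> 1) (?\<phi> r) \<in> carrier ?Q" using Q.pbr_closed[of "?\<phi> 1" "?\<phi> r"] that by (simp add: phi_ops cl talg_1)
    then obtain s where s: "b (?\<phi> 1) (?\<phi> r) = ?\<phi> s" by (auto simp: carrier)
    have "b (?\<phi> (1 * 1)) (?\<phi> r) = ?\<phi> (1 * s + s * 1)" by (rule hmult[OF s s refl talg_1 talg_1 that])
    then have "s = s + s" using s phi_UNIV_inj by fastforce
    then show ?thesis using s by simp
  qed
  have hcst: "b (?\<phi> (cst c)) (?\<phi> r) = ?\<phi> 0" if "r \<in> talg" for c r
    using Q.pbr_smult[of "?\<phi> 1" "?\<phi> r" c] one[OF that] that by (simp add: phi_ops cl talg_1)
  have anti: "b (?\<phi> p) (?\<phi> q) = ?\<phi> (- s)" if "b (?\<phi> q) (?\<phi> p) = ?\<phi> s" "p \<in> talg" "q \<in> talg" "s \<in> talg" for p q s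
    using Q.pbr_antisym[of "?\<phi> p" "?\<phi> q"] that by (simp add: phi_ops cl neg)
  have w: "b (?\<phi> (wpoly u)) (?\<phi> (wpoly v)) = ?\<phi> (pb (wpoly u) (wpoly v))" for u v
    using b by (simp add: is_trace_bracket_def phi_wpoly phi_pb_wpoly)
  have 1: "b (?\<phi> p) (?\<phi> (wpoly v)) = ?\<phi> (pb p (wpoly v))" if "p \<in> talg" for p v
    using that
  proof induction
    case (cst c) show ?case using hcst[OF talg.wpoly] by (simp add: pb_cst)
  next
    case (add p q) then show ?case by (intro hadd[OF add.IH pb_add_left] talg.wpoly) 
  next
    case (mult p q) then show ?case by (intro hmult[OF mult.IH pb_mult_left] talg.wpoly)
  qed (rule w)
  have "b (?\<phi> q) (?\<phi> p) = ?\<phi> (pb q p)"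
    using assms(3)
  proof induction
    case (cst c) show ?case using hcst[OF assms(2)] by (simp add: pb_cst)
  next
    case (wpoly w)
    have "b (?\<phi> (wpoly w)) (?\<phi> p) = ?\<phi> (- pb p (wpoly w))"
      by (rule anti[OF 1]) (use assms(2) in \<open>auto intro: talg.wpoly talg_pb\<close>)
    then show ?case by (subst pb_antisym)
  next
    case (add p q) then show ?case by (intro hadd[OF add.IH pb_add_left] assms)
  next
    case (mult p q) then show ?case by (intro hmult[OF mult.IH pb_mult_left] assms)
  qed
  from anti[OF this assms(2,3)] show ?thesis
    using talg_pb[OF assms(3,2)] pb_antisym[of p q] by simp
qed

lemma trace_bracket_eq: "trace_bracket = tbr"
  unfolding trace_bracket_def
proof (rule the_equality)
  show "is_trace_bracket tbr" by (rule is_trace_bracket_tbr)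
  fix b :: "('a mpair \<Rightarrow> complex) \<Rightarrow> ('a mpair \<Rightarrow> complex) \<Rightarrow> 'a mpair \<Rightarrow> complex"
  assume b: "is_trace_bracket b"
  show "b = tbr"
  proof (intro ext)
    fix f g z
    have "b f g = tbr f g"
    proof (cases "f \<in> quotient_functions UNIV \<and> g \<in> quotient_functions UNIV")
      case True
      then show ?thesis
        unfolding quotient_functions_eq[OF conj_stable_UNIV] by (auto simp: is_trace_bracket_phi[OF b] tbr_phi)
    next
      case False
      then show ?thesis using b by (auto simp: is_trace_bracket_def tbr_def)
    qed
    then show "b f g z = tbr f g z" by simp
  qed
qed

context reducible_variety
begin

lemma conj_stable_V: "conj_stable V"
  using conj_stable by (simp add: conj_stable_def)

lemma phi_eq_iff: "phi V p = phi V s \<longleftrightarrow> p - s \<in> vanish V"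
  by (auto simp: phi_def vanish_def peval_simps restrict_def fun_eq_iff)

text \<open>Independence of the chosen extensions is \<open>pb_vanish\<close>: a difference of two
  extensions vanishes on V, and so do its brackets.\<close>

lemma induced_bracket_phi:
  assumes "p \<in> talg" "s \<in> talg"
  shows "induced_bracket V (phi V p) (phi V s) = phi V (pb p s)"
  unfolding induced_bracket_def
proof (rule the_equality)
  have r: "restrict (phi UNIV p) V = phi V p" for p by (simp add: phi_def)
  note QF = quotient_functions_eq[OF conj_stable_UNIV]
  show "\<exists>F\<in>quotient_functions UNIV. \<exists>G\<in>quotient_functions UNIV.
     phi V p = restrict F V \<and> phi V s = restrict G V \<and> phi V (pb p s) = restrict (trace_bracket F G) V"
    unfolding QF using assms
    by (intro bexI[of _ "phi UNIV p"] bexI[of _ "phi UNIV s"]) (auto simp: r trace_bracket_eq tbr_phi)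
  fix h assume "\<exists>F\<in>quotient_functions UNIV. \<exists>G\<in>quotient_functions UNIV.
     phi V p = restrict F V \<and> phi V s = restrict G V \<and> h = restrict (trace_bracket F G) V"
  then obtain p' s' where pq: "p' \<in> talg" "s' \<in> talg" "phi V p = phi V p'" "phi V s = phi V s'"
    and h: "h = phi V (pb p' s')"
    unfolding QF by (auto simp: r trace_bracket_eq tbr_phi)
  \<comment> \<open>One argument is changed at a time.\<close>
  have "pb p' s' - pb p s = pb (p' - p) s' - pb (s' - s) p"
    using pb_antisym[of s' p] pb_antisym[of s p] pb_add_left[of "p' - p" p s'] pb_add_left[of "s' - s" s p]
    by (simp add: algebra_simps)
  also have "\<dots> \<in> vanish V"
  proof (rule vanish_diff)
    have "p' - p \<in> vanish V" "s' - s \<in> vanish V" using pq phi_eq_iff[of p' p] phi_eq_iff[of s' s] by auto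
    then show "pb (p' - p) s' \<in> vanish V" "pb (s' - s) p \<in> vanish V"
      using pq assms by (auto intro!: pb_vanish talg_diff)
  qed
  finally show "h = phi V (pb p s)" unfolding h phi_eq_iff .
qed

theorem poisson_algebra_coord_alg: "poisson_algebra (coord_alg V)"
  unfolding coord_alg_def by (rule poisson_algebra_quotient_alg[OF conj_stable_V induced_bracket_phi])

end

section \<open>The tensor product decomposition\<close>

declare One_nat_def [simp del]

lemma poly_bracket_mixed:
  assumes "a \<in> polys_in {1, 2}" "s \<in> polys_in {3..14}"
  shows "poly_bracket \<epsilon> a s = 0"
  unfolding poly_bracket_def
proof (intro sum.neutral ballI)
  fix i j :: nat assume ij: "i \<in> {1..14}" "j \<in> {1..14}"
  show "pdiff i a * pdiff j s * gen_bracket \<epsilon> i j = 0"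
  proof (cases "i = 1 \<or> i = 2"; cases "j \<in> {3..14}")
    assume "i = 1 \<or> i = 2" "j \<in> {3..14}"
    then show ?thesis by (simp only: gen_bracket_linear mult_zero_right)
  qed (use pdiff_polys_in_0[OF assms(1), of i] pdiff_polys_in_0[OF assms(2), of j] in auto)
qed

lemma poly_bracket_closed_12:
  assumes "a \<in> polys_in {1, 2}" "b \<in> polys_in {1, 2}"
  shows "poly_bracket \<epsilon> a b \<in> polys_in {1, 2}"
  unfolding poly_bracket_def
proof (intro polys_in_sum)
  fix i j :: nat
  have g: "gen_bracket \<epsilon> i j \<in> polys_in {1, 2}" if "i = 1 \<or> i = 2" "j = 1 \<or> j = 2"
    using that gen_bracket_1_2[of \<epsilon>] gen_bracket_antisym[of \<epsilon> 2 1] by (auto simp: polys_in_uminus)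
  show "pdiff i a * pdiff j b * gen_bracket \<epsilon> i j \<in> polys_in {1, 2}"
  proof (cases "(i = 1 \<or> i = 2) \<and> (j = 1 \<or> j = 2)")
    case True
    then show ?thesis using g assms by (intro polys_in_mult polys_in_pdiff) auto
  next
    case False
    then have "pdiff i a = 0 \<or> pdiff j b = 0"
      using pdiff_polys_in_0[OF assms(1), of i] pdiff_polys_in_0[OF assms(2), of j] by auto
    then show ?thesis by auto
  qed
qed

text \<open>Mixed brackets vanish, which leaves exactly the bracket of a tensor product.\<close>

lemma poly_bracket_tensor:
  assumes "a \<in> polys_in {1, 2}" "a' \<in> polys_in {1, 2}" "s \<in> polys_in {3..14}" "s' \<in> polys_in {3..14}"
  shows "poly_bracket \<epsilon> (a * s) (a' * s') = poly_bracket \<epsilon> a a' * (s * s') + a * a' * poly_bracket \<epsilon> s s'"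
proof -
  have r: "poly_bracket \<epsilon> p (a' * s') = a' * poly_bracket \<epsilon> p s' + poly_bracket \<epsilon> p a' * s'" for p
    unfolding poly_bracket_antisym[of _ p] poly_bracket_mult by simp
  have "poly_bracket \<epsilon> s a' = 0" by (subst poly_bracket_antisym) (simp add: poly_bracket_mixed assms)
  then show ?thesis by (simp add: poly_bracket_mult r poly_bracket_mixed assms algebra_simps)
qed

context reducible_variety
begin

definition \<theta> :: "nat mpoly \<Rightarrow> 4 mpair \<Rightarrow> complex" where "\<theta> P = phi V (gsub P)"

lemma \<theta>_eq_iff: "\<theta> P = \<theta> R \<longleftrightarrow> (\<forall>z\<in>V. ev z (gsub P) = ev z (gsub R))"
  by (auto simp: \<theta>_def phi_def restrict_def fun_eq_iff)

lemma coord_ops: "\<theta> P \<otimes>\<^bsub>coord_alg V\<^esub> \<theta> R = \<theta> (P * R)" "\<theta> P \<oplus>\<^bsub>coord_alg V\<^esub> \<theta> R = \<theta> (P + R)"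
  "c \<odot>\<^bsub>coord_alg V\<^esub> \<theta> P = \<theta> (cst c * P)" "\<one>\<^bsub>coord_alg V\<^esub> = \<theta> 1" "\<zero>\<^bsub>coord_alg V\<^esub> = \<theta> 0"
  by (simp_all add: coord_alg_def phi_ops \<theta>_def csubst_simps)

lemma coord_pbr:
  assumes "P \<in> polys_in {1..14}" "R \<in> polys_in {1..14}"
  shows "\<lbrace>\<theta> P, \<theta> R\<rbrace>\<^bsub>coord_alg V\<^esub> = \<theta> (poly_bracket \<epsilon> P R)"
  using induced_bracket_phi[OF gsub_talg gsub_talg, of P R] pb_gsub_bracket[OF _ assms]
  by (simp add: coord_alg_def phi_ops \<theta>_def) (auto simp: phi_def restrict_def)

lemma carrier_coord: "carrier (coord_alg V) = \<theta> ` polys_in {1..14}"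
proof -
  have "carrier (coord_alg V) = phi V ` talg"
    using quotient_functions_eq[OF conj_stable_V] by (simp add: coord_alg_def quotient_alg_def)
  also have "\<dots> = \<theta> ` polys_in {1..14}"
  proof (intro equalityI subsetI)
    fix f assume "f \<in> phi V ` talg"
    then obtain p where p: "p \<in> talg" "f = phi V p" by blast
    then obtain P where P: "P \<in> polys_in {1..14}" "p - gsub P \<in> vanish1 V" using talg_redset unfolding redset_def by blast
    have "phi V p = \<theta> P" unfolding \<theta>_def phi_eq_iff using P(2) by (simp add: vanish1_def)
    then show "f \<in> \<theta> ` polys_in {1..14}" using p P by blast
  next
    fix f assume "f \<in> \<theta> ` polys_in {1..14}"
    then show "f \<in> phi V ` talg" using gsub_talg by (auto simp: \<theta>_def)
  qed
  finally show ?thesis .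
qed

abbreviation "PA \<equiv> poly_alg \<epsilon> {1, 2}"
abbreviation "PB \<equiv> poly_alg \<epsilon> {3..14}"
abbreviation "QB \<equiv> pquot PB (relations_ideal V)"

lemma gsub_diff_vanish: "gsub (P - R) \<in> vanish V \<longleftrightarrow> \<theta> P = \<theta> R"
  by (simp add: \<theta>_def phi_eq_iff csubst_simps)

sublocale B: pquotient PB "coord_alg V" "relations_ideal V" \<theta>
proof
  fix a b :: "nat mpoly"
  show "a \<in> relations_ideal V \<Longrightarrow> b \<in> relations_ideal V \<Longrightarrow> a + b \<in> relations_ideal V"
    by (simp add: relations_ideal_iff csubst_simps vanish_add polys_in_add)
  show "\<theta> a = \<theta> b \<longleftrightarrow> a - b \<in> relations_ideal V" if "a \<in> carrier PB" "b \<in> carrier PB"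
    using that gsub_diff_vanish[of a b] by (simp add: relations_ideal_iff polys_in_diff)
  show "\<theta> a \<in> carrier (coord_alg V)" if "a \<in> carrier PB"
    using that polys_in_inner[of a] by (auto simp: carrier_coord)
  show "\<theta> \<lbrace>a, b\<rbrace>\<^bsub>PB\<^esub> = \<lbrace>\<theta> a, \<theta> b\<rbrace>\<^bsub>coord_alg V\<^esub>" if "a \<in> carrier PB" "b \<in> carrier PB"
    using that coord_pbr[OF polys_in_inner polys_in_inner, of a b] by simp
qed (auto simp: coord_ops relations_ideal_iff polys_in_intros poly_bracket_polys_in)

text \<open>Picks a polynomial in a coset; its values on V do not depend on the choice.\<close>

definition rep :: "nat mpoly set \<Rightarrow> nat mpoly" where
  "rep S = (SOME s. s \<in> polys_in {3..14} \<and> B.cos s = S)"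

lemma rep: "S \<in> carrier QB \<Longrightarrow> rep S \<in> polys_in {3..14}" "S \<in> carrier QB \<Longrightarrow> B.cos (rep S) = S"
proof -
  assume "S \<in> carrier QB"
  then have "\<exists>s. s \<in> polys_in {3..14} \<and> B.cos s = S" by (auto simp: B.carrier_pquot)
  from someI_ex[OF this] show "rep S \<in> polys_in {3..14}" "B.cos (rep S) = S" by (simp_all add: rep_def)
qed

lemma cos_carrier: "s \<in> polys_in {3..14} \<Longrightarrow> B.cos s \<in> carrier QB"
  by (simp add: B.carrier_pquot)

lemma ev_rep: "s \<in> polys_in {3..14} \<Longrightarrow> z \<in> V \<Longrightarrow> ev z (gsub (rep (B.cos s))) = ev z (gsub s)"
proof -
  assume s: "s \<in> polys_in {3..14}" and z: "z \<in> V"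
  have "rep (B.cos s) \<in> B.cos s" using rep[OF cos_carrier[OF s]] B.in_cos[of "rep (B.cos s)"] by simp
  then have "\<theta> (rep (B.cos s)) = \<theta> s" by (rule B.cosD)
  then show ?thesis using z by (simp add: \<theta>_eq_iff)
qed

lemma ev_rep_ops:
  assumes "S \<in> carrier QB" "S' \<in> carrier QB" "z \<in> V"
  shows "ev z (gsub (rep (S \<otimes>\<^bsub>QB\<^esub> S'))) = ev z (gsub (rep S)) * ev z (gsub (rep S'))"
    "ev z (gsub (rep (S \<oplus>\<^bsub>QB\<^esub> S'))) = ev z (gsub (rep S)) + ev z (gsub (rep S'))"
    "ev z (gsub (rep (c \<odot>\<^bsub>QB\<^esub> S))) = c * ev z (gsub (rep S))"
    "ev z (gsub (rep \<lbrace>S, S'\<rbrace>\<^bsub>QB\<^esub>)) = ev z (gsub (poly_bracket \<epsilon> (rep S) (rep S')))"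
proof -
  obtain s where s: "s \<in> polys_in {3..14}" "S = B.cos s" "rep S = s" using rep assms(1) by metis
  obtain s' where s': "s' \<in> polys_in {3..14}" "S' = B.cos s'" "rep S' = s'" using rep assms(2) by metis
  have 1: "S \<otimes>\<^bsub>QB\<^esub> S' = B.cos (s * s')" "S \<oplus>\<^bsub>QB\<^esub> S' = B.cos (s + s')" "c \<odot>\<^bsub>QB\<^esub> S = B.cos (cst c * s)"
    "\<lbrace>S, S'\<rbrace>\<^bsub>QB\<^esub> = B.cos (poly_bracket \<epsilon> s s')"
    unfolding s(2) s'(2) using s(1) s'(1) by (simp_all add: B.pquot_simps)
  show "ev z (gsub (rep (S \<otimes>\<^bsub>QB\<^esub> S'))) = ev z (gsub (rep S)) * ev z (gsub (rep S'))"
    "ev z (gsub (rep (S \<oplus>\<^bsub>QB\<^esub> S'))) = ev z (gsub (rep S)) + ev z (gsub (rep S'))"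
    "ev z (gsub (rep (c \<odot>\<^bsub>QB\<^esub> S))) = c * ev z (gsub (rep S))"
    "ev z (gsub (rep \<lbrace>S, S'\<rbrace>\<^bsub>QB\<^esub>)) = ev z (gsub (poly_bracket \<epsilon> (rep S) (rep S')))"
    unfolding 1 s(3) s'(3) using s(1) s'(1) assms(3)
    by (simp_all add: ev_rep polys_in_intros poly_bracket_polys_in csubst_simps peval_simps)
qed

lemma QB_closed:
  assumes "S \<in> carrier QB" "S' \<in> carrier QB"
  shows "S \<otimes>\<^bsub>QB\<^esub> S' \<in> carrier QB" "S \<oplus>\<^bsub>QB\<^esub> S' \<in> carrier QB" "c \<odot>\<^bsub>QB\<^esub> S \<in> carrier QB" "\<lbrace>S, S'\<rbrace>\<^bsub>QB\<^esub> \<in> carrier QB"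
    "\<one>\<^bsub>QB\<^esub> \<in> carrier QB"
  using assms by (auto simp: B.carrier_pquot B.pquot_simps polys_in_intros poly_bracket_polys_in intro!: imageI)

subsection \<open>The map from the free vector space on pairs\<close>

abbreviation "TP \<equiv> free_pairs PA QB"

text \<open>The multiplication map that sends a tensored with the class of s to a s. It respects
  products and brackets only after evaluation on V, because chosen representatives need not multiply
  to representatives.\<close>

definition \<Psi> :: "((nat mpoly \<times> nat mpoly set) \<Rightarrow>\<^sub>0 complex) \<Rightarrow> nat mpoly" where
  "\<Psi> x = (\<Sum>k\<in>keys x. cst (lookup x k) * (fst k * rep (snd k)))"

lemma \<Psi>_superset: "finite A \<Longrightarrow> keys x \<subseteq> A \<Longrightarrow> \<Psi> x = (\<Sum>k\<in>A. cst (lookup x k) * (fst k * rep (snd k)))"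
  unfolding \<Psi>_def by (rule sum.mono_neutral_left) (auto simp: in_keys_iff)

lemma \<Psi>_add: "\<Psi> (x + y) = \<Psi> x + \<Psi> y"
  by (subst (1 2 3) \<Psi>_superset[of "keys x \<union> keys y"])
    (auto simp: keys_add lookup_add cst_add distrib_right sum.distrib)

lemma \<Psi>_0: "\<Psi> 0 = 0"
  by (simp add: \<Psi>_def)

lemma \<Psi>_single: "\<Psi> (Poly_Mapping.single (a, S) c) = cst c * (a * rep S)"
  by (subst \<Psi>_superset[of "{(a, S)}"]) auto

lemma \<Psi>_sum: "\<Psi> (\<Sum>i\<in>A. f i) = (\<Sum>i\<in>A. \<Psi> (f i))"
  by (induction A rule: infinite_finite_induct) (simp_all add: \<Psi>_0 \<Psi>_add)

lemma \<Psi>_diff: "\<Psi> (x - y) = \<Psi> x - \<Psi> y"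
  using \<Psi>_add[of "x - y" y] by (simp add: algebra_simps)

lemma lookup_scale: "lookup (Poly_Mapping.map ((*) c) x) k = c * lookup (x :: 'k \<Rightarrow>\<^sub>0 complex) k"
  by (simp add: Poly_Mapping.map.rep_eq when_def)

lemma \<Psi>_scale: "\<Psi> (Poly_Mapping.map ((*) c) x) = cst c * \<Psi> x"
proof -
  have "keys (Poly_Mapping.map ((*) c) x) \<subseteq> keys x" by (auto simp: in_keys_iff lookup_scale)
  then show ?thesis
    by (subst \<Psi>_superset[of "keys x"]) (auto simp: lookup_scale cst_mult \<Psi>_def sum_distrib_left mult.assoc)
qed

lemma carrier_TP: "carrier TP = {f. keys f \<subseteq> polys_in {1, 2} \<times> carrier QB}"
  by (simp add: free_pairs_def)

lemma TP_add: "x \<in> carrier TP \<Longrightarrow> y \<in> carrier TP \<Longrightarrow> x + y \<in> carrier TP"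
  using keys_add[of x y] by (auto simp: carrier_TP)

lemma TP_scale: "x \<in> carrier TP \<Longrightarrow> Poly_Mapping.map ((*) c) x \<in> carrier TP"
  by (auto simp: carrier_TP in_keys_iff lookup_scale)

lemma scale_minus_1: "Poly_Mapping.map ((*) (-1)) x = - (x :: 'k \<Rightarrow>\<^sub>0 complex)"
  by (rule poly_mapping_eqI) (simp add: lookup_scale)

lemma TP_diff: "x \<in> carrier TP \<Longrightarrow> y \<in> carrier TP \<Longrightarrow> x - y \<in> carrier TP"
  using TP_add[of x "- y"] TP_scale[of y "-1"] by (simp add: scale_minus_1)

lemma TP_0: "0 \<in> carrier TP"
  by (simp add: carrier_TP)

lemma TP_sum: "(\<And>i. i \<in> A \<Longrightarrow> f i \<in> carrier TP) \<Longrightarrow> sum f A \<in> carrier TP"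
  by (induction A rule: infinite_finite_induct) (auto intro: TP_add TP_0)

lemma TP_single: "a \<in> polys_in {1, 2} \<Longrightarrow> S \<in> carrier QB \<Longrightarrow> Poly_Mapping.single (a, S) c \<in> carrier TP"
  by (simp add: carrier_TP)

lemma polys_in_outer: "P \<in> polys_in {1, 2} \<Longrightarrow> P \<in> polys_in {1..14 :: nat}"
  by (erule polys_in_mono) auto

lemma keys_TP:
  assumes "x \<in> carrier TP" "k \<in> keys x" shows "fst k \<in> polys_in {1, 2}" "snd k \<in> carrier QB"
  using assms by (auto simp: carrier_TP)

lemma \<Psi>_closed: "x \<in> carrier TP \<Longrightarrow> \<Psi> x \<in> polys_in {1..14}"
  unfolding \<Psi>_def
  by (intro polys_in_sum polys_in_mult polys_in_cst) (use keys_TP polys_in_outer polys_in_inner rep(1) in blast)+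

lemma TP_ops:
  "x \<otimes>\<^bsub>TP\<^esub> y = (\<Sum>k\<in>keys x. \<Sum>l\<in>keys y. Poly_Mapping.single (fst k * fst l, snd k \<otimes>\<^bsub>QB\<^esub> snd l) (lookup x k * lookup y l))"
  "\<lbrace>x, y\<rbrace>\<^bsub>TP\<^esub> = (\<Sum>k\<in>keys x. \<Sum>l\<in>keys y.
    Poly_Mapping.single (poly_bracket \<epsilon> (fst k) (fst l), snd k \<otimes>\<^bsub>QB\<^esub> snd l) (lookup x k * lookup y l) +
    Poly_Mapping.single (fst k * fst l, \<lbrace>snd k, snd l\<rbrace>\<^bsub>QB\<^esub>) (lookup x k * lookup y l))"
  by (simp_all add: free_pairs_def case_prod_unfold)

lemma ev_\<Psi>_mult:
  assumes "x \<in> carrier TP" "y \<in> carrier TP" "z \<in> V"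
  shows "ev z (gsub (\<Psi> (x \<otimes>\<^bsub>TP\<^esub> y))) = ev z (gsub (\<Psi> x * \<Psi> y))"
proof -
  let ?e = "\<lambda>P. ev z (gsub P)"
  have e: "?e (\<Sum>i\<in>A. f i) = (\<Sum>i\<in>A. ?e (f i))" for f :: "nat mpoly \<times> nat mpoly set \<Rightarrow> nat mpoly" and A
    by (simp add: ring_map_sum[OF ring_map_poly_subst[OF ring_map_cst]] ring_map_sum[OF ring_map_ev])
  have "?e (\<Psi> (x \<otimes>\<^bsub>TP\<^esub> y)) = (\<Sum>k\<in>keys x. \<Sum>l\<in>keys y. ?e (cst (lookup x k) * (fst k * rep (snd k))) * ?e (cst (lookup y l) * (fst l * rep (snd l))))"
    unfolding TP_ops \<Psi>_sum e \<Psi>_single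
    by (intro sum.cong refl) (simp add: csubst_simps peval_simps ev_rep_ops[OF keys_TP(2)[OF assms(1)] keys_TP(2)[OF assms(2)] assms(3)])
  also have "\<dots> = ?e (\<Psi> x * \<Psi> y)"
    unfolding \<Psi>_def sum_product e by (simp add: csubst_simps peval_simps)
  finally show ?thesis .
qed

lemma ev_\<Psi>_pbr:
  assumes "x \<in> carrier TP" "y \<in> carrier TP" "z \<in> V"
  shows "ev z (gsub (\<Psi> \<lbrace>x, y\<rbrace>\<^bsub>TP\<^esub>)) = ev z (gsub (poly_bracket \<epsilon> (\<Psi> x) (\<Psi> y)))"
proof -
  let ?e = "\<lambda>P. ev z (gsub P)"
  have e: "?e (\<Sum>i\<in>A. f i) = (\<Sum>i\<in>A. ?e (f i))" for f :: "nat mpoly \<times> nat mpoly set \<Rightarrow> nat mpoly" and A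
    by (simp add: ring_map_sum[OF ring_map_poly_subst[OF ring_map_cst]] ring_map_sum[OF ring_map_ev])
  have c: "poly_bracket \<epsilon> (cst c * p) (cst d * r) = cst c * (cst d * poly_bracket \<epsilon> p r)" for c d p r
    unfolding poly_bracket_cst_mult poly_bracket_antisym[of \<epsilon> p] by simp
  have "?e (\<Psi> \<lbrace>x, y\<rbrace>\<^bsub>TP\<^esub>) = (\<Sum>k\<in>keys x. \<Sum>l\<in>keys y. ?e (cst (lookup x k) * (cst (lookup y l) * poly_bracket \<epsilon> (fst k * rep (snd k)) (fst l * rep (snd l)))))"
    unfolding TP_ops \<Psi>_sum e
  proof (intro sum.cong refl)
    fix k l assume k: "k \<in> keys x" and l: "l \<in> keys y"
    note kl = keys_TP[OF assms(1) k] keys_TP[OF assms(2) l]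
    show "?e (\<Psi> (Poly_Mapping.single (poly_bracket \<epsilon> (fst k) (fst l), snd k \<otimes>\<^bsub>QB\<^esub> snd l) (lookup x k * lookup y l) +
      Poly_Mapping.single (fst k * fst l, \<lbrace>snd k, snd l\<rbrace>\<^bsub>QB\<^esub>) (lookup x k * lookup y l))) =
      ?e (cst (lookup x k) * (cst (lookup y l) * poly_bracket \<epsilon> (fst k * rep (snd k)) (fst l * rep (snd l))))"
      unfolding \<Psi>_add \<Psi>_single poly_bracket_tensor[OF kl(1,3) rep(1)[OF kl(2)] rep(1)[OF kl(4)]]
      by (simp add: csubst_simps peval_simps ev_rep_ops[OF kl(2,4) assms(3)] algebra_simps)
  qed
  also have "\<dots> = ?e (poly_bracket \<epsilon> (\<Psi> x) (\<Psi> y))"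
    unfolding \<Psi>_def poly_bracket_sum_left poly_bracket_sum_right e c by (rule sum.swap)
  finally show ?thesis .
qed

end

lemma generator_translate:
  "generator 1 (X + smat s (mat 1), Y + smat t (mat 1)) = generator 1 (X, Y) + 4 * s"
  "generator 2 (X + smat s (mat 1), Y + smat t (mat 1)) = generator 2 (X, Y) + 4 * t"
  "i \<in> {3..14} \<Longrightarrow> generator i (X + smat s (mat 1), Y + smat t (mat 1)) = generator i (X, Y)"
proof -
  have tr: "trace (X + smat s (mat 1)) = trace X + 4 * s" for X :: "complex^4^4" and s
    by (simp add: trace_add trace_smat trace_I)
  have "X + smat s (mat 1) - mat (trace (X + smat s (mat 1)) / 4) = X - mat (trace X / 4)" for X :: "complex^4^4" and s
    unfolding tr by (rule mat_eqI) (simp add: mat_nth add_divide_distrib)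
  note sh = this
  show "generator 1 (X + smat s (mat 1), Y + smat t (mat 1)) = generator 1 (X, Y) + 4 * s"
    "generator 2 (X + smat s (mat 1), Y + smat t (mat 1)) = generator 2 (X, Y) + 4 * t"
    by (simp_all add: generator_def Let_def tr)
  assume "i \<in> {3..14}"
  then show "generator i (X + smat s (mat 1), Y + smat t (mat 1)) = generator i (X, Y)"
    by (elim index_cases) (simp_all add: generator_def Let_def sh)
qed

context reducible_variety
begin

abbreviation "TK \<equiv> tensor_relations PA QB"

lemma TK_carrier: "x \<in> TK \<Longrightarrow> x \<in> carrier TP"
proof (induction rule: tensor_relations.induct)
  case (add_left a a' b)
  then show ?case by (intro TP_diff TP_single) (auto simp: polys_in_add)
next
  case (add_right a b b')
  then show ?case by (intro TP_diff TP_single) (auto simp: QB_closed)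
next
  case (smult_left a b c)
  then show ?case by (intro TP_diff TP_single) (auto simp: polys_in_mult)
next
  case (smult_right a b c)
  then show ?case by (intro TP_diff TP_single) (auto simp: QB_closed)
qed (auto intro: TP_0 TP_add TP_scale)

lemma TK_\<Psi>: "x \<in> TK \<Longrightarrow> z \<in> V \<Longrightarrow> ev z (gsub (\<Psi> x)) = 0"
proof (induction rule: tensor_relations.induct)
  case (add_right a b b')
  then show ?case by (simp add: \<Psi>_diff \<Psi>_single csubst_simps peval_simps ev_rep_ops(2)) (simp add: algebra_simps)
next
  case (smult_right a b c)
  then show ?case by (simp add: \<Psi>_diff \<Psi>_single csubst_simps peval_simps ev_rep_ops(3)[OF _ smult_right(2)] algebra_simps)
qed (simp_all add: \<Psi>_0 \<Psi>_add \<Psi>_diff \<Psi>_scale \<Psi>_single csubst_simps peval_simps algebra_simps)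

lemma TK_0: "0 \<in> TK" by (rule tensor_relations.zero)

lemma TK_add: "x \<in> TK \<Longrightarrow> y \<in> TK \<Longrightarrow> x + y \<in> TK" by (rule tensor_relations.add)

lemma TK_uminus: "x \<in> TK \<Longrightarrow> - x \<in> TK"
  using tensor_relations.scale[of x PA QB "-1"] by (simp add: scale_minus_1)

lemma TK_diff: "x \<in> TK \<Longrightarrow> y \<in> TK \<Longrightarrow> x - y \<in> TK"
  using TK_add[of x "- y"] TK_uminus[of y] by simp

lemma TK_sum: "(\<And>i. i \<in> A \<Longrightarrow> f i \<in> TK) \<Longrightarrow> sum f A \<in> TK"
  by (induction A rule: infinite_finite_induct) (auto intro: TK_add TK_0)

lemma scale_single: "Poly_Mapping.map ((*) c) (Poly_Mapping.single k d) = Poly_Mapping.single k (c * d :: complex)"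
  by simp

lemma scale_diff: "Poly_Mapping.map ((*) c) (x - y) = Poly_Mapping.map ((*) c) x - Poly_Mapping.map ((*) c) (y :: 'k \<Rightarrow>\<^sub>0 complex)"
  by (rule poly_mapping_eqI) (simp add: lookup_scale lookup_minus right_diff_distrib)

lemma scale_add: "Poly_Mapping.map ((*) c) (x + y) = Poly_Mapping.map ((*) c) x + Poly_Mapping.map ((*) c) (y :: 'k \<Rightarrow>\<^sub>0 complex)"
  by (rule poly_mapping_eqI) (simp add: lookup_scale lookup_add distrib_left)

lemma TK_add_left:
  assumes "a \<in> polys_in {1, 2}" "a' \<in> polys_in {1, 2}" "S \<in> carrier QB"
  shows "Poly_Mapping.single (a + a', S) c - (Poly_Mapping.single (a, S) c + Poly_Mapping.single (a', S) c) \<in> TK"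
  using tensor_relations.scale[OF tensor_relations.add_left[of a PA a' S QB], of c] assms
  by (simp add: scale_diff scale_add scale_single algebra_simps)

lemma TK_cst_left:
  assumes "a \<in> polys_in {1, 2}" "S \<in> carrier QB"
  shows "Poly_Mapping.single (cst d * a, S) c - Poly_Mapping.single (a, S) (c * d) \<in> TK"
  using tensor_relations.scale[OF tensor_relations.smult_left[of a PA S QB d], of c] assms
  by (simp add: scale_diff scale_single)

lemma TK_cst_right:
  assumes "a \<in> polys_in {1, 2}" "s \<in> polys_in {3..14}"
  shows "Poly_Mapping.single (a, B.cos (cst d * s)) 1 - Poly_Mapping.single (a, B.cos s) d \<in> TK"
  using tensor_relations.smult_right[of a PA "B.cos s" QB d] assms by (simp add: cos_carrier B.smult_pquot)

lemma TK_add_right: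
  assumes "a \<in> polys_in {1, 2}" "s \<in> polys_in {3..14}" "s' \<in> polys_in {3..14}"
  shows "Poly_Mapping.single (a, B.cos (s + s')) 1 - (Poly_Mapping.single (a, B.cos s) 1 + Poly_Mapping.single (a, B.cos s') 1) \<in> TK"
  using tensor_relations.add_right[of a PA "B.cos s" QB "B.cos s'"] assms by (simp add: cos_carrier B.add_pquot algebra_simps)

definition mon :: "(nat \<Rightarrow>\<^sub>0 nat) \<Rightarrow> nat mpoly" where "mon m = Poly_Mapping.single m 1"

lemma cst_mon: "cst c * mon m = Poly_Mapping.single m c"
  by (simp add: cst_def mon_def mult_single)

lemma mon_polys_in: "keys m \<subseteq> W \<Longrightarrow> mon m \<in> polys_in W"
  by (simp add: mon_def polys_in_single)

text \<open>Quantifying over all larger \<open>M\<close> allows two normal forms to be added termwise.\<close>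

definition normal_form :: "((nat mpoly \<times> nat mpoly set) \<Rightarrow>\<^sub>0 complex) \<Rightarrow> bool" where
  "normal_form x \<longleftrightarrow> (\<exists>M0 s. finite M0 \<and> M0 \<subseteq> {m. keys m \<subseteq> {1, 2}} \<and> (\<forall>m. s m \<in> polys_in {3..14}) \<and>
    (\<forall>M. finite M \<longrightarrow> M0 \<subseteq> M \<longrightarrow> M \<subseteq> {m. keys m \<subseteq> {1, 2}} \<longrightarrow>
      x - (\<Sum>m\<in>M. Poly_Mapping.single (mon m, B.cos (s m)) 1) \<in> TK))"

lemma normal_form_0: "normal_form 0"
  unfolding normal_form_def
proof (intro exI[of _ "{}"] exI[of _ "\<lambda>_. 0"] conjI allI impI)
  fix M :: "(nat \<Rightarrow>\<^sub>0 nat) set" assume M: "M \<subseteq> {m. keys m \<subseteq> {1, 2}}"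
  have "Poly_Mapping.single (mon m, B.cos 0) 1 \<in> TK" if "m \<in> M" for m
    using TK_cst_right[of "mon m" 0 0] M that by (auto simp: mon_polys_in)
  then show "0 - (\<Sum>m\<in>M. Poly_Mapping.single (mon m, B.cos 0) 1) \<in> TK" by (intro TK_diff TK_0 TK_sum)
qed auto

lemma normal_form_add:
  assumes "normal_form x" "normal_form y" shows "normal_form (x + y)"
proof -
  obtain M1 s1 where 1: "finite M1" "M1 \<subseteq> {m. keys m \<subseteq> {1, 2}}" "\<And>m. s1 m \<in> polys_in {3..14}"
    "\<And>M. finite M \<Longrightarrow> M1 \<subseteq> M \<Longrightarrow> M \<subseteq> {m. keys m \<subseteq> {1, 2}} \<Longrightarrow> x - (\<Sum>m\<in>M. Poly_Mapping.single (mon m, B.cos (s1 m)) 1) \<in> TK"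
    using assms(1) unfolding normal_form_def by blast
  obtain M2 s2 where 2: "finite M2" "M2 \<subseteq> {m. keys m \<subseteq> {1, 2}}" "\<And>m. s2 m \<in> polys_in {3..14}"
    "\<And>M. finite M \<Longrightarrow> M2 \<subseteq> M \<Longrightarrow> M \<subseteq> {m. keys m \<subseteq> {1, 2}} \<Longrightarrow> y - (\<Sum>m\<in>M. Poly_Mapping.single (mon m, B.cos (s2 m)) 1) \<in> TK"
    using assms(2) unfolding normal_form_def by blast
  show ?thesis
    unfolding normal_form_def
  proof (intro exI[of _ "M1 \<union> M2"] exI[of _ "\<lambda>m. s1 m + s2 m"] conjI allI impI)
    fix M assume M: "finite M" "M1 \<union> M2 \<subseteq> M" "M \<subseteq> {m. keys m \<subseteq> {1, 2}}"
    let ?f = "\<lambda>s m. Poly_Mapping.single (mon m, B.cos (s m)) (1 :: complex)"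
    have "x - sum (?f s1) M + (y - sum (?f s2) M) - (\<Sum>m\<in>M. ?f (\<lambda>m. s1 m + s2 m) m - (?f s1 m + ?f s2 m)) \<in> TK"
      using M 1(3) 2(3) by (intro TK_diff TK_add TK_sum 1(4) 2(4) TK_add_right mon_polys_in) auto
    then show "x + y - (\<Sum>m\<in>M. ?f (\<lambda>m. s1 m + s2 m) m) \<in> TK"
      by (simp add: sum_subtractf sum.distrib algebra_simps)
  qed (use 1 2 in \<open>auto simp: polys_in_add\<close>)
qed

text \<open>The first factor is split into monomials one at a time, and their coefficients become
  scalars of the tensor.\<close>

lemma single_expand:
  assumes "p \<in> polys_in {1, 2}" "S \<in> carrier QB"
  shows "Poly_Mapping.single (p, S) c - (\<Sum>m\<in>keys p. Poly_Mapping.single (mon m, S) (c * lookup p m)) \<in> TK"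
proof -
  have k: "keys m \<subseteq> {1, 2}" if "m \<in> keys p" for m using that assms(1) by (auto simp: polys_in_def)
  have "Poly_Mapping.single (\<Sum>m\<in>A. cst (lookup p m) * mon m, S) c - (\<Sum>m\<in>A. Poly_Mapping.single (mon m, S) (c * lookup p m)) \<in> TK"
    if "finite A" "A \<subseteq> keys p" for A
    using that
  proof (induction A)
    case empty
    show ?case using TK_cst_left[of 0 S 0 c] assms(2) by simp
  next
    case (insert m A)
    let ?a = "cst (lookup p m) * mon m" and ?s = "\<Sum>m\<in>A. cst (lookup p m) * mon m" and ?t = "\<Sum>m\<in>A. Poly_Mapping.single (mon m, S) (c * lookup p m)"
    have m: "mon m \<in> polys_in {1, 2}" using k insert.prems by (intro mon_polys_in) auto
    have "Poly_Mapping.single (?a + ?s, S) c - (Poly_Mapping.single (?a, S) c + Poly_Mapping.single (?s, S) c) \<in> TK"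
      using insert.prems k m by (intro TK_add_left polys_in_sum polys_in_mult mon_polys_in assms) auto
    moreover have "Poly_Mapping.single (?a, S) c - Poly_Mapping.single (mon m, S) (c * lookup p m) \<in> TK"
      by (intro TK_cst_left m assms)
    moreover have "Poly_Mapping.single (?s, S) c - ?t \<in> TK" using insert by auto
    ultimately have "(Poly_Mapping.single (?a + ?s, S) c - (Poly_Mapping.single (?a, S) c + Poly_Mapping.single (?s, S) c)) +
        ((Poly_Mapping.single (?a, S) c - Poly_Mapping.single (mon m, S) (c * lookup p m)) + (Poly_Mapping.single (?s, S) c - ?t)) \<in> TK"
      by (intro TK_add)
    then show ?case using insert.hyps by (simp add: algebra_simps)
  qed
  from this[of "keys p"] show ?thesis by (simp add: cst_mon sum_monomials)
qed

lemma normal_form_single: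
  assumes "p \<in> polys_in {1, 2}" "S \<in> carrier QB"
  shows "normal_form (Poly_Mapping.single (p, S) c)"
  unfolding normal_form_def
\<comment> \<open>The scalars are absorbed into the second factor; they are 0 for monomials outside
  p, so every larger M works.\<close>
proof (intro exI[of _ "keys p"] exI[of _ "\<lambda>m. cst (c * lookup p m) * rep S"] conjI allI impI)
  fix M assume M: "finite M" "keys p \<subseteq> M" "M \<subseteq> {m. keys m \<subseteq> {1, 2}}"
  have "(\<Sum>m\<in>keys p. Poly_Mapping.single (mon m, S) (c * lookup p m)) = (\<Sum>m\<in>M. Poly_Mapping.single (mon m, S) (c * lookup p m))"
    using M by (intro sum.mono_neutral_left) (auto simp: in_keys_iff)
  then have 1: "Poly_Mapping.single (p, S) c - (\<Sum>m\<in>M. Poly_Mapping.single (mon m, S) (c * lookup p m)) \<in> TK"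
    using single_expand[OF assms, of c] by simp
  have "(\<Sum>m\<in>M. Poly_Mapping.single (mon m, B.cos (cst (c * lookup p m) * rep S)) 1 - Poly_Mapping.single (mon m, S) (c * lookup p m)) \<in> TK"
  proof (rule TK_sum)
    fix m assume "m \<in> M"
    then show "Poly_Mapping.single (mon m, B.cos (cst (c * lookup p m) * rep S)) 1 - Poly_Mapping.single (mon m, S) (c * lookup p m) \<in> TK"
      using TK_cst_right[of "mon m" "rep S" "c * lookup p m"] M(3) rep[OF assms(2)] by (auto simp: mon_polys_in)
  qed
  from TK_diff[OF 1 this]
  show "Poly_Mapping.single (p, S) c - (\<Sum>m\<in>M. Poly_Mapping.single (mon m, B.cos (cst (c * lookup p m) * rep S)) 1) \<in> TK"
    by (simp add: sum_subtractf)
qed (use assms rep[OF assms(2)] in \<open>auto simp: polys_in_def[of "{1, 2}"] intro: polys_in_mult\<close>)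

lemma normal_form_carrier:
  assumes "x \<in> carrier TP" shows "normal_form x"
proof -
  have "normal_form (\<Sum>k\<in>A. Poly_Mapping.single k (lookup x k))" if "finite A" "A \<subseteq> keys x" for A
    using that
  proof (induction A)
    case (insert k A)
    then have "normal_form (Poly_Mapping.single (fst k, snd k) (lookup x k))"
      using keys_TP[OF assms, of k] by (intro normal_form_single) auto
    then show ?case using insert by (simp add: normal_form_add)
  qed (simp add: normal_form_0)
  from this[of "keys x"] show ?thesis
    by (simp add: sum_monomials)
qed

text \<open>Translations change the values of the first two generators arbitrarily and fix the others, so
  the polynomials in the first two variables stay independent over the remaining functions.\<close>

lemma monomials_independent:
  assumes M: "finite M" "M \<subseteq> {m. keys m \<subseteq> {1, 2}}" and s: "\<And>m. s m \<in> polys_in {3..14}"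
    and zero: "\<And>z. z \<in> V \<Longrightarrow> ev z (gsub (\<Sum>m\<in>M. mon m * s m)) = 0" and m: "m \<in> M"
  shows "s m \<in> relations_ideal V"
proof -
  have "ev z (gsub (s m)) = 0" if z: "z \<in> V" for z
  proof -
    obtain X Y where zXY: "z = (X, Y)" by fastforce
    let ?F = "\<Sum>m\<in>M. cst (ev z (gsub (s m))) * mon m"
    have "peval x ?F = 0" for x
    proof -
      \<comment> \<open>A translation by s changes the trace of a 4 by 4 matrix by 4 s, hence the
        division by 4; the first two generators take the values x 1 and x 2 at the new
        point.\<close>
      define z' where "z' = (X + smat ((x 1 - generator 1 z) / 4) (mat 1), Y + smat ((x 2 - generator 2 z) / 4) (mat 1))"
      have z': "z' \<in> V" unfolding z'_def using translate z zXY by simp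
      have g: "generator 1 z' = x 1" "generator 2 z' = x 2" "\<And>i. i \<in> {3..14} \<Longrightarrow> generator i z' = generator i z"
        unfolding z'_def zXY generator_translate by (simp_all add: generator_translate diff_divide_distrib)
      have 1: "ev z' (gsub (s m)) = ev z (gsub (s m))" for m
        using poly_subst_cong[OF ring_map_id s[of m], of "\<lambda>i. generator i z'" "\<lambda>i. generator i z"] g(3)
        by (simp add: ev_gsub[OF polys_in_inner[OF s]])
      have 2: "ev z' (gsub (mon m)) = peval x (mon m)" if "m \<in> M" for m
      proof -
        have "mon m \<in> polys_in {1, 2}" using M(2) that by (auto intro: mon_polys_in)
        then show ?thesis
          using poly_subst_cong[OF ring_map_id, of "mon m" "{1, 2}" "\<lambda>i. generator i z'" x] g by (auto simp: ev_gsub polys_in_outer)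
      qed
      have "ev z' (gsub (\<Sum>m\<in>M. mon m * s m)) = (\<Sum>m\<in>M. peval x (mon m) * ev z (gsub (s m)))"
        by (simp add: ring_map_sum[OF ring_map_poly_subst[OF ring_map_cst]] ring_map_sum[OF ring_map_ev] csubst_simps peval_simps 1 2)
      then show ?thesis using zero[OF z']
        by (simp add: ring_map_sum[OF ring_map_poly_subst[OF ring_map_id]] peval_simps mult.commute)
    qed
    then have "?F = 0" by (rule peval_zero_imp_zero)
    then have "lookup ?F m = 0" by simp
    then show ?thesis using M(1) m by (simp add: cst_mon lookup_sum lookup_single when_def)
  qed
  then show ?thesis using s by (simp add: relations_ideal_iff vanish_def)
qed

text \<open>Injectivity of the multiplication map. In a normal form the monomials in a_1, a_2 are
  independent over functions of the other generators, so each second factor is a relation and its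
  coset is zero.\<close>

lemma kernel_TK:
  assumes x: "x \<in> carrier TP" and zero: "\<And>z. z \<in> V \<Longrightarrow> ev z (gsub (\<Psi> x)) = 0"
  shows "x \<in> TK"
proof -
  obtain M s where M: "finite M" "M \<subseteq> {m. keys m \<subseteq> {1, 2}}" and s: "\<And>m. s m \<in> polys_in {3..14}"
    and nf: "x - (\<Sum>m\<in>M. Poly_Mapping.single (mon m, B.cos (s m)) 1) \<in> TK"
    using normal_form_carrier[OF x] unfolding normal_form_def by blast
  let ?y = "\<Sum>m\<in>M. Poly_Mapping.single (mon m, B.cos (s m)) (1 :: complex)"
  have vanishing: "ev z (gsub (\<Sum>m\<in>M. mon m * s m)) = 0" if z: "z \<in> V" for z
  proof -
    have "ev z (gsub (\<Psi> ?y)) = 0" using TK_\<Psi>[OF nf z] zero[OF z] by (simp add: \<Psi>_diff csubst_simps peval_simps)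
    then show ?thesis
      by (simp add: \<Psi>_sum \<Psi>_single ring_map_sum[OF ring_map_poly_subst[OF ring_map_cst]] ring_map_sum[OF ring_map_ev] csubst_simps peval_simps ev_rep[OF s z])
  qed
  have si: "s m \<in> relations_ideal V" if "m \<in> M" for m
    by (rule monomials_independent[OF M s vanishing that])
  have "Poly_Mapping.single (mon m, B.cos (s m)) 1 \<in> TK" if "m \<in> M" for m
  proof -
    have "\<theta> (s m) = \<theta> 0" using B.kernel[of "s m" 0] si[OF that] s by simp
    then have "B.cos (s m) = B.cos 0" by (rule B.cos_eqI)
    moreover have "mon m \<in> polys_in {1, 2}" using M(2) that by (auto intro: mon_polys_in)
    ultimately show ?thesis using TK_cst_right[of "mon m" 0 0] by simp
  qed
  then have "?y \<in> TK" by (rule TK_sum)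
  from TK_add[OF nf this] show ?thesis by simp
qed

text \<open>The tensor relations are exactly the kernel of multiplication followed by restriction to
  V; together with \<open>\<Psi>_onto\<close> this identifies the tensor product with the coordinate
  algebra.\<close>

sublocale T: pquotient TP "coord_alg V" TK "\<lambda>x. \<theta> (\<Psi> x)"
proof
  fix a b
  show "a + b \<in> carrier TP" "a - b \<in> carrier TP" if "a \<in> carrier TP" "b \<in> carrier TP"
    using that by (simp_all add: TP_add TP_diff)
  show "\<one>\<^bsub>TP\<^esub> \<in> carrier TP" using TP_single[of 1 "\<one>\<^bsub>QB\<^esub>" 1] QB_closed(5)[OF cos_carrier cos_carrier, of 0 0] by (simp add: free_pairs_def)
  show "a \<otimes>\<^bsub>TP\<^esub> b \<in> carrier TP" if "a \<in> carrier TP" "b \<in> carrier TP"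
    unfolding TP_ops using keys_TP[OF that(1)] keys_TP[OF that(2)]
    by (intro TP_sum TP_single polys_in_mult QB_closed) auto
  show "\<lbrace>a, b\<rbrace>\<^bsub>TP\<^esub> \<in> carrier TP" if "a \<in> carrier TP" "b \<in> carrier TP"
    unfolding TP_ops using keys_TP[OF that(1)] keys_TP[OF that(2)]
    by (intro TP_sum TP_add TP_single polys_in_mult QB_closed poly_bracket_closed_12) auto
  show "c \<odot>\<^bsub>TP\<^esub> a \<in> carrier TP" if "a \<in> carrier TP" for c using TP_scale[OF that] by (simp add: free_pairs_def)
  show "TK \<subseteq> carrier TP" using TK_carrier by blast
  show "\<theta> (\<Psi> a) = \<theta> (\<Psi> b) \<longleftrightarrow> a - b \<in> TK" if "a \<in> carrier TP" "b \<in> carrier TP"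
  proof
    assume "\<theta> (\<Psi> a) = \<theta> (\<Psi> b)"
    then show "a - b \<in> TK"
      by (intro kernel_TK TP_diff that) (simp add: \<theta>_eq_iff \<Psi>_diff csubst_simps peval_simps)
  next
    assume "a - b \<in> TK"
    then show "\<theta> (\<Psi> a) = \<theta> (\<Psi> b)"
      using TK_\<Psi>[of "a - b"] by (simp add: \<theta>_eq_iff \<Psi>_diff csubst_simps peval_simps)
  qed
  show "\<theta> (\<Psi> a) \<in> carrier (coord_alg V)" if "a \<in> carrier TP"
    using \<Psi>_closed[OF that] by (auto simp: carrier_coord)
  show "\<theta> (\<Psi> \<one>\<^bsub>TP\<^esub>) = \<one>\<^bsub>coord_alg V\<^esub>"
    by (simp add: free_pairs_def coord_ops \<Psi>_single B.one_pquot \<theta>_eq_iff csubst_simps peval_simps ev_rep)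
  show "\<theta> (\<Psi> (a \<otimes>\<^bsub>TP\<^esub> b)) = \<theta> (\<Psi> a) \<otimes>\<^bsub>coord_alg V\<^esub> \<theta> (\<Psi> b)" if "a \<in> carrier TP" "b \<in> carrier TP"
    unfolding coord_ops \<theta>_eq_iff using ev_\<Psi>_mult[OF that] by blast
  show "\<theta> (\<Psi> \<lbrace>a, b\<rbrace>\<^bsub>TP\<^esub>) = \<lbrace>\<theta> (\<Psi> a), \<theta> (\<Psi> b)\<rbrace>\<^bsub>coord_alg V\<^esub>" if "a \<in> carrier TP" "b \<in> carrier TP"
    unfolding coord_pbr[OF \<Psi>_closed[OF that(1)] \<Psi>_closed[OF that(2)]] \<theta>_eq_iff using ev_\<Psi>_pbr[OF that] by blast
  show "\<theta> (\<Psi> (c \<odot>\<^bsub>TP\<^esub> a)) = c \<odot>\<^bsub>coord_alg V\<^esub> \<theta> (\<Psi> a)" for c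
    by (simp add: free_pairs_def coord_ops \<Psi>_scale)
qed (auto simp: free_pairs_def coord_ops \<Psi>_0 \<Psi>_add TK_add)

text \<open>The image is closed under sums and products, so it suffices to reach the generators: a_1
  and a_2 from the first factor, all others from the second.\<close>

lemma \<Psi>_onto: "P \<in> polys_in {1..14} \<Longrightarrow> \<exists>x\<in>carrier TP. \<theta> (\<Psi> x) = \<theta> P"
proof (induction rule: polys_in_induct)
  case (const c)
  show ?case using T.smult_closed[OF T.one_closed, of c] T.\<Phi>_smult[OF T.one_closed, of c] T.\<Phi>_one by (auto simp: coord_ops intro!: bexI)
next
  case (var i)
  show ?case
  proof (cases "i \<in> {3..14}")
    case True
    then show ?thesis
      by (intro bexI[of _ "Poly_Mapping.single (1, B.cos (\<a> i)) 1"] TP_single)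
        (auto simp: \<Psi>_single \<theta>_eq_iff csubst_simps peval_simps ev_rep cos_carrier)
  next
    case False
    then have "i = 1 \<or> i = 2" using var by auto
    then show ?thesis
      by (intro bexI[of _ "Poly_Mapping.single (\<a> i, B.cos 1) 1"] TP_single)
        (auto simp: \<Psi>_single \<theta>_eq_iff csubst_simps peval_simps ev_rep cos_carrier)
  qed
next
  case (add p r)
  then obtain x y where "x \<in> carrier TP" "\<theta> (\<Psi> x) = \<theta> p" "y \<in> carrier TP" "\<theta> (\<Psi> y) = \<theta> r" by blast
  then show ?case using TP_add T.\<Phi>_add[of x y] by (auto simp: coord_ops intro!: bexI)
next
  case (mult p r)
  then obtain x y where "x \<in> carrier TP" "\<theta> (\<Psi> x) = \<theta> p" "y \<in> carrier TP" "\<theta> (\<Psi> y) = \<theta> r" by blast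
  then show ?case using T.mult_closed[of x y] T.\<Phi>_mult[of x y] by (auto simp: coord_ops intro!: bexI)
qed

theorem coord_alg_isomorphic: "coord_alg V \<cong>\<^sub>P PA \<otimes>\<^sub>P QB"
  unfolding ptensor_def
proof (rule T.poisson_isomorphic_pquot[OF poisson_algebra_coord_alg], rule subsetI)
  fix f assume "f \<in> carrier (coord_alg V)"
  then obtain P where P: "P \<in> polys_in {1..14}" "f = \<theta> P" by (auto simp: carrier_coord)
  then obtain x where "x \<in> carrier TP" "\<theta> (\<Psi> x) = \<theta> P" using \<Psi>_onto by blast
  then show "f \<in> (\<lambda>x. \<theta> (\<Psi> x)) ` carrier TP" using P by (intro image_eqI[of _ _ x]) auto
qed

end

theorem theorem1p1:
  fixes I J :: "nat mpoly set"
  defines "I \<equiv> bracket_ideal 1 r\<^sub>1"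
    and "J \<equiv> bracket_ideal 0 (r\<^sub>1 - 8 * \<a> 3)"
  shows "I = relations_ideal CM_pairs \<and>
    J = relations_ideal commuting_pairs \<and>
    coord_alg (CM_pairs :: 4 mpair set)
      \<cong>\<^sub>P poly_alg 1 {1, 2} \<otimes>\<^sub>P pquot (poly_alg 1 {3..14}) I \<and>
    coord_alg (commuting_pairs :: 4 mpair set)
      \<cong>\<^sub>P poly_alg 0 {1, 2} \<otimes>\<^sub>P pquot (poly_alg 0 {3..14}) J"
  unfolding I_def J_def relations_CM relations_commuting
  using reducible_variety.coord_alg_isomorphic[OF reducible_CM] reducible_variety.coord_alg_isomorphic[OF reducible_Com]
  by blast

end
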